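(* Let $\mathcal{C}$ be a unital C$^*$-algebra and let $J$ be a skew-symmetric linear transformation on $\mathbb{R}^n$. Then the algebra $\mathcal{S}_J^{\mathcal{C}}(\mathbb{R}^n)$ is spectrally invariant in its C$^*$-completion $\overline{\mathcal{S}_J^{\mathcal{C}}(\mathbb{R}^n)}$.
   Context: For a C$^*$-algebra $\mathcal{C}$, $\mathcal{S}^{\mathcal{C}}(\mathbb{R}^n)$ is the space of $\mathcal{C}$-valued Schwartz functions on $\mathbb{R}^n$. $E_n$ is its completion in the norm $\|f\|_2:=\|\int_{\mathbb{R}^n}f(x)^*f(x)\,dx\|_{\mathcal{C}}^{1/2}$; it is a Hilbert $\mathcal{C}$-module with $\mathcal{C}$-valued inner product extending $\langle f,g\rangle=\int_{\mathbb{R}^n}f(x)^*g(x)\,dx$. $\mathcal{L}_{\mathcal{C}}(E_n)$ is the C$^*$-algebra of adjointable operators on $E_n$, with operator norm $\|\cdot\|$. $\mathcal{S}_J^{\mathcal{C}}(\mathbb{R}^n)$ is the $*$-algebra $\mathcal{S}^{\mathcal{C}}(\mathbb{R}^n)$ with pointwise involution and Rieffel's deformed product, given by the iterated integral $(f\times_J g)(x):=\int_{\mathbb{R}^n}\big(\int_{\mathbb{R}^n}f(x+Ju)\,g(x+v)\,e^{2\pi i u\cdot v}\,dv\big)du$. For $f\in\mathcal{S}_J^{\mathcal{C}}(\mathbb{R}^n)$, the map $g\mapsto f\times_J g$ on $\mathcal{S}^{\mathcal{C}}(\mathbb{R}^n)$ extends to an operator $L_f\in\mathcal{L}_{\mathcal{C}}(E_n)$;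 $f\mapsto L_f$ is an injective $*$-homomorphism, and $\overline{\mathcal{S}_J^{\mathcal{C}}(\mathbb{R}^n)}$ is the completion of $\mathcal{S}_J^{\mathcal{C}}(\mathbb{R}^n)$ in the C$^*$-norm $\|f\|_{\mathcal{S}_J^{\mathcal{C}}}:=\|L_f\|$. For an algebra $\mathcal{A}$ and a subalgebra $\mathcal{B}$: if $\mathcal{A}$ is non-unital then $\dot{\mathcal{A}}:=\tilde{\mathcal{A}}$ and $\dot{\mathcal{B}}:=\tilde{\mathcal{B}}$ (unitizations); if $\mathcal{A}$ and $\mathcal{B}$ are unital with the same unit, $\dot{\mathcal{A}}:=\mathcal{A}$, $\dot{\mathcal{B}}:=\mathcal{B}$; if $\mathcal{A}$ is unital but $1_{\mathcal{A}}\notin\mathcal{B}$, $\dot{\mathcal{A}}:=\mathcal{A}$ and $\dot{\mathcal{B}}$ is the subalgebra generated by $\mathcal{B}$ and $1_{\mathcal{A}}$. $\mathcal{B}$ is spectrally invariant in $\mathcal{A}$ if every element of $\dot{\mathcal{B}}$ has the same spectrum in $\dot{\mathcal{B}}$ as in $\dot{\mathcal{A}}$. *)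

theory Defs
  imports "HOL-Analysis.Analysis"
begin

section \<open>Unital C*-algebras\<close>

text \<open>
  The superclass \<^class>\<open>real_normed_algebra_1\<close> is avoided because it would impose
  \<open>norm 1 = 1\<close> and thereby exclude the zero algebra.
\<close>

class unital_cstar_algebra = real_normed_algebra + banach + monoid_mult +
  fixes scaleC :: "complex \<Rightarrow> 'a \<Rightarrow> 'a"  (infixr "*\<^sub>C" 75)
    and cstar :: "'a \<Rightarrow> 'a"
  assumes scaleC_add_right: "a *\<^sub>C (x + y) = a *\<^sub>C x + a *\<^sub>C y"
    and scaleC_add_left: "(a + b) *\<^sub>C x = a *\<^sub>C x + b *\<^sub>C x"
    and scaleC_scaleC: "a *\<^sub>C b *\<^sub>C x = (a * b) *\<^sub>C x"
    and scaleC_of_real: "complex_of_real r *\<^sub>C x = r *\<^sub>R x"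
    and mult_scaleC_left: "(a *\<^sub>C x) * y = a *\<^sub>C (x * y)"
    and mult_scaleC_right: "x * (a *\<^sub>C y) = a *\<^sub>C (x * y)"
    and norm_scaleC: "norm (a *\<^sub>C x) = cmod a * norm x"
    and cstar_cstar: "cstar (cstar x) = x"
    and cstar_add: "cstar (x + y) = cstar x + cstar y"
    and cstar_scaleC: "cstar (a *\<^sub>C x) = cnj a *\<^sub>C cstar x"
    and cstar_mult: "cstar (x * y) = cstar y * cstar x"
    and cstar_identity: "norm (cstar x * x) = (norm x)\<^sup>2"


section \<open>Schwartz functions\<close>

definition partial_deriv ::
    "'n::finite \<Rightarrow> (real^'n \<Rightarrow> 'c::real_normed_vector) \<Rightarrow> real^'n \<Rightarrow> 'c" where
  "partial_deriv i f x = vector_derivative (\<lambda>t. f (x + t *\<^sub>R axis i 1)) (at 0)"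

definition partial_derivs ::
    "'n::finite list \<Rightarrow> (real^'n \<Rightarrow> 'c::real_normed_vector) \<Rightarrow> real^'n \<Rightarrow> 'c" where
  "partial_derivs is f = foldr partial_deriv is f"

text \<open>
  A function is smooth iff all its iterated partial derivatives are (Frechet) differentiable
  everywhere; the partial derivatives are indexed by lists of coordinates instead of multi-indices.
\<close>

definition schwartz :: "(real^'n::finite \<Rightarrow> 'c::real_normed_vector) set" where
  "schwartz = {f. \<forall>is. (\<forall>x. partial_derivs is f differentiable (at x)) \<and>
     (\<forall>\<alpha> :: 'n \<Rightarrow> nat. bounded (range (\<lambda>x. (\<Prod>i\<in>UNIV. (x $ i) ^ \<alpha> i) *\<^sub>R partial_derivs is f x)))}"

text \<open>
  All integrals are Henstock-Kurzweil integrals: the Bochner integral of the library needs a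
  separable target space.  For Schwartz functions the two agree.
\<close>

definition rieffel_prod ::
    "(real^'n::finite \<Rightarrow> real^'n) \<Rightarrow> (real^'n \<Rightarrow> 'c::unital_cstar_algebra) \<Rightarrow> (real^'n \<Rightarrow> 'c)
      \<Rightarrow> real^'n \<Rightarrow> 'c" where
  "rieffel_prod J f g x =
     integral UNIV (\<lambda>u. integral UNIV (\<lambda>v.
       exp (2 * complex_of_real pi * \<i> * complex_of_real (u \<bullet> v)) *\<^sub>C (f (x + J u) * g (x + v))))"

definition schwartz_inner ::
    "(real^'n::finite \<Rightarrow> 'c::unital_cstar_algebra) \<Rightarrow> (real^'n \<Rightarrow> 'c) \<Rightarrow> 'c" where
  "schwartz_inner f g = integral UNIV (\<lambda>x. cstar (f x) * g x)"

definition schwartz_norm2 :: "(real^'n::finite \<Rightarrow> 'c::unital_cstar_algebra) \<Rightarrow> real" where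
  "schwartz_norm2 f = sqrt (norm (schwartz_inner f f))"


section \<open>Completions\<close>

text \<open>
  The completion of the set \<open>V\<close> in the distance \<open>d\<close> consists of the classes of Cauchy sequences
  in \<open>V\<close> modulo sequences whose distance tends to \<open>0\<close>.
\<close>

definition cauchy_seqs :: "'a set \<Rightarrow> ('a \<Rightarrow> 'a \<Rightarrow> real) \<Rightarrow> (nat \<Rightarrow> 'a) set" where
  "cauchy_seqs V d =
     {X. range X \<subseteq> V \<and> (\<forall>e>0. \<exists>N. \<forall>m\<ge>N. \<forall>k\<ge>N. d (X m) (X k) < e)}"

definition cauchy_rel :: "'a set \<Rightarrow> ('a \<Rightarrow> 'a \<Rightarrow> real) \<Rightarrow> ((nat \<Rightarrow> 'a) \<times> (nat \<Rightarrow> 'a)) set" where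
  "cauchy_rel V d =
     {(X, Y). X \<in> cauchy_seqs V d \<and> Y \<in> cauchy_seqs V d \<and> (\<lambda>k. d (X k) (Y k)) \<longlonglongrightarrow> 0}"

definition completion :: "'a set \<Rightarrow> ('a \<Rightarrow> 'a \<Rightarrow> real) \<Rightarrow> (nat \<Rightarrow> 'a) set set" where
  "completion V d = cauchy_seqs V d // cauchy_rel V d"

definition completion_embed :: "'a set \<Rightarrow> ('a \<Rightarrow> 'a \<Rightarrow> real) \<Rightarrow> 'a \<Rightarrow> (nat \<Rightarrow> 'a) set" where
  "completion_embed V d a = cauchy_rel V d `` {\<lambda>_. a}"

definition completion_lift ::
    "'a set \<Rightarrow> ('a \<Rightarrow> 'a \<Rightarrow> real) \<Rightarrow> ('a \<Rightarrow> 'a) \<Rightarrow> (nat \<Rightarrow> 'a) set \<Rightarrow> (nat \<Rightarrow> 'a) set" where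
  "completion_lift V d F \<xi> = (\<Union>X\<in>\<xi>. cauchy_rel V d `` {\<lambda>k. F (X k)})"

definition completion_lift2 ::
    "'a set \<Rightarrow> ('a \<Rightarrow> 'a \<Rightarrow> real) \<Rightarrow> ('a \<Rightarrow> 'a \<Rightarrow> 'a)
      \<Rightarrow> (nat \<Rightarrow> 'a) set \<Rightarrow> (nat \<Rightarrow> 'a) set \<Rightarrow> (nat \<Rightarrow> 'a) set" where
  "completion_lift2 V d F \<xi> \<eta> = (\<Union>X\<in>\<xi>. \<Union>Y\<in>\<eta>. cauchy_rel V d `` {\<lambda>k. F (X k) (Y k)})"


section \<open>The Hilbert module and its adjointable operators\<close>

definition schwartz_dist2 ::
    "(real^'n::finite \<Rightarrow> 'c::unital_cstar_algebra) \<Rightarrow> (real^'n \<Rightarrow> 'c) \<Rightarrow> real" where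
  "schwartz_dist2 f g = schwartz_norm2 (\<lambda>x. f x - g x)"

definition hilb :: "(nat \<Rightarrow> real^'n::finite \<Rightarrow> 'c::unital_cstar_algebra) set set" where
  "hilb = completion schwartz schwartz_dist2"

definition hilb_embed ::
    "(real^'n::finite \<Rightarrow> 'c::unital_cstar_algebra) \<Rightarrow> (nat \<Rightarrow> real^'n \<Rightarrow> 'c) set" where
  "hilb_embed = completion_embed schwartz schwartz_dist2"

definition hilb_inner ::
    "(nat \<Rightarrow> real^'n::finite \<Rightarrow> 'c::unital_cstar_algebra) set
      \<Rightarrow> (nat \<Rightarrow> real^'n \<Rightarrow> 'c) set \<Rightarrow> 'c" where
  "hilb_inner \<xi> \<eta> = (THE c. \<exists>X\<in>\<xi>. \<exists>Y\<in>\<eta>. (\<lambda>k. schwartz_inner (X k) (Y k)) \<longlonglongrightarrow> c)"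

definition hilb_norm :: "(nat \<Rightarrow> real^'n::finite \<Rightarrow> 'c::unital_cstar_algebra) set \<Rightarrow> real" where
  "hilb_norm \<xi> = sqrt (norm (hilb_inner \<xi> \<xi>))"

text \<open>
  Linearity over the coefficient algebra and boundedness follow from the existence of an adjoint.
  Operators are extensional functions, so that they are determined by their values on the module.
\<close>

definition adjointable ::
    "((nat \<Rightarrow> real^'n::finite \<Rightarrow> 'c::unital_cstar_algebra) set
      \<Rightarrow> (nat \<Rightarrow> real^'n \<Rightarrow> 'c) set) set" where
  "adjointable = {T \<in> hilb \<rightarrow>\<^sub>E hilb. \<exists>S \<in> hilb \<rightarrow>\<^sub>E hilb.
     \<forall>\<xi>\<in>hilb. \<forall>\<eta>\<in>hilb. hilb_inner (T \<xi>) \<eta> = hilb_inner \<xi> (S \<eta>)}"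

definition op_norm ::
    "((nat \<Rightarrow> real^'n::finite \<Rightarrow> 'c::unital_cstar_algebra) set
      \<Rightarrow> (nat \<Rightarrow> real^'n \<Rightarrow> 'c) set) \<Rightarrow> real" where
  "op_norm T = Sup {hilb_norm (T \<xi>) | \<xi>. \<xi> \<in> hilb \<and> hilb_norm \<xi> \<le> 1}"

definition left_op ::
    "(real^'n::finite \<Rightarrow> real^'n) \<Rightarrow> (real^'n \<Rightarrow> 'c::unital_cstar_algebra)
      \<Rightarrow> (nat \<Rightarrow> real^'n \<Rightarrow> 'c) set \<Rightarrow> (nat \<Rightarrow> real^'n \<Rightarrow> 'c) set" where
  "left_op J f = (THE T. T \<in> adjointable \<and>
     (\<forall>g\<in>schwartz. T (hilb_embed g) = hilb_embed (rieffel_prod J f g)))"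


section \<open>Complex algebras and spectral invariance\<close>

text \<open>
  Algebras are records with an explicit carrier and need not be unital, which rules out
  the rings of HOL-Algebra.
\<close>

record 'a calgebra =
  car :: "'a set"
  zer :: "'a"
  add :: "'a \<Rightarrow> 'a \<Rightarrow> 'a"
  scl :: "complex \<Rightarrow> 'a \<Rightarrow> 'a"
  mul :: "'a \<Rightarrow> 'a \<Rightarrow> 'a"

record 'a star_calgebra = "'a calgebra" +
  str :: "'a \<Rightarrow> 'a"

definition is_unit_of :: "('a, 'm) calgebra_scheme \<Rightarrow> 'a \<Rightarrow> bool" where
  "is_unit_of A e \<longleftrightarrow> e \<in> car A \<and> (\<forall>a\<in>car A. mul A e a = a \<and> mul A a e = a)"

definition unital :: "('a, 'm) calgebra_scheme \<Rightarrow> bool" where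
  "unital A \<longleftrightarrow> (\<exists>e. is_unit_of A e)"

definition unit_of :: "('a, 'm) calgebra_scheme \<Rightarrow> 'a" where
  "unit_of A = (THE e. is_unit_of A e)"

definition spectrum :: "('a, 'm) calgebra_scheme \<Rightarrow> 'a \<Rightarrow> complex set" where
  "spectrum A a = {z. \<not> (\<exists>b\<in>car A.
     let c = add A (scl A z (unit_of A)) (scl A (-1) a)
     in mul A c b = unit_of A \<and> mul A b c = unit_of A)}"

definition unitization :: "('a, 'm) calgebra_scheme \<Rightarrow> ('a \<times> complex) calgebra" where
  "unitization A = \<lparr>
     car = car A \<times> UNIV,
     zer = (zer A, 0),
     add = (\<lambda>(a, s) (b, t). (add A a b, s + t)),
     scl = (\<lambda>r (a, s). (scl A r a, r * s)),
     mul = (\<lambda>(a, s) (b, t). (add A (mul A a b) (add A (scl A s b) (scl A t a)), s * t))\<rparr>"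

definition is_subalgebra :: "('a, 'm) calgebra_scheme \<Rightarrow> 'a set \<Rightarrow> bool" where
  "is_subalgebra A B \<longleftrightarrow> B \<subseteq> car A \<and> zer A \<in> B \<and>
     (\<forall>a\<in>B. \<forall>b\<in>B. add A a b \<in> B \<and> mul A a b \<in> B) \<and> (\<forall>s. \<forall>a\<in>B. scl A s a \<in> B)"

definition subalgebra_gen :: "('a, 'm) calgebra_scheme \<Rightarrow> 'a set \<Rightarrow> 'a set" where
  "subalgebra_gen A M = \<Inter>{B. is_subalgebra A B \<and> M \<subseteq> B}"

text \<open>
  For a subalgebra \<open>B\<close> of \<open>A\<close>.  The condition \<open>unit_of A \<in> B\<close> says that \<open>A\<close> and \<open>B\<close> are
  unital with the same unit.
\<close>

definition spectrally_invariant :: "('a, 'm) calgebra_scheme \<Rightarrow> 'a set \<Rightarrow> bool" where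
  "spectrally_invariant A B \<longleftrightarrow>
     (if \<not> unital A then
        (\<forall>b \<in> car (unitization (A\<lparr>car := B\<rparr>)).
           spectrum (unitization (A\<lparr>car := B\<rparr>)) b = spectrum (unitization A) b)
      else if unit_of A \<in> B then
        (\<forall>b\<in>B. spectrum (A\<lparr>car := B\<rparr>) b = spectrum A b)
      else
        (let B' = subalgebra_gen A (insert (unit_of A) B)
         in \<forall>b\<in>B'. spectrum (A\<lparr>car := B'\<rparr>) b = spectrum A b))"


section \<open>Rieffel's deformed algebra and its C*-completion\<close>

definition schwartz_alg ::
    "(real^'n::finite \<Rightarrow> real^'n) \<Rightarrow> (real^'n \<Rightarrow> 'c::unital_cstar_algebra) star_calgebra" where
  "schwartz_alg J = \<lparr>
     car = schwartz,
     zer = (\<lambda>_. 0),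
     add = (\<lambda>f g x. f x + g x),
     scl = (\<lambda>s f x. s *\<^sub>C f x),
     mul = rieffel_prod J,
     str = (\<lambda>f x. cstar (f x))\<rparr>"

definition schwartz_cstar_norm ::
    "(real^'n::finite \<Rightarrow> real^'n) \<Rightarrow> (real^'n \<Rightarrow> 'c::unital_cstar_algebra) \<Rightarrow> real" where
  "schwartz_cstar_norm J f = op_norm (left_op J f)"

definition norm_dist :: "('a, 'm) calgebra_scheme \<Rightarrow> ('a \<Rightarrow> real) \<Rightarrow> 'a \<Rightarrow> 'a \<Rightarrow> real" where
  "norm_dist A nrm a b = nrm (add A a (scl A (-1) b))"

definition alg_completion ::
    "'a star_calgebra \<Rightarrow> ('a \<Rightarrow> real) \<Rightarrow> (nat \<Rightarrow> 'a) set star_calgebra" where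
  "alg_completion A nrm = (let V = car A; d = norm_dist A nrm in \<lparr>
     car = completion V d,
     zer = completion_embed V d (zer A),
     add = completion_lift2 V d (add A),
     scl = (\<lambda>s. completion_lift V d (scl A s)),
     mul = completion_lift2 V d (mul A),
     str = completion_lift V d (str A)\<rparr>)"

definition schwartz_alg_completion ::
    "(real^'n::finite \<Rightarrow> real^'n)
      \<Rightarrow> (nat \<Rightarrow> real^'n \<Rightarrow> 'c::unital_cstar_algebra) set star_calgebra" where
  "schwartz_alg_completion J = alg_completion (schwartz_alg J) (schwartz_cstar_norm J)"

definition schwartz_alg_embed ::
    "(real^'n::finite \<Rightarrow> real^'n) \<Rightarrow> (real^'n \<Rightarrow> 'c::unital_cstar_algebra)
      \<Rightarrow> (nat \<Rightarrow> real^'n \<Rightarrow> 'c) set" where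
  "schwartz_alg_embed J =
     completion_embed (car (schwartz_alg J)) (norm_dist (schwartz_alg J) (schwartz_cstar_norm J))"

end

theory Submission
  imports Defs "HOL-Probability.Characteristic_Functions"
    "HOL-Probability.Sinc_Integral"
begin

text \<open>
  Fourier inversion turns the product into \<open>f \<odot> g = \<integral> fourier f p e(p \<cdot> x) g (x + J p) dp\<close>, a superposition of
  modulated translates of \<open>g\<close>.  Associativity, the adjoint relation, the Leibniz rule and the
  boundedness of \<open>L\<^sub>f\<close> in the module norm can be read off from this form.

  If \<open>\<parallel>L\<^sub>f\<parallel> < 1\<close>, then the Neumann series of \<open>f\<close> converges in the Schwartz topology, so that \<open>1 - f\<close> has
  an inverse \<open>1 + h\<close> with \<open>h\<close> a Schwartz function: a Sobolev inequality bounds the Schwartz seminorms by the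
  operator norms of finitely many derivatives, and the differential seminorms
  \<open>T\<^sub>0 f = \<parallel>L\<^sub>f\<parallel>\<close>, \<open>T\<^sub>m\<^sub>+\<^sub>1 f = T\<^sub>m f + s \<Sum>\<^sub>i T\<^sub>m (\<partial>\<^sub>i f)\<close> are submultiplicative and, for small \<open>s\<close>,
  still smaller than \<open>1\<close> at \<open>f\<close>.  If \<open>g + \<mu>\<close> has an inverse in the completion, approximate it by some
  \<open>y + \<nu>\<close> with \<open>y\<close> a Schwartz function; then \<open>(g + \<mu>) (y + \<nu>)\<close> and \<open>(y + \<nu>) (g + \<mu>)\<close> differ from \<open>1\<close> by
  Schwartz functions of norm less than \<open>1\<close>, so \<open>g + \<mu>\<close> is invertible over the Schwartz functions.
  The completion is unital only if it is zero.
\<close>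

section \<open>Positivity in C*-algebras\<close>

text \<open>The coefficient algebra may be non-separable, so all integrals are Henstock-Kurzweil
  integrals. Every interchange of integrals is reduced to boxes: integrands are continuous and
  dominated by products of one fixed weight \<open>wt\<close>, which makes truncation errors
  uniform. The Hilbert module rests on a theory of positivity that uses neither spectra nor states:
  Cauchy-Schwarz and the bound of \<open>a * f x\<close> by \<open>norm a\<close> follow from the
  positivity of \<open>cstar a * a\<close> and the monotonicity of the norm on the positive cone.
  The Neumann argument is shaped by a mismatch: the Sobolev inequality involves the module norm,
  whereas the powers of \<open>f\<close> decay in operator norm. Every term of the series after the
  first is therefore kept as (derivative of a power) times a fixed Schwartz function
  \<open>h\<close>, because the module norm of \<open>G \<odot> h\<close> is at most the operator
  norm of \<open>G\<close> times the module norm of \<open>h\<close>. Multiplication by coordinates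
  preserves this form: it falls on \<open>h\<close>, up to a combination of first derivatives of
  \<open>G\<close>. The parameter \<open>s\<close> and the rate of decay depend on the derivative
  under consideration, which is harmless since each Schwartz seminorm involves finitely
  many.\<close>

lemma cstar_zero [simp]: "cstar 0 = (0::'c::unital_cstar_algebra)"
  using cstar_add[of "0::'c" 0] by simp

lemma cstar_minus:
  fixes x :: "'c::unital_cstar_algebra"
  shows "cstar (- x) = - cstar x"
  using cstar_add[of x "- x"] by (simp add: eq_neg_iff_add_eq_0 add.commute)

lemma cstar_diff:
  fixes x y :: "'c::unital_cstar_algebra"
  shows "cstar (x - y) = cstar x - cstar y"
  using cstar_add[of x "- y"] by (simp add: cstar_minus)

lemma cstar_scaleR:
  fixes x :: "'c::unital_cstar_algebra"
  shows "cstar (r *\<^sub>R x) = r *\<^sub>R cstar x"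
  using cstar_scaleC[of "complex_of_real r" x] by (simp add: scaleC_of_real)

lemma cstar_one [simp]: "cstar 1 = (1::'c::unital_cstar_algebra)"
  by (metis cstar_cstar cstar_mult mult_1_left mult_1_right)

lemma norm_cstar [simp]:
  fixes x :: "'c::unital_cstar_algebra"
  shows "norm (cstar x) = norm x"
proof -
  have le: "norm x \<le> norm (cstar x)" for x :: 'c
  proof (cases "x = 0")
    case False
    have "(norm x)\<^sup>2 \<le> norm (cstar x) * norm x"
      using norm_mult_ineq[of "cstar x" x] by (simp add: cstar_identity)
    with False show ?thesis by (simp add: power2_eq_square)
  qed simp
  from le[of x] le[of "cstar x"] show ?thesis by (simp add: cstar_cstar)
qed

lemma norm_one_le: "norm (1::'c::unital_cstar_algebra) \<le> 1"
proof -
  have "norm (1::'c) * norm (1::'c) = norm (1::'c)"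
    using cstar_identity[of "1::'c"] by (simp add: power2_eq_square)
  then show ?thesis by auto
qed

lemma norm_scaleR_one_le: "0 \<le> r \<Longrightarrow> norm (r *\<^sub>R (1::'c::unital_cstar_algebra)) \<le> r"
  using norm_one_le mult_left_mono[of "norm (1::'c)" 1 r] by simp

lemma scaleC_one [simp]:
  fixes x :: "'c::unital_cstar_algebra"
  shows "1 *\<^sub>C x = x"
  using scaleC_of_real[of 1 x] by simp

lemma scaleC_zero_left [simp]:
  fixes x :: "'c::unital_cstar_algebra"
  shows "0 *\<^sub>C x = 0"
  using scaleC_of_real[of 0 x] by simp

lemma scaleC_zero_right [simp]: "c *\<^sub>C 0 = (0::'c::unital_cstar_algebra)"
  using scaleC_add_right[of c "0::'c" 0] by simp

lemma scaleC_minus_left: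
  fixes x :: "'c::unital_cstar_algebra"
  shows "(- c) *\<^sub>C x = - (c *\<^sub>C x)"
  using scaleC_add_left[of c "- c" x] by (simp add: eq_neg_iff_add_eq_0 add.commute)

lemma scaleC_minus_right:
  fixes x :: "'c::unital_cstar_algebra"
  shows "c *\<^sub>C (- x) = - (c *\<^sub>C x)"
  using scaleC_add_right[of c x "- x"] by (simp add: eq_neg_iff_add_eq_0 add.commute)

lemma scaleC_diff_right:
  fixes x y :: "'c::unital_cstar_algebra"
  shows "c *\<^sub>C (x - y) = c *\<^sub>C x - c *\<^sub>C y"
  using scaleC_add_right[of c x "- y"] by (simp add: scaleC_minus_right)

lemma scaleC_scaleR:
  fixes x :: "'c::unital_cstar_algebra"
  shows "c *\<^sub>C (r *\<^sub>R x) = r *\<^sub>R (c *\<^sub>C x)"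
  by (metis mult.commute scaleC_of_real scaleC_scaleC)

lemma scaleR_scaleC:
  fixes x :: "'c::unital_cstar_algebra"
  shows "(r *\<^sub>R c) *\<^sub>C x = r *\<^sub>R (c *\<^sub>C x)"
  by (metis scaleC_of_real scaleC_scaleC scaleR_conv_of_real)

lemma bounded_linear_cstar: "bounded_linear (cstar :: 'c::unital_cstar_algebra \<Rightarrow> 'c)"
  by (rule bounded_linear_intro[where K=1]) (simp_all add: cstar_add cstar_scaleR)

lemma bounded_bilinear_scaleC:
  "bounded_bilinear (scaleC :: complex \<Rightarrow> 'c::unital_cstar_algebra \<Rightarrow> 'c)"
proof
  show "\<exists>K. \<forall>a (b::'c). norm (a *\<^sub>C b) \<le> norm a * norm b * K"
    by (rule exI[of _ 1]) (simp add: norm_scaleC)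
qed (simp_all add: scaleC_add_left scaleC_add_right scaleC_scaleR scaleR_scaleC)

lemmas tendsto_cstar [tendsto_intros] = bounded_linear.tendsto[OF bounded_linear_cstar]
lemmas continuous_on_cstar [continuous_intros] = bounded_linear.continuous_on[OF bounded_linear_cstar]
lemmas continuous_on_scaleC [continuous_intros] =
  bounded_bilinear.continuous_on[OF bounded_bilinear_scaleC]

text \<open>For self-adjoint \<open>y\<close> the C*-identity makes \<open>y * y = 0\<close> force
  \<open>y = 0\<close>. The cube enters through the fourth power, from which this descends in two
  steps. Takes the place of spectral arguments.\<close>

lemma cstar_self_power_eq_0:
  fixes x :: "'c::unital_cstar_algebra"
  assumes "cstar x = x" "x * x * x = 0"
  shows "x = 0"
proof -
  have sq: "y * y = 0 \<Longrightarrow> y = 0" if "cstar y = y" for y :: 'c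
    using cstar_identity[of y] that by simp
  have "(x * x) * (x * x) = 0" using assms(2) by (simp add: mult.assoc[symmetric])
  then have "x * x = 0" by (rule sq[rotated]) (simp add: cstar_mult assms(1))
  then show ?thesis using assms(1) by (rule sq[rotated])
qed

text \<open>The iteration \<open>y \<mapsto> (t + y\<^sup>2) / 2\<close> converges to \<open>1 - sqrt (1 - t)\<close> for \<open>norm t \<le> 1\<close>;
  its scalar instance at \<open>t = 1\<close> majorises the increments.\<close>

primrec sqrt_iter :: "'c::real_normed_algebra \<Rightarrow> nat \<Rightarrow> 'c" where
  "sqrt_iter t 0 = 0"
| "sqrt_iter t (Suc n) = (1/2) *\<^sub>R (t + sqrt_iter t n * sqrt_iter t n)"

lemma sqrt_iter_real_bounds:
  "0 \<le> sqrt_iter (1::real) n \<and> sqrt_iter (1::real) n \<le> 1 \<and> sqrt_iter (1::real) n \<le> sqrt_iter 1 (Suc n)"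
proof (induction n)
  case (Suc n)
  let ?s = "sqrt_iter (1::real) n"
  have s: "?s * ?s \<le> 1" using Suc mult_le_one[of ?s ?s] by simp
  have m: "?s * ?s \<le> sqrt_iter 1 (Suc n) * sqrt_iter 1 (Suc n)"
    using Suc by (intro mult_mono) auto
  show ?case using Suc s m by auto
qed simp

text \<open>Both bounds go through one induction: the increment estimate needs the sizes of the two
  iterates involved, and the size of the next iterate needs the increment.\<close>

lemma sqrt_iter_bounds:
  fixes t :: "'c::real_normed_algebra"
  assumes t: "norm t \<le> 1"
  shows "norm (sqrt_iter t n) \<le> sqrt_iter 1 n
    \<and> norm (sqrt_iter t (Suc n) - sqrt_iter t n) \<le> sqrt_iter 1 (Suc n) - sqrt_iter 1 n"
proof (induction n)
  case 0
  then show ?case using t by simp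
next
  case (Suc n)
  define y where "y = sqrt_iter t n"
  define z where "z = sqrt_iter t (Suc n)"
  define s where "s = sqrt_iter (1::real) n"
  define u where "u = sqrt_iter (1::real) (Suc n)"
  have IH: "norm y \<le> s" "norm (z - y) \<le> u - s" using Suc by (simp_all only: y_def z_def s_def u_def)
  have z: "norm z \<le> u"
    using norm_triangle_sub[of z y] IH by simp
  \<comment> \<open>The difference of squares is factored without commutativity; for the scalar
    iteration the same factorisation is an exact identity, which closes the induction.\<close>
  have "sqrt_iter t (Suc (Suc n)) - z = (1/2) *\<^sub>R (z * (z - y) + (z - y) * y)"
  proof -
    have "z = (1/2) *\<^sub>R (t + y * y)" by (simp add: z_def y_def)
    moreover have "sqrt_iter t (Suc (Suc n)) = (1/2) *\<^sub>R (t + z * z)" by (simp add: z_def)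
    ultimately have "sqrt_iter t (Suc (Suc n)) - z = (1/2) *\<^sub>R (t + z * z) - (1/2) *\<^sub>R (t + y * y)"
      by (simp only:)
    also have "\<dots> = (1/2) *\<^sub>R (z * z - y * y)" by (simp add: algebra_simps)
    finally have "sqrt_iter t (Suc (Suc n)) - z = (1/2) *\<^sub>R (z * z - y * y)" .
    moreover have "z * z - y * y = z * (z - y) + (z - y) * y" by (simp add: algebra_simps)
    ultimately show ?thesis by (simp only:)
  qed
  also have "norm \<dots> \<le> (1/2) * (norm z * norm (z - y) + norm (z - y) * norm y)"
    using norm_triangle_ineq[of "z * (z - y)" "(z - y) * y"] norm_mult_ineq[of z "z - y"]
      norm_mult_ineq[of "z - y" y] by simp
  also have "\<dots> \<le> (1/2) * (u * (u - s) + (u - s) * s)"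
    using IH z order_trans[OF norm_ge_zero z] order_trans[OF norm_ge_zero IH(2)]
    by (intro mult_left_mono add_mono mult_mono) auto
  also have "\<dots> = sqrt_iter 1 (Suc (Suc n)) - u"
  proof -
    have "u = (1/2) * (1 + s * s)" by (simp add: u_def s_def)
    moreover have "sqrt_iter 1 (Suc (Suc n)) = (1/2) * (1 + u * u)" by (simp add: u_def)
    ultimately show ?thesis by (simp add: algebra_simps)
  qed
  finally show ?case using z unfolding u_def z_def by blast
qed

text \<open>The scalar iterates increase and stay below 1, hence form a Cauchy sequence; telescoping
  transfers their increments to \<open>t\<close>.\<close>

lemma sqrt_iter_convergent:
  fixes t :: "'c::{real_normed_algebra,banach}"
  assumes t: "norm t \<le> 1"
  shows "convergent (sqrt_iter t)"
proof -
  define s where "s = sqrt_iter (1::real)"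
  have "incseq s" unfolding s_def using sqrt_iter_real_bounds by (intro incseq_SucI) blast
  moreover have "bdd_above (range s)"
    using sqrt_iter_real_bounds by (intro bdd_aboveI[of _ 1]) (auto simp: s_def)
  ultimately have "Cauchy s"
    using LIMSEQ_incseq_SUP LIMSEQ_imp_Cauchy by blast
  have diff: "norm (sqrt_iter t (n + k) - sqrt_iter t n) \<le> s (n + k) - s n" for n k
  proof (induction k)
    case (Suc k)
    have "norm (sqrt_iter t (n + Suc k) - sqrt_iter t n)
        \<le> norm (sqrt_iter t (Suc (n + k)) - sqrt_iter t (n + k)) + norm (sqrt_iter t (n + k) - sqrt_iter t n)"
      using norm_triangle_ineq[of "sqrt_iter t (Suc (n + k)) - sqrt_iter t (n + k)"
          "sqrt_iter t (n + k) - sqrt_iter t n"] by (simp del: sqrt_iter.simps)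
    also have "\<dots> \<le> (s (Suc (n + k)) - s (n + k)) + (s (n + k) - s n)"
      using sqrt_iter_bounds[OF t, of "n + k"] Suc unfolding s_def by (intro add_mono) blast+
    finally show ?case by simp
  qed simp
  have "Cauchy (sqrt_iter t)"
  proof (rule CauchyI)
    fix e :: real assume "0 < e"
    then obtain M where M: "\<And>m n. m \<ge> M \<Longrightarrow> n \<ge> M \<Longrightarrow> norm (s m - s n) < e / 2"
      using CauchyD[OF \<open>Cauchy s\<close>, of "e/2"] by auto
    have near: "norm (sqrt_iter t m - sqrt_iter t M) < e / 2" if "m \<ge> M" for m
      using diff[of M "m - M"] M[of m M] that abs_ge_self[of "s m - s M"] by simp
    show "\<exists>M. \<forall>m\<ge>M. \<forall>n\<ge>M. norm (sqrt_iter t m - sqrt_iter t n) < e"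
    proof (intro exI allI impI)
      fix m n assume "m \<ge> M" "n \<ge> M"
      with near[of m] near[of n]
        norm_triangle_ineq4[of "sqrt_iter t m - sqrt_iter t M" "sqrt_iter t n - sqrt_iter t M"]
      show "norm (sqrt_iter t m - sqrt_iter t n) < e" by simp
    qed
  qed
  then show ?thesis by (rule Cauchy_convergent)
qed

definition sqrt_one_minus :: "'c::unital_cstar_algebra \<Rightarrow> 'c" where
  "sqrt_one_minus t = 1 - lim (sqrt_iter t)"

text \<open>The limit \<open>y\<close> of the iteration satisfies
  \<open>2 y = t + y\<^sup>2\<close>, that is \<open>(1 - y)\<^sup>2 = 1 - t\<close>. The norm bound
  on \<open>y\<close> is the certificate that makes the root itself positive in the sense of
  \<open>pos\<close>.\<close>

lemma sqrt_one_minus: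
  fixes t :: "'c::unital_cstar_algebra"
  assumes t: "norm t \<le> 1"
  shows sqrt_one_minus_square: "sqrt_one_minus t * sqrt_one_minus t = 1 - t"
    and norm_one_minus_sqrt: "norm (1 - sqrt_one_minus t) \<le> 1"
proof -
  define y where "y = lim (sqrt_iter t)"
  have lim: "sqrt_iter t \<longlonglongrightarrow> y"
    unfolding y_def using sqrt_iter_convergent[OF t] by (simp add: convergent_LIMSEQ_iff)
  have "(\<lambda>n. sqrt_iter t (Suc n)) \<longlonglongrightarrow> (1/2) *\<^sub>R (t + y * y)"
    unfolding sqrt_iter.simps by (intro tendsto_intros lim)
  with LIMSEQ_Suc[OF lim] have "y = (1/2) *\<^sub>R (t + y * y)" using LIMSEQ_unique by blast
  then have "2 *\<^sub>R y = 2 *\<^sub>R (1/2) *\<^sub>R (t + y * y)" by (rule arg_cong)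
  then have "2 *\<^sub>R y = t + y * y" by simp
  then have "y + y = t + y * y" by (simp add: scaleR_2)
  moreover have "(1 - y) * (1 - y) = 1 - (y + y) + y * y" by (simp add: algebra_simps)
  ultimately show "sqrt_one_minus t * sqrt_one_minus t = 1 - t"
    by (simp add: sqrt_one_minus_def flip: y_def)
  have "norm (sqrt_iter t n) \<le> 1" for n
    using sqrt_iter_bounds[OF t, of n] sqrt_iter_real_bounds[of n] by linarith
  then have "norm y \<le> 1" by (intro LIMSEQ_le_const2[OF tendsto_norm[OF lim]]) blast
  then show "norm (1 - sqrt_one_minus t) \<le> 1" by (simp add: sqrt_one_minus_def y_def)
qed

text \<open>The relation passes to all iterates and to their limits. Two different elements are
  allowed because Kaplansky's step moves \<open>cstar b\<close> past the roots of two different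
  squares; \<open>t = t'\<close> gives commutation.\<close>

lemma sqrt_one_minus_intertwine:
  fixes t :: "'c::unital_cstar_algebra"
  assumes "norm t \<le> 1" "norm t' \<le> 1" "t * b = b * t'"
  shows "sqrt_one_minus t * b = b * sqrt_one_minus t'"
proof -
  have lim: "sqrt_iter t \<longlonglongrightarrow> lim (sqrt_iter t)" "sqrt_iter t' \<longlonglongrightarrow> lim (sqrt_iter t')"
    using sqrt_iter_convergent assms by (simp_all add: convergent_LIMSEQ_iff)
  have eq: "sqrt_iter t n * b = b * sqrt_iter t' n" for n
    by (induction n) (simp_all add: algebra_simps assms(3), metis (no_types) mult.assoc)
  have "(\<lambda>n. sqrt_iter t n * b) \<longlonglongrightarrow> lim (sqrt_iter t) * b" by (intro tendsto_intros lim)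
  moreover have "(\<lambda>n. sqrt_iter t n * b) \<longlonglongrightarrow> b * lim (sqrt_iter t')"
    unfolding eq by (intro tendsto_intros lim)
  ultimately have "lim (sqrt_iter t) * b = b * lim (sqrt_iter t')" using LIMSEQ_unique by blast
  then show ?thesis by (simp add: sqrt_one_minus_def algebra_simps)
qed

lemma cstar_sqrt_one_minus:
  fixes t :: "'c::unital_cstar_algebra"
  assumes "norm t \<le> 1" "cstar t = t"
  shows "cstar (sqrt_one_minus t) = sqrt_one_minus t"
proof -
  have lim: "sqrt_iter t \<longlonglongrightarrow> lim (sqrt_iter t)"
    using sqrt_iter_convergent assms by (simp add: convergent_LIMSEQ_iff)
  have eq: "cstar (sqrt_iter t n) = sqrt_iter t n" for n
    by (induction n) (simp_all add: cstar_scaleR cstar_add cstar_mult assms)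
  have "(\<lambda>n. cstar (sqrt_iter t n)) \<longlonglongrightarrow> cstar (lim (sqrt_iter t))" by (intro tendsto_intros lim)
  then have "cstar (lim (sqrt_iter t)) = lim (sqrt_iter t)" using lim eq LIMSEQ_unique by simp
  then show ?thesis by (simp add: sqrt_one_minus_def cstar_diff)
qed

text \<open>Positivity is expressed by a norm inequality, which makes the positive elements a convex cone
  before anything is known about spectra.\<close>

definition pos :: "'c::unital_cstar_algebra \<Rightarrow> bool" where
  "pos x \<longleftrightarrow> cstar x = x \<and> (\<exists>t\<ge>0. norm (t *\<^sub>R 1 - x) \<le> t)"

lemma pos_add: "pos x \<Longrightarrow> pos y \<Longrightarrow> pos (x + y)"
  unfolding pos_def
proof (elim conjE exE, intro conjI exI)
  fix s t :: real
  assume *: "norm (s *\<^sub>R 1 - x) \<le> s" "norm (t *\<^sub>R 1 - y) \<le> t"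
  have "(s + t) *\<^sub>R 1 - (x + y) = (s *\<^sub>R 1 - x) + (t *\<^sub>R 1 - y)" by (simp add: algebra_simps)
  also have "norm \<dots> \<le> s + t" using * norm_triangle_mono by blast
  finally show "norm ((s + t) *\<^sub>R 1 - (x + y)) \<le> s + t" .
qed (simp_all add: cstar_add)

lemma pos_scaleR: "0 \<le> r \<Longrightarrow> pos x \<Longrightarrow> pos (r *\<^sub>R x)"
  unfolding pos_def
proof (elim conjE exE, intro conjI exI)
  fix t :: real
  assume *: "norm (t *\<^sub>R 1 - x) \<le> t" "0 \<le> r"
  have "(r * t) *\<^sub>R 1 - r *\<^sub>R x = r *\<^sub>R (t *\<^sub>R 1 - x)" by (simp add: algebra_simps)
  then show "norm ((r * t) *\<^sub>R 1 - r *\<^sub>R x) \<le> r * t" using * by (simp add: mult_left_mono)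
qed (simp_all add: cstar_scaleR)

lemma pos_zero [simp]: "pos 0"
  unfolding pos_def by (auto intro: exI[of _ 0])

lemma pos_scaleR_one_minus: "cstar h = h \<Longrightarrow> norm h \<le> r \<Longrightarrow> pos (r *\<^sub>R 1 - h)"
  unfolding pos_def using norm_ge_zero[of h]
  by (auto simp: cstar_diff cstar_scaleR intro!: exI[of _ r] simp del: norm_ge_zero)

text \<open>If \<open>d\<close> and \<open>e\<close> are commuting and self-adjoint, then \<open>u = d + i e\<close> satisfies
  \<open>u\<^sup>* u = d\<^sup>2 + e\<^sup>2\<close>.\<close>

lemma cstar_identity_commuting:
  fixes d e :: "'c::unital_cstar_algebra"
  assumes "cstar d = d" "cstar e = e" "d * e = e * d"
  shows "(norm (d + \<i> *\<^sub>C e))\<^sup>2 = norm (d * d + e * e)"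
proof -
  have "cstar (d + \<i> *\<^sub>C e) * (d + \<i> *\<^sub>C e) = d * d + e * e"
    by (simp add: cstar_add cstar_scaleC assms distrib_left distrib_right mult_scaleC_left
        mult_scaleC_right scaleC_scaleC scaleC_minus_left scaleC_add_right scaleC_diff_right
        left_diff_distrib right_diff_distrib)
  then show ?thesis using cstar_identity[of "d + \<i> *\<^sub>C e"] by simp
qed

text \<open>\<open>d\<close> is the real part of \<open>u = d + i e\<close>, so its norm is at most
  that of \<open>u\<close>, which the C*-identity controls. Substitutes for
  \<open>d\<^sup>2 \<le> d\<^sup>2 + e\<^sup>2\<close> as long as the norm is not known to be
  monotone on positive elements.\<close>

lemma norm_le_of_square_sum:
  fixes d e :: "'c::unital_cstar_algebra"
  assumes "cstar d = d" "cstar e = e" "d * e = e * d" "norm (d * d + e * e) \<le> r\<^sup>2" "0 \<le> r"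
  shows "norm d \<le> r"
proof -
  define u where "u = d + \<i> *\<^sub>C e"
  have "(norm u)\<^sup>2 \<le> r\<^sup>2"
    unfolding u_def cstar_identity_commuting[OF assms(1-3)] by (rule assms(4))
  then have u: "norm u \<le> r" using assms(5) by (rule power2_le_imp_le)
  have "2 *\<^sub>R d = u + cstar u"
    by (simp add: u_def cstar_add cstar_scaleC assms(1,2) scaleC_minus_left scaleR_2)
  then have "norm (2 *\<^sub>R d) = norm (u + cstar u)" by (rule arg_cong)
  also have "\<dots> \<le> norm u + norm (cstar u)" by (rule norm_triangle_ineq)
  finally show ?thesis using u by simp
qed

section \<open>Square roots of positive elements\<close>

text \<open>The square root of \<open>x\<close>, as \<open>sqrt t\<close> times the root of
  \<open>1 - (1 - x / t)\<close>. The scale \<open>t\<close> is an argument so that the roots of two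
  elements can be taken by the same iteration and compared by
  \<open>pos_sqrt_intertwine\<close>.\<close>

definition pos_sqrt :: "'c::unital_cstar_algebra \<Rightarrow> real \<Rightarrow> 'c" where
  "pos_sqrt x t = sqrt t *\<^sub>R sqrt_one_minus (1 - (1/t) *\<^sub>R x)"

lemma norm_one_minus_scaled:
  fixes x :: "'c::unital_cstar_algebra"
  assumes "0 < t" "norm (t *\<^sub>R 1 - x) \<le> t"
  shows "norm (1 - (1/t) *\<^sub>R x) \<le> 1"
proof -
  have "1 - (1/t) *\<^sub>R x = (1/t) *\<^sub>R (t *\<^sub>R 1 - x)" using assms(1) by (simp add: scaleR_right_diff_distrib)
  then show ?thesis using assms by (simp add: divide_simps)
qed

lemma pos_sqrt:
  fixes x :: "'c::unital_cstar_algebra"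
  assumes "0 < t" "norm (t *\<^sub>R 1 - x) \<le> t"
  shows pos_sqrt_square: "pos_sqrt x t * pos_sqrt x t = x"
    and cstar_pos_sqrt: "cstar x = x \<Longrightarrow> cstar (pos_sqrt x t) = pos_sqrt x t"
    and pos_pos_sqrt: "cstar x = x \<Longrightarrow> pos (pos_sqrt x t)"
proof -
  have n: "norm (1 - (1/t) *\<^sub>R x) \<le> 1" by (rule norm_one_minus_scaled[OF assms])
  show "pos_sqrt x t * pos_sqrt x t = x"
    using assms(1) by (simp add: pos_sqrt_def sqrt_one_minus_square[OF n])
  assume "cstar x = x"
  then have sa: "cstar (sqrt_one_minus (1 - (1/t) *\<^sub>R x)) = sqrt_one_minus (1 - (1/t) *\<^sub>R x)"
    by (intro cstar_sqrt_one_minus n) (simp add: cstar_diff cstar_scaleR)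
  then show "cstar (pos_sqrt x t) = pos_sqrt x t" by (simp add: pos_sqrt_def cstar_scaleR)
  have "pos (sqrt_one_minus (1 - (1/t) *\<^sub>R x))"
    unfolding pos_def using sa norm_one_minus_sqrt[OF n] by (auto intro!: exI[of _ 1])
  then show "pos (pos_sqrt x t)" unfolding pos_sqrt_def using assms(1) by (intro pos_scaleR) simp_all
qed

lemma pos_sqrt_intertwine:
  fixes x :: "'c::unital_cstar_algebra"
  assumes "0 < t" "norm (t *\<^sub>R 1 - x) \<le> t" "norm (t *\<^sub>R 1 - x') \<le> t" "x * b = b * x'"
  shows "pos_sqrt x t * b = b * pos_sqrt x' t"
proof -
  have "sqrt_one_minus (1 - (1/t) *\<^sub>R x) * b = b * sqrt_one_minus (1 - (1/t) *\<^sub>R x')"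
    by (intro sqrt_one_minus_intertwine norm_one_minus_scaled assms) (simp add: algebra_simps assms(4))
  then show ?thesis by (simp add: pos_sqrt_def)
qed

text \<open>A certificate can be enlarged at will, because \<open>norm 1 \<le> 1\<close>. This
  supplies a strictly positive scale for a root and a common scale for two roots.\<close>

lemma pos_obtain_bound:
  fixes x :: "'c::unital_cstar_algebra"
  assumes "pos x"
  obtains t where "0 < t" "\<And>s. t \<le> s \<Longrightarrow> norm (s *\<^sub>R 1 - x) \<le> s"
proof -
  obtain t where t: "0 \<le> t" "norm (t *\<^sub>R 1 - x) \<le> t" using assms by (auto simp: pos_def)
  have "norm (s *\<^sub>R 1 - x) \<le> s" if "t \<le> s" for s
  proof -
    have "s *\<^sub>R 1 - x = (s - t) *\<^sub>R 1 + (t *\<^sub>R 1 - x)" by (simp add: algebra_simps)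
    also have "norm \<dots> \<le> (s - t) + t"
      using norm_scaleR_one_le[of "s - t"] t(2) that by (intro norm_triangle_mono) auto
    finally show ?thesis by simp
  qed
  then show thesis by (intro that[of "t + 1"]) (use t(1) in auto)
qed

lemma pos_imp_square:
  fixes x :: "'c::unital_cstar_algebra"
  assumes "pos x"
  obtains d where "d * d = x" "cstar d = d" "pos d" "\<And>b. x * b = b * x \<Longrightarrow> d * b = b * d"
proof -
  obtain t where t: "0 < t" "norm (t *\<^sub>R 1 - x) \<le> t" using pos_obtain_bound[OF assms] by blast
  have "cstar x = x" using assms by (simp add: pos_def)
  then show thesis
    by (intro that[of "pos_sqrt x t"] pos_sqrt[OF t] pos_sqrt_intertwine[OF t t(2)])
qed

lemma norm_square_self: "cstar d = d \<Longrightarrow> norm (d * d) = (norm (d::'c::unital_cstar_algebra))\<^sup>2"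
  using cstar_identity[of d] by simp

text \<open>Pythagoras: a root \<open>e\<close> of the complement
  \<open>r\<^sup>2 - d\<^sup>2\<close> commutes with \<open>d\<close>, so
  \<open>norm_le_of_square_sum\<close> bounds \<open>e\<close> by \<open>r\<close>, and the square
  of \<open>e\<close> is the element in question.\<close>

lemma square_bound:
  fixes d :: "'c::unital_cstar_algebra"
  assumes d: "cstar d = d" and r: "0 < r" "norm d \<le> r"
  shows "norm (r\<^sup>2 *\<^sub>R 1 - d * d) \<le> r\<^sup>2"
proof -
  have n: "norm (d * d) \<le> r\<^sup>2" using r by (simp add: norm_square_self[OF d] power_mono)
  have p: "pos (r\<^sup>2 *\<^sub>R 1 - d * d)" using n by (intro pos_scaleR_one_minus) (simp_all add: cstar_mult d)
  obtain e where e: "e * e = r\<^sup>2 *\<^sub>R 1 - d * d" "cstar e = e"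
      "\<And>b. (r\<^sup>2 *\<^sub>R 1 - d * d) * b = b * (r\<^sup>2 *\<^sub>R 1 - d * d) \<Longrightarrow> e * b = b * e"
    using pos_imp_square[OF p] by metis
  have "e * d = d * e" by (rule e(3)) (simp add: algebra_simps)
  moreover have "norm (e * e + d * d) \<le> r\<^sup>2"
    using norm_scaleR_one_le[of "r\<^sup>2", where 'c='c] by (simp add: e(1))
  ultimately have "norm e \<le> r" using e(2) d r by (intro norm_le_of_square_sum[of e d r]) simp_all
  then show ?thesis using norm_square_self[OF e(2)] e(1) by (simp add: power_mono)
qed

lemma pos_square:
  fixes d :: "'c::unital_cstar_algebra"
  assumes d: "cstar d = d"
  shows "pos (d * d)"
proof -
  \<comment> \<open>The \<open>+ 1\<close> keeps the radius positive when
    \<open>d = 0\<close>.\<close>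
  have "norm ((norm d + 1)\<^sup>2 *\<^sub>R 1 - d * d) \<le> (norm d + 1)\<^sup>2"
    by (rule square_bound[OF d]) (auto intro: add_nonneg_pos)
  then have "\<exists>t\<ge>0. norm (t *\<^sub>R 1 - d * d) \<le> t" by (intro exI[of _ "(norm d + 1)\<^sup>2"]) simp
  then show ?thesis unfolding pos_def using d by (simp add: cstar_mult)
qed

text \<open>The commuting case of conjugation: with a root \<open>d\<close> of \<open>x\<close>,
  \<open>y * x * y\<close> is the square of the self-adjoint \<open>d * y\<close>. It is available
  before \<open>cstar b * b\<close> is known to be positive.\<close>

lemma pos_cong_square:
  fixes x y :: "'c::unital_cstar_algebra"
  assumes "pos x" "cstar y = y" "x * y = y * x"
  shows "pos (y * x * y)"
proof -
  obtain d where d: "d * d = x" "cstar d = d" "\<And>b. x * b = b * x \<Longrightarrow> d * b = b * d"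
    using pos_imp_square[OF assms(1)] by metis
  have "d * y = y * d" using assms(3) by (rule d(3))
  then have "y * x * y = (d * y) * (d * y)" unfolding d(1)[symmetric] by (simp add: mult.assoc)
  moreover have "cstar (d * y) = d * y" using \<open>d * y = y * d\<close> by (simp add: cstar_mult d(2) assms(2))
  ultimately show ?thesis using pos_square by metis
qed

text \<open>Roots \<open>d\<close> of \<open>h\<close> and \<open>e\<close> of \<open>- h\<close>
  commute and their squares add up to 0, so the square-sum estimate with radius 0 gives
  \<open>d = 0\<close>.\<close>

lemma pos_antisym:
  fixes h :: "'c::unital_cstar_algebra"
  assumes "pos h" "pos (- h)"
  shows "h = 0"
proof -
  obtain d where d: "d * d = h" "cstar d = d" "\<And>b. h * b = b * h \<Longrightarrow> d * b = b * d"
    using pos_imp_square[OF assms(1)] by metis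
  obtain e where e: "e * e = - h" "cstar e = e" "\<And>b. (-h) * b = b * (-h) \<Longrightarrow> e * b = b * e"
    using pos_imp_square[OF assms(2)] by metis
  have "d * h = h * d" by (simp add: mult.assoc flip: d(1))
  then have "e * d = d * e" by (intro e(3)) simp
  then have "norm d \<le> 0" using d(1,2) e(1,2) by (intro norm_le_of_square_sum[of d e 0]) simp_all
  then show ?thesis using d(1) by simp
qed

text \<open>With \<open>c = p - s\<close>, the conjugates of \<open>p\<close> and of
  \<open>s\<close> by \<open>c\<close> are positive and add up to
  \<open>c * (p + s) * c = 0\<close>, so both vanish; their difference is the cube of
  \<open>c\<close>.\<close>

lemma pos_sqrt_unique:
  fixes p s :: "'c::unital_cstar_algebra"
  assumes "pos p" "pos s" "p * s = s * p" "p * p = s * s"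
  shows "p = s"
proof -
  define c where "c = p - s"
  have sa: "cstar c = c" using assms(1,2) by (simp add: c_def cstar_diff pos_def)
  have z: "c * (p + s) = 0" using assms(3,4) by (simp add: c_def algebra_simps)
  have "c * p * c + c * s * c = 0" using arg_cong[OF z, of "\<lambda>u. u * c"] by (simp add: distrib_left distrib_right)
  then have "c * s * c = - (c * p * c)" by (simp add: add.commute eq_neg_iff_add_eq_0)
  moreover have "p * c = c * p" "s * c = c * s"
    unfolding c_def using assms(3) by (simp_all add: right_diff_distrib left_diff_distrib)
  then have "pos (c * p * c)" "pos (c * s * c)" using assms sa by (intro pos_cong_square; simp)+
  ultimately have "c * p * c = 0" using pos_antisym[of "c * p * c"] by simp
  moreover from this have "c * s * c = 0" using \<open>c * s * c = - (c * p * c)\<close> by simp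
  ultimately have "c * (p - s) * c = 0" by (simp add: right_diff_distrib left_diff_distrib)
  then have "c * c * c = 0" by (simp add: c_def)
  then have "c = 0" using sa by (rule cstar_self_power_eq_0[rotated])
  then show ?thesis by (simp add: c_def)
qed

text \<open>Kaplansky's step: \<open>b\<^sup>* b\<close> cannot be negative, because \<open>b b\<^sup>* = 2 (x\<^sup>2 + y\<^sup>2) - b\<^sup>* b\<close> is then
  positive, and the functional calculus carries \<open>\<bar>b b\<^sup>*\<bar> = b b\<^sup>*\<close> over to \<open>\<bar>b\<^sup>* b\<bar> = b\<^sup>* b\<close>.\<close>

lemma pos_minus_cstar_mult_self:
  fixes b :: "'c::unital_cstar_algebra"
  assumes "pos (- (cstar b * b))"
  shows "b = 0"
proof -
  define p where "p = - (cstar b * b)"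
  define q where "q = b * cstar b"
  define x where "x = b + cstar b"
  define y where "y = \<i> *\<^sub>C (cstar b - b)"
  have "cstar x = x" by (simp add: x_def cstar_add cstar_cstar)
  moreover have "cstar y = y"
    by (simp add: y_def cstar_scaleC cstar_diff cstar_cstar scaleC_minus_left scaleC_diff_right)
  ultimately have "pos (x * x + y * y)" by (intro pos_add pos_square)
  moreover have "x * x + y * y = 2 *\<^sub>R (q - p)"
  proof -
    have "y * y = - ((cstar b - b) * (cstar b - b))"
      unfolding y_def mult_scaleC_left mult_scaleC_right scaleC_scaleC by (simp add: scaleC_minus_left)
    then show ?thesis by (simp add: x_def p_def q_def algebra_simps scaleR_2)
  qed
  ultimately have "pos (q - p)" using pos_scaleR[of "1/2" "2 *\<^sub>R (q - p)"] by simp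
  then have q: "pos q" using pos_add[of "q - p" p] assms by (simp add: p_def)
  have p: "pos p" using assms by (simp add: p_def)
  obtain s where s: "0 < s" "\<And>r. s \<le> r \<Longrightarrow> norm (r *\<^sub>R 1 - p * p) \<le> r"
    using p pos_obtain_bound[of "p * p"] pos_square[of p] unfolding pos_def by metis
  obtain t where t: "0 < t" "\<And>r. t \<le> r \<Longrightarrow> norm (r *\<^sub>R 1 - q * q) \<le> r"
    using q pos_obtain_bound[of "q * q"] pos_square[of q] unfolding pos_def by metis
  \<comment> \<open>A common scale, so that the roots of \<open>p * p\<close> and
    \<open>q * q\<close> arise from the same iteration.\<close>
  define r where "r = max s t"
  have r: "0 < r" "norm (r *\<^sub>R 1 - p * p) \<le> r" "norm (r *\<^sub>R 1 - q * q) \<le> r"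
    using s t by (auto simp: r_def)
  have root: "pos_sqrt (z * z) r = z" if "pos z" "norm (r *\<^sub>R 1 - z * z) \<le> r" for z :: 'c
  proof (rule pos_sqrt_unique)
    have "cstar z = z" using that by (simp add: pos_def)
    then show "pos (pos_sqrt (z * z) r)" using r that by (intro pos_pos_sqrt) (simp_all add: cstar_mult)
    show "pos_sqrt (z * z) r * z = z * pos_sqrt (z * z) r"
      using r that by (intro pos_sqrt_intertwine) (simp_all add: mult.assoc)
    show "pos_sqrt (z * z) r * pos_sqrt (z * z) r = z * z" using r that by (intro pos_sqrt_square)
  qed (use that in simp)
  have pq: "(p * p) * cstar b = cstar b * (q * q)" by (simp add: p_def q_def mult.assoc)
  have "p * cstar b = cstar b * q"
    using pos_sqrt_intertwine[OF r pq] root[OF p r(2)] root[OF q r(3)] by simp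
  \<comment> \<open>Bracketing \<open>cstar b * b * cstar b\<close> the other way shows that the
    element is its own negative.\<close>
  also have "\<dots> = - (p * cstar b)" by (simp add: p_def q_def mult.assoc)
  finally have "p * cstar b + p * cstar b = 0" by (simp add: eq_neg_iff_add_eq_0)
  then have "2 *\<^sub>R (p * cstar b) = 0" by (simp only: scaleR_2)
  then have "p * cstar b = 0" by simp
  then have "p * cstar b * b = 0" by simp
  then have "p * p = 0" by (simp add: p_def mult.assoc)
  then have "p = 0" using norm_square_self[of p] p by (simp add: pos_def)
  then show ?thesis using cstar_identity[of b] by (simp add: p_def)
qed

text \<open>\<open>m\<close> is the absolute value of \<open>h\<close>, and \<open>c = h - m\<close>
  is minus twice its negative part. Since \<open>c * h = - (c * m)\<close>, the element
  \<open>cstar (a * c) * (a * c) = c * h * c\<close> is negative, and Kaplansky's step gives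
  \<open>a * c = 0\<close>. Then the cube of \<open>c\<close> vanishes, so
  \<open>h = m\<close>.\<close>

theorem pos_cstar_mult_self:
  fixes a :: "'c::unital_cstar_algebra"
  shows "pos (cstar a * a)"
proof -
  define h where "h = cstar a * a"
  have h: "cstar h = h" by (simp add: h_def cstar_mult cstar_cstar)
  obtain m where m: "m * m = h * h" "cstar m = m" "pos m" "\<And>b. h * h * b = b * (h * h) \<Longrightarrow> m * b = b * m"
    using pos_imp_square[OF pos_square[OF h]] by metis
  have mh: "m * h = h * m" by (rule m(4)) (simp add: mult.assoc)
  define c where "c = h - m"
  have c: "cstar c = c" by (simp add: c_def cstar_diff h m)
  have chc: "cstar (a * c) * (a * c) = c * h * c" by (simp add: cstar_mult c h_def mult.assoc)
  have "c * (h + m) = 0" by (simp add: c_def algebra_simps m(1) mh)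
  then have hm: "c * h = - (c * m)" by (simp add: algebra_simps eq_neg_iff_add_eq_0)
  have "m * c = c * m" by (simp add: c_def algebra_simps mh)
  then have "pos (c * m * c)" using m(3) c by (intro pos_cong_square)
  then have "pos (- (cstar (a * c) * (a * c)))" by (simp add: chc hm)
  then have "a * c = 0" by (rule pos_minus_cstar_mult_self)
  then have chc0: "c * h * c = 0" using chc by simp
  then have cmc0: "c * m * c = 0" using hm by simp
  have "c * c * c = c * h * c - c * m * c" by (subst (2) c_def) (simp add: algebra_simps)
  then have "c * c * c = 0" using chc0 cmc0 by simp
  then have "c = 0" by (rule cstar_self_power_eq_0[OF c])
  then have "h = m" by (simp only: c_def eq_iff_diff_eq_0[of h m])
  with m(3) have "pos h" by (simp only:)
  then show ?thesis by (simp only: h_def)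
qed

section \<open>Order estimates and closedness of the positive cone\<close>

lemma pos_conj:
  fixes x b :: "'c::unital_cstar_algebra"
  assumes "pos x"
  shows "pos (cstar b * x * b)"
proof -
  obtain d where d: "d * d = x" "cstar d = d" using pos_imp_square[OF assms] by metis
  have "cstar b * x * b = cstar (d * b) * (d * b)"
    by (simp add: cstar_mult d(2) mult.assoc flip: d(1))
  then show ?thesis using pos_cstar_mult_self[of "d * b"] by metis
qed

text \<open>The norm itself serves as certificate of positivity. Unlike an arbitrary certificate it
  varies continuously, which is what closedness of the cone needs.\<close>

lemma pos_norm_bound:
  fixes x :: "'c::unital_cstar_algebra"
  assumes "pos x" "norm x \<le> r" "0 \<le> r"
  shows "norm (r *\<^sub>R 1 - x) \<le> r"
proof (cases "r = 0")
  case False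
  obtain d where d: "d * d = x" "cstar d = d" using pos_imp_square[OF assms(1)] by metis
  have "norm d \<le> sqrt r" using assms norm_square_self[OF d(2)] d(1) by (simp add: real_le_rsqrt)
  then have "norm ((sqrt r)\<^sup>2 *\<^sub>R 1 - d * d) \<le> (sqrt r)\<^sup>2"
    using assms False by (intro square_bound d(2)) auto
  then show ?thesis using assms d by simp
qed (use assms in simp)

text \<open>Let \<open>r = norm y\<close>. Then \<open>x\<close> and
  \<open>r - x = (r - y) + (y - x)\<close> are positive, and they have commuting roots whose squares
  add up to \<open>r\<close>; so the root of \<open>x\<close> is bounded by
  \<open>sqrt r\<close>.\<close>

lemma pos_norm_mono:
  fixes x y :: "'c::unital_cstar_algebra"
  assumes "pos x" "pos (y - x)"
  shows "norm x \<le> norm y"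
proof -
  define r where "r = norm y"
  have "cstar y = y" using assms by (simp add: pos_def cstar_diff)
  then have "pos (r *\<^sub>R 1 - y)" by (intro pos_scaleR_one_minus) (simp_all add: r_def)
  then have p: "pos (r *\<^sub>R 1 - x)" using pos_add[OF _ assms(2), of "r *\<^sub>R 1 - y"] by simp
  obtain e where e: "e * e = r *\<^sub>R 1 - x" "cstar e = e"
      "\<And>b. (r *\<^sub>R 1 - x) * b = b * (r *\<^sub>R 1 - x) \<Longrightarrow> e * b = b * e"
    using pos_imp_square[OF p] by metis
  obtain d where d: "d * d = x" "cstar d = d" using pos_imp_square[OF assms(1)] by metis
  have "e * d = d * e" by (rule e(3)) (simp add: algebra_simps d(1)[symmetric])
  moreover have "norm (d * d + e * e) \<le> (sqrt r)\<^sup>2"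
    using norm_scaleR_one_le[of r, where 'c='c] by (simp add: d e(1) r_def)
  ultimately have "norm d \<le> sqrt r"
    using d e(2) by (intro norm_le_of_square_sum[of d e]) (simp_all add: r_def)
  then have "(norm d)\<^sup>2 \<le> (sqrt r)\<^sup>2" by (intro power_mono) simp_all
  then show ?thesis using norm_square_self[OF d(2)] d(1) by (simp add: r_def)
qed

lemma closed_pos: "closed {x :: 'c::unital_cstar_algebra. pos x}"
proof (subst closed_sequential_limits, intro allI impI, elim conjE)
  fix X and l :: 'c
  assume X: "\<forall>n. X n \<in> {x. pos x}" and lim: "X \<longlonglongrightarrow> l"
  have "cstar (X n) = X n" for n using X by (simp add: pos_def)
  then have sa: "cstar l = l" using tendsto_cstar[OF lim] lim LIMSEQ_unique by auto
  have "norm (norm (X n) *\<^sub>R 1 - X n) \<le> norm (X n)" for n using X by (intro pos_norm_bound) simp_all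
  moreover have "(\<lambda>n. norm (norm (X n) *\<^sub>R 1 - X n)) \<longlonglongrightarrow> norm (norm l *\<^sub>R 1 - l)"
    by (intro tendsto_intros lim)
  ultimately have "norm (norm l *\<^sub>R 1 - l) \<le> norm l"
    by (intro LIMSEQ_le[OF _ tendsto_norm[OF lim]]) auto
  then show "l \<in> {x. pos x}" using sa by (auto simp: pos_def intro!: exI[of _ "norm l"])
qed

lemma pos_one_minus_norm:
  fixes a :: "'c::unital_cstar_algebra"
  shows "pos ((norm a)\<^sup>2 *\<^sub>R 1 - cstar a * a)"
  by (rule pos_scaleR_one_minus) (simp_all add: cstar_identity cstar_mult cstar_cstar)

section \<open>Integrals of dominated continuous functions\<close>

text \<open>The square of the Japanese bracket; as a polynomial in the coordinates it maps Schwartz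
  functions to Schwartz functions.\<close>

definition jap :: "'a::real_normed_vector \<Rightarrow> real" where
  "jap x = 1 + (norm x)\<^sup>2"

text \<open>The exponent is the one for which \<open>wt\<close> lies below a product of functions
  \<open>1 / (1 + t\<^sup>2)\<close> of the single coordinates, hence is integrable, and is
  cancelled exactly by an integral power of \<open>jap\<close>.\<close>

definition wt :: "'a::euclidean_space \<Rightarrow> real" where
  "wt x = inverse (jap x ^ DIM('a))"

lemma jap_ge_1: "1 \<le> jap x" by (simp add: jap_def)
lemma jap_pos: "0 < jap x" using jap_ge_1[of x] by linarith
lemma wt_pos: "0 < wt x" by (simp add: wt_def jap_pos)
lemma wt_nonneg: "0 \<le> wt x" using wt_pos[of x] by simp
lemma wt_le_1: "wt x \<le> 1"
  unfolding wt_def by (intro inverse_le_1_iff[THEN iffD2] disjI2 one_le_power jap_ge_1)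

lemma jap_minus: "jap (- x) = jap x" by (simp add: jap_def)
lemma wt_minus: "wt (- x) = wt x" by (simp add: wt_def jap_minus)

lemma norm_le_jap: "norm x \<le> jap x"
proof -
  have "2 * norm x \<le> (norm x)\<^sup>2 + 1" using zero_le_power2[of "norm x - 1"] by (simp add: power2_diff)
  then show ?thesis using norm_ge_zero[of x] unfolding jap_def by linarith
qed

lemma jap_add_le: "jap (x + y) \<le> 2 * jap x * jap y"
proof -
  have "norm (x + y) \<le> norm x + norm y" by (rule norm_triangle_ineq)
  then have "(norm (x + y))\<^sup>2 \<le> (norm x + norm y)\<^sup>2" by (intro power_mono) simp_all
  also have "\<dots> \<le> 2 * (norm x)\<^sup>2 + 2 * (norm y)\<^sup>2"
    using zero_le_power2[of "norm x - norm y"] by (simp add: power2_eq_square algebra_simps)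
  finally have "jap (x + y) \<le> 1 + 2 * (norm x)\<^sup>2 + 2 * (norm y)\<^sup>2" by (simp add: jap_def)
  also have "\<dots> \<le> 2 * jap x * jap y" by (simp add: jap_def algebra_simps)
  finally show ?thesis .
qed

text \<open>Peetre's inequality \<open>jap_add_le\<close> for \<open>x = (x + y) - y\<close>:
  translating the weight by \<open>y\<close> costs a power of \<open>jap y\<close>, to be paid for
  by decay in \<open>y\<close>.\<close>

lemma wt_add_le:
  fixes x y :: "'a::euclidean_space"
  shows "wt (x + y) \<le> (2 * jap y) ^ DIM('a) * wt x"
proof -
  have "jap x \<le> 2 * jap (x + y) * jap y" using jap_add_le[of "x + y" "- y"] by (simp add: jap_minus)
  then have "jap x ^ DIM('a) \<le> (2 * jap (x + y) * jap y) ^ DIM('a)"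
    using jap_pos[of x] by (intro power_mono) simp_all
  then have "inverse ((2 * jap (x + y) * jap y) ^ DIM('a)) \<le> wt x"
    unfolding wt_def using jap_pos[of x] by (intro le_imp_inverse_le) simp_all
  then have "(2 * jap y) ^ DIM('a) * inverse ((2 * jap (x + y) * jap y) ^ DIM('a)) \<le> (2 * jap y) ^ DIM('a) * wt x"
    using jap_pos[of y] by (intro mult_left_mono) simp_all
  moreover have "(2 * jap y) ^ DIM('a) * inverse ((2 * jap (x + y) * jap y) ^ DIM('a)) = wt (x + y)"
    using jap_pos[of y] by (simp add: wt_def power_mult_distrib field_simps)
  ultimately show ?thesis by (simp only:)
qed

lemma continuous_on_jap [continuous_intros]:
  "continuous_on A f \<Longrightarrow> continuous_on A (\<lambda>x. jap (f x))"
  unfolding jap_def by (intro continuous_intros)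

lemma continuous_on_wt [continuous_intros]: "continuous_on A (wt :: 'a::euclidean_space \<Rightarrow> real)"
  unfolding wt_def
proof (intro continuous_intros ballI)
  fix x show "jap x ^ DIM('a) \<noteq> 0" using jap_pos[of x] by simp
qed

text \<open>Lebesgue measure is the image of the product measure under the coordinate expansion.
  Serves both the integrability of \<open>wt\<close> and the Fourier transform of the
  Gaussian.\<close>

lemma lborel_integral_prod_Basis:
  fixes g :: "'a::euclidean_space \<Rightarrow> real \<Rightarrow> 'b::{real_normed_field,banach,second_countable_topology}"
  assumes "\<And>b. b \<in> Basis \<Longrightarrow> integrable lborel (g b)"
  shows lborel_integrable_prod_Basis: "integrable lborel (\<lambda>x::'a. \<Prod>b\<in>Basis. g b (x \<bullet> b))"
    and "(LINT x|lborel. (\<Prod>b\<in>Basis. g b (x \<bullet> b))) = (\<Prod>b\<in>(Basis::'a set). LINT t|lborel. g b t)"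
proof -
  interpret finite_product_sigma_finite "\<lambda>_::'a. lborel :: real measure" "Basis :: 'a set"
    proof qed simp
  let ?T = "\<lambda>f::'a \<Rightarrow> real. \<Sum>b\<in>Basis. f b *\<^sub>R b"
  have T: "?T \<in> measurable (\<Pi>\<^sub>M b\<in>Basis. lborel) borel"
  proof (intro borel_measurable_sum borel_measurable_scaleR borel_measurable_const)
    fix b :: 'a assume "b \<in> Basis"
    then have "(\<lambda>f. f b) \<in> measurable (\<Pi>\<^sub>M b\<in>Basis. lborel) (lborel :: real measure)"
      by (rule measurable_component_singleton)
    then show "(\<lambda>f. f b) \<in> measurable (\<Pi>\<^sub>M b\<in>Basis. lborel) (borel :: real measure)" by simp
  qed
  have m: "(\<lambda>x::'a. \<Prod>b\<in>Basis. g b (x \<bullet> b)) \<in> borel_measurable borel"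
  proof (rule borel_measurable_prod)
    fix b :: 'a assume "b \<in> Basis"
    then have "g b \<in> borel_measurable borel" using borel_measurable_integrable[OF assms] by simp
    then show "(\<lambda>x. g b (x \<bullet> b)) \<in> borel_measurable borel" by (rule measurable_compose[rotated]) simp
  qed
  have eq: "(\<Prod>b\<in>Basis. g b (?T f \<bullet> b)) = (\<Prod>b\<in>Basis. g b (f b))" for f by simp
  show "integrable lborel (\<lambda>x::'a. \<Prod>b\<in>Basis. g b (x \<bullet> b))"
    by (subst lborel_eq, subst integrable_distr_eq[OF T m], subst eq, rule product_integrable_prod)
      (simp_all add: assms)
  show "(LINT x|lborel. (\<Prod>b\<in>Basis. g b (x \<bullet> b))) = (\<Prod>b\<in>(Basis::'a set). LINT t|lborel. g b t)"
    by (subst lborel_eq, subst integral_distr[OF T m], subst eq, rule product_integral_prod)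
      (simp_all add: assms)
qed

lemma integrable_continuous_bound:
  fixes f :: "'a::euclidean_space \<Rightarrow> 'b::banach"
  assumes "continuous_on UNIV f" "\<And>x. norm (f x) \<le> g x" "g integrable_on UNIV"
  shows "f integrable_on UNIV"
  using assms
  by (intro integrable_on_all_intervals_integrable_bound[of UNIV f g])
    (auto intro: integrable_continuous continuous_on_subset)

lemma integrable_wt: "(wt :: 'a::euclidean_space \<Rightarrow> real) integrable_on UNIV"
proof -
  let ?g = "\<lambda>t::real. inverse (1 + t\<^sup>2)"
  have "integrable lborel ?g"
    using integrable_inverse_1_plus_square unfolding set_integrable_def by simp
  then have "integrable lborel (\<lambda>x::'a. \<Prod>b\<in>Basis. ?g (x \<bullet> b))"
    by (intro lborel_integrable_prod_Basis)
  then have i: "(\<lambda>x::'a. \<Prod>b\<in>Basis. ?g (x \<bullet> b)) integrable_on UNIV" by (rule integrable_on_lborel)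
  have n: "norm (wt x) \<le> (\<Prod>b\<in>Basis. ?g (x \<bullet> b))" for x :: 'a
  proof -
    have "(\<Prod>b\<in>(Basis :: 'a set). inverse (jap x)) \<le> (\<Prod>b\<in>Basis. ?g (x \<bullet> b))"
    proof (intro prod_mono conjI le_imp_inverse_le)
      fix b :: 'a assume "b \<in> Basis"
      then have "\<bar>x \<bullet> b\<bar> \<le> norm x" by (rule Basis_le_norm)
      then have "\<bar>x \<bullet> b\<bar>\<^sup>2 \<le> (norm x)\<^sup>2" by (intro power_mono) simp_all
      then show "1 + (x \<bullet> b)\<^sup>2 \<le> jap x" by (simp add: jap_def)
      show "0 < 1 + (x \<bullet> b)\<^sup>2" by (simp add: add_pos_nonneg)
      show "0 \<le> inverse (jap x)" using jap_pos[of x] by simp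
    qed
    then show ?thesis using wt_nonneg[of x] by (simp add: wt_def power_inverse)
  qed
  show ?thesis by (rule integrable_continuous_bound[OF continuous_on_wt n i])
qed

definition wt_total :: "'a::euclidean_space itself \<Rightarrow> real" where
  "wt_total _ = integral UNIV (wt :: 'a \<Rightarrow> real)"

lemma wt_total_nonneg: "0 \<le> wt_total TYPE('a::euclidean_space)"
  unfolding wt_total_def by (intro integral_nonneg integrable_wt wt_nonneg)

text \<open>Wide enough to contain \<open>\<lambda>x. wt x *\<^sub>R 1\<close>, against which
  Cauchy-Schwarz is applied in the Sobolev inequality.\<close>

definition dec :: "('a::euclidean_space \<Rightarrow> 'b::banach) \<Rightarrow> bool" where
  "dec f \<longleftrightarrow> continuous_on UNIV f \<and> (\<exists>K. \<forall>x. norm (f x) \<le> K * wt x)"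

lemma decI: "continuous_on UNIV f \<Longrightarrow> (\<And>x. norm (f x) \<le> K * wt x) \<Longrightarrow> dec f"
  unfolding dec_def by blast

lemma integrable_wt_bound:
  fixes f :: "'a::euclidean_space \<Rightarrow> 'b::banach"
  assumes "continuous_on UNIV f" "\<And>x. norm (f x) \<le> K * wt x"
  shows "f integrable_on UNIV"
  using assms by (rule integrable_continuous_bound) (intro integrable_on_mult_right integrable_wt)

lemma norm_integral_wt_bound:
  fixes f :: "'a::euclidean_space \<Rightarrow> 'b::banach"
  assumes "continuous_on UNIV f" "\<And>x. norm (f x) \<le> K * wt x"
  shows "norm (integral UNIV f) \<le> K * wt_total TYPE('a)"
proof -
  have "norm (integral UNIV f) \<le> integral UNIV (\<lambda>x::'a. K * wt x)"
    by (intro Henstock_Kurzweil_Integration.integral_norm_bound_integral integrable_wt_bound[OF assms] assms(2)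
        integrable_on_mult_right integrable_wt)
  then show ?thesis by (simp add: wt_total_def)
qed

lemma dec_integrable: "dec f \<Longrightarrow> f integrable_on UNIV"
  unfolding dec_def using integrable_wt_bound by blast

lemma dec_add: "dec f \<Longrightarrow> dec g \<Longrightarrow> dec (\<lambda>x. f x + g x)"
  unfolding dec_def
proof (elim conjE exE, intro conjI exI allI)
  fix K L x assume "\<forall>x. norm (f x) \<le> K * wt x" "\<forall>x. norm (g x) \<le> L * wt x"
  then show "norm (f x + g x) \<le> (K + L) * wt x"
    using norm_triangle_mono[of "f x" "K * wt x" "g x" "L * wt x"] by (simp add: algebra_simps)
qed (intro continuous_intros)

section \<open>Truncation to boxes and interchange of integrals\<close>

lemma has_integral_UNIV_ball:
  fixes f :: "'a::euclidean_space \<Rightarrow> 'b::real_normed_vector"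
  assumes "(f has_integral i) UNIV" "0 < e"
  obtains B where "0 < B" "\<forall>a b. ball 0 B \<subseteq> cbox a b \<longrightarrow> (\<exists>z. (f has_integral z) (cbox a b) \<and> norm (z - i) < e)"
proof -
  have "\<nexists>a b. (UNIV :: 'a set) = cbox a b" using not_bounded_UNIV bounded_cbox by metis
  from has_integral_altD[OF assms(1) this assms(2)] obtain B where "0 < B"
    "\<forall>a b. ball 0 B \<subseteq> cbox a b \<longrightarrow>
      (\<exists>z. ((\<lambda>x. if x \<in> UNIV then f x else 0) has_integral z) (cbox a b) \<and> norm (z - i) < e)" .
  then show thesis by (intro that[of B]) simp_all
qed

lemma box_seq_tendsto:
  fixes f :: "'a::euclidean_space \<Rightarrow> 'b::banach"
  assumes "f integrable_on UNIV"
  shows "(\<lambda>k. integral (cbox (- (real k *\<^sub>R One)) (real k *\<^sub>R One)) f) \<longlonglongrightarrow> integral UNIV f"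
proof (rule LIMSEQ_I)
  fix e :: real assume e: "0 < e"
  obtain B where B: "0 < B"
      "\<forall>a b. ball 0 B \<subseteq> cbox a b \<longrightarrow> (\<exists>z. (f has_integral z) (cbox a b) \<and> norm (z - integral UNIV f) < e)"
      by (rule has_integral_UNIV_ball[OF integrable_integral[OF assms] e])
  show "\<exists>N. \<forall>k\<ge>N. norm (integral (cbox (- (real k *\<^sub>R One)) (real k *\<^sub>R One)) f - integral UNIV f) < e"
  proof (intro exI allI impI)
    fix k assume k: "nat \<lceil>B\<rceil> \<le> k"
    have "ball 0 B \<subseteq> cbox (- (real k *\<^sub>R One)) (real k *\<^sub>R One :: 'a)"
    proof
      fix x :: 'a assume x: "x \<in> ball 0 B"
      have "B \<le> real k" using k by linarith
      have "\<bar>x \<bullet> i\<bar> \<le> real k" if "i \<in> Basis" for i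
        using Basis_le_norm[OF that, of x] x \<open>B \<le> real k\<close> by simp
      then show "x \<in> cbox (- (real k *\<^sub>R One)) (real k *\<^sub>R One)"
        by (auto simp: mem_box inner_sum_left_Basis abs_le_iff minus_le_iff)
    qed
    from B(2)[rule_format, OF this] show "norm (integral (cbox (- (real k *\<^sub>R One)) (real k *\<^sub>R One)) f - integral UNIV f) < e"
      by (auto dest: integral_unique)
  qed
qed

abbreviation bx :: "nat \<Rightarrow> 'a::euclidean_space set" where
  "bx k \<equiv> cbox (- (real k *\<^sub>R One)) (real k *\<^sub>R One)"

text \<open>One null sequence bounds the truncation errors of all functions dominated by the weight,
  so limits over boxes are uniform in parameters. It takes the place of dominated
  convergence.\<close>

definition wt_tail :: "'a::euclidean_space itself \<Rightarrow> nat \<Rightarrow> real" where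
  "wt_tail _ k = integral UNIV (wt :: 'a \<Rightarrow> real) - integral (bx k) (wt :: 'a \<Rightarrow> real)"

lemma wt_tail_tendsto: "wt_tail TYPE('a::euclidean_space) \<longlonglongrightarrow> 0"
  using tendsto_diff[OF tendsto_const box_seq_tendsto[OF integrable_wt[where 'a='a]],
      of "integral UNIV (wt :: 'a \<Rightarrow> real)"]
  by (simp add: wt_tail_def[abs_def])

lemma box_tail_bound:
  fixes f :: "'a::euclidean_space \<Rightarrow> 'b::banach"
  assumes "continuous_on UNIV f" "\<And>x. norm (f x) \<le> K * wt x"
  shows "norm (integral UNIV f - integral (bx k) f) \<le> K * wt_tail TYPE('a) k"
proof -
  have i: "(\<lambda>x. g x - (if x \<in> bx k then g x else 0)) integrable_on UNIV"
    "integral UNIV (\<lambda>x. g x - (if x \<in> bx k then g x else 0)) = integral UNIV g - integral (bx k) g"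
    if "continuous_on UNIV g" "\<And>x. norm (g x) \<le> K * wt x" for g :: "'a \<Rightarrow> 'c::banach" and K
  proof -
    have g: "g integrable_on UNIV" by (rule integrable_wt_bound[OF that])
    have "g integrable_on bx k" using g by (rule integrable_on_subcbox) simp
    then have "((\<lambda>x. if x \<in> bx k then g x else 0) has_integral integral (bx k) g) UNIV"
      by (simp add: has_integral_restrict_UNIV has_integral_integral)
    from has_integral_diff[OF integrable_integral[OF g] this]
    show "(\<lambda>x. g x - (if x \<in> bx k then g x else 0)) integrable_on UNIV"
      "integral UNIV (\<lambda>x. g x - (if x \<in> bx k then g x else 0)) = integral UNIV g - integral (bx k) g"
      by (auto simp: integral_unique integrable_on_def)
  qed
  have w: "continuous_on UNIV (\<lambda>x::'a. K * wt x)" "\<And>x::'a. norm (K * wt x) \<le> \<bar>K\<bar> * wt x"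
    by (auto intro!: continuous_intros simp: abs_mult wt_nonneg)
  have "norm (integral UNIV f - integral (bx k) f)
      \<le> integral UNIV (\<lambda>x::'a. K * wt x - (if x \<in> bx k then K * wt x else 0))"
    unfolding i(2)[OF assms, symmetric]
    using assms(2) by (intro Henstock_Kurzweil_Integration.integral_norm_bound_integral i(1)[OF assms] i(1)[OF w]) auto
  also have "\<dots> = K * wt_tail TYPE('a) k" unfolding i(2)[OF w] by (simp add: wt_tail_def algebra_simps)
  finally show ?thesis .
qed

lemma continuous_on_slice:
  assumes "continuous_on UNIV (\<lambda>(x, y). F x y)"
  shows "continuous_on UNIV (\<lambda>y. F x y)" "continuous_on UNIV (\<lambda>x. F x y)"
proof -
  have "continuous_on UNIV (\<lambda>y. (x, y))" by (intro continuous_intros)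
  from continuous_on_compose2[OF assms this] show "continuous_on UNIV (\<lambda>y. F x y)" by simp
  have "continuous_on UNIV (\<lambda>x. (x, y))" by (intro continuous_intros)
  from continuous_on_compose2[OF assms this] show "continuous_on UNIV (\<lambda>x. F x y)" by simp
qed

lemma wt_tail_nonneg: "0 \<le> wt_tail TYPE('a::euclidean_space) k"
proof -
  have "norm (integral UNIV (wt :: 'a \<Rightarrow> real) - integral (bx k) (wt :: 'a \<Rightarrow> real)) \<le> 1 * wt_tail TYPE('a) k"
    by (rule box_tail_bound) (simp_all add: wt_nonneg continuous_on_wt)
  then show ?thesis using norm_ge_zero[of "integral UNIV (wt :: 'a \<Rightarrow> real) - integral (bx k) (wt :: 'a \<Rightarrow> real)"] by linarith
qed

text \<open>Box integrals depend continuously on the parameter by compactness of the box, and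
  \<open>wt_tail\<close> makes their convergence uniform.\<close>

lemma continuous_on_integral_param:
  fixes F :: "'p::topological_space \<Rightarrow> 'a::euclidean_space \<Rightarrow> 'b::banach"
  assumes c: "continuous_on UNIV (\<lambda>(x, y). F x y)" and b: "\<And>x y. norm (F x y) \<le> K * wt y"
  shows "continuous_on UNIV (\<lambda>x. integral UNIV (F x))"
proof (rule uniform_limit_theorem)
  show "\<forall>\<^sub>F k in sequentially. continuous_on UNIV (\<lambda>x. integral (bx k) (F x))"
    by (intro always_eventually allI integral_continuous_on_param continuous_on_subset[OF c]) simp
  show "uniform_limit UNIV (\<lambda>k x. integral (bx k) (F x)) (\<lambda>x. integral UNIV (F x)) sequentially"
  proof (rule uniform_limitI)
    fix e :: real assume "0 < e"
    have "(\<lambda>k. K * wt_tail TYPE('a) k) \<longlonglongrightarrow> K * 0" by (intro tendsto_intros wt_tail_tendsto)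
    then have "\<forall>\<^sub>F k in sequentially. K * wt_tail TYPE('a) k < e"
      using \<open>0 < e\<close> by (intro order_tendstoD) simp_all
    then show "\<forall>\<^sub>F k in sequentially. \<forall>x\<in>UNIV. dist (integral (bx k) (F x)) (integral UNIV (F x)) < e"
    proof eventually_elim
      case (elim k)
      show ?case
      proof
        fix x
        have "norm (integral UNIV (F x) - integral (bx k) (F x)) \<le> K * wt_tail TYPE('a) k"
          by (intro box_tail_bound continuous_on_slice(1)[OF c] b)
        then show "dist (integral (bx k) (F x)) (integral UNIV (F x)) < e"
          using elim by (simp add: dist_norm norm_minus_commute)
      qed
    qed
  qed
qed simp

text \<open>The truncation error splits into the outer tail of the full inner integral and the inner
  tails integrated over the outer box; both are multiples of \<open>wt_tail\<close>.\<close>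

lemma iterated_box_tendsto:
  fixes F :: "'a::euclidean_space \<Rightarrow> 'b::euclidean_space \<Rightarrow> 'c::banach"
  assumes c: "continuous_on UNIV (\<lambda>(x, y). F x y)" and b: "\<And>x y. norm (F x y) \<le> K * wt x * wt y"
  shows "(\<lambda>k. integral (bx k) (\<lambda>x. integral (bx k) (F x))) \<longlonglongrightarrow> integral UNIV (\<lambda>x. integral UNIV (F x))"
proof -
  define G where "G = (\<lambda>x. integral UNIV (F x))"
  define D where "D = (\<lambda>k. K * wt_total TYPE('b) * wt_tail TYPE('a) k + K * wt_total TYPE('a) * wt_tail TYPE('b) k)"
  have K: "0 \<le> K"
  proof -
    have "0 \<le> K * (wt (0::'a) * wt (0::'b))"
      using order_trans[OF norm_ge_zero b[of 0 0]] by (simp add: mult.assoc)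
    then show ?thesis using mult_pos_pos[OF wt_pos[of "0::'a"] wt_pos[of "0::'b"]]
      by (simp add: zero_le_mult_iff)
  qed
  have b': "norm (F x y) \<le> K * wt y" for x y
  proof -
    have "K * wt x * wt y \<le> K * 1 * wt y"
      using K wt_le_1 wt_nonneg by (intro mult_right_mono mult_left_mono)
    then show ?thesis using b[of x y] by simp
  qed
  have cG: "continuous_on UNIV G" unfolding G_def using c b' by (rule continuous_on_integral_param)
  have bG: "norm (G x) \<le> (K * wt_total TYPE('b)) * wt x" for x
    using norm_integral_wt_bound[OF continuous_on_slice(1)[OF c] b, of x]
    by (simp add: G_def mult_ac)
  have "norm (integral UNIV G - integral (bx k) (\<lambda>x. integral (bx k) (F x))) \<le> D k" for k
  proof -
    have ck: "continuous_on UNIV (\<lambda>x. integral (bx k) (F x))"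
      by (rule integral_continuous_on_param) (rule continuous_on_subset[OF c], simp)
    have int: "g integrable_on bx k" if "continuous_on UNIV g" for g :: "'a \<Rightarrow> 'd::banach"
      by (rule integrable_continuous) (rule continuous_on_subset[OF that], simp)
    have "norm (integral (bx k) G - integral (bx k) (\<lambda>x. integral (bx k) (F x)))
        = norm (integral (bx k) (\<lambda>x. G x - integral (bx k) (F x)))"
      by (subst Henstock_Kurzweil_Integration.integral_diff) (simp_all add: int cG ck)
    also have "\<dots> \<le> integral (bx k) (\<lambda>x::'a. K * wt_tail TYPE('b) k * wt x)"
    proof (rule Henstock_Kurzweil_Integration.integral_norm_bound_integral)
      show "(\<lambda>x. G x - integral (bx k) (F x)) integrable_on bx k"
        by (intro int continuous_intros cG ck)
      show "(\<lambda>x::'a. K * wt_tail TYPE('b) k * wt x) integrable_on bx k"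
        by (intro int continuous_intros)
      show "norm (G x - integral (bx k) (F x)) \<le> K * wt_tail TYPE('b) k * wt x" for x
        using box_tail_bound[OF continuous_on_slice(1)[OF c] b, of x k] by (simp add: G_def mult_ac)
    qed
    also have "\<dots> = K * wt_tail TYPE('b) k * integral (bx k) (wt :: 'a \<Rightarrow> real)" by simp
    also have "\<dots> \<le> K * wt_tail TYPE('b) k * wt_total TYPE('a)"
    proof (rule mult_left_mono)
      show "integral (bx k) (wt :: 'a \<Rightarrow> real) \<le> wt_total TYPE('a)"
        using wt_tail_nonneg[of k, where 'a='a] by (simp add: wt_tail_def wt_total_def)
      show "0 \<le> K * wt_tail TYPE('b) k" using K wt_tail_nonneg by (rule mult_nonneg_nonneg)
    qed
    finally have "norm (integral (bx k) G - integral (bx k) (\<lambda>x. integral (bx k) (F x)))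
        \<le> K * wt_total TYPE('a) * wt_tail TYPE('b) k" by (simp add: mult_ac)
    then show ?thesis
      using box_tail_bound[OF cG bG, of k]
        norm_triangle_ineq[of "integral UNIV G - integral (bx k) G"
          "integral (bx k) G - integral (bx k) (\<lambda>x. integral (bx k) (F x))"]
      by (simp add: D_def)
  qed
  note le = this
  have D0: "D \<longlonglongrightarrow> 0"
    unfolding D_def
    using tendsto_add[OF tendsto_mult[OF tendsto_const wt_tail_tendsto] tendsto_mult[OF tendsto_const wt_tail_tendsto]]
    by simp
  have "(\<lambda>k. integral UNIV G - integral (bx k) (\<lambda>x. integral (bx k) (F x))) \<longlonglongrightarrow> 0"
    by (rule Lim_null_comparison[OF _ D0]) (simp add: le)
  then have "(\<lambda>k. integral UNIV G - (integral UNIV G - integral (bx k) (\<lambda>x. integral (bx k) (F x))))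
      \<longlonglongrightarrow> integral UNIV G - 0"
    by (intro tendsto_diff tendsto_const)
  then show ?thesis by (simp add: G_def)
qed

text \<open>Fubini's theorem for continuous functions on boxes, carried to the whole space along the
  same sequence of boxes in both orders.\<close>

lemma integral_swap_UNIV:
  fixes F :: "'a::euclidean_space \<Rightarrow> 'b::euclidean_space \<Rightarrow> 'c::banach"
  assumes c: "continuous_on UNIV (\<lambda>(x, y). F x y)" and b: "\<And>x y. norm (F x y) \<le> K * wt x * wt y"
  shows "integral UNIV (\<lambda>x. integral UNIV (\<lambda>y. F x y)) = integral UNIV (\<lambda>y. integral UNIV (\<lambda>x. F x y))"
proof -
  have c': "continuous_on UNIV (\<lambda>(y, x). F x y)"
    using continuous_on_compose2[OF c, of UNIV "\<lambda>(y, x). (x, y)"]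
    by (simp add: case_prod_unfold continuous_intros)
  have "integral (bx k) (\<lambda>x. integral (bx k) (F x)) = integral (bx k) (\<lambda>y. integral (bx k) (\<lambda>x. F x y))" for k
    by (rule integral_swap_continuous) (rule continuous_on_subset[OF c], simp)
  moreover have "norm (F x y) \<le> K * wt y * wt x" for x y using b[of x y] by (simp add: mult_ac)
  ultimately show ?thesis
    using iterated_box_tendsto[OF c b] iterated_box_tendsto[OF c', of K] LIMSEQ_unique by simp
qed

section \<open>Affine changes of variables on the whole space\<close>

lemma has_integral_affinity_UNIV:
  fixes f :: "'a::euclidean_space \<Rightarrow> 'b::real_normed_vector"
  assumes f: "(f has_integral i) UNIV" and m: "m \<noteq> 0"
  shows "((\<lambda>x. f (m *\<^sub>R x + c)) has_integral ((1 / \<bar>m\<bar> ^ DIM('a)) *\<^sub>R i)) UNIV"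
proof -
  have nb: "\<not> (\<exists>a b. (UNIV :: 'a set) = cbox a b)" using not_bounded_UNIV bounded_cbox by metis
  define d where "d = 1 / \<bar>m\<bar> ^ DIM('a)"
  have d: "0 < d" using m by (simp add: d_def)
  have "\<exists>B>0. \<forall>a b. ball 0 B \<subseteq> cbox a b \<longrightarrow>
      (\<exists>z. ((\<lambda>x. f (m *\<^sub>R x + c)) has_integral z) (cbox a b) \<and> norm (z - d *\<^sub>R i) < e)" if e: "0 < e" for e
  proof -
    have ed: "0 < e / d" using d e by (intro divide_pos_pos)
    obtain B where B: "0 < B"
      "\<forall>a b. ball 0 B \<subseteq> cbox a b \<longrightarrow> (\<exists>z. (f has_integral z) (cbox a b) \<and> norm (z - i) < e / d)"
      by (rule has_integral_UNIV_ball[OF f ed])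
    show ?thesis
    \<comment> \<open>Large enough that the image under \<open>x \<mapsto> m x + c\<close> of any
      box containing this ball contains \<open>ball 0 B\<close>.\<close>
    proof (intro exI[of _ "(B + norm c) / \<bar>m\<bar>"] conjI allI impI)
      show "0 < (B + norm c) / \<bar>m\<bar>" using B(1) m by (simp add: add_pos_nonneg)
      fix a b :: 'a assume sub: "ball 0 ((B + norm c) / \<bar>m\<bar>) \<subseteq> cbox a b"
      have "0 < (B + norm c) / \<bar>m\<bar>" using B(1) m by (simp add: add_pos_nonneg)
      then have "0 \<in> ball (0::'a) ((B + norm c) / \<bar>m\<bar>)" by (simp only: mem_ball dist_self)
      with sub have "0 \<in> cbox a b" by (rule subsetD)
      then have ne: "cbox a b \<noteq> {}" by (rule ex_in_conv[THEN iffD1, OF exI])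
      obtain a' b' where ab: "(\<lambda>x. m *\<^sub>R x + c) ` cbox a b = cbox a' b'"
        using ne by (simp add: image_affinity_cbox) metis
      have "ball 0 B \<subseteq> cbox a' b'"
      proof
        fix y :: 'a assume y: "y \<in> ball 0 B"
        define x where "x = (1/m) *\<^sub>R (y - c)"
        have "norm x = norm (y - c) / \<bar>m\<bar>" by (simp add: x_def)
        also have "\<dots> < (B + norm c) / \<bar>m\<bar>"
          using y m norm_triangle_ineq4[of y c] by (intro divide_strict_right_mono) auto
        finally have "x \<in> cbox a b" using sub by auto
        moreover have "y = m *\<^sub>R x + c" using m by (simp add: x_def)
        ultimately show "y \<in> cbox a' b'" unfolding ab[symmetric] by blast
      qed
      from B(2)[rule_format, OF this] obtain z where z: "(f has_integral z) (cbox a' b')" "norm (z - i) < e / d" by auto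
      have "(\<lambda>x. (1 / m) *\<^sub>R x + - ((1 / m) *\<^sub>R c)) ` cbox a' b' = cbox a b"
        unfolding ab[symmetric] image_image using m by (simp add: algebra_simps)
      with has_integral_affinity[OF z(1) m, of c]
      have "((\<lambda>x. f (m *\<^sub>R x + c)) has_integral d *\<^sub>R z) (cbox a b)" by (simp add: d_def)
      moreover have "norm (d *\<^sub>R z - d *\<^sub>R i) < e"
      proof -
        have "norm (d *\<^sub>R z - d *\<^sub>R i) = d * norm (z - i)"
          using d by (metis abs_of_pos norm_scaleR scaleR_right_diff_distrib)
        also have "\<dots> < d * (e / d)" using z(2) d by (intro mult_strict_left_mono)
        finally show ?thesis using d by simp
      qed
      ultimately show "\<exists>z. ((\<lambda>x. f (m *\<^sub>R x + c)) has_integral z) (cbox a b) \<and> norm (z - d *\<^sub>R i) < e"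
        by blast
    qed
  qed
  then show ?thesis using nb by (subst has_integral_alt) (simp add: d_def)
qed

text \<open>Integrability is carried back by the inverse affinity, so in the non-integrable case
  both sides take the default value 0.\<close>

lemma integral_affinity_UNIV:
  fixes f :: "'a::euclidean_space \<Rightarrow> 'b::real_normed_vector"
  assumes m: "m \<noteq> 0"
  shows "integral UNIV (\<lambda>x. f (m *\<^sub>R x + c)) = (1 / \<bar>m\<bar> ^ DIM('a)) *\<^sub>R integral UNIV f"
proof (cases "f integrable_on UNIV")
  case True
  show ?thesis by (rule integral_unique[OF has_integral_affinity_UNIV[OF integrable_integral[OF True] m]])
next
  case False
  have "\<not> (\<lambda>x. f (m *\<^sub>R x + c)) integrable_on UNIV"
  proof
    assume "(\<lambda>x. f (m *\<^sub>R x + c)) integrable_on UNIV"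
    then obtain i where "((\<lambda>x. f (m *\<^sub>R x + c)) has_integral i) UNIV" by (auto simp: integrable_on_def)
    from has_integral_affinity_UNIV[OF this, of "1/m" "- (1/m) *\<^sub>R c"] m
    have "f integrable_on UNIV" by (auto simp: integrable_on_def algebra_simps)
    with False show False by simp
  qed
  with False show ?thesis by (simp add: not_integrable_integral)
qed

lemma integral_shift_UNIV:
  fixes f :: "'a::euclidean_space \<Rightarrow> 'b::real_normed_vector"
  shows "integral UNIV (\<lambda>x. f (x + c)) = integral UNIV f"
  using integral_affinity_UNIV[of 1 f c] by simp

lemma integral_reflect_UNIV:
  fixes f :: "'a::euclidean_space \<Rightarrow> 'b::real_normed_vector"
  shows "integral UNIV (\<lambda>x. f (- x)) = integral UNIV f"
  using integral_affinity_UNIV[of "-1" f 0] by simp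

text \<open>A closed convex cone contains all Riemann sums of a function with values in it.\<close>

lemma integral_in_closed_cone:
  fixes f :: "'a::euclidean_space \<Rightarrow> 'b::real_normed_vector"
  assumes C: "closed C" "0 \<in> C" "\<And>x y. x \<in> C \<Longrightarrow> y \<in> C \<Longrightarrow> x + y \<in> C"
      "\<And>r x. 0 \<le> r \<Longrightarrow> x \<in> C \<Longrightarrow> r *\<^sub>R x \<in> C"
    and f: "\<And>x. f x \<in> C" "f integrable_on UNIV"
  shows "integral UNIV f \<in> C"
proof -
  have box: "z \<in> C" if z: "(f has_integral z) (cbox a b)" for z a b
    unfolding closed_approachable[OF C(1), symmetric]
  proof (intro allI impI)
    fix e :: real assume "0 < e"
    obtain \<gamma> where g: "gauge \<gamma>"
      "\<And>D. D tagged_division_of cbox a b \<Longrightarrow> \<gamma> fine D \<Longrightarrow> norm ((\<Sum>(x,k)\<in>D. measure lborel k *\<^sub>R f x) - z) < e"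
      using has_integralD[OF z \<open>0 < e\<close>] by metis
    obtain D where D: "D tagged_division_of cbox a b" "\<gamma> fine D" by (rule fine_division_exists[OF g(1)])
    have "finite D" by (rule tagged_division_ofD(1)[OF D(1)])
    then have "(\<Sum>(x,k)\<in>D. measure lborel k *\<^sub>R f x) \<in> C"
      by (induction D rule: finite_induct) (simp_all add: C f case_prod_unfold)
    with g(2)[OF D] show "\<exists>y\<in>C. dist y z < e" by (auto simp: dist_norm)
  qed
  show ?thesis
    unfolding closed_approachable[OF C(1), symmetric]
  proof (intro allI impI)
    fix e :: real assume "0 < e"
    obtain B where B: "0 < B"
      "\<forall>a b. ball 0 B \<subseteq> cbox a b \<longrightarrow> (\<exists>z. (f has_integral z) (cbox a b) \<and> norm (z - integral UNIV f) < e)"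
      by (rule has_integral_UNIV_ball[OF integrable_integral[OF f(2)] \<open>0 < e\<close>])
    obtain a :: 'a where "ball 0 B \<subseteq> cbox (- a) a" by (rule bounded_subset_cbox_symmetric[OF bounded_ball])
    from B(2)[rule_format, OF this] obtain z where z: "(f has_integral z) (cbox (- a) a)" "norm (z - integral UNIV f) < e"
      by (elim exE conjE)
    show "\<exists>y\<in>C. dist y (integral UNIV f) < e"
      using z(2) by (intro bexI[OF _ box[OF z(1)]]) (simp add: dist_norm)
  qed
qed

lemma pos_integral:
  fixes f :: "'a::euclidean_space \<Rightarrow> 'c::unital_cstar_algebra"
  assumes "\<And>x. pos (f x)" "f integrable_on UNIV"
  shows "pos (integral UNIV f)"
proof -
  have "integral UNIV f \<in> {x. pos x}"
    by (rule integral_in_closed_cone) (simp_all add: assms closed_pos pos_add pos_scaleR)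
  then show ?thesis by simp
qed

section \<open>The Schwartz space\<close>

lemma partial_deriv_has_derivative:
  fixes f :: "real^'n::finite \<Rightarrow> 'c::real_normed_vector"
  assumes "(f has_derivative f') (at x)"
  shows "partial_deriv i f x = f' (axis i 1)"
proof -
  let ?a = "axis i 1 :: real^'n"
  have "((\<lambda>t. x + t *\<^sub>R ?a) has_derivative (\<lambda>t. t *\<^sub>R ?a)) (at 0)"
    by (auto intro!: derivative_eq_intros)
  moreover have "(f has_derivative f') (at (x + 0 *\<^sub>R ?a))" using assms by simp
  ultimately have "((\<lambda>t. f (x + t *\<^sub>R ?a)) has_derivative (\<lambda>t. f' (t *\<^sub>R ?a))) (at 0)"
    by (rule has_derivative_compose)
  moreover have "(\<lambda>t. f' (t *\<^sub>R ?a)) = (\<lambda>t. t *\<^sub>R f' ?a)"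
    using has_derivative_linear[OF assms] by (simp add: linear_scale)
  ultimately have "((\<lambda>t. f (x + t *\<^sub>R ?a)) has_vector_derivative f' ?a) (at 0)"
    by (simp add: has_vector_derivative_def)
  then show ?thesis unfolding partial_deriv_def by (rule vector_derivative_at)
qed

definition dird :: "(real^'n::finite \<Rightarrow> 'c::real_normed_vector) \<Rightarrow> real^'n \<Rightarrow> real^'n \<Rightarrow> 'c" where
  "dird f h x = (\<Sum>i\<in>UNIV. h $ i *\<^sub>R partial_deriv i f x)"

lemma has_derivative_dird:
  fixes f :: "real^'n::finite \<Rightarrow> 'c::real_normed_vector"
  assumes "f differentiable (at x)"
  shows "(f has_derivative (\<lambda>h. dird f h x)) (at x)"
proof -
  obtain f' where f': "(f has_derivative f') (at x)" using assms by (auto simp: differentiable_def)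
  interpret linear f' by (rule has_derivative_linear[OF f'])
  have "f' h = dird f h x" for h
  proof -
    have "h = (\<Sum>i\<in>UNIV. h $ i *\<^sub>R axis i 1)"
      using basis_expansion[of h] by (simp add: scalar_mult_eq_scaleR)
    then have "f' h = f' (\<Sum>i\<in>UNIV. h $ i *\<^sub>R axis i 1)" by (rule arg_cong)
    also have "\<dots> = dird f h x"
      by (simp add: sum scale dird_def partial_deriv_has_derivative[OF f'])
    finally show ?thesis .
  qed
  then have "f' = (\<lambda>h. dird f h x)" by (rule ext)
  then show ?thesis using f' by (simp only:)
qed

lemma partial_derivs_Nil [simp]: "partial_derivs [] f = f"
  by (simp add: partial_derivs_def)

lemma partial_derivs_Cons: "partial_derivs (i # is) f = partial_deriv i (partial_derivs is f)"
  by (simp add: partial_derivs_def)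

lemma partial_derivs_partial_deriv: "partial_derivs is (partial_deriv i f) = partial_derivs (is @ [i]) f"
  by (simp add: partial_derivs_def)

lemma schwartzD_differentiable: "f \<in> schwartz \<Longrightarrow> partial_derivs is f differentiable (at x)"
  unfolding schwartz_def mem_Collect_eq by (drule spec[of _ "is"], drule conjunct1, erule spec)

lemma schwartzD_bounded:
  "f \<in> schwartz \<Longrightarrow> bounded (range (\<lambda>x. (\<Prod>i\<in>UNIV. (x $ i) ^ \<alpha> i) *\<^sub>R partial_derivs is f x))"
  unfolding schwartz_def mem_Collect_eq by (drule spec[of _ "is"], drule conjunct2, erule spec)

lemma schwartzI:
  assumes "\<And>is x. partial_derivs is f differentiable (at x)"
    and "\<And>is \<alpha>. bounded (range (\<lambda>x. (\<Prod>i\<in>UNIV. (x $ i) ^ \<alpha> i) *\<^sub>R partial_derivs is f x))"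
  shows "f \<in> schwartz"
  unfolding schwartz_def mem_Collect_eq by (intro allI conjI assms)

lemma schwartz_partial_deriv:
  assumes "f \<in> schwartz"
  shows "partial_deriv i f \<in> schwartz"
  by (rule schwartzI) (unfold partial_derivs_partial_deriv,
      rule schwartzD_differentiable[OF assms], rule schwartzD_bounded[OF assms])

lemma schwartz_differentiable: "f \<in> schwartz \<Longrightarrow> f differentiable (at x)"
  using schwartzD_differentiable[of f "[]" x] by simp

lemma schwartz_bounded: "f \<in> schwartz \<Longrightarrow> bounded (range f)"
  using schwartzD_bounded[of f "\<lambda>_. 0" "[]"] by simp

text \<open>The Schwartz space is the largest space of bounded differentiable functions that is stable
  under partial derivatives and multiplication by coordinates.\<close>

lemma schwartz_coinduct:
  assumes f: "f \<in> X"
    and diff: "\<And>f x. f \<in> X \<Longrightarrow> f differentiable (at x)"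
    and bdd: "\<And>f. f \<in> X \<Longrightarrow> bounded (range f)"
    and deriv: "\<And>f i. f \<in> X \<Longrightarrow> partial_deriv i f \<in> X"
    and coord: "\<And>f i. f \<in> X \<Longrightarrow> (\<lambda>x. x $ i *\<^sub>R f x) \<in> X"
  shows "f \<in> schwartz"
proof -
  have D: "partial_derivs is f \<in> X" for "is"
    by (induction "is") (simp_all add: f partial_derivs_Cons deriv)
  have pow: "(\<lambda>x. (x $ i) ^ k *\<^sub>R g x) \<in> X" if "g \<in> X" for g i k
  proof (induction k)
    case (Suc k)
    from coord[OF this, of i] show ?case by simp
  qed (simp add: that)
  have "(\<lambda>x. (\<Prod>i\<in>A. (x $ i) ^ \<alpha> i) *\<^sub>R g x) \<in> X" if "finite A" "g \<in> X" for A g and \<alpha> :: "'a \<Rightarrow> nat"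
    using that(1)
  proof (induction A rule: finite_induct)
    case (insert i A)
    from pow[OF insert.IH, of i "\<alpha> i"] insert.hyps show ?case by simp
  qed (simp add: that)
  note mon = this
  show ?thesis
    by (rule schwartzI) (rule diff[OF D], rule bdd[OF mon[OF finite D]])
qed

lemma partial_deriv_coord:
  fixes f :: "real^'n::finite \<Rightarrow> 'c::real_normed_vector"
  assumes "f differentiable (at x)"
  shows "partial_deriv i (\<lambda>x. x $ j *\<^sub>R f x) x = (if i = j then f x else 0) + x $ j *\<^sub>R partial_deriv i f x"
    and "(\<lambda>x. x $ j *\<^sub>R f x) differentiable (at x)"
proof -
  obtain f' where f': "(f has_derivative f') (at x)" using assms by (auto simp: differentiable_def)
  have c: "((\<lambda>x. x $ j) has_derivative (\<lambda>h. h $ j)) (at x)"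
    by (rule bounded_linear_imp_has_derivative) (rule bounded_linear_vec_nth)
  have d: "((\<lambda>x. x $ j *\<^sub>R f x) has_derivative (\<lambda>h. x $ j *\<^sub>R f' h + h $ j *\<^sub>R f x)) (at x)"
    by (rule has_derivative_scaleR[OF c f'])
  show "partial_deriv i (\<lambda>x. x $ j *\<^sub>R f x) x = (if i = j then f x else 0) + x $ j *\<^sub>R partial_deriv i f x"
    unfolding partial_deriv_has_derivative[OF d] partial_deriv_has_derivative[OF f'] by (simp add: axis_def)
  show "(\<lambda>x. x $ j *\<^sub>R f x) differentiable (at x)" using d by (rule differentiableI)
qed

lemma partial_deriv_add:
  fixes f g :: "real^'n::finite \<Rightarrow> 'c::real_normed_vector"
  assumes "f differentiable (at x)" "g differentiable (at x)"
  shows "partial_deriv i (\<lambda>x. f x + g x) x = partial_deriv i f x + partial_deriv i g x"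
proof -
  obtain f' g' where d: "(f has_derivative f') (at x)" "(g has_derivative g') (at x)"
    using assms by (auto simp: differentiable_def)
  show ?thesis
    unfolding partial_deriv_has_derivative[OF d(1)] partial_deriv_has_derivative[OF d(2)]
      partial_deriv_has_derivative[OF has_derivative_add[OF d]] ..
qed

lemma partial_deriv_linear:
  fixes f :: "real^'n::finite \<Rightarrow> 'c::real_normed_vector"
  assumes "bounded_linear L" "f differentiable (at x)"
  shows "partial_deriv i (\<lambda>x. L (f x)) x = L (partial_deriv i f x)"
    and "(\<lambda>x. L (f x)) differentiable (at x)"
proof -
  obtain f' where f': "(f has_derivative f') (at x)" using assms by (auto simp: differentiable_def)
  note d = bounded_linear.has_derivative[OF assms(1) f']
  show "partial_deriv i (\<lambda>x. L (f x)) x = L (partial_deriv i f x)"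
    unfolding partial_deriv_has_derivative[OF f'] partial_deriv_has_derivative[OF d] ..
  show "(\<lambda>x. L (f x)) differentiable (at x)" using d by (rule differentiableI)
qed

lemma bounded_add_range:
  fixes f g :: "'x \<Rightarrow> 'c::real_normed_vector"
  assumes "bounded (range f)" "bounded (range g)"
  shows "bounded (range (\<lambda>x. f x + g x))"
proof -
  obtain K L where "\<And>x. norm (f x) \<le> K" "\<And>x. norm (g x) \<le> L"
    using assms unfolding bounded_iff by blast
  then have "norm (f x + g x) \<le> K + L" for x by (rule norm_triangle_mono)
  then show ?thesis unfolding bounded_iff by blast
qed

section \<open>Closure properties of the Schwartz space\<close>

text \<open>The invariant set behind \<open>schwartz_coord\<close>. Differentiating a coordinate
  multiple of \<open>g\<close> produces an extra term \<open>g\<close>, so sums have to be included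
  for stability under derivatives.\<close>

inductive_set moments :: "(real^'n::finite \<Rightarrow> 'c::real_normed_vector) \<Rightarrow> (real^'n \<Rightarrow> 'c) set"
  for f where
  base: "partial_derivs is f \<in> moments f"
| coord: "g \<in> moments f \<Longrightarrow> (\<lambda>x. x $ i *\<^sub>R g x) \<in> moments f"
| add: "g \<in> moments f \<Longrightarrow> h \<in> moments f \<Longrightarrow> (\<lambda>x. g x + h x) \<in> moments f"

lemma moments_subset_schwartz:
  fixes f :: "real^'n::finite \<Rightarrow> 'c::real_normed_vector"
  assumes f: "f \<in> schwartz" and g: "g \<in> moments f"
  shows "g \<in> schwartz"
  using g
proof (rule schwartz_coinduct)
  show diff: "g differentiable (at x)" if "g \<in> moments f" for g x
    using that
  proof induction
    case (base "is")
    show ?case by (rule schwartzD_differentiable[OF f])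
  next
    case (coord g i)
    from coord.IH show ?case by (rule partial_deriv_coord(2))
  next
    case (add g h)
    from add.IH show ?case by (rule differentiable_add)
  qed
  have mon: "(\<Prod>j\<in>UNIV. (x $ j) ^ (\<alpha>(i := Suc (\<alpha> i))) j) = (\<Prod>j\<in>UNIV. (x $ j) ^ \<alpha> j) * x $ i"
    for x :: "real^'n" and \<alpha> i
    by (simp add: prod.remove[of UNIV i] algebra_simps)
  \<comment> \<open>All monomial multiples are treated at once: a further coordinate factor only
    raises one exponent, whereas boundedness of \<open>g\<close> alone would not be
    inductive.\<close>
  have "bounded (range (\<lambda>x. (\<Prod>i\<in>UNIV. (x $ i) ^ \<alpha> i) *\<^sub>R g x))" if "g \<in> moments f" for g \<alpha>
    using that
  proof (induction arbitrary: \<alpha>)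
    case (base "is")
    show ?case by (rule schwartzD_bounded[OF f])
  next
    case (coord g i)
    from coord.IH[of "\<alpha>(i := Suc (\<alpha> i))"] show ?case unfolding mon by simp
  next
    case (add g h)
    from bounded_add_range[OF add.IH(1)[of \<alpha>] add.IH(2)[of \<alpha>]] show ?case by (simp add: scaleR_add_right)
  qed
  from this[of _ "\<lambda>_. 0"] show "bounded (range g)" if "g \<in> moments f" for g using that by simp
  show "partial_deriv i g \<in> moments f" if "g \<in> moments f" for g i
    using that
  proof induction
    case (base "is")
    then show ?case using moments.base[of "i # is" f] by (simp add: partial_derivs_Cons)
  next
    case (coord g j)
    have "partial_deriv i (\<lambda>x. x $ j *\<^sub>R g x)
      = (\<lambda>x. (if i = j then g x else 0) + x $ j *\<^sub>R partial_deriv i g x)"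
      by (rule ext, rule partial_deriv_coord(1)[OF diff[OF coord.hyps]])
    then show ?case using moments.add[OF coord.hyps moments.coord[OF coord.IH]] moments.coord[OF coord.IH]
      by (cases "i = j") simp_all
  next
    case (add g h)
    have "partial_deriv i (\<lambda>x. g x + h x) = (\<lambda>x. partial_deriv i g x + partial_deriv i h x)"
      by (rule ext, rule partial_deriv_add[OF diff[OF add.hyps(1)] diff[OF add.hyps(2)]])
    then show ?case using moments.add[OF add.IH] by simp
  qed
qed (rule moments.coord)

lemma schwartz_coord:
  assumes "f \<in> schwartz"
  shows "(\<lambda>x. x $ i *\<^sub>R f x) \<in> schwartz"
  using moments_subset_schwartz[OF assms moments.coord[OF moments.base[of "[]"]]] by simp

lemma schwartz_add:
  fixes f g :: "real^'n::finite \<Rightarrow> 'c::real_normed_vector"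
  assumes "f \<in> schwartz" "g \<in> schwartz"
  shows "(\<lambda>x. f x + g x) \<in> schwartz"
proof -
  define X where "X = {h. \<exists>f\<in>schwartz. \<exists>g\<in>schwartz. h = (\<lambda>x::real^'n. f x + g x :: 'c)}"
  have XI: "(\<lambda>x. f x + g x) \<in> X" if "f \<in> schwartz" "g \<in> schwartz" for f g :: "real^'n \<Rightarrow> 'c"
    unfolding X_def by (intro CollectI bexI[OF _ that(1)] bexI[OF _ that(2)] refl)
  show ?thesis
  proof (rule schwartz_coinduct[of _ X])
    show "(\<lambda>x. f x + g x) \<in> X" by (rule XI[OF assms])
    fix h assume "h \<in> X"
    then obtain f g where h: "h = (\<lambda>x. f x + g x)" and f: "f \<in> schwartz" and g: "g \<in> schwartz"
      unfolding X_def by blast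
    show "h differentiable (at x)" for x
      unfolding h by (rule differentiable_add[OF schwartz_differentiable[OF f] schwartz_differentiable[OF g]])
    show "bounded (range h)" unfolding h by (rule bounded_add_range[OF schwartz_bounded[OF f] schwartz_bounded[OF g]])
    fix i
    have "partial_deriv i h = (\<lambda>x. partial_deriv i f x + partial_deriv i g x)"
      unfolding h by (rule ext, rule partial_deriv_add[OF schwartz_differentiable[OF f] schwartz_differentiable[OF g]])
    then show "partial_deriv i h \<in> X" using XI[OF schwartz_partial_deriv[OF f] schwartz_partial_deriv[OF g]] by simp
    have "(\<lambda>x. x $ i *\<^sub>R h x) = (\<lambda>x. x $ i *\<^sub>R f x + x $ i *\<^sub>R g x)"
      unfolding h by (simp add: scaleR_add_right)
    then show "(\<lambda>x. x $ i *\<^sub>R h x) \<in> X" using XI[OF schwartz_coord[OF f] schwartz_coord[OF g]] by simp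
  qed
qed

lemma schwartz_linear:
  fixes f :: "real^'n::finite \<Rightarrow> 'c::real_normed_vector" and L :: "'c \<Rightarrow> 'd::real_normed_vector"
  assumes L: "bounded_linear L" and "f \<in> schwartz"
  shows "(\<lambda>x. L (f x)) \<in> schwartz"
proof -
  define X where "X = {h. \<exists>f\<in>schwartz. h = (\<lambda>x::real^'n. L (f x))}"
  have XI: "(\<lambda>x. L (f x)) \<in> X" if "f \<in> schwartz" for f
    unfolding X_def by (intro CollectI bexI[OF _ that] refl)
  show ?thesis
  proof (rule schwartz_coinduct[of _ X])
    show "(\<lambda>x. L (f x)) \<in> X" by (rule XI[OF assms(2)])
    fix h assume "h \<in> X"
    then obtain f where h: "h = (\<lambda>x. L (f x))" and f: "f \<in> schwartz" unfolding X_def by blast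
    show "h differentiable (at x)" for x
      unfolding h by (rule partial_deriv_linear(2)[OF L schwartz_differentiable[OF f]])
    have "bounded (L ` range f)" by (rule bounded_linear_image[OF schwartz_bounded[OF f] L])
    then show "bounded (range h)" by (simp add: h image_image)
    fix i
    have "partial_deriv i h = (\<lambda>x. L (partial_deriv i f x))"
      unfolding h by (rule ext, rule partial_deriv_linear(1)[OF L schwartz_differentiable[OF f]])
    then show "partial_deriv i h \<in> X" using XI[OF schwartz_partial_deriv[OF f]] by simp
    have "(\<lambda>x. x $ i *\<^sub>R h x) = (\<lambda>x. L (x $ i *\<^sub>R f x))"
      unfolding h using L by (simp add: linear_simps)
    then show "(\<lambda>x. x $ i *\<^sub>R h x) \<in> X" using XI[OF schwartz_coord[OF f]] by simp
  qed
qed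

lemma schwartz_zero: "(\<lambda>_. 0) \<in> schwartz"
proof -
  have "(\<lambda>_. 0) differentiable (at x)" for x :: "real^'n" by simp
  have d: "((\<lambda>_. 0) has_derivative (\<lambda>_. 0)) (at x)" for x :: "real^'n" by simp
  have "partial_deriv i (\<lambda>_. 0) = (\<lambda>_::real^'n. 0)" for i
    by (rule ext) (simp add: partial_deriv_has_derivative[OF d])
  then show ?thesis by (intro schwartz_coinduct[of _ "{\<lambda>_. 0}"]) auto
qed

lemma schwartz_scaleR: "f \<in> schwartz \<Longrightarrow> (\<lambda>x. r *\<^sub>R f x) \<in> schwartz"
  by (rule schwartz_linear[OF bounded_linear_scaleR_right])

lemma schwartz_minus: "f \<in> schwartz \<Longrightarrow> (\<lambda>x. - f x) \<in> schwartz"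
  using schwartz_scaleR[of f "-1"] by simp

lemma schwartz_diff: "f \<in> schwartz \<Longrightarrow> g \<in> schwartz \<Longrightarrow> (\<lambda>x. f x - g x) \<in> schwartz"
  using schwartz_add[of f "\<lambda>x. - g x"] schwartz_minus[of g] by simp

lemma schwartz_sum:
  assumes "\<And>i. i \<in> A \<Longrightarrow> f i \<in> schwartz"
  shows "(\<lambda>x. \<Sum>i\<in>A. f i x) \<in> schwartz"
proof (cases "finite A")
  case True
  then show ?thesis using assms
    by (induction A rule: finite_induct) (simp_all add: schwartz_zero schwartz_add)
qed (simp add: schwartz_zero)

lemma schwartz_translate:
  fixes f :: "real^'n::finite \<Rightarrow> 'c::real_normed_vector"
  assumes "f \<in> schwartz"
  shows "(\<lambda>x. f (x + a)) \<in> schwartz"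
    and partial_deriv_translate: "partial_deriv i (\<lambda>x. f (x + a)) = (\<lambda>x. partial_deriv i f (x + a))"
proof -
  have d: "((\<lambda>x. f (x + a)) has_derivative (\<lambda>h. dird f h (x + a))) (at x)"
    if "f \<in> schwartz" for f :: "real^'n \<Rightarrow> 'c" and x
  proof (rule has_derivative_compose[where g = f])
    show "((\<lambda>x. x + a) has_derivative (\<lambda>h. h)) (at x)" by (auto intro!: derivative_eq_intros)
  qed (rule has_derivative_dird[OF schwartz_differentiable[OF that]])
  have pd: "partial_deriv i (\<lambda>x. f (x + a)) = (\<lambda>x. partial_deriv i f (x + a))"
    if "f \<in> schwartz" for f :: "real^'n \<Rightarrow> 'c" and i
    using partial_deriv_has_derivative[OF d[OF that], of i]
      partial_deriv_has_derivative[OF has_derivative_dird[OF schwartz_differentiable[OF that]], of i]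
    by auto
  show "partial_deriv i (\<lambda>x. f (x + a)) = (\<lambda>x. partial_deriv i f (x + a))" by (rule pd[OF assms])
  define X where "X = {h. \<exists>f\<in>schwartz. h = (\<lambda>x::real^'n. f (x + a) :: 'c)}"
  have XI: "(\<lambda>x. f (x + a)) \<in> X" if "f \<in> schwartz" for f :: "real^'n \<Rightarrow> 'c"
    unfolding X_def by (intro CollectI bexI[OF _ that] refl)
  show "(\<lambda>x. f (x + a)) \<in> schwartz"
  proof (rule schwartz_coinduct[of _ X])
    show "(\<lambda>x. f (x + a)) \<in> X" by (rule XI[OF assms])
    fix h assume "h \<in> X"
    then obtain f where h: "h = (\<lambda>x. f (x + a))" and f: "f \<in> schwartz" unfolding X_def by blast
    show "h differentiable (at x)" for x unfolding h using d[OF f] by (rule differentiableI)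
    have "bounded (range f)" by (rule schwartz_bounded[OF f])
    then show "bounded (range h)" unfolding h by (rule bounded_subset) auto
    fix i
    show "partial_deriv i h \<in> X" unfolding h pd[OF f] by (rule XI[OF schwartz_partial_deriv[OF f]])
    have "(\<lambda>x. x $ i *\<^sub>R h x) = (\<lambda>x. (\<lambda>y. y $ i *\<^sub>R f y - a $ i *\<^sub>R f y) (x + a))"
      unfolding h by (simp add: algebra_simps)
    moreover have "(\<lambda>y. y $ i *\<^sub>R f y - a $ i *\<^sub>R f y) \<in> schwartz"
      by (rule schwartz_diff[OF schwartz_coord[OF f] schwartz_scaleR[OF f]])
    ultimately show "(\<lambda>x. x $ i *\<^sub>R h x) \<in> X" using XI by (simp only:)
  qed
qed

section \<open>Characters, modulation and decay\<close>

text \<open>The character \<open>exp (2 \<pi> i t)\<close>, in the normalisation for which Fourier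
  inversion and the Gaussian carry no constants.\<close>

definition ec :: "real \<Rightarrow> complex" where "ec t = cis (2 * pi * t)"

lemma ec_add: "ec (s + t) = ec s * ec t" by (simp add: ec_def cis_mult distrib_left)
lemma ec_0 [simp]: "ec 0 = 1" by (simp add: ec_def)
lemma norm_ec [simp]: "cmod (ec t) = 1" by (simp add: ec_def)
lemma cnj_ec: "cnj (ec t) = ec (- t)" by (simp add: ec_def cis_cnj)
lemma exp_eq_ec: "exp (2 * complex_of_real pi * \<i> * complex_of_real t) = ec t"
  by (simp add: ec_def cis_conv_exp mult_ac)

lemma continuous_on_ec [continuous_intros]: "continuous_on A f \<Longrightarrow> continuous_on A (\<lambda>x. ec (f x))"
  unfolding ec_def cis_conv_exp by (intro continuous_intros)

lemma norm_ec_scaleC [simp]: "norm (ec t *\<^sub>C x) = norm x" by (simp add: norm_scaleC)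

lemma has_derivative_ec:
  fixes p x :: "'a::real_inner"
  shows "((\<lambda>x. ec (p \<bullet> x)) has_derivative (\<lambda>h. (2 * pi * (p \<bullet> h)) *\<^sub>R (\<i> * ec (p \<bullet> x)))) (at x)"
proof -
  have "((\<lambda>x. 2 * pi * (p \<bullet> x)) has_derivative (\<lambda>h. 2 * pi * (p \<bullet> h))) (at x)"
    by (auto intro!: derivative_eq_intros)
  from has_derivative_cis[OF this]
  show ?thesis unfolding ec_def by (simp add: scaleR_conv_of_real mult_ac)
qed

lemma bounded_linear_scaleC_right: "bounded_linear (\<lambda>x::'c::unital_cstar_algebra. c *\<^sub>C x)"
  by (rule bounded_bilinear.bounded_linear_right[OF bounded_bilinear_scaleC])

lemma schwartz_scaleC: "f \<in> schwartz \<Longrightarrow> (\<lambda>x. c *\<^sub>C f x) \<in> schwartz"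
  by (rule schwartz_linear[OF bounded_linear_scaleC_right])

lemma schwartz_cstar: "f \<in> schwartz \<Longrightarrow> (\<lambda>x. cstar (f x)) \<in> schwartz"
  by (rule schwartz_linear[OF bounded_linear_cstar])

lemma schwartz_mult_left:
  fixes a :: "'c::real_normed_algebra"
  shows "f \<in> schwartz \<Longrightarrow> (\<lambda>x. a * f x) \<in> schwartz"
  by (rule schwartz_linear[OF bounded_linear_mult_right])

lemma schwartz_modulate:
  fixes f :: "real^'n::finite \<Rightarrow> 'c::unital_cstar_algebra"
  assumes "f \<in> schwartz"
  shows "(\<lambda>x. ec (p \<bullet> x) *\<^sub>C f x) \<in> schwartz"
    and partial_deriv_modulate: "partial_deriv i (\<lambda>x. ec (p \<bullet> x) *\<^sub>C f x)
      = (\<lambda>x. ec (p \<bullet> x) *\<^sub>C (partial_deriv i f x + (2 * pi * p $ i) *\<^sub>R \<i> *\<^sub>C f x))"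
proof -
  have d: "((\<lambda>x. ec (p \<bullet> x) *\<^sub>C f x) has_derivative
      (\<lambda>h. ec (p \<bullet> x) *\<^sub>C dird f h x + ((2 * pi * (p \<bullet> h)) *\<^sub>R (\<i> * ec (p \<bullet> x))) *\<^sub>C f x)) (at x)"
    if "f \<in> schwartz" for f :: "real^'n \<Rightarrow> 'c" and x
    by (rule bounded_bilinear.FDERIV[OF bounded_bilinear_scaleC has_derivative_ec
        has_derivative_dird[OF schwartz_differentiable[OF that]]])
  have ax: "p \<bullet> axis i 1 = p $ i" for i by (simp add: inner_axis)
  have pd: "partial_deriv i (\<lambda>x. ec (p \<bullet> x) *\<^sub>C f x)
      = (\<lambda>x. ec (p \<bullet> x) *\<^sub>C (partial_deriv i f x + (2 * pi * p $ i) *\<^sub>R \<i> *\<^sub>C f x))"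
    if "f \<in> schwartz" for f :: "real^'n \<Rightarrow> 'c" and i
  proof
    fix x
    show "partial_deriv i (\<lambda>x. ec (p \<bullet> x) *\<^sub>C f x) x
      = ec (p \<bullet> x) *\<^sub>C (partial_deriv i f x + (2 * pi * p $ i) *\<^sub>R \<i> *\<^sub>C f x)"
      unfolding partial_deriv_has_derivative[OF d[OF that], of i]
        partial_deriv_has_derivative[OF has_derivative_dird[OF schwartz_differentiable[OF that]], of i]
      by (simp add: ax scaleC_add_right scaleC_scaleR scaleR_scaleC scaleC_scaleC mult.commute)
  qed
  show "partial_deriv i (\<lambda>x. ec (p \<bullet> x) *\<^sub>C f x)
      = (\<lambda>x. ec (p \<bullet> x) *\<^sub>C (partial_deriv i f x + (2 * pi * p $ i) *\<^sub>R \<i> *\<^sub>C f x))" by (rule pd[OF assms])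
  define X where "X = {h. \<exists>f\<in>schwartz. h = (\<lambda>x::real^'n. ec (p \<bullet> x) *\<^sub>C f x :: 'c)}"
  have XI: "(\<lambda>x. ec (p \<bullet> x) *\<^sub>C f x) \<in> X" if "f \<in> schwartz" for f :: "real^'n \<Rightarrow> 'c"
    unfolding X_def by (intro CollectI bexI[OF _ that] refl)
  show "(\<lambda>x. ec (p \<bullet> x) *\<^sub>C f x) \<in> schwartz"
  proof (rule schwartz_coinduct[of _ X])
    show "(\<lambda>x. ec (p \<bullet> x) *\<^sub>C f x) \<in> X" by (rule XI[OF assms])
    fix h assume "h \<in> X"
    then obtain f where h: "h = (\<lambda>x. ec (p \<bullet> x) *\<^sub>C f x)" and f: "f \<in> schwartz"
      unfolding X_def by blast
    show "h differentiable (at x)" for x unfolding h using d[OF f] by (rule differentiableI)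
    have "bounded (range f)" by (rule schwartz_bounded[OF f])
    then show "bounded (range h)" unfolding h by (simp add: bounded_iff)
    fix i
    have "(\<lambda>x. partial_deriv i f x + (2 * pi * p $ i) *\<^sub>R \<i> *\<^sub>C f x) \<in> schwartz"
      by (rule schwartz_add[OF schwartz_partial_deriv[OF f] schwartz_scaleR[OF schwartz_scaleC[OF f]]])
    then show "partial_deriv i h \<in> X" unfolding h pd[OF f] by (rule XI)
    have "(\<lambda>x. x $ i *\<^sub>R h x) = (\<lambda>x. ec (p \<bullet> x) *\<^sub>C (x $ i *\<^sub>R f x))"
      unfolding h by (simp add: scaleC_scaleR)
    then show "(\<lambda>x. x $ i *\<^sub>R h x) \<in> X" using XI[OF schwartz_coord[OF f]] by (simp only:)
  qed
qed

lemma schwartz_jap: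
  assumes "f \<in> schwartz"
  shows "(\<lambda>x. jap x ^ m *\<^sub>R f x) \<in> schwartz"
proof (induction m)
  case (Suc m)
  have j: "jap x = 1 + (\<Sum>i\<in>UNIV. x $ i * x $ i)" for x :: "real^'a"
    unfolding jap_def power2_norm_eq_inner inner_vec_def by simp
  let ?g = "\<lambda>x. jap x ^ m *\<^sub>R f x"
  have "(\<lambda>x. jap x ^ Suc m *\<^sub>R f x) = (\<lambda>x. ?g x + (\<Sum>i\<in>UNIV. x $ i *\<^sub>R (x $ i *\<^sub>R ?g x)))"
  proof
    fix x
    have "jap x ^ Suc m *\<^sub>R f x = (1 + (\<Sum>i\<in>UNIV. x $ i * x $ i)) *\<^sub>R ?g x"
      unfolding j[of x, symmetric] by simp
    also have "\<dots> = ?g x + (\<Sum>i\<in>UNIV. (x $ i * x $ i) *\<^sub>R ?g x)"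
      unfolding scaleR_add_left scaleR_left.sum scaleR_one ..
    finally show "jap x ^ Suc m *\<^sub>R f x = ?g x + (\<Sum>i\<in>UNIV. x $ i *\<^sub>R (x $ i *\<^sub>R ?g x))"
      by (simp add: mult.assoc)
  qed
  moreover have "(\<lambda>x. ?g x + (\<Sum>i\<in>UNIV. x $ i *\<^sub>R (x $ i *\<^sub>R ?g x))) \<in> schwartz"
    by (intro schwartz_add schwartz_sum schwartz_coord Suc.IH)
  ultimately show ?case by (simp only:)
qed (simp add: assms)

lemma schwartz_decay:
  fixes f :: "real^'n::finite \<Rightarrow> 'c::real_normed_vector"
  assumes "f \<in> schwartz"
  obtains K where "0 \<le> K" "\<And>x. norm (f x) \<le> K * inverse (jap x ^ m)"
proof -
  obtain K where K: "\<And>x. norm (jap x ^ m *\<^sub>R f x) \<le> K"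
    using schwartz_bounded[OF schwartz_jap[OF assms, of m]] unfolding bounded_iff by blast
  show thesis
  proof
    show "0 \<le> K" using order_trans[OF norm_ge_zero K] .
    fix x :: "real^'n"
    have p: "0 < jap x ^ m" using jap_pos[of x] by simp
    then show "norm (f x) \<le> K * inverse (jap x ^ m)" using K[of x] by (simp add: field_simps)
  qed
qed

lemma schwartz_wt_bound:
  fixes f :: "real^'n::finite \<Rightarrow> 'c::real_normed_vector"
  assumes "f \<in> schwartz"
  obtains K where "0 \<le> K" "\<And>x. norm (f x) \<le> K * wt x"
  by (rule schwartz_decay[OF assms, of "DIM(real^'n)"]) (rule that; simp add: wt_def)

lemma schwartz_norm_bound:
  fixes f :: "real^'n::finite \<Rightarrow> 'c::real_normed_vector"
  assumes "f \<in> schwartz"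
  obtains K where "0 \<le> K" "\<And>x. norm (f x) \<le> K"
  by (rule schwartz_decay[OF assms, of 0]) (rule that; simp)

lemma schwartz_continuous: "f \<in> schwartz \<Longrightarrow> continuous_on A f"
  by (intro continuous_at_imp_continuous_on ballI differentiable_imp_continuous_within schwartz_differentiable)

lemma schwartz_dec:
  fixes f :: "real^'n::finite \<Rightarrow> 'c::banach"
  shows "f \<in> schwartz \<Longrightarrow> dec f"
  by (rule schwartz_wt_bound[of f]) (auto intro: decI schwartz_continuous)

lemma schwartz_integrable:
  fixes f :: "real^'n::finite \<Rightarrow> 'c::banach"
  shows "f \<in> schwartz \<Longrightarrow> f integrable_on UNIV"
  by (rule dec_integrable[OF schwartz_dec])

section \<open>Taylor estimates and the integral of a derivative\<close>

lemma vector_increment_bound: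
  fixes \<psi> :: "real \<Rightarrow> 'c::real_normed_vector"
  assumes "\<And>s. 0 \<le> s \<Longrightarrow> s \<le> t \<Longrightarrow> (\<psi> has_vector_derivative \<psi>' s) (at s)"
    and "\<And>s. 0 \<le> s \<Longrightarrow> s \<le> t \<Longrightarrow> norm (\<psi>' s) \<le> B" and "0 \<le> t"
  shows "norm (\<psi> t - \<psi> 0) \<le> B * t"
proof -
  have B: "0 \<le> B" using order_trans[OF norm_ge_zero assms(2)[of 0]] assms(3) by simp
  have "norm (\<psi> t - \<psi> 0) \<le> B * norm (t - 0)"
  proof (rule differentiable_bound[of "{0..t}" \<psi> "\<lambda>s h. h *\<^sub>R \<psi>' s"])
    fix s assume s: "s \<in> {0..t}"
    show "(\<psi> has_derivative (\<lambda>h. h *\<^sub>R \<psi>' s)) (at s within {0..t})"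
      using assms(1)[of s] s by (auto simp: has_vector_derivative_def intro: has_derivative_at_withinI)
    show "onorm (\<lambda>h. h *\<^sub>R \<psi>' s) \<le> B"
      using assms(2)[of s] s B by (intro onorm_bound) (simp_all add: mult.commute[of B] mult_left_mono)
  qed (use assms(3) in auto)
  then show ?thesis using assms(3) by simp
qed

lemma schwartz_dird: "f \<in> schwartz \<Longrightarrow> dird f h \<in> schwartz"
  unfolding dird_def[abs_def] by (intro schwartz_sum schwartz_scaleR schwartz_partial_deriv)

lemma schwartz_has_vector_derivative:
  fixes f :: "real^'n::finite \<Rightarrow> 'c::real_normed_vector"
  assumes "f \<in> schwartz"
  shows "((\<lambda>t. f (x + t *\<^sub>R h)) has_vector_derivative dird f h (x + t *\<^sub>R h)) (at t)"
proof -
  have l: "((\<lambda>t. x + t *\<^sub>R h) has_derivative (\<lambda>s. s *\<^sub>R h)) (at t)" by (auto intro!: derivative_eq_intros)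
  have "((\<lambda>t. f (x + t *\<^sub>R h)) has_derivative (\<lambda>s. dird f (s *\<^sub>R h) (x + t *\<^sub>R h))) (at t)"
    by (rule has_derivative_compose[OF l has_derivative_dird[OF schwartz_differentiable[OF assms]]])
  moreover have "dird f (s *\<^sub>R h) y = s *\<^sub>R dird f h y" for s y by (simp add: dird_def scaleR_sum_right)
  ultimately show ?thesis by (simp add: has_vector_derivative_def)
qed

lemma dird_dird_bound:
  fixes f :: "real^'n::finite \<Rightarrow> 'c::real_normed_vector"
  assumes f: "f \<in> schwartz" and M: "\<And>i j. norm (partial_deriv i (partial_deriv j f) y) \<le> M"
  shows "norm (dird (dird f h) h y) \<le> (real CARD('n))\<^sup>2 * M * (norm h)\<^sup>2"
proof -
  have pd: "partial_deriv i (dird f h) y = (\<Sum>j\<in>UNIV. h $ j *\<^sub>R partial_deriv i (partial_deriv j f) y)" for i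
  proof -
    have d: "((\<lambda>x. \<Sum>j\<in>UNIV. h $ j *\<^sub>R partial_deriv j f x) has_derivative
        (\<lambda>k. \<Sum>j\<in>UNIV. h $ j *\<^sub>R dird (partial_deriv j f) k y)) (at y)"
      by (intro has_derivative_sum has_derivative_scaleR_right has_derivative_dird schwartz_differentiable
          schwartz_partial_deriv f)
    have "partial_deriv i (partial_deriv j f) y = dird (partial_deriv j f) (axis i 1) y" for j
      by (rule partial_deriv_has_derivative[OF has_derivative_dird])
        (intro schwartz_differentiable schwartz_partial_deriv f)
    then show ?thesis using partial_deriv_has_derivative[OF d, of i] by (simp add: dird_def[abs_def])
  qed
  have M0: "0 \<le> M" using order_trans[OF norm_ge_zero M] .
  have "norm (dird (dird f h) h y) \<le> (\<Sum>i\<in>(UNIV::'n set). norm h * (\<Sum>j\<in>(UNIV::'n set). norm h * M))"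
    unfolding dird_def[of "dird f h"] pd
  proof (rule sum_norm_le)
    fix i :: 'n
    have "norm (\<Sum>j\<in>UNIV. h $ j *\<^sub>R partial_deriv i (partial_deriv j f) y) \<le> (\<Sum>j\<in>(UNIV::'n set). norm h * M)"
      by (intro sum_norm_le) (auto intro!: mult_mono M simp: component_le_norm_cart)
    then show "norm (h $ i *\<^sub>R (\<Sum>j\<in>UNIV. h $ j *\<^sub>R partial_deriv i (partial_deriv j f) y))
        \<le> norm h * (\<Sum>j\<in>(UNIV::'n set). norm h * M)"
      by (auto intro!: mult_mono simp: component_le_norm_cart)
  qed
  then show ?thesis by (simp add: power2_eq_square mult_ac)
qed

text \<open>The mean value inequality, applied first to the directional derivative and then to the
  remainder. Second derivatives are bounded along the segment only, so that \<open>M\<close> may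
  depend on \<open>x\<close> and decay with it.\<close>

lemma taylor_bound:
  fixes f :: "real^'n::finite \<Rightarrow> 'c::real_normed_vector"
  assumes f: "f \<in> schwartz"
    and M: "\<And>i j s. 0 \<le> s \<Longrightarrow> s \<le> 1 \<Longrightarrow> norm (partial_deriv i (partial_deriv j f) (x + s *\<^sub>R h)) \<le> M"
  shows "norm (f (x + h) - f x - dird f h x) \<le> (real CARD('n))\<^sup>2 * M * (norm h)\<^sup>2"
proof -
  define B where "B = (real CARD('n))\<^sup>2 * M * (norm h)\<^sup>2"
  have "0 \<le> M" using order_trans[OF norm_ge_zero M[of 0]] by simp
  then have B0: "0 \<le> B" by (simp add: B_def)
  have 1: "norm (dird f h (x + t *\<^sub>R h) - dird f h x) \<le> B" if t: "0 \<le> t" "t \<le> 1" for t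
  proof -
    have "norm (dird f h (x + t *\<^sub>R h) - dird f h (x + 0 *\<^sub>R h)) \<le> B * t"
    proof (rule vector_increment_bound[where \<psi> = "\<lambda>t. dird f h (x + t *\<^sub>R h)"])
      fix s assume s: "0 \<le> s" "s \<le> t"
      show "((\<lambda>t. dird f h (x + t *\<^sub>R h)) has_vector_derivative dird (dird f h) h (x + s *\<^sub>R h)) (at s)"
        by (intro schwartz_has_vector_derivative schwartz_dird f)
      show "norm (dird (dird f h) h (x + s *\<^sub>R h)) \<le> B"
        unfolding B_def by (rule dird_dird_bound[OF f M]) (use s t in auto)
    qed (rule t)
    also have "\<dots> \<le> B" using mult_left_mono[OF t(2) B0] by simp
    finally show ?thesis by simp
  qed
  have "norm ((f (x + 1 *\<^sub>R h) - 1 *\<^sub>R dird f h x) - (f (x + 0 *\<^sub>R h) - 0 *\<^sub>R dird f h x)) \<le> B * 1"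
  proof (rule vector_increment_bound[where \<psi> = "\<lambda>t. f (x + t *\<^sub>R h) - t *\<^sub>R dird f h x"])
    fix s :: real assume s: "0 \<le> s" "s \<le> 1"
    have "((\<lambda>t. t *\<^sub>R dird f h x) has_vector_derivative dird f h x) (at s)"
      by (auto intro!: derivative_eq_intros)
    then show "((\<lambda>t. f (x + t *\<^sub>R h) - t *\<^sub>R dird f h x) has_vector_derivative
        dird f h (x + s *\<^sub>R h) - dird f h x) (at s)"
      by (intro has_vector_derivative_diff schwartz_has_vector_derivative f)
    show "norm (dird f h (x + s *\<^sub>R h) - dird f h x) \<le> B" by (rule 1[OF s])
  qed simp
  then show ?thesis by (simp add: B_def algebra_simps)
qed

text \<open>Translation invariance does the work of integration by parts: the integral of
  \<open>f (x + t a) - f x\<close> is 0, while Taylor bounds its distance from \<open>t\<close>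
  times the integral of the derivative by \<open>C t\<^sup>2\<close>. Divide by \<open>t\<close> and
  let \<open>t\<close> tend to 0.\<close>

lemma integral_partial_deriv:
  fixes f :: "real^'n::finite \<Rightarrow> 'c::banach"
  assumes f: "f \<in> schwartz"
  shows "integral UNIV (partial_deriv i f) = 0"
proof -
  have "\<exists>K\<ge>0. \<forall>x. norm (partial_deriv k (partial_deriv j f) x) \<le> K * wt x" for k j
    by (rule schwartz_wt_bound[OF schwartz_partial_deriv[OF schwartz_partial_deriv[OF f]], of k j]) blast
  then obtain K where K: "\<And>k j. 0 \<le> K k j" "\<And>k j x. norm (partial_deriv k (partial_deriv j f) x) \<le> K k j * wt x"
    by metis
  define L where "L = (\<Sum>k\<in>UNIV. \<Sum>j\<in>UNIV. K k j)"
  have KL: "K k j \<le> L" for k j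
  proof -
    have "K k j \<le> (\<Sum>j\<in>UNIV. K k j)" using K(1) by (intro member_le_sum) auto
    also have "\<dots> \<le> L" unfolding L_def using K(1) by (intro member_le_sum sum_nonneg) auto
    finally show ?thesis .
  qed
  have L0: "0 \<le> L" using K(1) unfolding L_def by (intro sum_nonneg)
  define a where "a = (axis i 1 :: real^'n)"
  have da: "dird f (t *\<^sub>R a) x = t *\<^sub>R partial_deriv i f x" for t x
  proof -
    have "dird f (t *\<^sub>R a) x = (\<Sum>j\<in>UNIV. if j = i then t *\<^sub>R partial_deriv j f x else 0)"
      unfolding dird_def a_def by (rule sum.cong) (simp_all add: axis_def)
    then show ?thesis by simp
  qed
  define C where "C = (real CARD('n))\<^sup>2 * (L * 4 ^ DIM(real^'n)) * wt_total TYPE(real^'n)"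
  have est: "norm (integral UNIV (partial_deriv i f)) \<le> C * t" if t: "0 < t" "t \<le> 1" for t
  proof -
    have na: "norm (t *\<^sub>R a) = t" using t by (simp add: a_def)
    have bd: "norm (f (x + t *\<^sub>R a) - f x - t *\<^sub>R partial_deriv i f x)
        \<le> ((real CARD('n))\<^sup>2 * (L * 4 ^ DIM(real^'n)) * t\<^sup>2) * wt x" for x
    proof -
      have "norm (partial_deriv k (partial_deriv j f) (x + s *\<^sub>R (t *\<^sub>R a))) \<le> L * 4 ^ DIM(real^'n) * wt x"
        if s: "0 \<le> s" "s \<le> 1" for k j s
      proof -
        \<comment> \<open>Displacements of norm at most 1 change the weight by at most a factor 4
          per dimension.\<close>
        have "norm (s *\<^sub>R (t *\<^sub>R a)) \<le> 1" using na s t mult_le_one[of s t] by simp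
        then have "(norm (s *\<^sub>R (t *\<^sub>R a)))\<^sup>2 \<le> 1" by (intro power_le_one) auto
        then have "2 * jap (s *\<^sub>R (t *\<^sub>R a)) \<le> 4" by (simp add: jap_def)
        then have "(2 * jap (s *\<^sub>R (t *\<^sub>R a))) ^ DIM(real^'n) \<le> 4 ^ DIM(real^'n)"
          using jap_pos[of "s *\<^sub>R (t *\<^sub>R a)"] by (intro power_mono) auto
        then have w: "wt (x + s *\<^sub>R (t *\<^sub>R a)) \<le> 4 ^ DIM(real^'n) * wt x"
          by (rule order_trans[OF wt_add_le mult_right_mono[OF _ wt_nonneg]])
        have "norm (partial_deriv k (partial_deriv j f) (x + s *\<^sub>R (t *\<^sub>R a)))
            \<le> L * (4 ^ DIM(real^'n) * wt x)"
          using order_trans[OF K(2) mult_mono[OF KL w L0 wt_nonneg]] .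
        then show ?thesis by (simp add: mult.assoc)
      qed
      from taylor_bound[OF f this] show ?thesis unfolding da na by (simp add: mult_ac)
    qed
    have c: "continuous_on UNIV (\<lambda>x. f (x + t *\<^sub>R a) - f x - t *\<^sub>R partial_deriv i f x)"
      by (intro schwartz_continuous schwartz_diff schwartz_translate schwartz_scaleR schwartz_partial_deriv f)
    have i: "(\<lambda>x. f (x + t *\<^sub>R a)) integrable_on UNIV" "f integrable_on UNIV"
      "(\<lambda>x. t *\<^sub>R partial_deriv i f x) integrable_on UNIV"
      by (intro schwartz_integrable schwartz_translate schwartz_scaleR schwartz_partial_deriv f)+
    have "integral UNIV (\<lambda>x. f (x + t *\<^sub>R a) - f x - t *\<^sub>R partial_deriv i f x)
        = - (t *\<^sub>R integral UNIV (partial_deriv i f))"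
      using Henstock_Kurzweil_Integration.integral_diff[OF integrable_diff[OF i(1,2)] i(3)]
        Henstock_Kurzweil_Integration.integral_diff[OF i(1,2)]
      by (simp add: integral_shift_UNIV)
    with norm_integral_wt_bound[OF c bd] t
    have "t * norm (integral UNIV (partial_deriv i f)) \<le> C * t * t"
      by (simp add: C_def power2_eq_square mult_ac)
    then show ?thesis using t by (simp add: mult_ac)
  qed
  have "(\<lambda>n. C * inverse (real (Suc n))) \<longlonglongrightarrow> C * 0"
    by (intro tendsto_mult tendsto_const LIMSEQ_inverse_real_of_nat)
  moreover have "norm (integral UNIV (partial_deriv i f)) \<le> C * inverse (real (Suc n))" for n
    by (rule est) (simp_all add: inverse_le_1_iff)
  ultimately have "norm (integral UNIV (partial_deriv i f)) \<le> C * 0"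
    by (intro LIMSEQ_le_const[of "\<lambda>n. C * inverse (real (Suc n))"]) blast+
  then show ?thesis by simp
qed

section \<open>Fourier inversion\<close>

lemma integral_bounded_linear:
  fixes f :: "'a::euclidean_space \<Rightarrow> 'b::real_normed_vector"
  assumes "bounded_linear L" "f integrable_on UNIV"
  shows "integral UNIV (\<lambda>x. L (f x)) = L (integral UNIV f)"
  using integral_linear[OF assms(2,1)] by (simp add: o_def)

definition fourier :: "(real^'n::finite \<Rightarrow> 'c::unital_cstar_algebra) \<Rightarrow> real^'n \<Rightarrow> 'c" where
  "fourier f p = integral UNIV (\<lambda>x. ec (- (p \<bullet> x)) *\<^sub>C f x)"

lemma schwartz_ec_minus:
  fixes f :: "real^'n::finite \<Rightarrow> 'c::unital_cstar_algebra"
  assumes "f \<in> schwartz"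
  shows "(\<lambda>x. ec (- (p \<bullet> x)) *\<^sub>C f x) \<in> schwartz"
  using schwartz_modulate[OF assms, where p = "- p"] by simp

lemma norm_fourier_le:
  fixes f :: "real^'n::finite \<Rightarrow> 'c::unital_cstar_algebra"
  assumes "f \<in> schwartz" "\<And>x. norm (f x) \<le> K * wt x"
  shows "norm (fourier f p) \<le> K * wt_total TYPE(real^'n)"
  unfolding fourier_def
  by (rule norm_integral_wt_bound[OF schwartz_continuous[OF schwartz_ec_minus[OF assms(1)]]])
    (simp add: assms(2))

lemma continuous_on_snd_compose:
  assumes "continuous_on UNIV f"
  shows "continuous_on UNIV (\<lambda>z. f (snd z))" "continuous_on UNIV (\<lambda>z. f (fst z))"
  using continuous_on_compose2[OF assms, of UNIV snd] continuous_on_compose2[OF assms, of UNIV fst]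
  by (simp_all add: continuous_on_fst continuous_on_snd)

lemma continuous_on_fourier:
  fixes f :: "real^'n::finite \<Rightarrow> 'c::unital_cstar_algebra"
  assumes f: "f \<in> schwartz"
  shows "continuous_on UNIV (fourier f)"
proof -
  obtain K where K: "\<And>x. norm (f x) \<le> K * wt x" by (rule schwartz_wt_bound[OF f]) blast
  have "continuous_on UNIV (\<lambda>p. integral UNIV (\<lambda>x. ec (- (p \<bullet> x)) *\<^sub>C f x))"
  proof (rule continuous_on_integral_param)
    show "continuous_on UNIV (\<lambda>(p, x). ec (- (p \<bullet> x)) *\<^sub>C f x)"
      unfolding case_prod_unfold
      by (intro continuous_intros continuous_on_snd_compose schwartz_continuous f)
    show "norm (ec (- (p \<bullet> x)) *\<^sub>C f x) \<le> K * wt x" for p x by (simp add: K)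
  qed
  then show ?thesis by (simp add: fourier_def[abs_def])
qed

lemma fourier_add:
  fixes f g :: "real^'n::finite \<Rightarrow> 'c::unital_cstar_algebra"
  assumes "f \<in> schwartz" "g \<in> schwartz"
  shows "fourier (\<lambda>x. f x + g x) p = fourier f p + fourier g p"
  unfolding fourier_def scaleC_add_right
  by (rule Henstock_Kurzweil_Integration.integral_add)
    (intro schwartz_integrable schwartz_ec_minus assms)+

lemma fourier_scaleC:
  fixes f :: "real^'n::finite \<Rightarrow> 'c::unital_cstar_algebra"
  assumes "f \<in> schwartz"
  shows "fourier (\<lambda>x. c *\<^sub>C f x) p = c *\<^sub>C fourier f p"
proof -
  have "ec (- (p \<bullet> x)) *\<^sub>C c *\<^sub>C f x = c *\<^sub>C ec (- (p \<bullet> x)) *\<^sub>C f x" for x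
    by (simp add: scaleC_scaleC mult.commute)
  then show ?thesis
    using integral_bounded_linear[OF bounded_linear_scaleC_right schwartz_integrable[OF schwartz_ec_minus[OF assms]]]
    by (simp add: fourier_def)
qed

lemma fourier_scaleR:
  fixes f :: "real^'n::finite \<Rightarrow> 'c::unital_cstar_algebra"
  assumes "f \<in> schwartz"
  shows "fourier (\<lambda>x. r *\<^sub>R f x) p = r *\<^sub>R fourier f p"
  using fourier_scaleC[OF assms, of "complex_of_real r"] by (simp add: scaleC_of_real)

lemma fourier_sum:
  fixes f :: "'i \<Rightarrow> real^'n::finite \<Rightarrow> 'c::unital_cstar_algebra"
  assumes "finite A" "\<And>i. i \<in> A \<Longrightarrow> f i \<in> schwartz"
  shows "fourier (\<lambda>x. \<Sum>i\<in>A. f i x) p = (\<Sum>i\<in>A. fourier (f i) p)"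
  using assms
proof (induction A rule: finite_induct)
  case empty
  then show ?case by (simp add: fourier_def)
next
  case (insert i A)
  then show ?case by (simp add: fourier_add schwartz_sum)
qed

text \<open>The derivative of \<open>ec (- (p \<bullet> x)) *\<^sub>C f x\<close> has integral 0;
  expanding it by the product rule relates the two transforms.\<close>

lemma fourier_partial_deriv:
  fixes f :: "real^'n::finite \<Rightarrow> 'c::unital_cstar_algebra"
  assumes f: "f \<in> schwartz"
  shows "fourier (partial_deriv i f) p = (2 * pi * p $ i) *\<^sub>R \<i> *\<^sub>C fourier f p"
proof -
  let ?e = "\<lambda>x. ec (- (p \<bullet> x))"
  have "partial_deriv i (\<lambda>x. ?e x *\<^sub>C f x)
      = (\<lambda>x. ?e x *\<^sub>C partial_deriv i f x - (2 * pi * p $ i) *\<^sub>R \<i> *\<^sub>C (?e x *\<^sub>C f x))"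
    using partial_deriv_modulate[OF f, of i "- p"]
    by (simp add: scaleC_add_right scaleC_diff_right scaleC_scaleR scaleC_scaleC mult.commute scaleC_minus_right)
  with integral_partial_deriv[OF schwartz_ec_minus[OF f], of i p]
  have "integral UNIV (\<lambda>x. ?e x *\<^sub>C partial_deriv i f x - (2 * pi * p $ i) *\<^sub>R \<i> *\<^sub>C (?e x *\<^sub>C f x)) = 0"
    by simp
  also have "integral UNIV (\<lambda>x. ?e x *\<^sub>C partial_deriv i f x - (2 * pi * p $ i) *\<^sub>R \<i> *\<^sub>C (?e x *\<^sub>C f x))
      = fourier (partial_deriv i f) p - integral UNIV (\<lambda>x. (2 * pi * p $ i) *\<^sub>R \<i> *\<^sub>C (?e x *\<^sub>C f x))"
    unfolding fourier_def
    by (rule Henstock_Kurzweil_Integration.integral_diff)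
      (intro schwartz_integrable schwartz_scaleR schwartz_scaleC schwartz_ec_minus schwartz_partial_deriv f)+
  also have "integral UNIV (\<lambda>x. (2 * pi * p $ i) *\<^sub>R \<i> *\<^sub>C (?e x *\<^sub>C f x))
      = (2 * pi * p $ i) *\<^sub>R \<i> *\<^sub>C fourier f p"
    unfolding fourier_def
    using integral_bounded_linear[OF bounded_linear_scaleC_right[of \<i>] schwartz_integrable[OF schwartz_ec_minus[OF f]], of p]
    by simp
  finally show ?thesis by simp
qed

text \<open>The operator \<open>1 - \<Delta> / (4 \<pi>\<^sup>2)\<close>; with this constant its
  Fourier multiplier is exactly \<open>jap p\<close>.\<close>

definition bessel :: "(real^'n::finite \<Rightarrow> 'c::real_normed_vector) \<Rightarrow> real^'n \<Rightarrow> 'c" where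
  "bessel f x = f x - (1 / (4 * pi\<^sup>2)) *\<^sub>R (\<Sum>i\<in>UNIV. partial_deriv i (partial_deriv i f) x)"

lemma schwartz_bessel: "f \<in> schwartz \<Longrightarrow> bessel f \<in> schwartz"
  unfolding bessel_def[abs_def] by (intro schwartz_diff schwartz_scaleR schwartz_sum schwartz_partial_deriv)

lemma schwartz_bessel_funpow: "f \<in> schwartz \<Longrightarrow> (bessel ^^ m) f \<in> schwartz"
  by (induction m) (simp_all add: schwartz_bessel)

lemma fourier_bessel:
  fixes f :: "real^'n::finite \<Rightarrow> 'c::unital_cstar_algebra"
  assumes f: "f \<in> schwartz"
  shows "fourier (bessel f) p = jap p *\<^sub>R fourier f p"
proof -
  have dd: "fourier (partial_deriv i (partial_deriv i f)) p = (- (4 * pi\<^sup>2 * (p $ i * p $ i))) *\<^sub>R fourier f p" for i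
    unfolding fourier_partial_deriv[OF schwartz_partial_deriv[OF f]] fourier_partial_deriv[OF f]
    by (simp add: scaleC_scaleR scaleC_scaleC scaleC_minus_left power2_eq_square mult_ac)
  let ?s = "\<lambda>x. \<Sum>i\<in>UNIV. partial_deriv i (partial_deriv i f) x"
  have s: "?s \<in> schwartz" by (intro schwartz_sum schwartz_partial_deriv f)
  have "bessel f = (\<lambda>x. f x + (- (1 / (4 * pi\<^sup>2))) *\<^sub>R ?s x)" by (simp add: bessel_def[abs_def])
  then have "fourier (bessel f) p = fourier f p + (- (1 / (4 * pi\<^sup>2))) *\<^sub>R fourier ?s p"
    by (simp only: fourier_add[OF f schwartz_scaleR[OF s]] fourier_scaleR[OF s])
  also have "fourier ?s p = (\<Sum>i\<in>UNIV. (- (4 * pi\<^sup>2 * (p $ i * p $ i))) *\<^sub>R fourier f p)"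
    using fourier_sum[of UNIV "\<lambda>i. partial_deriv i (partial_deriv i f)" p] f
    by (simp add: schwartz_partial_deriv dd)
  also have "\<dots> = (- (4 * pi\<^sup>2 * (p \<bullet> p))) *\<^sub>R fourier f p"
    by (simp add: inner_vec_def sum_distrib_left sum_negf flip: scaleR_left.sum)
  finally have "fourier (bessel f) p = fourier f p + (p \<bullet> p) *\<^sub>R fourier f p" by simp
  then show ?thesis by (simp add: jap_def power2_norm_eq_inner scaleR_add_left)
qed

lemma fourier_bessel_funpow:
  fixes f :: "real^'n::finite \<Rightarrow> 'c::unital_cstar_algebra"
  assumes f: "f \<in> schwartz"
  shows "fourier ((bessel ^^ m) f) p = jap p ^ m *\<^sub>R fourier f p"
  by (induction m) (simp_all add: fourier_bessel schwartz_bessel_funpow f)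

text \<open>Powers of \<open>bessel\<close> become powers of \<open>jap p\<close> on the Fourier
  side, and the transform of a Schwartz function is bounded.\<close>

lemma fourier_decay:
  fixes f :: "real^'n::finite \<Rightarrow> 'c::unital_cstar_algebra"
  assumes f: "f \<in> schwartz"
  obtains K where "0 \<le> K" "\<And>p. norm (fourier f p) \<le> K * inverse (jap p ^ m)"
proof -
  obtain K where K: "0 \<le> K" "\<And>x. norm ((bessel ^^ m) f x) \<le> K * wt x"
    using schwartz_wt_bound[OF schwartz_bessel_funpow[OF f]] by blast
  show thesis
  proof
    show "0 \<le> K * wt_total TYPE(real^'n)" using K(1) wt_total_nonneg by (rule mult_nonneg_nonneg)
    fix p :: "real^'n"
    have j: "0 < jap p ^ m" using jap_pos[of p] by simp
    have "norm (jap p ^ m *\<^sub>R fourier f p) \<le> K * wt_total TYPE(real^'n)"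
      using norm_fourier_le[OF schwartz_bessel_funpow[OF f] K(2), of p] by (simp add: fourier_bessel_funpow[OF f])
    then show "norm (fourier f p) \<le> K * wt_total TYPE(real^'n) * inverse (jap p ^ m)"
      using j by (simp add: field_simps)
  qed
qed

lemma fourier_wt_bound:
  fixes f :: "real^'n::finite \<Rightarrow> 'c::unital_cstar_algebra"
  assumes "f \<in> schwartz"
  obtains K where "0 \<le> K" "\<And>p. norm (fourier f p) \<le> K * wt p"
  by (rule fourier_decay[OF assms, of "DIM(real^'n)"]) (rule that; simp add: wt_def)

section \<open>Gaussians\<close>

text \<open>The characteristic function of the standard normal distribution, rescaled by
  \<open>sqrt (2 * pi)\<close> to the variance at which the Gaussian is its own transform.\<close>

lemma gauss_fourier_real:
  "integrable lborel (\<lambda>t::real. complex_of_real (exp (- pi * t\<^sup>2)) * ec (- (s * t)))"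
  "(LINT t|lborel. complex_of_real (exp (- pi * t\<^sup>2)) * ec (- (s * t))) = complex_of_real (exp (- pi * s\<^sup>2))"
proof -
  let ?c = "sqrt (2 * pi)"
  let ?G = "\<lambda>t. complex_of_real (exp (- pi * t\<^sup>2)) * ec (- (s * t))"
  let ?g = "\<lambda>x::real. std_normal_density x *\<^sub>R iexp (- (?c * s) * x)"
  have c: "?c \<noteq> 0" by simp
  have c2: "?c\<^sup>2 = 2 * pi" by simp
  have "integrable lborel std_normal_density" by (rule integrable_normal_density) simp
  then have gi: "integrable lborel ?g"
    by (rule Bochner_Integration.integrable_bound) (auto simp: normal_density_nonneg)
  have "char std_normal_distribution (- (?c * s)) = (LINT x|lborel. ?g x)"
    unfolding char_def by (subst integral_density) (auto simp: normal_density_nonneg)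
  then have gv: "(LINT x|lborel. ?g x) = complex_of_real (exp (- pi * s\<^sup>2))"
    by (simp add: char_std_normal_distribution power_mult_distrib c2)
  have eq: "?g (0 + ?c * t) = (1 / ?c) *\<^sub>R ?G t" for t
  proof -
    have "std_normal_density (?c * t) = (1 / ?c) * exp (- pi * t\<^sup>2)"
      by (simp add: normal_density_def power_mult_distrib c2)
    moreover have "iexp (- (?c * s) * (?c * t)) = ec (- (s * t))"
    proof -
      have "- (?c * s) * (?c * t) = - (?c\<^sup>2 * (s * t))" by (simp add: power2_eq_square mult_ac)
      also have "\<dots> = 2 * pi * (- (s * t))" by (simp add: c2)
      finally show ?thesis unfolding ec_def cis_conv_exp by (simp only:)
    qed
    ultimately show ?thesis by (simp add: scaleR_conv_of_real)
  qed
  have "integrable lborel (\<lambda>t. ?g (0 + ?c * t))" using gi c by (rule lborel_integrable_real_affine)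
  then have "integrable lborel (\<lambda>t. ?c *\<^sub>R ((1 / ?c) *\<^sub>R ?G t))" unfolding eq by (rule integrable_scaleR_right)
  then show "integrable lborel ?G" by simp
  have "(LINT x|lborel. ?g x) = \<bar>?c\<bar> *\<^sub>R (LINT t|lborel. ?g (0 + ?c * t))"
    by (rule lborel_integral_real_affine[OF c])
  also have "\<dots> = (LINT t|lborel. ?G t)" unfolding eq by simp
  finally show "(LINT t|lborel. ?G t) = complex_of_real (exp (- pi * s\<^sup>2))" using gv by simp
qed

definition gauss :: "'a::real_normed_vector \<Rightarrow> complex" where
  "gauss x = complex_of_real (exp (- pi * (norm x)\<^sup>2))"

lemma gauss_fourier:
  fixes s :: "'a::euclidean_space"
  shows "((\<lambda>x. gauss x * ec (- (s \<bullet> x))) has_integral gauss s) UNIV"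
proof -
  let ?G = "\<lambda>b t. complex_of_real (exp (- pi * t\<^sup>2)) * ec (- ((s \<bullet> b) * t))"
  have n2: "(norm y)\<^sup>2 = (\<Sum>b\<in>Basis. (y \<bullet> b)\<^sup>2)" for y :: 'a
    unfolding power2_norm_eq_inner by (subst euclidean_inner) (simp add: power2_eq_square)
  have ecs: "(\<Prod>b\<in>A. ec (u b)) = ec (\<Sum>b\<in>A. u b)" if "finite A" for A :: "'a set" and u
    using that by (induction A rule: finite_induct) (simp_all add: ec_add)
  have exps: "(\<Prod>b\<in>(Basis::'a set). complex_of_real (exp (- pi * (y \<bullet> b)\<^sup>2))) = gauss y" for y
    unfolding gauss_def n2
    by (simp add: exp_sum sum_distrib_left flip: of_real_prod sum_negf)
  have prod: "(\<Prod>b\<in>Basis. ?G b (x \<bullet> b)) = gauss x * ec (- (s \<bullet> x))" for x :: 'a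
    unfolding prod.distrib exps ecs[OF finite_Basis]
    by (subst (2) euclidean_inner) (simp add: sum_negf)
  have "((\<lambda>x. \<Prod>b\<in>Basis. ?G b (x \<bullet> b)) has_integral (LINT x|lborel. (\<Prod>b\<in>(Basis::'a set). ?G b (x \<bullet> b)))) UNIV"
    by (rule has_integral_integral_lborel[OF lborel_integrable_prod_Basis[OF gauss_fourier_real(1)]])
  moreover have "(LINT x|lborel. (\<Prod>b\<in>(Basis::'a set). ?G b (x \<bullet> b))) = gauss s"
    unfolding lborel_integral_prod_Basis[OF gauss_fourier_real(1)] gauss_fourier_real(2) by (rule exps)
  ultimately show ?thesis unfolding prod by simp
qed

lemma gauss_fourier_scaled:
  fixes s :: "'a::euclidean_space"
  assumes "0 < e"
  shows "((\<lambda>x. gauss (e *\<^sub>R x) * ec (- (s \<bullet> x))) has_integral (1 / e ^ DIM('a)) *\<^sub>R gauss ((1/e) *\<^sub>R s)) UNIV"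
  using has_integral_affinity_UNIV[OF gauss_fourier[of "(1/e) *\<^sub>R s"], of e 0] assms by simp

lemma jap_power_le_exp:
  assumes "0 < c"
  obtains C where "0 < C" "\<And>x::'a::real_normed_vector. jap x ^ m * exp (- c * (norm x)\<^sup>2) \<le> C"
proof -
  \<comment> \<open>With \<open>r\<close> the squared norm, \<open>d \<le> 1\<close> gives
    \<open>jap x \<le> (1 + d r) / d\<close>, and \<open>d m \<le> c\<close> lets the Gaussian
    absorb the power \<open>m\<close> of \<open>exp (d r)\<close>. The denominator
    \<open>m + 1\<close> avoids division by 0.\<close>
  define d where "d = min 1 (c / (real m + 1))"
  have d: "0 < d" "d \<le> 1" using assms by (auto simp: d_def)
  have "d \<le> c / (real m + 1)" by (simp add: d_def)
  then have "d * (real m + 1) \<le> c" by (simp add: pos_le_divide_eq)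
  then have md: "d * real m \<le> c" using d by (simp add: algebra_simps)
  show thesis
  proof
    show "0 < (1 / d) ^ m" using d by simp
    fix x :: 'a
    let ?r = "(norm x)\<^sup>2"
    have "jap x \<le> (1 / d) * (1 + d * ?r)" using d by (simp add: jap_def field_simps)
    also have "\<dots> \<le> (1 / d) * exp (d * ?r)" using d by (intro mult_left_mono exp_ge_add_one_self) auto
    finally have "jap x ^ m \<le> ((1 / d) * exp (d * ?r)) ^ m" using jap_pos[of x] by (intro power_mono) auto
    also have "\<dots> = (1 / d) ^ m * exp ((d * real m) * ?r)"
      by (simp only: power_mult_distrib exp_of_nat_mult[symmetric] mult_ac)
    also have "\<dots> \<le> (1 / d) ^ m * exp (c * ?r)"
      using d md by (intro mult_left_mono) (simp_all add: mult_right_mono)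
    finally have "jap x ^ m * exp (- c * ?r) \<le> (1 / d) ^ m * exp (c * ?r) * exp (- c * ?r)"
      by (intro mult_right_mono) simp_all
    then show "jap x ^ m * exp (- c * ?r) \<le> (1 / d) ^ m" by (simp add: mult.assoc flip: exp_add)
  qed
qed

lemma norm_gauss: "norm (gauss x) = exp (- pi * (norm x)\<^sup>2)"
  by (simp add: gauss_def)

text \<open>The extra factor \<open>jap x\<close> will absorb the growth of the Lipschitz bound in
  \<open>integral_fourier\<close>.\<close>

lemma gauss_wt_bound:
  assumes "0 < e"
  obtains C where "0 < C" "\<And>x::'a::euclidean_space. jap x * norm (gauss (e *\<^sub>R x)) \<le> C * wt x"
proof -
  have "0 < pi * e\<^sup>2" using assms by simp
  then obtain C where C: "0 < C"
    "\<And>x::'a. jap x ^ Suc (DIM('a)) * exp (- (pi * e\<^sup>2) * (norm x)\<^sup>2) \<le> C"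
    using jap_power_le_exp[of "pi * e\<^sup>2" "Suc (DIM('a))"] by metis
  show thesis
  proof
    show "0 < C" by (rule C)
    fix x :: 'a
    have "0 < jap x ^ DIM('a)" using jap_pos[of x] by simp
    moreover have "norm (gauss (e *\<^sub>R x)) = exp (- (pi * e\<^sup>2) * (norm x)\<^sup>2)"
      using assms by (simp add: norm_gauss power_mult_distrib mult_ac)
    ultimately show "jap x * norm (gauss (e *\<^sub>R x)) \<le> C * wt x"
      using C(2)[of x] by (simp add: wt_def field_simps)
  qed
qed

lemma continuous_on_gauss [continuous_intros]:
  "continuous_on A f \<Longrightarrow> continuous_on A (\<lambda>x. gauss (f x))"
  unfolding gauss_def by (intro continuous_intros)

lemma schwartz_lipschitz:
  fixes f :: "real^'n::finite \<Rightarrow> 'c::real_normed_vector"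
  assumes f: "f \<in> schwartz"
  obtains L where "0 \<le> L" "\<And>x h. norm (f (x + h) - f x) \<le> L * norm h"
proof -
  have "\<exists>K\<ge>0. \<forall>x. norm (partial_deriv i f x) \<le> K" for i
    by (rule schwartz_norm_bound[OF schwartz_partial_deriv[OF f], of i]) blast
  then obtain K where K: "\<And>i. 0 \<le> K i" "\<And>i x. norm (partial_deriv i f x) \<le> K i" by metis
  show thesis
  proof
    show "0 \<le> (\<Sum>i\<in>UNIV. K i)" using K(1) by (intro sum_nonneg)
    fix x h
    have "norm (f (x + 1 *\<^sub>R h) - f (x + 0 *\<^sub>R h)) \<le> ((\<Sum>i\<in>UNIV. K i) * norm h) * 1"
    proof (rule vector_increment_bound[where \<psi> = "\<lambda>t. f (x + t *\<^sub>R h)"])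
      fix s :: real
      show "((\<lambda>t. f (x + t *\<^sub>R h)) has_vector_derivative dird f h (x + s *\<^sub>R h)) (at s)"
        by (rule schwartz_has_vector_derivative[OF f])
      have "norm (dird f h (x + s *\<^sub>R h)) \<le> (\<Sum>i\<in>UNIV. norm h * K i)"
        unfolding dird_def
        by (rule sum_norm_le) (simp add: mult_mono K component_le_norm_cart)
      then show "norm (dird f h (x + s *\<^sub>R h)) \<le> (\<Sum>i\<in>UNIV. K i) * norm h"
        by (simp add: sum_distrib_left mult.commute)
    qed simp
    then show "norm (f (x + h) - f x) \<le> (\<Sum>i\<in>UNIV. K i) * norm h" by simp
  qed
qed

lemma bounded_linear_scaleC_left: "bounded_linear (\<lambda>c. c *\<^sub>C (x::'c::unital_cstar_algebra))"
  by (rule bounded_bilinear.bounded_linear_left[OF bounded_bilinear_scaleC])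

section \<open>Inversion by Gaussian regularisation\<close>

text \<open>A Gaussian factor makes the double integral absolutely convergent. After the interchange
  the inner integral is a Gaussian of width \<open>e\<close> around 0, and rescaling by
  \<open>e\<close> moves the parameter into \<open>f\<close>.\<close>

lemma gauss_regularised_inversion:
  fixes f :: "real^'n::finite \<Rightarrow> 'c::unital_cstar_algebra"
  assumes f: "f \<in> schwartz" and e: "0 < e"
  shows "integral UNIV (\<lambda>p. gauss (e *\<^sub>R p) *\<^sub>C fourier f p) = integral UNIV (\<lambda>z. gauss z *\<^sub>C f (e *\<^sub>R z))"
proof -
  obtain K where K: "0 \<le> K" "\<And>x. norm (f x) \<le> K * wt x" using schwartz_wt_bound[OF f] by blast
  obtain C where C: "0 < C" "\<And>x::real^'n. jap x * norm (gauss (e *\<^sub>R x)) \<le> C * wt x"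
    using gauss_wt_bound[OF e] by blast
  have C': "norm (gauss (e *\<^sub>R x)) \<le> C * wt x" for x :: "real^'n"
    using C(2)[of x] mult_right_mono[OF jap_ge_1[of x], of "norm (gauss (e *\<^sub>R x))"] by simp
  let ?F = "\<lambda>p x. (gauss (e *\<^sub>R p) * ec (- (p \<bullet> x))) *\<^sub>C f x"
  have c: "continuous_on UNIV (\<lambda>(p, x). ?F p x)"
    unfolding case_prod_unfold
    by (intro continuous_intros continuous_on_snd_compose schwartz_continuous f)
  have b: "norm (?F p x) \<le> (C * K) * wt p * wt x" for p x
  proof -
    have "norm (gauss (e *\<^sub>R p)) * norm (f x) \<le> (C * wt p) * (K * wt x)"
      using C'[of p] K C(1) wt_nonneg[of p] by (intro mult_mono) auto
    then show ?thesis by (simp add: norm_scaleC norm_mult mult_ac)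
  qed
  have "integral UNIV (\<lambda>p. gauss (e *\<^sub>R p) *\<^sub>C fourier f p) = integral UNIV (\<lambda>p. integral UNIV (\<lambda>x. ?F p x))"
    unfolding fourier_def
    using integral_bounded_linear[OF bounded_linear_scaleC_right schwartz_integrable[OF schwartz_ec_minus[OF f]]]
    by (simp add: scaleC_scaleC)
  also have "\<dots> = integral UNIV (\<lambda>x. integral UNIV (\<lambda>p. ?F p x))"
    by (rule integral_swap_UNIV[OF c b])
  also have "\<dots> = integral UNIV (\<lambda>x. (1 / e ^ DIM(real^'n)) *\<^sub>R (gauss ((1/e) *\<^sub>R x) *\<^sub>C f x))"
  proof (rule arg_cong[where f = "integral UNIV"], rule ext)
    fix x
    have "((\<lambda>p. ?F p x) has_integral ((1 / e ^ DIM(real^'n)) *\<^sub>R gauss ((1/e) *\<^sub>R x)) *\<^sub>C f x) UNIV"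
      using has_integral_linear[OF gauss_fourier_scaled[OF e, of x] bounded_linear_scaleC_left[of "f x"]]
      by (simp add: o_def inner_commute)
    then show "integral UNIV (\<lambda>p. ?F p x) = (1 / e ^ DIM(real^'n)) *\<^sub>R (gauss ((1/e) *\<^sub>R x) *\<^sub>C f x)"
      by (simp add: integral_unique scaleR_scaleC)
  qed
  also have "\<dots> = (1 / \<bar>e\<bar> ^ DIM(real^'n)) *\<^sub>R integral UNIV (\<lambda>x. gauss ((1/e) *\<^sub>R x) *\<^sub>C f x)" using e by simp
  also have "\<dots> = integral UNIV (\<lambda>z. gauss z *\<^sub>C f (e *\<^sub>R z))"
    using integral_affinity_UNIV[of e "\<lambda>x. gauss ((1/e) *\<^sub>R x) *\<^sub>C f x" 0] e by simp
  finally show ?thesis .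
qed

text \<open>\<open>A e\<close> is compared with both sides as \<open>e\<close> tends to 0: in its
  defining form the Gaussian tends to 1, in the form of \<open>gauss_regularised_inversion\<close>
  \<open>f (e z)\<close> tends to \<open>f 0\<close>.\<close>

lemma integral_fourier:
  fixes f :: "real^'n::finite \<Rightarrow> 'c::unital_cstar_algebra"
  assumes f: "f \<in> schwartz"
  shows "integral UNIV (fourier f) = f 0"
proof -
  define A where "A = (\<lambda>e. integral UNIV (\<lambda>p. gauss (e *\<^sub>R p) *\<^sub>C fourier f p))"
  \<comment> \<open>One power of \<open>jap\<close> more than integrability requires: it pays for
    \<open>1 - exp (- u) \<le> u\<close> with
    \<open>u = \<pi> e\<^sup>2 |p|\<^sup>2\<close>.\<close>
  obtain K where K: "0 \<le> K" "\<And>p. norm (fourier f p) \<le> K * inverse (jap p ^ Suc (DIM(real^'n)))"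
    using fourier_decay[OF f] by blast
  have K': "jap p * norm (fourier f p) \<le> K * wt p" for p
    using K(2)[of p] jap_pos[of p] by (simp add: wt_def field_simps)
  have K1: "norm (fourier f p) \<le> K * wt p" for p
    using K'[of p] mult_right_mono[OF jap_ge_1[of p], of "norm (fourier f p)"] by simp
  obtain L where L: "0 \<le> L" "\<And>x h. norm (f (x + h) - f x) \<le> L * norm h" using schwartz_lipschitz[OF f] by blast
  obtain B where B: "0 \<le> B" "\<And>x. norm (f x) \<le> B" using schwartz_norm_bound[OF f] by blast
  obtain C where C: "0 < C" "\<And>x::real^'n. jap x * norm (gauss (1 *\<^sub>R x)) \<le> C * wt x"
    using gauss_wt_bound[of 1] by auto
  have C1: "norm (gauss x) \<le> C * wt x" for x :: "real^'n"
    using C(2)[of x] mult_right_mono[OF jap_ge_1[of x], of "norm (gauss x)"] by simp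
  have cf: "continuous_on UNIV (fourier f)" by (rule continuous_on_fourier[OF f])
  have fi: "fourier f integrable_on UNIV" by (rule integrable_wt_bound[OF cf K1])
  have gle: "norm (gauss x) \<le> 1" for x :: "real^'n" by (simp add: norm_gauss)
  have 1: "norm (A e - integral UNIV (fourier f)) \<le> (pi * e\<^sup>2 * K) * wt_total TYPE(real^'n)" if "0 < e" for e
  proof -
    have c: "continuous_on UNIV (\<lambda>p. gauss (e *\<^sub>R p) *\<^sub>C fourier f p)" by (intro continuous_intros cf)
    have "norm (gauss (e *\<^sub>R p) *\<^sub>C fourier f p) \<le> K * wt p" for p
      using mult_right_mono[OF gle[of "e *\<^sub>R p"], of "norm (fourier f p)"] K1[of p] by (simp add: norm_scaleC)
    then have i: "(\<lambda>p. gauss (e *\<^sub>R p) *\<^sub>C fourier f p) integrable_on UNIV" by (rule integrable_wt_bound[OF c])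
    have b: "norm (gauss (e *\<^sub>R p) *\<^sub>C fourier f p - fourier f p) \<le> (pi * e\<^sup>2 * K) * wt p" for p
    proof -
      let ?u = "pi * e\<^sup>2 * (norm p)\<^sup>2"
      have "gauss (e *\<^sub>R p) = complex_of_real (exp (- ?u))"
        using that by (simp add: gauss_def power_mult_distrib mult_ac)
      then have "norm (gauss (e *\<^sub>R p) - 1) = \<bar>exp (- ?u) - 1\<bar>"
        by (metis norm_of_real of_real_1 of_real_diff)
      also have "\<dots> = 1 - exp (- ?u)" by simp
      also have "\<dots> \<le> ?u" using exp_ge_add_one_self[of "- ?u"] by linarith
      also have "\<dots> \<le> pi * e\<^sup>2 * jap p" by (simp add: jap_def mult_left_mono)
      finally have "norm (gauss (e *\<^sub>R p) - 1) * norm (fourier f p) \<le> (pi * e\<^sup>2 * jap p) * norm (fourier f p)"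
        by (rule mult_right_mono) simp
      also have "\<dots> = pi * e\<^sup>2 * (jap p * norm (fourier f p))" by simp
      also have "\<dots> \<le> pi * e\<^sup>2 * (K * wt p)" using K'[of p] by (intro mult_left_mono) simp_all
      finally have "norm ((gauss (e *\<^sub>R p) - 1) *\<^sub>C fourier f p) \<le> (pi * e\<^sup>2 * K) * wt p"
        by (simp add: norm_scaleC)
      moreover have "(gauss (e *\<^sub>R p) - 1) *\<^sub>C fourier f p = gauss (e *\<^sub>R p) *\<^sub>C fourier f p - fourier f p"
        using scaleC_add_left[of "gauss (e *\<^sub>R p)" "- 1" "fourier f p"] by (simp add: scaleC_minus_left)
      ultimately show ?thesis by simp
    qed
    have "A e - integral UNIV (fourier f) = integral UNIV (\<lambda>p. gauss (e *\<^sub>R p) *\<^sub>C fourier f p - fourier f p)"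
      unfolding A_def by (rule Henstock_Kurzweil_Integration.integral_diff[OF i fi, symmetric])
    then show ?thesis using norm_integral_wt_bound[OF _ b] c cf by (simp add: continuous_on_diff)
  qed
  have 2: "norm (A e - f 0) \<le> (e * L * C) * wt_total TYPE(real^'n)" if "0 < e" for e
  proof -
    have cfe: "continuous_on UNIV (\<lambda>z. f (e *\<^sub>R z))"
      by (rule continuous_on_compose2[OF schwartz_continuous[OF f, of UNIV]]) (auto intro!: continuous_intros)
    have c: "continuous_on UNIV (\<lambda>z. gauss z *\<^sub>C f (e *\<^sub>R z))" by (intro continuous_intros cfe)
    have "norm (gauss z *\<^sub>C f (e *\<^sub>R z)) \<le> (C * B) * wt z" for z
      using mult_mono[OF C1[of z] B(2)[of "e *\<^sub>R z"]] C(1) wt_nonneg[of z] by (simp add: norm_scaleC mult_ac)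
    then have i: "(\<lambda>z. gauss z *\<^sub>C f (e *\<^sub>R z)) integrable_on UNIV" by (rule integrable_wt_bound[OF c])
    have i0: "((\<lambda>z::real^'n. gauss z *\<^sub>C f 0) has_integral f 0) UNIV"
      using has_integral_linear[OF gauss_fourier[of "0::real^'n"] bounded_linear_scaleC_left[of "f 0"]]
      by (simp add: o_def gauss_def)
    have b: "norm (gauss z *\<^sub>C f (e *\<^sub>R z) - gauss z *\<^sub>C f 0) \<le> (e * L * C) * wt z" for z
    proof -
      have "norm (f (e *\<^sub>R z) - f 0) \<le> L * norm (e *\<^sub>R z)" using L(2)[of 0 "e *\<^sub>R z"] by simp
      also have "\<dots> \<le> L * (e * jap z)" using that L(1) norm_le_jap[of z] by (simp add: mult_left_mono)
      finally have "norm (gauss z) * norm (f (e *\<^sub>R z) - f 0) \<le> norm (gauss z) * (L * (e * jap z))"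
        by (rule mult_left_mono) simp
      also have "\<dots> = (e * L) * (jap z * norm (gauss z))" by simp
      also have "\<dots> \<le> (e * L) * (C * wt z)" using C(2)[of z] that L(1) by (intro mult_left_mono) simp_all
      finally show ?thesis by (simp add: norm_scaleC flip: scaleC_diff_right)
    qed
    have "A e - f 0 = integral UNIV (\<lambda>z. gauss z *\<^sub>C f (e *\<^sub>R z) - gauss z *\<^sub>C f 0)"
      unfolding A_def gauss_regularised_inversion[OF f that]
      using Henstock_Kurzweil_Integration.integral_diff[OF i] i0 integral_unique[OF i0]
      by (auto simp: integrable_on_def)
    then show ?thesis using norm_integral_wt_bound[OF _ b] c
      by (simp add: continuous_on_diff continuous_on_gauss continuous_intros)
  qed
  define e where "e = (\<lambda>n. inverse (real (Suc n)))"
  have e: "0 < e n" for n by (simp add: e_def)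
  have elim: "e \<longlonglongrightarrow> 0" unfolding e_def by (rule LIMSEQ_inverse_real_of_nat)
  have "(\<lambda>n. A (e n) - integral UNIV (fourier f)) \<longlonglongrightarrow> 0"
  proof (rule Lim_null_comparison)
    show "\<forall>\<^sub>F n in sequentially. norm (A (e n) - integral UNIV (fourier f)) \<le> (pi * (e n)\<^sup>2 * K) * wt_total TYPE(real^'n)"
      by (intro always_eventually allI 1 e)
    have "(\<lambda>n. (pi * (e n)\<^sup>2 * K) * wt_total TYPE(real^'n)) \<longlonglongrightarrow> (pi * 0\<^sup>2 * K) * wt_total TYPE(real^'n)"
      by (intro tendsto_intros elim)
    then show "(\<lambda>n. (pi * (e n)\<^sup>2 * K) * wt_total TYPE(real^'n)) \<longlonglongrightarrow> 0" by simp
  qed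
  moreover have "(\<lambda>n. A (e n) - f 0) \<longlonglongrightarrow> 0"
  proof (rule Lim_null_comparison)
    show "\<forall>\<^sub>F n in sequentially. norm (A (e n) - f 0) \<le> (e n * L * C) * wt_total TYPE(real^'n)"
      by (intro always_eventually allI 2 e)
    have "(\<lambda>n. (e n * L * C) * wt_total TYPE(real^'n)) \<longlonglongrightarrow> (0 * L * C) * wt_total TYPE(real^'n)"
      by (intro tendsto_intros elim)
    then show "(\<lambda>n. (e n * L * C) * wt_total TYPE(real^'n)) \<longlonglongrightarrow> 0" by simp
  qed
  ultimately have "(\<lambda>n. (A (e n) - integral UNIV (fourier f)) - (A (e n) - f 0)) \<longlonglongrightarrow> 0 - 0"
    by (rule tendsto_diff)
  then have "(\<lambda>n::nat. f 0 - integral UNIV (fourier f)) \<longlonglongrightarrow> 0" by simp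
  then show ?thesis by (simp add: LIMSEQ_const_iff)
qed

lemma fourier_translate:
  fixes f :: "real^'n::finite \<Rightarrow> 'c::unital_cstar_algebra"
  assumes f: "f \<in> schwartz"
  shows "fourier (\<lambda>y. f (y + a)) p = ec (p \<bullet> a) *\<^sub>C fourier f p"
proof -
  define h where "h = (\<lambda>y. ec (p \<bullet> a) *\<^sub>C ec (- (p \<bullet> y)) *\<^sub>C f y)"
  have "ec (- (p \<bullet> y)) *\<^sub>C f (y + a) = h (y + a)" for y
    by (simp add: h_def scaleC_scaleC inner_add_right flip: ec_add)
  then have "fourier (\<lambda>y. f (y + a)) p = integral UNIV h"
    unfolding fourier_def by (simp add: integral_shift_UNIV)
  then show ?thesis
    using integral_bounded_linear[OF bounded_linear_scaleC_right schwartz_integrable[OF schwartz_ec_minus[OF f]]]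
    by (simp add: fourier_def h_def)
qed

text \<open>Translating \<open>f\<close> multiplies its transform by a character, so the value at 0
  suffices.\<close>

theorem fourier_inversion:
  fixes f :: "real^'n::finite \<Rightarrow> 'c::unital_cstar_algebra"
  assumes f: "f \<in> schwartz"
  shows "integral UNIV (\<lambda>p. ec (p \<bullet> x) *\<^sub>C fourier f p) = f x"
proof -
  have "fourier (\<lambda>y. f (y + x)) = (\<lambda>p. ec (p \<bullet> x) *\<^sub>C fourier f p)"
    by (rule ext) (rule fourier_translate[OF f])
  then show ?thesis using integral_fourier[OF schwartz_translate(1)[OF f, of x]] by simp
qed

section \<open>The Hilbert module norm\<close>

lemma integral_mult_left':
  fixes f :: "'a::euclidean_space \<Rightarrow> 'c::unital_cstar_algebra"
  assumes "f integrable_on UNIV"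
  shows "integral UNIV (\<lambda>x. a * f x) = a * integral UNIV f"
    and "integral UNIV (\<lambda>x. f x * a) = integral UNIV f * a"
    and "integral UNIV (\<lambda>x. c *\<^sub>C f x) = c *\<^sub>C integral UNIV f"
  by (rule integral_bounded_linear[OF bounded_linear_mult_right assms]
      integral_bounded_linear[OF bounded_linear_mult_left assms]
      integral_bounded_linear[OF bounded_linear_scaleC_right assms])+

lemma dec_imp:
  assumes "dec f"
  obtains K where "0 \<le> K" "\<And>x. norm (f x) \<le> K * wt x"
proof -
  obtain K where K: "\<And>x. norm (f x) \<le> K * wt x" using assms unfolding dec_def by blast
  have "0 \<le> K * wt (undefined :: 'a)" by (rule order_trans[OF norm_ge_zero K])
  then have "0 \<le> K" using wt_pos[of "undefined :: 'a"] by (simp add: zero_le_mult_iff)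
  then show thesis using K that by blast
qed

lemma dec_cstar_mult:
  fixes f g :: "'a::euclidean_space \<Rightarrow> 'c::unital_cstar_algebra"
  assumes "dec f" "dec g"
  shows "dec (\<lambda>x. cstar (f x) * g x)"
proof -
  obtain K where K: "0 \<le> K" "\<And>x. norm (f x) \<le> K * wt x" using dec_imp[OF assms(1)] by blast
  obtain L where L: "0 \<le> L" "\<And>x. norm (g x) \<le> L * wt x" using dec_imp[OF assms(2)] by blast
  show ?thesis
  proof (rule decI)
    show "continuous_on UNIV (\<lambda>x. cstar (f x) * g x)"
      using assms unfolding dec_def by (intro continuous_intros) simp_all
    fix x
    have "norm (cstar (f x) * g x) \<le> norm (f x) * norm (g x)"
      using norm_mult_ineq[of "cstar (f x)" "g x"] by simp
    also have "\<dots> \<le> (K * 1) * (L * wt x)"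
    proof (rule mult_mono)
      show "norm (f x) \<le> K * 1" using K(2)[of x] mult_left_mono[OF wt_le_1[of x] K(1)] by simp
    qed (use K L in simp_all)
    finally show "norm (cstar (f x) * g x) \<le> (K * L) * wt x" by (simp add: mult.assoc)
  qed
qed

lemma dec_mult_const:
  fixes f :: "'a::euclidean_space \<Rightarrow> 'c::unital_cstar_algebra"
  assumes "dec f"
  shows "dec (\<lambda>x. f x * c)" "dec (\<lambda>x. c * f x)"
proof -
  obtain K where K: "0 \<le> K" "\<And>x. norm (f x) \<le> K * wt x" using dec_imp[OF assms(1)] by blast
  have c: "continuous_on UNIV f" using assms by (simp add: dec_def)
  have b: "norm (f x) * norm c \<le> (K * norm c) * wt x" for x
    using mult_right_mono[OF K(2)[of x] norm_ge_zero[of c]] by (simp add: mult_ac)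
  show "dec (\<lambda>x. f x * c)"
    by (rule decI[where K = "K * norm c"]) (intro continuous_intros c, rule order_trans[OF norm_mult_ineq b])
  have b': "norm c * norm (f x) \<le> (K * norm c) * wt x" for x using b[of x] by (simp add: mult.commute)
  show "dec (\<lambda>x. c * f x)"
    by (rule decI[where K = "K * norm c"]) (intro continuous_intros c, rule order_trans[OF norm_mult_ineq b'])
qed

lemma dec_minus: "dec f \<Longrightarrow> dec (\<lambda>x. - f x)"
  unfolding dec_def by (auto intro: continuous_intros)

lemma dec_diff: "dec f \<Longrightarrow> dec g \<Longrightarrow> dec (\<lambda>x. f x - g x)"
  using dec_add[of f "\<lambda>x. - g x"] dec_minus[of g] by simp

lemma
  fixes f g h :: "real^'n::finite \<Rightarrow> 'c::unital_cstar_algebra"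
  assumes "dec f" "dec g" "dec h"
  shows inner_add_right': "schwartz_inner f (\<lambda>x. g x + h x) = schwartz_inner f g + schwartz_inner f h"
    and inner_diff_right': "schwartz_inner f (\<lambda>x. g x - h x) = schwartz_inner f g - schwartz_inner f h"
    and inner_add_left': "schwartz_inner (\<lambda>x. f x + g x) h = schwartz_inner f h + schwartz_inner g h"
    and inner_diff_left': "schwartz_inner (\<lambda>x. f x - g x) h = schwartz_inner f h - schwartz_inner g h"
  unfolding schwartz_inner_def cstar_add cstar_diff distrib_left right_diff_distrib distrib_right left_diff_distrib
  by (rule Henstock_Kurzweil_Integration.integral_add Henstock_Kurzweil_Integration.integral_diff;
      intro dec_integrable dec_cstar_mult assms)+

lemma
  fixes f g :: "real^'n::finite \<Rightarrow> 'c::unital_cstar_algebra"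
  assumes "dec f" "dec g"
  shows inner_mult_right: "schwartz_inner f (\<lambda>x. g x * c) = schwartz_inner f g * c"
    and inner_mult_left: "schwartz_inner (\<lambda>x. f x * c) g = cstar c * schwartz_inner f g"
    and cstar_inner: "cstar (schwartz_inner f g) = schwartz_inner g f"
proof -
  have i: "(\<lambda>x. cstar (f x) * g x) integrable_on UNIV" by (intro dec_integrable dec_cstar_mult assms)
  show "schwartz_inner f (\<lambda>x. g x * c) = schwartz_inner f g * c"
    using integral_mult_left'(2)[OF i, of c] by (simp add: schwartz_inner_def mult.assoc)
  show "schwartz_inner (\<lambda>x. f x * c) g = cstar c * schwartz_inner f g"
    using integral_mult_left'(1)[OF i, of "cstar c"] by (simp add: schwartz_inner_def mult.assoc cstar_mult)
  show "cstar (schwartz_inner f g) = schwartz_inner g f"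
    using integral_bounded_linear[OF bounded_linear_cstar i]
    by (simp add: schwartz_inner_def cstar_mult cstar_cstar)
qed

lemma pos_inner: "dec f \<Longrightarrow> pos (schwartz_inner f f)"
  unfolding schwartz_inner_def
  by (rule pos_integral[OF pos_cstar_mult_self dec_integrable[OF dec_cstar_mult]])

lemma norm2_nonneg [simp]: "0 \<le> schwartz_norm2 f"
  by (simp add: schwartz_norm2_def)

lemma norm2_square: "(schwartz_norm2 f)\<^sup>2 = norm (schwartz_inner f f)"
  by (simp add: schwartz_norm2_def)

text \<open>Positivity of \<open>\<langle>g - f W, g - f W\<rangle>\<close> with \<open>W = \<langle>f, g\<rangle> / r\<close>.\<close>

lemma inner_cauchy_schwarz_aux:
  fixes f g :: "real^'n::finite \<Rightarrow> 'c::unital_cstar_algebra"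
  assumes f: "dec f" and g: "dec g" and r: "0 < r" "norm (schwartz_inner f f) \<le> r"
  shows "(norm (schwartz_inner f g))\<^sup>2 \<le> r * norm (schwartz_inner g g)"
proof -
  define X where "X = schwartz_inner f f"
  define Y where "Y = schwartz_inner f g"
  define Z where "Z = schwartz_inner g g"
  define W where "W = (1/r) *\<^sub>R Y"
  define YY where "YY = cstar Y * Y"
  define YXY where "YXY = cstar Y * X * Y"
  have Ys: "schwartz_inner g f = cstar Y" using cstar_inner[OF f g] by (simp add: Y_def)
  have fW: "dec (\<lambda>x. f x * W)" by (rule dec_mult_const[OF f])
  have gfW: "dec (\<lambda>x. g x - f x * W)" by (rule dec_diff[OF g fW])
  have "schwartz_inner (\<lambda>x. g x - f x * W) (\<lambda>x. g x - f x * W) = Z - cstar Y * W - (cstar W * Y - cstar W * (X * W))"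
    unfolding inner_diff_left'[OF g fW gfW] inner_diff_right'[OF g g fW] inner_diff_right'[OF fW g fW]
      inner_mult_right[OF g f] inner_mult_left[OF f g] inner_mult_right[OF fW f] inner_mult_left[OF f f]
      Ys X_def[symmetric] Y_def[symmetric] Z_def[symmetric] mult.assoc ..
  also have "\<dots> = Z - (1/r) *\<^sub>R YY - ((1/r) *\<^sub>R YY - (1/r\<^sup>2) *\<^sub>R YXY)"
    by (simp add: W_def YY_def YXY_def cstar_scaleR mult.assoc power2_eq_square)
  finally have p1: "pos (Z - (1/r) *\<^sub>R YY - ((1/r) *\<^sub>R YY - (1/r\<^sup>2) *\<^sub>R YXY))"
    using pos_inner[OF gfW] by simp
  \<comment> \<open>Conjugating the positive element \<open>r - X\<close> by \<open>Y\<close> gives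
    \<open>YXY \<le> r YY\<close>; added to \<open>p1\<close> this removes the quadratic term
    together with one of the two mixed terms.\<close>
  have "cstar X = X" using pos_inner[OF f] by (simp add: X_def pos_def)
  then have "pos (r *\<^sub>R 1 - X)" using r by (intro pos_scaleR_one_minus) (simp_all add: X_def)
  then have "pos (cstar Y * (r *\<^sub>R 1 - X) * Y)" by (rule pos_conj)
  then have "pos ((1/r\<^sup>2) *\<^sub>R (cstar Y * (r *\<^sub>R 1 - X) * Y))" by (intro pos_scaleR) simp_all
  moreover have "(1/r\<^sup>2) *\<^sub>R (cstar Y * (r *\<^sub>R 1 - X) * Y) = (1/r) *\<^sub>R YY - (1/r\<^sup>2) *\<^sub>R YXY"
    using r by (simp add: YY_def YXY_def left_diff_distrib right_diff_distrib scaleR_right_diff_distrib power2_eq_square)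
  ultimately have "pos ((1/r) *\<^sub>R YY - (1/r\<^sup>2) *\<^sub>R YXY)" by simp
  with p1 have "pos (Z - (1/r) *\<^sub>R YY)" using pos_add by fastforce
  moreover have "pos ((1/r) *\<^sub>R YY)" unfolding YY_def using r by (intro pos_scaleR pos_cstar_mult_self) simp
  ultimately have "norm ((1/r) *\<^sub>R YY) \<le> norm Z" by (intro pos_norm_mono)
  then have "norm YY \<le> r * norm Z" using r by (simp add: field_simps)
  then show ?thesis by (simp add: YY_def cstar_identity Y_def Z_def)
qed

text \<open>The auxiliary estimate needs a strictly positive bound on
  \<open>schwartz_inner f f\<close>, which null vectors do not supply through their norm; a slack
  \<open>d\<close> that tends to 0 covers them.\<close>

theorem inner_cauchy_schwarz:
  fixes f g :: "real^'n::finite \<Rightarrow> 'c::unital_cstar_algebra"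
  assumes f: "dec f" and g: "dec g"
  shows "norm (schwartz_inner f g) \<le> schwartz_norm2 f * schwartz_norm2 g"
proof -
  have "(norm (schwartz_inner f g))\<^sup>2 \<le> (schwartz_norm2 f)\<^sup>2 * (schwartz_norm2 g)\<^sup>2 + e" if "0 < e" for e
  proof -
    \<comment> \<open>Chosen so that the slack contributes at most \<open>e\<close>; the
      \<open>+ 1\<close> keeps the denominator positive.\<close>
    define d where "d = e / (norm (schwartz_inner g g) + 1)"
    have d: "0 < d" using that by (simp add: d_def add_nonneg_pos)
    have "norm (schwartz_inner f f) \<le> norm (schwartz_inner f f) + d" "0 < norm (schwartz_inner f f) + d"
      using d by (simp_all add: add_nonneg_pos)
    from inner_cauchy_schwarz_aux[OF f g this(2,1)]
    have "(norm (schwartz_inner f g))\<^sup>2 \<le> (norm (schwartz_inner f f) + d) * norm (schwartz_inner g g)" .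
    also have "\<dots> \<le> norm (schwartz_inner f f) * norm (schwartz_inner g g) + d * (norm (schwartz_inner g g) + 1)"
      using d by (simp add: algebra_simps)
    also have "d * (norm (schwartz_inner g g) + 1) = e"
    proof -
      have "0 < norm (schwartz_inner g g) + 1" by (rule add_nonneg_pos) simp_all
      then show ?thesis by (simp add: d_def)
    qed
    finally show ?thesis by (simp add: norm2_square)
  qed
  then have "(norm (schwartz_inner f g))\<^sup>2 \<le> (schwartz_norm2 f * schwartz_norm2 g)\<^sup>2"
    unfolding power_mult_distrib by (rule field_le_epsilon)
  then show ?thesis by (rule power2_le_imp_le) simp
qed

lemma norm2_triangle:
  fixes f g :: "real^'n::finite \<Rightarrow> 'c::unital_cstar_algebra"
  assumes f: "dec f" and g: "dec g"
  shows "schwartz_norm2 (\<lambda>x. f x + g x) \<le> schwartz_norm2 f + schwartz_norm2 g"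
proof (rule power2_le_imp_le)
  have fg: "dec (\<lambda>x. f x + g x)" by (rule dec_add[OF f g])
  have "(schwartz_norm2 (\<lambda>x. f x + g x))\<^sup>2 = norm (schwartz_inner f f + schwartz_inner f g + (schwartz_inner g f + schwartz_inner g g))"
    unfolding norm2_square inner_add_left'[OF f g fg] inner_add_right'[OF f f g] inner_add_right'[OF g f g] ..
  also have "\<dots> \<le> schwartz_norm2 f * schwartz_norm2 f + schwartz_norm2 f * schwartz_norm2 g
      + (schwartz_norm2 g * schwartz_norm2 f + schwartz_norm2 g * schwartz_norm2 g)"
    by (intro norm_triangle_mono inner_cauchy_schwarz f g)
  also have "\<dots> = (schwartz_norm2 f + schwartz_norm2 g)\<^sup>2" by (simp add: power2_eq_square algebra_simps)
  finally show "(schwartz_norm2 (\<lambda>x. f x + g x))\<^sup>2 \<le> (schwartz_norm2 f + schwartz_norm2 g)\<^sup>2" .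
qed simp

text \<open>The difference of the squares is the integral of
  \<open>(norm a)\<^sup>2 - cstar a * a\<close> conjugated by \<open>f x\<close>, hence positive,
  and the norm is monotone on the positive cone.\<close>

lemma norm2_mult_left:
  fixes f :: "real^'n::finite \<Rightarrow> 'c::unital_cstar_algebra"
  assumes f: "dec f"
  shows "schwartz_norm2 (\<lambda>x. a * f x) \<le> norm a * schwartz_norm2 f"
proof (rule power2_le_imp_le)
  have af: "dec (\<lambda>x. a * f x)" by (rule dec_mult_const[OF f])
  have i: "(\<lambda>x. cstar (f x) * f x) integrable_on UNIV" "(\<lambda>x. cstar (a * f x) * (a * f x)) integrable_on UNIV"
    by (intro dec_integrable dec_cstar_mult f af)+
  have "(norm a)\<^sup>2 *\<^sub>R schwartz_inner f f - schwartz_inner (\<lambda>x. a * f x) (\<lambda>x. a * f x)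
      = integral UNIV (\<lambda>x. (norm a)\<^sup>2 *\<^sub>R (cstar (f x) * f x) - cstar (a * f x) * (a * f x))"
    unfolding schwartz_inner_def
    using Henstock_Kurzweil_Integration.integral_diff[OF integrable_cmul[OF i(1), of "(norm a)\<^sup>2"] i(2)] by simp
  also have "pos \<dots>"
  proof (rule pos_integral)
    show "(\<lambda>x. (norm a)\<^sup>2 *\<^sub>R (cstar (f x) * f x) - cstar (a * f x) * (a * f x)) integrable_on UNIV"
      by (intro integrable_diff integrable_cmul i)
    fix x
    have "pos (cstar (f x) * ((norm a)\<^sup>2 *\<^sub>R 1 - cstar a * a) * f x)" by (intro pos_conj pos_one_minus_norm)
    then show "pos ((norm a)\<^sup>2 *\<^sub>R (cstar (f x) * f x) - cstar (a * f x) * (a * f x))"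
      by (simp add: cstar_mult right_diff_distrib left_diff_distrib mult.assoc)
  qed
  finally have "norm (schwartz_inner (\<lambda>x. a * f x) (\<lambda>x. a * f x)) \<le> norm ((norm a)\<^sup>2 *\<^sub>R schwartz_inner f f)"
    using pos_inner[OF af] by (intro pos_norm_mono)
  then show "(schwartz_norm2 (\<lambda>x. a * f x))\<^sup>2 \<le> (norm a * schwartz_norm2 f)\<^sup>2"
    by (simp add: norm2_square power_mult_distrib)
qed simp

lemma mult_cnj_scaleC: "c *\<^sub>C cnj c *\<^sub>C x = (cmod c)\<^sup>2 *\<^sub>R x"
  for x :: "'c::unital_cstar_algebra"
  by (simp only: scaleC_scaleC complex_norm_square[symmetric] scaleC_of_real)

lemma norm2_scaleC: "schwartz_norm2 (\<lambda>x. c *\<^sub>C f x) = cmod c * schwartz_norm2 f"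
proof -
  have "schwartz_inner (\<lambda>x. c *\<^sub>C f x) (\<lambda>x. c *\<^sub>C f x) = (cmod c)\<^sup>2 *\<^sub>R schwartz_inner f f"
    unfolding schwartz_inner_def cstar_scaleC mult_scaleC_left mult_scaleC_right mult_cnj_scaleC by simp
  then show ?thesis by (simp add: schwartz_norm2_def real_sqrt_mult)
qed

lemma norm2_modulate: "schwartz_norm2 (\<lambda>x. ec (u x) *\<^sub>C f x) = schwartz_norm2 f"
  unfolding schwartz_norm2_def schwartz_inner_def cstar_scaleC mult_scaleC_left mult_scaleC_right
    mult_cnj_scaleC by simp

lemma norm2_translate: "schwartz_norm2 (\<lambda>x. f (x + a)) = schwartz_norm2 f"
  unfolding schwartz_norm2_def schwartz_inner_def
  using integral_shift_UNIV[of "\<lambda>x. cstar (f x) * f x" a] by simp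

lemma norm2_minus: "schwartz_norm2 (\<lambda>x. - f x) = schwartz_norm2 f"
  by (simp add: schwartz_norm2_def schwartz_inner_def cstar_minus)

section \<open>Rieffel's deformed product\<close>

lemma dec_iterated_integral:
  fixes F :: "'a::euclidean_space \<Rightarrow> 'b::euclidean_space \<Rightarrow> 'c::banach"
  assumes c: "continuous_on UNIV (\<lambda>(x, y). F x y)" and K: "0 \<le> K"
    and b: "\<And>x y. norm (F x y) \<le> K * wt x * wt y"
  shows "dec (\<lambda>x. integral UNIV (F x))"
proof (rule decI)
  have b': "norm (F x y) \<le> K * wt y" for x y
    using b[of x y] mult_right_mono[OF mult_left_mono[OF wt_le_1[of x] K] wt_nonneg[of y]] by simp
  show "continuous_on UNIV (\<lambda>x. integral UNIV (F x))" by (rule continuous_on_integral_param[OF c b'])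
  show "norm (integral UNIV (F x)) \<le> (K * wt_total TYPE('b)) * wt x" for x
    using norm_integral_wt_bound[OF continuous_on_slice(1)[OF c] b, of x] by (simp add: mult_ac)
qed

lemma schwartz_cont:
  assumes "f \<in> schwartz" "continuous_on A h"
  shows "continuous_on A (\<lambda>z. f (h z))"
  by (rule continuous_on_compose2[OF schwartz_continuous[OF assms(1), of UNIV] assms(2)]) simp

lemma fourier_cont:
  assumes "f \<in> schwartz" "continuous_on A h"
  shows "continuous_on A (\<lambda>z. fourier f (h z))"
  by (rule continuous_on_compose2[OF continuous_on_fourier[OF assms(1)] assms(2)]) simp

text \<open>Serves to differentiate under an integral and under a series: the quadratic Taylor
  remainders are integrated or summed, with no separate interchange of limits.\<close>

lemma has_derivative_quadratic:
  fixes F :: "'a::real_normed_vector \<Rightarrow> 'b::real_normed_vector"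
  assumes "bounded_linear D" "\<And>h. norm (F (x + h) - F x - D h) \<le> C * (norm h)\<^sup>2"
  shows "(F has_derivative D) (at x)"
  unfolding has_derivative_at
proof
  show "(\<lambda>h. norm (F (x + h) - F x - D h) / norm h) \<midarrow>0\<rightarrow> 0"
  proof (rule Lim_null_comparison)
    show "\<forall>\<^sub>F h in at 0. norm (norm (F (x + h) - F x - D h) / norm h) \<le> C * norm h"
    proof (rule always_eventually, rule allI)
      fix h
      show "norm (norm (F (x + h) - F x - D h) / norm h) \<le> C * norm h"
        using assms(2)[of h] by (cases "h = 0") (simp_all add: divide_simps power2_eq_square mult_ac)
    qed
    have "((\<lambda>h::'a. C * norm h) \<longlongrightarrow> C * norm (0::'a)) (at 0)" by (intro tendsto_intros)
    then show "((\<lambda>h::'a. C * norm h) \<longlongrightarrow> 0) (at 0)" by simp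
  qed
qed (rule assms(1))

locale skew_form =
  fixes J :: "real^'n::finite \<Rightarrow> real^'n"
  assumes linear_J: "linear J"
    and skew_J: "\<And>x y. J x \<bullet> y = - (x \<bullet> J y)"
begin

lemma J_self [simp]: "p \<bullet> J p = 0"
  using skew_J[of p p] by (simp add: inner_commute)

lemma J_add: "J (x + y) = J x + J y" by (rule linear_add[OF linear_J])
lemma J_minus: "J (- x) = - J x" by (rule linear_neg[OF linear_J])

lemma J_cont: "continuous_on A h \<Longrightarrow> continuous_on A (\<lambda>z. J (h z))"
  using continuous_on_compose2[OF linear_continuous_on[OF linear_J[unfolded linear_conv_bounded_linear], of UNIV]]
  by auto

lemma jap_J_bound: obtains C where "1 \<le> C" "\<And>p. jap (J p) \<le> C * jap p"
proof -
  obtain B where B: "\<And>x. norm (J x) \<le> norm x * B"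
    using bounded_linear.bounded[OF linear_J[unfolded linear_conv_bounded_linear]] by blast
  show thesis
  proof
    show "1 \<le> 1 + B\<^sup>2" by simp
    fix p
    have "(norm (J p))\<^sup>2 \<le> (norm p * B)\<^sup>2" by (rule power_mono[OF B]) simp
    then have "(norm (J p))\<^sup>2 \<le> B\<^sup>2 * (norm p)\<^sup>2" by (simp add: power_mult_distrib mult.commute)
    moreover have "(1 + B\<^sup>2) * jap p = 1 + (norm p)\<^sup>2 + B\<^sup>2 + B\<^sup>2 * (norm p)\<^sup>2"
      by (simp add: jap_def algebra_simps)
    ultimately show "jap (J p) \<le> (1 + B\<^sup>2) * jap p"
      using zero_le_power2[of B] zero_le_power2[of "norm p"] unfolding jap_def by linarith
  qed
qed

text \<open>Peetre's inequality for the two translations that occur: by \<open>J p\<close> inside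
  the product, by \<open>p\<close> in the twisted convolution \<open>fourier_rp\<close>.\<close>

lemma translate_bound:
  obtains D where "0 \<le> D" "\<And>p x. wt (x + J p) \<le> D * jap p ^ DIM(real^'n) * wt x"
    "\<And>p x::real^'n. wt (x - p) \<le> D * jap p ^ DIM(real^'n) * wt x"
proof -
  obtain C where C: "1 \<le> C" "\<And>p. jap (J p) \<le> C * jap p" by (rule jap_J_bound) blast
  show thesis
  proof
    show "0 \<le> (2 * C) ^ DIM(real^'n)" using C(1) by simp
    fix p x :: "real^'n"
    have "(2 * jap (J p)) ^ DIM(real^'n) \<le> (2 * C * jap p) ^ DIM(real^'n)"
      using C(2)[of p] jap_pos[of "J p"] by (intro power_mono) simp_all
    from order_trans[OF wt_add_le mult_right_mono[OF this wt_nonneg[of x]]]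
    show "wt (x + J p) \<le> (2 * C) ^ DIM(real^'n) * jap p ^ DIM(real^'n) * wt x"
      by (simp only: power_mult_distrib)
    have "(2 * jap (- p)) ^ DIM(real^'n) \<le> (2 * C * jap p) ^ DIM(real^'n)"
      using C(1) jap_pos[of p] by (intro power_mono) (simp_all add: jap_minus)
    from order_trans[OF wt_add_le mult_right_mono[OF this wt_nonneg[of x]]]
    show "wt (x - p) \<le> (2 * C) ^ DIM(real^'n) * jap p ^ DIM(real^'n) * wt x"
      by (simp only: power_mult_distrib add_uminus_conv_diff)
  qed
qed

text \<open>Twice the decay needed for integrability: one half compensates the factor from Peetre's
  inequality, the other keeps the integral over \<open>p\<close> convergent.\<close>

lemma fourier_double_decay:
  fixes f :: "real^'n \<Rightarrow> 'c::unital_cstar_algebra"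
  assumes "f \<in> schwartz"
  obtains K where "0 \<le> K" "\<And>p. norm (fourier f p) * jap p ^ DIM(real^'n) \<le> K * wt p"
proof -
  obtain K where K: "0 \<le> K" "\<And>p. norm (fourier f p) \<le> K * inverse (jap p ^ (DIM(real^'n) + DIM(real^'n)))"
    using fourier_decay[OF assms] by blast
  show thesis
  proof (rule that[OF K(1)])
    fix p :: "real^'n"
    have "0 < jap p ^ DIM(real^'n)" using jap_pos[of p] by simp
    then show "norm (fourier f p) * jap p ^ DIM(real^'n) \<le> K * wt p"
      using K(2)[of p] by (simp add: wt_def power_add field_simps)
  qed
qed

text \<open>\<open>kern f g p\<close> is the contribution of the plane wave \<open>fourier f p\<close> to the product.\<close>

definition kern :: "(real^'n \<Rightarrow> 'c::unital_cstar_algebra) \<Rightarrow> (real^'n \<Rightarrow> 'c) \<Rightarrow> real^'n \<Rightarrow> real^'n \<Rightarrow> 'c" where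
  "kern f g p x = ec (p \<bullet> x) *\<^sub>C (fourier f p * g (x + J p))"

abbreviation rp :: "(real^'n \<Rightarrow> 'c::unital_cstar_algebra) \<Rightarrow> (real^'n \<Rightarrow> 'c) \<Rightarrow> real^'n \<Rightarrow> 'c"
  (infixl "\<odot>" 70) where "f \<odot> g \<equiv> rieffel_prod J f g"

context
  fixes f g :: "real^'n \<Rightarrow> 'c::unital_cstar_algebra"
  assumes f: "f \<in> schwartz" and g: "g \<in> schwartz"
begin

text \<open>The inner integral is, up to a phase, a Fourier transform of \<open>g\<close>. In this
  form \<open>f\<close> enters through its values only, which suits coordinate multiples of
  \<open>f\<close> and sup-norm bounds in \<open>f\<close>.\<close>

lemma rieffel_prod_frequency:
  "(f \<odot> g) x = integral UNIV (\<lambda>u. f (x + J u) * (ec (- (u \<bullet> x)) *\<^sub>C fourier g (- u)))"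
proof -
  have "integral UNIV (\<lambda>v. ec (u \<bullet> v) *\<^sub>C (f (x + J u) * g (x + v)))
      = f (x + J u) * (ec (- (u \<bullet> x)) *\<^sub>C fourier g (- u))" for u
  proof -
    define k where "k = (\<lambda>y. ec (- ((- u) \<bullet> y)) *\<^sub>C g y)"
    define h where "h = (\<lambda>y. f (x + J u) * (ec (- (u \<bullet> x)) *\<^sub>C k y))"
    have k: "k \<in> schwartz" unfolding k_def by (rule schwartz_ec_minus[OF g])
    have "ec (u \<bullet> v) *\<^sub>C (f (x + J u) * g (x + v)) = h (v + x)" for v
    proof -
      have "ec (u \<bullet> v) = ec (- (u \<bullet> x)) * ec (- ((- u) \<bullet> (v + x)))"
        by (simp add: inner_add_right flip: ec_add)
      then show ?thesis by (simp add: h_def k_def mult_scaleC_right scaleC_scaleC add.commute)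
    qed
    then have "integral UNIV (\<lambda>v. ec (u \<bullet> v) *\<^sub>C (f (x + J u) * g (x + v))) = integral UNIV h"
      by (simp add: integral_shift_UNIV)
    also have "\<dots> = f (x + J u) * (ec (- (u \<bullet> x)) *\<^sub>C fourier g (- u))"
      unfolding h_def fourier_def k_def[symmetric]
        integral_mult_left'(1)[OF schwartz_integrable[OF schwartz_scaleC[OF k]]]
        integral_mult_left'(3)[OF schwartz_integrable[OF k]] ..
    finally show ?thesis .
  qed
  then show ?thesis unfolding rieffel_prod_def exp_eq_ec by simp
qed

lemma norm_kern_le: "norm (kern f g p x) \<le> norm (fourier f p) * norm (g (x + J p))"
  by (simp add: kern_def norm_mult_ineq)

lemma kern_bound: obtains K where "0 \<le> K" "\<And>p x. norm (kern f g p x) \<le> K * wt p"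
proof -
  obtain K where K: "0 \<le> K" "\<And>p. norm (fourier f p) \<le> K * wt p" using fourier_wt_bound[OF f] by blast
  obtain B where B: "0 \<le> B" "\<And>x. norm (g x) \<le> B" using schwartz_norm_bound[OF g] by blast
  show thesis
  proof
    show "0 \<le> K * B" using K(1) B(1) by (rule mult_nonneg_nonneg)
    fix p x
    have "norm (fourier f p) * norm (g (x + J p)) \<le> (K * wt p) * B"
      using K B wt_nonneg[of p] by (intro mult_mono) simp_all
    then show "norm (kern f g p x) \<le> (K * B) * wt p" using norm_kern_le[of p x] by (simp add: mult_ac)
  qed
qed

text \<open>Decay in \<open>x\<close> and \<open>p\<close> at once, as the interchange of integrals
  in \<open>fourier_rp\<close> requires.\<close>

lemma kern_bound2: obtains K where "0 \<le> K" "\<And>p x. norm (kern f g p x) \<le> K * wt x * wt p"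
proof -
  obtain K where K: "0 \<le> K" "\<And>p. norm (fourier f p) * jap p ^ DIM(real^'n) \<le> K * wt p"
    using fourier_double_decay[OF f] by blast
  obtain B where B: "0 \<le> B" "\<And>x. norm (g x) \<le> B * wt x" using schwartz_wt_bound[OF g] by blast
  obtain D where D: "0 \<le> D" "\<And>p x. wt (x + J p) \<le> D * jap p ^ DIM(real^'n) * wt x"
    using translate_bound by metis
  show thesis
  proof
    show "0 \<le> B * D * K" using K(1) B(1) D(1) by (intro mult_nonneg_nonneg)
    fix p x
    have "norm (g (x + J p)) \<le> B * (D * jap p ^ DIM(real^'n) * wt x)"
      using B(2)[of "x + J p"] mult_left_mono[OF D(2)[of x p] B(1)] by linarith
    then have "norm (fourier f p) * norm (g (x + J p)) \<le> norm (fourier f p) * (B * (D * jap p ^ DIM(real^'n) * wt x))"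
      by (rule mult_left_mono) simp
    also have "\<dots> = (B * D * wt x) * (norm (fourier f p) * jap p ^ DIM(real^'n))" by simp
    also have "\<dots> \<le> (B * D * wt x) * (K * wt p)"
      using K(2)[of p] B(1) D(1) wt_nonneg[of x] by (intro mult_left_mono) simp_all
    finally show "norm (kern f g p x) \<le> (B * D * K) * wt x * wt p"
      using norm_kern_le[of p x] by (simp add: mult_ac)
  qed
qed

lemma continuous_on_kern: "continuous_on UNIV (\<lambda>(x, p). kern f g p x)"
  unfolding kern_def case_prod_unfold
  by (intro continuous_intros fourier_cont[OF f] schwartz_cont[OF g] J_cont)

lemma kern_integrable: "(\<lambda>p. kern f g p x) integrable_on UNIV"
proof -
  obtain K where K: "\<And>p x. norm (kern f g p x) \<le> K * wt p" by (rule kern_bound) blast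
  show ?thesis by (rule integrable_wt_bound[OF continuous_on_slice(1)[OF continuous_on_kern] K])
qed

text \<open>Expand \<open>f (x + J u)\<close> by Fourier inversion, interchange the integrals, and
  undo the transform of \<open>g\<close> by inversion again; \<open>J\<close> thereby passes from
  \<open>u\<close> to \<open>p\<close>.\<close>

lemma rieffel_prod_kern: "(f \<odot> g) x = integral UNIV (\<lambda>p. kern f g p x)"
proof -
  let ?F = "\<lambda>u p. ec (p \<bullet> (x + J u) - u \<bullet> x) *\<^sub>C (fourier f p * fourier g (- u))"
  obtain K where K: "0 \<le> K" "\<And>p. norm (fourier f p) \<le> K * wt p" using fourier_wt_bound[OF f] by blast
  obtain L where L: "0 \<le> L" "\<And>p. norm (fourier g p) \<le> L * wt p" using fourier_wt_bound[OF g] by blast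
  have fi: "(\<lambda>p. ec (p \<bullet> y) *\<^sub>C fourier f p) integrable_on UNIV" for y
    by (rule integrable_wt_bound[of _ K]) (intro continuous_intros fourier_cont[OF f], simp add: K)
  have gi: "(\<lambda>p. ec (p \<bullet> y) *\<^sub>C fourier g p) integrable_on UNIV" for y
    by (rule integrable_wt_bound[of _ L]) (intro continuous_intros fourier_cont[OF g], simp add: L)
  have c: "continuous_on UNIV (\<lambda>(u, p). ?F u p)"
    unfolding case_prod_unfold
    by (intro continuous_intros fourier_cont[OF f] fourier_cont[OF g] J_cont)
  have b: "norm (?F u p) \<le> (L * K) * wt u * wt p" for u p
  proof -
    have "norm (fourier f p * fourier g (- u)) \<le> norm (fourier f p) * norm (fourier g (- u))"
      by (rule norm_mult_ineq)
    also have "\<dots> \<le> (K * wt p) * (L * wt (- u))"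
      using K L wt_nonneg[of p] by (intro mult_mono) simp_all
    finally show ?thesis by (simp add: wt_minus mult_ac)
  qed
  have "f (x + J u) * (ec (- (u \<bullet> x)) *\<^sub>C fourier g (- u)) = integral UNIV (\<lambda>p. ?F u p)" for u
  proof -
    have "integral UNIV (\<lambda>p. ?F u p)
        = integral UNIV (\<lambda>p. (ec (p \<bullet> (x + J u)) *\<^sub>C fourier f p) * (ec (- (u \<bullet> x)) *\<^sub>C fourier g (- u)))"
      by (simp add: mult_scaleC_left mult_scaleC_right scaleC_scaleC flip: ec_add)
    also have "\<dots> = f (x + J u) * (ec (- (u \<bullet> x)) *\<^sub>C fourier g (- u))"
      unfolding integral_mult_left'(2)[OF fi] fourier_inversion[OF f] ..
    finally show ?thesis ..
  qed
  then have "(f \<odot> g) x = integral UNIV (\<lambda>u. integral UNIV (\<lambda>p. ?F u p))"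
    unfolding rieffel_prod_frequency by simp
  also have "\<dots> = integral UNIV (\<lambda>p. integral UNIV (\<lambda>u. ?F u p))" by (rule integral_swap_UNIV[OF c b])
  also have "\<dots> = integral UNIV (\<lambda>p. kern f g p x)"
  proof (rule arg_cong[where f = "integral UNIV"], rule ext)
    fix p
    \<comment> \<open>Skew-symmetry turns \<open>- (p \<bullet> J u)\<close> into
      \<open>u \<bullet> J p\<close>; \<open>u\<close> is reflected to match the frequency
      \<open>- u\<close> in \<open>fourier g\<close>.\<close>
    have phase: "?F (- u) p = ec (p \<bullet> x) *\<^sub>C (fourier f p * (ec (u \<bullet> (x + J p)) *\<^sub>C fourier g u))" for u
    proof -
      have "p \<bullet> (x + J (- u)) - (- u) \<bullet> x = p \<bullet> x + u \<bullet> (x + J p)"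
        using skew_J[of p u] by (simp add: J_minus inner_add_right inner_diff_right inner_commute)
      then show ?thesis by (simp add: ec_add mult_scaleC_right scaleC_scaleC)
    qed
    have "integral UNIV (\<lambda>u. ?F u p) = integral UNIV (\<lambda>u. ?F (- u) p)"
      by (rule integral_reflect_UNIV[symmetric])
    also have "\<dots> = integral UNIV (\<lambda>u. ec (p \<bullet> x) *\<^sub>C (fourier f p * (ec (u \<bullet> (x + J p)) *\<^sub>C fourier g u)))"
      by (rule arg_cong[where f = "integral UNIV"], rule ext, rule phase)
    also have "integral UNIV (\<lambda>u. ec (p \<bullet> x) *\<^sub>C (fourier f p * (ec (u \<bullet> (x + J p)) *\<^sub>C fourier g u)))
        = ec (p \<bullet> x) *\<^sub>C (fourier f p * g (x + J p))"
    proof -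
      have "(\<lambda>u. fourier f p * (ec (u \<bullet> (x + J p)) *\<^sub>C fourier g u)) integrable_on UNIV"
        using integrable_linear[OF gi[of "x + J p"] bounded_linear_mult_right] by (simp add: o_def)
      then show ?thesis
        by (simp only: integral_mult_left'(3) integral_mult_left'(1)[OF gi] fourier_inversion[OF g])
    qed
    finally show "integral UNIV (\<lambda>u. ?F u p) = kern f g p x" by (simp add: kern_def)
  qed
  finally show ?thesis .
qed

lemma schwartz_kern: "kern f g p \<in> schwartz"
  unfolding kern_def[abs_def] by (intro schwartz_modulate schwartz_mult_left schwartz_translate g)

text \<open>Differentiating the character gives \<open>2 \<pi> i\<close> times a component of
  \<open>p\<close>, the multiplier of the derivative of \<open>f\<close>. The Leibniz rule thus
  holds already for each plane wave.\<close>

lemma partial_deriv_kern: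
  "partial_deriv i (kern f g p) = (\<lambda>x. kern (partial_deriv i f) g p x + kern f (partial_deriv i g) p x)"
proof -
  have t: "(\<lambda>x. g (x + J p)) \<in> schwartz" by (rule schwartz_translate[OF g])
  have m: "(\<lambda>x. fourier f p * g (x + J p)) \<in> schwartz" by (rule schwartz_mult_left[OF t])
  have "partial_deriv i (\<lambda>x. fourier f p * g (x + J p)) = (\<lambda>x. fourier f p * partial_deriv i g (x + J p))"
    by (rule ext, subst partial_deriv_linear(1)[OF bounded_linear_mult_right schwartz_differentiable[OF t]])
      (simp only: partial_deriv_translate[OF g])
  then have "partial_deriv i (kern f g p) = (\<lambda>x. ec (p \<bullet> x) *\<^sub>C (fourier f p * partial_deriv i g (x + J p)
      + (2 * pi * p $ i) *\<^sub>R \<i> *\<^sub>C (fourier f p * g (x + J p))))"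
    unfolding kern_def[abs_def] partial_deriv_modulate[OF m] by simp
  then show ?thesis
    by (simp add: kern_def fourier_partial_deriv[OF f] scaleC_add_right mult_scaleC_left add.commute)
qed

end

text \<open>Taylor's bound for the kernel at each \<open>p\<close> is integrated over
  \<open>p\<close>; the second derivatives are at most \<open>L * wt p\<close> uniformly in
  \<open>x\<close>.\<close>

lemma rieffel_prod_has_derivative:
  fixes f g :: "real^'n \<Rightarrow> 'c::unital_cstar_algebra"
  assumes f: "f \<in> schwartz" and g: "g \<in> schwartz"
  shows "((f \<odot> g) has_derivative
      (\<lambda>h. \<Sum>i\<in>UNIV. h $ i *\<^sub>R ((partial_deriv i f \<odot> g) x + (f \<odot> partial_deriv i g) x))) (at x)"
proof -
  note df = schwartz_partial_deriv[OF f] and dg = schwartz_partial_deriv[OF g]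
  note ddf = schwartz_partial_deriv[OF df] and ddg = schwartz_partial_deriv[OF dg]
  have pp: "partial_deriv i (partial_deriv j (kern f g p)) = (\<lambda>x.
      (kern (partial_deriv i (partial_deriv j f)) g p x + kern (partial_deriv j f) (partial_deriv i g) p x)
      + (kern (partial_deriv i f) (partial_deriv j g) p x + kern f (partial_deriv i (partial_deriv j g)) p x))"
    for i j p
    unfolding partial_deriv_kern[OF f g]
    by (rule ext, subst partial_deriv_add)
      (intro schwartz_differentiable schwartz_kern f g df dg,
       intro schwartz_differentiable schwartz_kern f g df dg,
       simp only: partial_deriv_kern[OF df g] partial_deriv_kern[OF f dg])
  have "\<exists>K\<ge>0. \<forall>p x. norm (partial_deriv i (partial_deriv j (kern f g p)) x) \<le> K * wt p" for i j
  proof -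
    obtain K1 where 1: "0 \<le> K1" "\<And>p x. norm (kern (partial_deriv i (partial_deriv j f)) g p x) \<le> K1 * wt p"
      by (rule kern_bound[OF ddf g]) blast
    obtain K2 where 2: "0 \<le> K2" "\<And>p x. norm (kern (partial_deriv j f) (partial_deriv i g) p x) \<le> K2 * wt p"
      by (rule kern_bound[OF df dg]) blast
    obtain K3 where 3: "0 \<le> K3" "\<And>p x. norm (kern (partial_deriv i f) (partial_deriv j g) p x) \<le> K3 * wt p"
      by (rule kern_bound[OF df dg]) blast
    obtain K4 where 4: "0 \<le> K4" "\<And>p x. norm (kern f (partial_deriv i (partial_deriv j g)) p x) \<le> K4 * wt p"
      by (rule kern_bound[OF f ddg]) blast
    have "norm (partial_deriv i (partial_deriv j (kern f g p)) x) \<le> ((K1 + K2) + (K3 + K4)) * wt p" for p x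
      unfolding pp distrib_right by (intro norm_triangle_mono 1 2 3 4)
    moreover have "0 \<le> (K1 + K2) + (K3 + K4)" using 1 2 3 4 by simp
    ultimately show ?thesis by blast
  qed
  then obtain K where K: "\<And>i j. 0 \<le> K i j"
    "\<And>i j p x. norm (partial_deriv i (partial_deriv j (kern f g p)) x) \<le> K i j * wt p" by metis
  define L where "L = (\<Sum>i\<in>UNIV. \<Sum>j\<in>UNIV. K i j)"
  have KL: "K i j \<le> L" for i j
  proof -
    have "K i j \<le> (\<Sum>j\<in>UNIV. K i j)" using K(1) by (intro member_le_sum) simp_all
    also have "\<dots> \<le> L" unfolding L_def using K(1) by (intro member_le_sum sum_nonneg) simp_all
    finally show ?thesis .
  qed
  have bd: "norm (partial_deriv i (partial_deriv j (kern f g p)) x) \<le> L * wt p" for i j p x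
    using K(2)[of i j p x] mult_right_mono[OF KL[of i j] wt_nonneg[of p]] by linarith
  let ?D = "\<lambda>h. \<Sum>i\<in>UNIV. h $ i *\<^sub>R ((partial_deriv i f \<odot> g) x + (f \<odot> partial_deriv i g) x)"
  have iD: "(\<lambda>p. partial_deriv i (kern f g p) x) integrable_on UNIV"
    "integral UNIV (\<lambda>p. partial_deriv i (kern f g p) x) = (partial_deriv i f \<odot> g) x + (f \<odot> partial_deriv i g) x"
    for i
    unfolding partial_deriv_kern[OF f g] rieffel_prod_kern[OF df g] rieffel_prod_kern[OF f dg]
    by (intro integrable_add kern_integrable f g df dg)
      (rule Henstock_Kurzweil_Integration.integral_add; intro kern_integrable f g df dg)
  have iDh: "((\<lambda>p. dird (kern f g p) h x) has_integral ?D h) UNIV" for h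
    unfolding dird_def iD(2)[symmetric]
    by (intro has_integral_sum has_integral_cmul integrable_integral iD(1)) simp_all
  show ?thesis
  proof (rule has_derivative_quadratic)
    show "bounded_linear ?D"
      by (intro bounded_linear_sum bounded_linear_scaleR_left[THEN bounded_linear_compose] bounded_linear_vec_nth)
    fix h
    have r: "((\<lambda>p. kern f g p (x + h) - kern f g p x - dird (kern f g p) h x) has_integral
        ((f \<odot> g) (x + h) - (f \<odot> g) x - ?D h)) UNIV"
      unfolding rieffel_prod_kern[OF f g]
      by (intro has_integral_diff integrable_integral kern_integrable f g iDh)
    have "norm (kern f g p (x + h) - kern f g p x - dird (kern f g p) h x)
        \<le> ((real CARD('n))\<^sup>2 * L * (norm h)\<^sup>2) * wt p" for p
      using taylor_bound[OF schwartz_kern[OF f g, of p] bd, of x h] by (simp add: mult_ac)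
    then have "norm ((f \<odot> g) (x + h) - (f \<odot> g) x - ?D h)
        \<le> integral UNIV (\<lambda>p::real^'n. ((real CARD('n))\<^sup>2 * L * (norm h)\<^sup>2) * wt p)"
      unfolding integral_unique[OF r, symmetric]
      by (intro Henstock_Kurzweil_Integration.integral_norm_bound_integral has_integral_integrable[OF r]
          integrable_on_mult_right integrable_wt)
    then show "norm ((f \<odot> g) (x + h) - (f \<odot> g) x - ?D h)
        \<le> ((real CARD('n))\<^sup>2 * L * wt_total TYPE(real^'n)) * (norm h)\<^sup>2"
      by (simp add: wt_total_def mult_ac)
  qed
qed

end

section \<open>Algebraic rules for the product\<close>

context skew_form
begin

lemma rp_partial_deriv:
  fixes f g :: "real^'n \<Rightarrow> 'c::unital_cstar_algebra"
  assumes f: "f \<in> schwartz" and g: "g \<in> schwartz"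
  shows "partial_deriv i (f \<odot> g) = (\<lambda>x. (partial_deriv i f \<odot> g) x + (f \<odot> partial_deriv i g) x)"
proof
  fix x
  have "partial_deriv i (f \<odot> g) x
      = (\<Sum>j\<in>UNIV. axis i 1 $ j *\<^sub>R ((partial_deriv j f \<odot> g) x + (f \<odot> partial_deriv j g) x))"
    by (rule partial_deriv_has_derivative[OF rieffel_prod_has_derivative[OF f g]])
  also have "\<dots> = (\<Sum>j\<in>UNIV. if j = i then (partial_deriv j f \<odot> g) x + (f \<odot> partial_deriv j g) x else 0)"
    by (rule sum.cong) (simp_all add: axis_def)
  also have "\<dots> = (partial_deriv i f \<odot> g) x + (f \<odot> partial_deriv i g) x" by simp
  finally show "partial_deriv i (f \<odot> g) x = (partial_deriv i f \<odot> g) x + (f \<odot> partial_deriv i g) x" .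
qed

lemma rp_add_left:
  fixes f g h :: "real^'n \<Rightarrow> 'c::unital_cstar_algebra"
  assumes f: "f \<in> schwartz" and h: "h \<in> schwartz" and g: "g \<in> schwartz"
  shows "((\<lambda>x. f x + h x) \<odot> g) = (\<lambda>x. (f \<odot> g) x + (h \<odot> g) x)"
proof
  fix x
  have k: "kern (\<lambda>x. f x + h x) g p x = kern f g p x + kern h g p x" for p
    by (simp add: kern_def fourier_add[OF f h] distrib_right scaleC_add_right)
  show "((\<lambda>x. f x + h x) \<odot> g) x = (f \<odot> g) x + (h \<odot> g) x"
    unfolding rieffel_prod_kern[OF schwartz_add[OF f h] g] rieffel_prod_kern[OF f g] rieffel_prod_kern[OF h g] k
    by (rule Henstock_Kurzweil_Integration.integral_add[OF kern_integrable[OF f g] kern_integrable[OF h g]])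
qed

lemma rp_add_right:
  fixes f g h :: "real^'n \<Rightarrow> 'c::unital_cstar_algebra"
  assumes f: "f \<in> schwartz" and g: "g \<in> schwartz" and h: "h \<in> schwartz"
  shows "(f \<odot> (\<lambda>x. g x + h x)) = (\<lambda>x. (f \<odot> g) x + (f \<odot> h) x)"
proof
  fix x
  have k: "kern f (\<lambda>x. g x + h x) p x = kern f g p x + kern f h p x" for p
    by (simp add: kern_def distrib_left scaleC_add_right)
  show "(f \<odot> (\<lambda>x. g x + h x)) x = (f \<odot> g) x + (f \<odot> h) x"
    unfolding rieffel_prod_kern[OF f schwartz_add[OF g h]] rieffel_prod_kern[OF f g] rieffel_prod_kern[OF f h] k
    by (rule Henstock_Kurzweil_Integration.integral_add[OF kern_integrable[OF f g] kern_integrable[OF f h]])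
qed

lemma rp_scaleC:
  fixes f g :: "real^'n \<Rightarrow> 'c::unital_cstar_algebra"
  assumes f: "f \<in> schwartz" and g: "g \<in> schwartz"
  shows rp_scaleC_left: "((\<lambda>x. c *\<^sub>C f x) \<odot> g) = (\<lambda>x. c *\<^sub>C (f \<odot> g) x)"
    and rp_scaleC_right: "(f \<odot> (\<lambda>x. c *\<^sub>C g x)) = (\<lambda>x. c *\<^sub>C (f \<odot> g) x)"
proof -
  have k: "kern (\<lambda>x. c *\<^sub>C f x) g p x = c *\<^sub>C kern f g p x" "kern f (\<lambda>x. c *\<^sub>C g x) p x = c *\<^sub>C kern f g p x" for p x
    by (simp_all add: kern_def fourier_scaleC[OF f] mult_scaleC_left mult_scaleC_right scaleC_scaleC mult.commute)
  show "((\<lambda>x. c *\<^sub>C f x) \<odot> g) = (\<lambda>x. c *\<^sub>C (f \<odot> g) x)"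
    by (rule ext) (simp only: rieffel_prod_kern[OF schwartz_scaleC[OF f] g] rieffel_prod_kern[OF f g] k
        integral_mult_left'(3)[OF kern_integrable[OF f g]])
  show "(f \<odot> (\<lambda>x. c *\<^sub>C g x)) = (\<lambda>x. c *\<^sub>C (f \<odot> g) x)"
    by (rule ext) (simp only: rieffel_prod_kern[OF f schwartz_scaleC[OF g]] rieffel_prod_kern[OF f g] k
        integral_mult_left'(3)[OF kern_integrable[OF f g]])
qed

lemma scaleC_minus_one: "(- 1) *\<^sub>C x = - (x :: 'c::unital_cstar_algebra)"
  by (simp add: scaleC_minus_left)

lemma rp_minus:
  fixes f g :: "real^'n \<Rightarrow> 'c::unital_cstar_algebra"
  assumes f: "f \<in> schwartz" and g: "g \<in> schwartz"
  shows rp_minus_left: "((\<lambda>x. - f x) \<odot> g) = (\<lambda>x. - (f \<odot> g) x)"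
    and rp_minus_right: "(f \<odot> (\<lambda>x. - g x)) = (\<lambda>x. - (f \<odot> g) x)"
  using rp_scaleC[OF f g, of "- 1"] by (simp_all add: scaleC_minus_one)

lemma rp_diff:
  fixes f g h :: "real^'n \<Rightarrow> 'c::unital_cstar_algebra"
  assumes f: "f \<in> schwartz" and g: "g \<in> schwartz" and h: "h \<in> schwartz"
  shows rp_diff_left: "((\<lambda>x. f x - h x) \<odot> g) = (\<lambda>x. (f \<odot> g) x - (h \<odot> g) x)"
    and rp_diff_right: "(f \<odot> (\<lambda>x. g x - h x)) = (\<lambda>x. (f \<odot> g) x - (f \<odot> h) x)"
  using rp_add_left[OF f schwartz_minus[OF h] g] rp_add_right[OF f g schwartz_minus[OF h]]
    rp_minus_left[OF h g] rp_minus_right[OF f h] by simp_all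

text \<open>\<open>Jd j f\<close> is the function with Fourier transform \<open>(J p)\<^sub>j fourier f p\<close>.\<close>

definition Jd :: "'n \<Rightarrow> (real^'n \<Rightarrow> 'c::unital_cstar_algebra) \<Rightarrow> real^'n \<Rightarrow> 'c" where
  "Jd j f x = (\<Sum>k\<in>UNIV. (J (axis k 1) $ j) *\<^sub>R ((- \<i> / complex_of_real (2 * pi)) *\<^sub>C partial_deriv k f x))"

lemma schwartz_Jd: "f \<in> schwartz \<Longrightarrow> Jd j f \<in> schwartz"
  unfolding Jd_def[abs_def] by (intro schwartz_sum schwartz_scaleR schwartz_scaleC schwartz_partial_deriv)

lemma fourier_Jd:
  fixes f :: "real^'n \<Rightarrow> 'c::unital_cstar_algebra"
  assumes f: "f \<in> schwartz"
  shows "fourier (Jd j f) p = (J p $ j) *\<^sub>R fourier f p"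
proof -
  let ?c = "- \<i> / complex_of_real (2 * pi)"
  have sk: "(\<lambda>x. ?c *\<^sub>C partial_deriv k f x) \<in> schwartz" for k
    by (rule schwartz_scaleC[OF schwartz_partial_deriv[OF f]])
  have c: "?c *\<^sub>C (2 * pi * p $ k) *\<^sub>R \<i> *\<^sub>C fourier f p = p $ k *\<^sub>R fourier f p" for k
  proof -
    have "(2 * pi * p $ k) *\<^sub>R ((?c * \<i>) *\<^sub>C fourier f p) = p $ k *\<^sub>R fourier f p"
    proof -
      have "?c * \<i> = complex_of_real (1 / (2 * pi))" by (simp add: field_simps)
      then show ?thesis by (simp only: scaleC_of_real) simp
    qed
    then show ?thesis by (simp add: scaleC_scaleR scaleC_scaleC)
  qed
  have "fourier (Jd j f) p = (\<Sum>k\<in>UNIV. fourier (\<lambda>x. (J (axis k 1) $ j) *\<^sub>R (?c *\<^sub>C partial_deriv k f x)) p)"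
    unfolding Jd_def[abs_def] by (rule fourier_sum) (simp, rule schwartz_scaleR[OF sk])
  also have "\<dots> = (\<Sum>k\<in>UNIV. (J (axis k 1) $ j * p $ k) *\<^sub>R fourier f p)"
    unfolding fourier_scaleR[OF sk] fourier_scaleC[OF schwartz_partial_deriv[OF f]] fourier_partial_deriv[OF f] c
    by simp
  also have "\<dots> = (\<Sum>k\<in>UNIV. J (axis k 1) $ j * p $ k) *\<^sub>R fourier f p" by (rule scaleR_left.sum[symmetric])
  also have "(\<Sum>k\<in>UNIV. J (axis k 1) $ j * p $ k) = J p $ j"
  proof -
    have "p = (\<Sum>k\<in>UNIV. p $ k *\<^sub>R axis k 1)"
      using basis_expansion[of p] by (simp add: scalar_mult_eq_scaleR)
    then have "J p = J (\<Sum>k\<in>UNIV. p $ k *\<^sub>R axis k 1)" by (rule arg_cong)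
    also have "\<dots> = (\<Sum>k\<in>UNIV. p $ k *\<^sub>R J (axis k 1))"
      by (simp add: linear_sum[OF linear_J] linear_scale[OF linear_J])
    finally show ?thesis by (simp add: mult.commute)
  qed
  finally show ?thesis .
qed

text \<open>Write \<open>x\<close> as \<open>(x + J p) - J p\<close> in component \<open>j\<close>:
  the first part multiplies \<open>g\<close>, the second is a Fourier multiplier on
  \<open>f\<close>. Coordinates are traded for derivatives of the left factor.\<close>

lemma rp_coord_right:
  fixes f g :: "real^'n \<Rightarrow> 'c::unital_cstar_algebra"
  assumes f: "f \<in> schwartz" and g: "g \<in> schwartz"
  shows "x $ j *\<^sub>R (f \<odot> g) x = (f \<odot> (\<lambda>x. x $ j *\<^sub>R g x)) x - (Jd j f \<odot> g) x"
proof -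
  have k: "x $ j *\<^sub>R kern f g p x = kern f (\<lambda>x. x $ j *\<^sub>R g x) p x - kern (Jd j f) g p x" for p
    by (simp add: kern_def fourier_Jd[OF f] scaleC_scaleR scaleR_add_left scaleC_add_right distrib_left)
  have "x $ j *\<^sub>R (f \<odot> g) x = integral UNIV (\<lambda>p. x $ j *\<^sub>R kern f g p x)"
    unfolding rieffel_prod_kern[OF f g] by simp
  also have "\<dots> = (f \<odot> (\<lambda>x. x $ j *\<^sub>R g x)) x - (Jd j f \<odot> g) x"
    unfolding k rieffel_prod_kern[OF f schwartz_coord[OF g]] rieffel_prod_kern[OF schwartz_Jd[OF f] g]
    by (rule Henstock_Kurzweil_Integration.integral_diff
        [OF kern_integrable[OF f schwartz_coord[OF g]] kern_integrable[OF schwartz_Jd[OF f] g]])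
  finally show ?thesis .
qed

lemma frequency_integrand:
  fixes f g :: "real^'n \<Rightarrow> 'c::unital_cstar_algebra"
  assumes f: "f \<in> schwartz" and g: "g \<in> schwartz" and B: "\<And>x. norm (f x) \<le> B"
    and K: "\<And>p. norm (fourier g p) \<le> K * wt p"
  shows "continuous_on UNIV (\<lambda>u. f (x + J u) * (ec (- (u \<bullet> x)) *\<^sub>C fourier g (- u)))"
    and "norm (f (x + J u) * (ec (- (u \<bullet> x)) *\<^sub>C fourier g (- u))) \<le> (B * K) * wt u"
proof -
  show "continuous_on UNIV (\<lambda>u. f (x + J u) * (ec (- (u \<bullet> x)) *\<^sub>C fourier g (- u)))"
    by (intro continuous_intros fourier_cont[OF g] schwartz_cont[OF f] J_cont)
  have "norm (f (x + J u) * (ec (- (u \<bullet> x)) *\<^sub>C fourier g (- u))) \<le> norm (f (x + J u)) * norm (fourier g (- u))"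
    using norm_mult_ineq[of "f (x + J u)" "ec (- (u \<bullet> x)) *\<^sub>C fourier g (- u)"] by simp
  also have "\<dots> \<le> B * (K * wt (- u))"
    using B[of "x + J u"] K[of "- u"] order_trans[OF norm_ge_zero B[of x]] by (intro mult_mono) simp_all
  finally show "norm (f (x + J u) * (ec (- (u \<bullet> x)) *\<^sub>C fourier g (- u))) \<le> (B * K) * wt u"
    by (simp add: wt_minus)
qed

lemma frequency_integrable:
  fixes f g :: "real^'n \<Rightarrow> 'c::unital_cstar_algebra"
  assumes f: "f \<in> schwartz" and g: "g \<in> schwartz"
  shows "(\<lambda>u. f (x + J u) * (ec (- (u \<bullet> x)) *\<^sub>C fourier g (- u))) integrable_on UNIV"
proof -
  obtain B where B: "\<And>x. norm (f x) \<le> B" using schwartz_norm_bound[OF f] by blast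
  obtain K where K: "\<And>p. norm (fourier g p) \<le> K * wt p" using fourier_wt_bound[OF g] by blast
  show ?thesis by (rule integrable_wt_bound[OF frequency_integrand[OF f g B K]])
qed

text \<open>The counterpart in frequency form, from the component \<open>j\<close> of
  \<open>x + J u\<close>. Together with \<open>rp_coord_right\<close> it allows the coordinate of
  the output to be eliminated.\<close>

lemma rp_coord_left:
  fixes f g :: "real^'n \<Rightarrow> 'c::unital_cstar_algebra"
  assumes f: "f \<in> schwartz" and g: "g \<in> schwartz"
  shows "((\<lambda>x. x $ j *\<^sub>R f x) \<odot> g) x = x $ j *\<^sub>R (f \<odot> g) x - (f \<odot> Jd j g) x"
proof -
  let ?I = "\<lambda>g u. f (x + J u) * (ec (- (u \<bullet> x)) *\<^sub>C fourier g (- u))"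
  have k: "((x + J u) $ j *\<^sub>R f (x + J u)) * (ec (- (u \<bullet> x)) *\<^sub>C fourier g (- u))
      = x $ j *\<^sub>R ?I g u - ?I (Jd j g) u" for u
    by (simp add: fourier_Jd[OF g] J_minus scaleC_scaleR scaleC_minus_right scaleR_add_left algebra_simps)
  have "((\<lambda>x. x $ j *\<^sub>R f x) \<odot> g) x = integral UNIV (\<lambda>u. x $ j *\<^sub>R ?I g u - ?I (Jd j g) u)"
    unfolding rieffel_prod_frequency[OF schwartz_coord[OF f] g] k ..
  also have "\<dots> = integral UNIV (\<lambda>u. x $ j *\<^sub>R ?I g u) - integral UNIV (?I (Jd j g))"
    by (rule Henstock_Kurzweil_Integration.integral_diff
        [OF integrable_cmul[OF frequency_integrable[OF f g]] frequency_integrable[OF f schwartz_Jd[OF g]]])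
  finally show ?thesis
    unfolding rieffel_prod_frequency[OF f g] rieffel_prod_frequency[OF f schwartz_Jd[OF g]] by simp
qed

text \<open>Sup-norm continuity in the left factor, by the integrability of
  \<open>fourier g\<close>. It lets uniform limits of partial sums pass through the product in
  \<open>local_inverse\<close>.\<close>

lemma rp_sup_left:
  fixes g :: "real^'n \<Rightarrow> 'c::unital_cstar_algebra"
  assumes g: "g \<in> schwartz"
  obtains C where "0 \<le> C"
    "\<forall>f\<in>schwartz. \<forall>B. (\<forall>x. norm (f x) \<le> B) \<longrightarrow> (\<forall>x. norm ((f \<odot> g) x) \<le> B * C)"
proof -
  obtain K where K: "0 \<le> K" "\<And>p. norm (fourier g p) \<le> K * wt p" using fourier_wt_bound[OF g] by blast
  show thesis
  proof
    show "0 \<le> K * wt_total TYPE(real^'n)" using K(1) wt_total_nonneg by (rule mult_nonneg_nonneg)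
    show "\<forall>f\<in>schwartz. \<forall>B. (\<forall>x. norm (f x) \<le> B) \<longrightarrow>
        (\<forall>x. norm ((f \<odot> g) x) \<le> B * (K * wt_total TYPE(real^'n)))"
    proof (intro ballI allI impI)
    fix f :: "real^'n \<Rightarrow> 'c" and B x
    assume f: "f \<in> schwartz" and "\<forall>x. norm (f x) \<le> B"
    then have B: "\<And>x. norm (f x) \<le> B" by blast
    show "norm ((f \<odot> g) x) \<le> B * (K * wt_total TYPE(real^'n))"
      using norm_integral_wt_bound[OF frequency_integrand[OF f g B K(2), of x]]
      unfolding rieffel_prod_frequency[OF f g] by (simp add: mult.assoc)
    qed
  qed
qed

lemma rp_sup_right:
  fixes f :: "real^'n \<Rightarrow> 'c::unital_cstar_algebra"
  assumes f: "f \<in> schwartz"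
  obtains C where "0 \<le> C"
    "\<forall>g\<in>schwartz. \<forall>B. (\<forall>x. norm (g x) \<le> B) \<longrightarrow> (\<forall>x. norm ((f \<odot> g) x) \<le> B * C)"
proof -
  obtain K where K: "0 \<le> K" "\<And>p. norm (fourier f p) \<le> K * wt p" using fourier_wt_bound[OF f] by blast
  show thesis
  proof
    show "0 \<le> K * wt_total TYPE(real^'n)" using K(1) wt_total_nonneg by (rule mult_nonneg_nonneg)
    show "\<forall>g\<in>schwartz. \<forall>B. (\<forall>x. norm (g x) \<le> B) \<longrightarrow>
        (\<forall>x. norm ((f \<odot> g) x) \<le> B * (K * wt_total TYPE(real^'n)))"
    proof (intro ballI allI impI)
    fix g :: "real^'n \<Rightarrow> 'c" and B x
    assume g: "g \<in> schwartz" and "\<forall>x. norm (g x) \<le> B"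
    then have B: "\<And>x. norm (g x) \<le> B" by blast
    have "norm (kern f g p x) \<le> (B * K) * wt p" for p
    proof -
      have "norm (fourier f p) * norm (g (x + J p)) \<le> (K * wt p) * B"
        using K B[of "x + J p"] wt_nonneg[of p] by (intro mult_mono) simp_all
      then show ?thesis using norm_kern_le[OF f g, of p x] by (simp add: mult_ac)
    qed
    from norm_integral_wt_bound[OF continuous_on_slice(1)[OF continuous_on_kern[OF f g]] this]
    show "norm ((f \<odot> g) x) \<le> B * (K * wt_total TYPE(real^'n))"
      unfolding rieffel_prod_kern[OF f g] by (simp add: mult.assoc)
    qed
  qed
qed

text \<open>The Leibniz rule and the coordinate rule turn one product into a sum of two, so finite
  sums of products form the invariant set for \<open>schwartz_coinduct\<close>.\<close>

inductive_set prods :: "(real^'n \<Rightarrow> 'c::unital_cstar_algebra) set" where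
  base: "f \<in> schwartz \<Longrightarrow> g \<in> schwartz \<Longrightarrow> f \<odot> g \<in> prods"
| add: "h \<in> prods \<Longrightarrow> k \<in> prods \<Longrightarrow> (\<lambda>x. h x + k x) \<in> prods"

lemma prods_subset_schwartz:
  fixes h :: "real^'n \<Rightarrow> 'c::unital_cstar_algebra"
  assumes "h \<in> prods"
  shows "h \<in> schwartz"
  using assms
proof (rule schwartz_coinduct)
  show diff: "h differentiable (at x)" if "h \<in> prods" for h :: "real^'n \<Rightarrow> 'c" and x
    using that
  proof induction
    case (base f g)
    show ?case by (rule differentiableI[OF rieffel_prod_has_derivative[OF base]])
  next
    case (add h k)
    from add.IH show ?case by (rule differentiable_add)
  qed
  show "bounded (range h)" if "h \<in> prods" for h :: "real^'n \<Rightarrow> 'c"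
    using that
  proof induction
    case (base f g)
    obtain C where C: "\<forall>g\<in>schwartz. \<forall>B. (\<forall>x. norm (g x) \<le> B) \<longrightarrow> (\<forall>x. norm ((f \<odot> g) x) \<le> B * C)"
      by (rule rp_sup_right[OF base(1)])
    obtain B where "\<And>x. norm (g x) \<le> B" using schwartz_norm_bound[OF base(2)] by blast
    then have "\<forall>x. norm ((f \<odot> g) x) \<le> B * C" using C base(2) by simp
    then show ?case unfolding bounded_iff by (intro exI[of _ "B * C"]) auto
  next
    case (add h k)
    from add.IH show ?case by (rule bounded_add_range)
  qed
  show "partial_deriv i h \<in> prods" if "h \<in> prods" for h :: "real^'n \<Rightarrow> 'c" and i
    using that
  proof induction
    case (base f g)
    show ?case unfolding rp_partial_deriv[OF base]
      by (intro prods.add prods.base schwartz_partial_deriv base)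
  next
    case (add h k)
    have "partial_deriv i (\<lambda>x. h x + k x) = (\<lambda>x. partial_deriv i h x + partial_deriv i k x)"
      by (rule ext, rule partial_deriv_add[OF diff[OF add.hyps(1)] diff[OF add.hyps(2)]])
    then show ?case using prods.add[OF add.IH] by simp
  qed
  show "(\<lambda>x. x $ i *\<^sub>R h x) \<in> prods" if "h \<in> prods" for h :: "real^'n \<Rightarrow> 'c" and i
    using that
  proof induction
    case (base f g)
    have "(\<lambda>x. x $ i *\<^sub>R (f \<odot> g) x) = (\<lambda>x. (f \<odot> (\<lambda>x. x $ i *\<^sub>R g x)) x + ((\<lambda>x. - Jd i f x) \<odot> g) x)"
      unfolding rp_coord_right[OF base] rp_minus_left[OF schwartz_Jd[OF base(1)] base(2)] by simp
    then show ?case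
      using prods.add[OF prods.base[OF base(1) schwartz_coord[OF base(2)]]
          prods.base[OF schwartz_minus[OF schwartz_Jd[OF base(1)]] base(2)]] by simp
  next
    case (add h k)
    show ?case using prods.add[OF add.IH] by (simp add: scaleR_add_right)
  qed
qed

lemma schwartz_rp:
  fixes f g :: "real^'n \<Rightarrow> 'c::unital_cstar_algebra"
  shows "f \<in> schwartz \<Longrightarrow> g \<in> schwartz \<Longrightarrow> f \<odot> g \<in> schwartz"
  by (rule prods_subset_schwartz[OF prods.base])

lemma rp_translate: "(f \<odot> g) (x + a) = ((\<lambda>x. f (x + a)) \<odot> (\<lambda>x. g (x + a))) x"
  unfolding rieffel_prod_def by (simp add: add_ac)

text \<open>Duality: \<open>k\<close> is paired with itself under the integral over
  \<open>p\<close>. Modulation and translation are isometries, so Cauchy-Schwarz bounds each plane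
  wave by the norms of \<open>k\<close>, of \<open>fourier f p\<close> and of \<open>g\<close>, and
  one factor \<open>schwartz_norm2 k\<close> cancels. All integrals are algebra-valued, none is
  taken in the module.\<close>

lemma norm2_rp_le:
  fixes f g :: "real^'n \<Rightarrow> 'c::unital_cstar_algebra"
  assumes f: "f \<in> schwartz" and g: "g \<in> schwartz" and K: "0 \<le> K" "\<And>p. norm (fourier f p) \<le> K * wt p"
  shows "schwartz_norm2 (f \<odot> g) \<le> (K * wt_total TYPE(real^'n)) * schwartz_norm2 g"
proof -
  define k where "k = f \<odot> g"
  have k: "k \<in> schwartz" unfolding k_def by (rule schwartz_rp[OF f g])
  obtain B where B: "0 \<le> B" "\<And>x. norm (k x) \<le> B * wt x" using schwartz_wt_bound[OF k] by blast
  obtain C where C: "0 \<le> C" "\<And>p x. norm (kern f g p x) \<le> C * wt p" by (rule kern_bound[OF f g]) blast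
  let ?F = "\<lambda>x p. cstar (k x) * kern f g p x"
  have c: "continuous_on UNIV (\<lambda>(x, p). ?F x p)"
    unfolding kern_def case_prod_unfold
    by (intro continuous_intros fourier_cont[OF f] schwartz_cont[OF g] schwartz_cont[OF k] J_cont)
  have b: "norm (?F x p) \<le> (B * C) * wt x * wt p" for x p
  proof -
    have "norm (?F x p) \<le> norm (k x) * norm (kern f g p x)" using norm_mult_ineq[of "cstar (k x)"] by simp
    also have "\<dots> \<le> (B * wt x) * (C * wt p)"
      using B C wt_nonneg[of x] by (intro mult_mono) simp_all
    finally show ?thesis by (simp add: mult_ac)
  qed
  have ip: "norm (schwartz_inner k (kern f g p)) \<le> schwartz_norm2 k * (norm (fourier f p) * schwartz_norm2 g)" for p
  proof -
    have "norm (schwartz_inner k (kern f g p)) \<le> schwartz_norm2 k * schwartz_norm2 (kern f g p)"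
      by (rule inner_cauchy_schwarz[OF schwartz_dec[OF k] schwartz_dec[OF schwartz_kern[OF f g]]])
    moreover have "schwartz_norm2 (kern f g p) \<le> norm (fourier f p) * schwartz_norm2 g"
      unfolding kern_def[abs_def] norm2_modulate
      using norm2_mult_left[OF schwartz_dec[OF schwartz_translate(1)[OF g]], of "fourier f p" "J p"]
      by (simp add: norm2_translate)
    ultimately show ?thesis by (meson mult_left_mono norm2_nonneg order_trans)
  qed
  have "schwartz_inner k k = integral UNIV (\<lambda>x. integral UNIV (\<lambda>p. ?F x p))"
    unfolding schwartz_inner_def
    by (subst (2) k_def, subst rieffel_prod_kern[OF f g]) (simp only: integral_mult_left'(1)[OF kern_integrable[OF f g]])
  also have "\<dots> = integral UNIV (\<lambda>p. integral UNIV (\<lambda>x. ?F x p))" by (rule integral_swap_UNIV[OF c b])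
  also have "\<dots> = integral UNIV (\<lambda>p. schwartz_inner k (kern f g p))" by (simp add: schwartz_inner_def)
  finally have eq: "schwartz_inner k k = integral UNIV (\<lambda>p. schwartz_inner k (kern f g p))" .
  have c': "continuous_on UNIV (\<lambda>(p, x). ?F x p)"
    unfolding kern_def case_prod_unfold
    by (intro continuous_intros fourier_cont[OF f] schwartz_cont[OF g] schwartz_cont[OF k] J_cont)
  have b': "norm (?F x p) \<le> (B * C) * wt p * wt x" for x p using b[of x p] by (simp add: mult_ac)
  have "dec (\<lambda>p. schwartz_inner k (kern f g p))"
    unfolding schwartz_inner_def
    by (rule dec_iterated_integral[OF c' _ b']) (use B C in simp)
  then have "continuous_on UNIV (\<lambda>p. schwartz_inner k (kern f g p))" by (simp add: dec_def)
  moreover have "norm (schwartz_inner k (kern f g p)) \<le> (schwartz_norm2 k * K * schwartz_norm2 g) * wt p" for p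
  proof -
    have "schwartz_norm2 k * (norm (fourier f p) * schwartz_norm2 g) \<le> schwartz_norm2 k * ((K * wt p) * schwartz_norm2 g)"
      by (intro mult_left_mono mult_right_mono K) simp_all
    then show ?thesis using ip[of p] by (simp add: mult_ac)
  qed
  ultimately have "norm (schwartz_inner k k) \<le> (schwartz_norm2 k * K * schwartz_norm2 g) * wt_total TYPE(real^'n)"
    unfolding eq by (rule norm_integral_wt_bound)
  then have le: "schwartz_norm2 k * schwartz_norm2 k
      \<le> schwartz_norm2 k * ((K * wt_total TYPE(real^'n)) * schwartz_norm2 g)"
    by (simp add: mult_ac flip: norm2_square power2_eq_square)
  show ?thesis
  proof (cases "schwartz_norm2 k = 0")
    case True
    then show ?thesis using K(1) wt_total_nonneg[where 'a = "real^'n"] by (simp add: k_def)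
  next
    case False
    then have "0 < schwartz_norm2 k" by (simp add: less_le)
    with le show ?thesis unfolding k_def by (simp only: mult_le_cancel_left_pos)
  qed
qed

lemma fourier_cstar:
  fixes f :: "real^'n \<Rightarrow> 'c::unital_cstar_algebra"
  assumes f: "f \<in> schwartz"
  shows "fourier (\<lambda>x. cstar (f x)) p = cstar (fourier f (- p))"
  unfolding fourier_def
  using integral_bounded_linear[OF bounded_linear_cstar schwartz_integrable[OF schwartz_ec_minus[OF f, of "- p"]]]
  by (simp add: cstar_scaleC cnj_ec)

text \<open>The plane wave of \<open>f\<close> at \<open>p\<close> has as adjoint the plane wave of
  \<open>\<lambda>x. cstar (f x)\<close> at \<open>- p\<close>, by the shift
  \<open>y = x + J p\<close>; the phases match because \<open>p \<bullet> J p = 0\<close>.\<close>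

lemma inner_rp_adjoint:
  fixes f g k :: "real^'n \<Rightarrow> 'c::unital_cstar_algebra"
  assumes f: "f \<in> schwartz" and g: "g \<in> schwartz" and k: "k \<in> schwartz"
  shows "schwartz_inner (f \<odot> g) k = schwartz_inner g ((\<lambda>x. cstar (f x)) \<odot> k)"
proof -
  let ?f = "\<lambda>x. cstar (f x)"
  have fs: "?f \<in> schwartz" by (rule schwartz_cstar[OF f])
  obtain A where A: "0 \<le> A" "\<And>x. norm (g x) \<le> A * wt x" using schwartz_wt_bound[OF g] by blast
  obtain B where B: "0 \<le> B" "\<And>x. norm (k x) \<le> B * wt x" using schwartz_wt_bound[OF k] by blast
  obtain C where C: "0 \<le> C" "\<And>p x. norm (kern f g p x) \<le> C * wt p" by (rule kern_bound[OF f g]) blast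
  obtain D where D: "0 \<le> D" "\<And>p x. norm (kern ?f k p x) \<le> D * wt p" by (rule kern_bound[OF fs k]) blast
  let ?F = "\<lambda>x p. cstar (kern f g p x) * k x"
  let ?G = "\<lambda>y p. cstar (g y) * kern ?f k p y"
  have cF: "continuous_on UNIV (\<lambda>(x, p). ?F x p)"
    unfolding kern_def case_prod_unfold
    by (intro continuous_intros fourier_cont[OF f] schwartz_cont[OF g] schwartz_cont[OF k] J_cont)
  have cG: "continuous_on UNIV (\<lambda>(x, p). ?G x p)"
    unfolding kern_def case_prod_unfold
    by (intro continuous_intros fourier_cont[OF fs] schwartz_cont[OF g] schwartz_cont[OF k] J_cont)
  have bF: "norm (?F x p) \<le> (C * B) * wt x * wt p" for x p
  proof -
    have "norm (?F x p) \<le> norm (kern f g p x) * norm (k x)" using norm_mult_ineq[of "cstar (kern f g p x)"] by simp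
    also have "\<dots> \<le> (C * wt p) * (B * wt x)" using B C wt_nonneg[of p] by (intro mult_mono) simp_all
    finally show ?thesis by (simp add: mult_ac)
  qed
  have bG: "norm (?G x p) \<le> (A * D) * wt x * wt p" for x p
  proof -
    have "norm (?G x p) \<le> norm (g x) * norm (kern ?f k p x)" using norm_mult_ineq[of "cstar (g x)"] by simp
    also have "\<dots> \<le> (A * wt x) * (D * wt p)" using A D wt_nonneg[of x] by (intro mult_mono) simp_all
    finally show ?thesis by (simp add: mult_ac)
  qed
  have "schwartz_inner (f \<odot> g) k = integral UNIV (\<lambda>x. integral UNIV (\<lambda>p. ?F x p))"
  proof -
    have "cstar ((f \<odot> g) x) * k x = integral UNIV (\<lambda>p. ?F x p)" for x
    proof -
      have i: "(\<lambda>p. cstar (kern f g p x)) integrable_on UNIV"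
        using integrable_linear[OF kern_integrable[OF f g] bounded_linear_cstar] by (simp add: o_def)
      show ?thesis
        unfolding rieffel_prod_kern[OF f g] integral_mult_left'(2)[OF i]
          integral_bounded_linear[OF bounded_linear_cstar kern_integrable[OF f g]] ..
    qed
    then show ?thesis unfolding schwartz_inner_def by simp
  qed
  also have "\<dots> = integral UNIV (\<lambda>p. integral UNIV (\<lambda>x. ?F x p))" by (rule integral_swap_UNIV[OF cF bF])
  also have "\<dots> = integral UNIV (\<lambda>p. integral UNIV (\<lambda>y. ?G y (- p)))"
  proof (rule arg_cong[where f = "integral UNIV"], rule ext)
    fix p
    have "?F x p = (\<lambda>y. ?G y (- p)) (x + J p)" for x
      by (simp add: kern_def fourier_cstar[OF f] cstar_scaleC cnj_ec cstar_mult mult_scaleC_left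
          mult_scaleC_right J_minus inner_add_right mult.assoc)
    then have "integral UNIV (\<lambda>x. ?F x p) = integral UNIV (\<lambda>x. (\<lambda>y. ?G y (- p)) (x + J p))" by simp
    also have "\<dots> = integral UNIV (\<lambda>y. ?G y (- p))" by (rule integral_shift_UNIV)
    finally show "integral UNIV (\<lambda>x. ?F x p) = integral UNIV (\<lambda>y. ?G y (- p))" .
  qed
  also have "\<dots> = integral UNIV (\<lambda>p. integral UNIV (\<lambda>y. ?G y p))"
    using integral_reflect_UNIV[of "\<lambda>p. integral UNIV (\<lambda>y. ?G y p)"] by simp
  also have "\<dots> = integral UNIV (\<lambda>y. integral UNIV (\<lambda>p. ?G y p))"
    by (rule integral_swap_UNIV[OF cG bG, symmetric])
  also have "\<dots> = schwartz_inner g (?f \<odot> k)"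
    unfolding schwartz_inner_def rieffel_prod_kern[OF fs k] integral_mult_left'(1)[OF kern_integrable[OF fs k]] ..
  finally show ?thesis .
qed

text \<open>The modulated translate of \<open>g\<close> at \<open>p\<close> has as transform that of
  \<open>g\<close> at \<open>s - p\<close>, with a phase. In this form, a twisted convolution,
  associativity becomes a substitution.\<close>

lemma fourier_rp:
  fixes f g :: "real^'n \<Rightarrow> 'c::unital_cstar_algebra"
  assumes f: "f \<in> schwartz" and g: "g \<in> schwartz"
  shows "fourier (f \<odot> g) s = integral UNIV (\<lambda>p. ec (s \<bullet> J p) *\<^sub>C (fourier f p * fourier g (s - p)))"
proof -
  obtain K where K: "0 \<le> K" "\<And>p x. norm (kern f g p x) \<le> K * wt x * wt p" by (rule kern_bound2[OF f g]) blast
  let ?F = "\<lambda>x p. ec (- (s \<bullet> x)) *\<^sub>C kern f g p x"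
  have c: "continuous_on UNIV (\<lambda>(x, p). ?F x p)"
    unfolding kern_def case_prod_unfold
    by (intro continuous_intros fourier_cont[OF f] schwartz_cont[OF g] J_cont)
  have b: "norm (?F x p) \<le> K * wt x * wt p" for x p by (simp add: K)
  have "fourier (f \<odot> g) s = integral UNIV (\<lambda>x. integral UNIV (\<lambda>p. ?F x p))"
    unfolding fourier_def[of "f \<odot> g"] rieffel_prod_kern[OF f g] integral_mult_left'(3)[OF kern_integrable[OF f g]] ..
  also have "\<dots> = integral UNIV (\<lambda>p. integral UNIV (\<lambda>x. ?F x p))" by (rule integral_swap_UNIV[OF c b])
  also have "\<dots> = integral UNIV (\<lambda>p. ec (s \<bullet> J p) *\<^sub>C (fourier f p * fourier g (s - p)))"
  proof (rule arg_cong[where f = "integral UNIV"], rule ext)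
    fix p
    let ?g = "\<lambda>y. ec (- ((s - p) \<bullet> y)) *\<^sub>C g y"
    have gi: "?g \<in> schwartz" by (rule schwartz_ec_minus[OF g])
    have "?F x p = (\<lambda>y. ec (s \<bullet> J p) *\<^sub>C (fourier f p * ?g y)) (x + J p)" for x
    proof -
      have "- (s \<bullet> x) + p \<bullet> x = s \<bullet> J p + - ((s - p) \<bullet> (x + J p))"
        by (simp add: inner_diff_left inner_add_right)
      then show ?thesis
        by (simp only: kern_def scaleC_scaleC mult_scaleC_right ec_add[symmetric])
    qed
    then have "integral UNIV (\<lambda>x. ?F x p) = integral UNIV (\<lambda>x. (\<lambda>y. ec (s \<bullet> J p) *\<^sub>C (fourier f p * ?g y)) (x + J p))"
      by simp
    also have "\<dots> = integral UNIV (\<lambda>y. ec (s \<bullet> J p) *\<^sub>C (fourier f p * ?g y))" by (rule integral_shift_UNIV)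
    also have "\<dots> = ec (s \<bullet> J p) *\<^sub>C (fourier f p * fourier g (s - p))"
      unfolding integral_mult_left'(3)[OF schwartz_integrable[OF schwartz_mult_left[OF gi]]]
        integral_mult_left'(1)[OF schwartz_integrable[OF gi]] fourier_def[of g] ..
    finally show "integral UNIV (\<lambda>x. ?F x p) = ec (s \<bullet> J p) *\<^sub>C (fourier f p * fourier g (s - p))" .
  qed
  finally show ?thesis .
qed

text \<open>Both sides are integrals over two frequencies: \<open>s\<close> and \<open>p\<close> on
  the left, with \<open>s\<close> belonging to \<open>f \<odot> g\<close>, and
  \<open>q = s - p\<close> and \<open>p\<close> on the right. Shifting \<open>s\<close> by
  \<open>p\<close> identifies them.\<close>

theorem rp_assoc:
  fixes f g h :: "real^'n \<Rightarrow> 'c::unital_cstar_algebra"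
  assumes f: "f \<in> schwartz" and g: "g \<in> schwartz" and h: "h \<in> schwartz"
  shows "(f \<odot> g) \<odot> h = f \<odot> (g \<odot> h)"
proof
  fix x
  have fg: "f \<odot> g \<in> schwartz" and gh: "g \<odot> h \<in> schwartz" by (rule schwartz_rp[OF f g], rule schwartz_rp[OF g h])
  obtain K where K: "0 \<le> K" "\<And>p. norm (fourier f p) * jap p ^ DIM(real^'n) \<le> K * wt p"
    using fourier_double_decay[OF f] by blast
  obtain L where L: "0 \<le> L" "\<And>p. norm (fourier g p) \<le> L * wt p" using fourier_wt_bound[OF g] by blast
  obtain M where M: "0 \<le> M" "\<And>x. norm (h x) \<le> M" using schwartz_norm_bound[OF h] by blast
  obtain D where D: "0 \<le> D" "\<And>p x::real^'n. wt (x - p) \<le> D * jap p ^ DIM(real^'n) * wt x"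
    using translate_bound by metis
  let ?G = "\<lambda>s p. ec (s \<bullet> J p) *\<^sub>C (fourier f p * fourier g (s - p))"
  let ?F = "\<lambda>s p. ec (s \<bullet> x) *\<^sub>C (?G s p * h (x + J s))"
  have G: "norm (?G s p) \<le> (K * L * D) * wt s * wt p" for s p
  proof -
    have "norm (fourier g (s - p)) \<le> L * (D * jap p ^ DIM(real^'n) * wt s)"
      using L(2)[of "s - p"] mult_left_mono[OF D(2)[of s p] L(1)] by linarith
    then have "norm (fourier f p) * norm (fourier g (s - p)) \<le> norm (fourier f p) * (L * (D * jap p ^ DIM(real^'n) * wt s))"
      by (rule mult_left_mono) simp
    also have "\<dots> = (L * D * wt s) * (norm (fourier f p) * jap p ^ DIM(real^'n))" by simp
    also have "\<dots> \<le> (L * D * wt s) * (K * wt p)"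
      using K(2)[of p] L(1) D(1) wt_nonneg[of s] by (intro mult_left_mono) simp_all
    finally show ?thesis
      using norm_mult_ineq[of "fourier f p" "fourier g (s - p)"] by (simp add: mult_ac)
  qed
  have cG: "continuous_on UNIV (\<lambda>(s, p). ?G s p)"
    unfolding case_prod_unfold by (intro continuous_intros fourier_cont[OF f] fourier_cont[OF g] J_cont)
  have Gi: "?G s integrable_on UNIV" for s
    by (rule integrable_wt_bound[OF continuous_on_slice(1)[OF cG] G])
  have c: "continuous_on UNIV (\<lambda>(s, p). ?F s p)"
    unfolding case_prod_unfold
    by (intro continuous_intros fourier_cont[OF f] fourier_cont[OF g] schwartz_cont[OF h] J_cont)
  have b: "norm (?F s p) \<le> (K * L * D * M) * wt s * wt p" for s p
  proof -
    have "norm (?F s p) \<le> norm (?G s p) * norm (h (x + J s))"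
      using norm_mult_ineq[of "?G s p" "h (x + J s)"] by (simp only: norm_ec_scaleC)
    also have "\<dots> \<le> ((K * L * D) * wt s * wt p) * M"
      by (intro mult_mono G M mult_nonneg_nonneg K(1) L(1) D(1) wt_nonneg norm_ge_zero)
    finally show ?thesis by (simp only: mult_ac)
  qed
  have "((f \<odot> g) \<odot> h) x = integral UNIV (\<lambda>s. integral UNIV (\<lambda>p. ?F s p))"
  proof -
    have "kern (f \<odot> g) h s x = integral UNIV (\<lambda>p. ?F s p)" for s
    proof -
      have i: "(\<lambda>p. ?G s p * h (x + J s)) integrable_on UNIV"
        using integrable_linear[OF Gi bounded_linear_mult_left] by (simp only: o_def)
      show ?thesis
        unfolding kern_def fourier_rp[OF f g] integral_mult_left'(3)[OF i] integral_mult_left'(2)[OF Gi] ..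
    qed
    then show ?thesis unfolding rieffel_prod_kern[OF fg h] by simp
  qed
  also have "\<dots> = integral UNIV (\<lambda>p. integral UNIV (\<lambda>s. ?F s p))" by (rule integral_swap_UNIV[OF c b])
  also have "\<dots> = integral UNIV (\<lambda>p. kern f (g \<odot> h) p x)"
  proof (rule arg_cong[where f = "integral UNIV"], rule ext)
    fix p
    have ki: "(\<lambda>q. kern g h q (x + J p)) integrable_on UNIV" by (rule kern_integrable[OF g h])
    have i: "(\<lambda>q. fourier f p * kern g h q (x + J p)) integrable_on UNIV"
      using integrable_linear[OF ki bounded_linear_mult_right] by (simp only: o_def)
    have "?F (q + p) p = ec (p \<bullet> x) *\<^sub>C (fourier f p * kern g h q (x + J p))" for q
    proof -
      \<comment> \<open>The term \<open>p \<bullet> J p\<close> drops out by skew-symmetry.\<close>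
      have ph: "(q + p) \<bullet> x + (q + p) \<bullet> J p = p \<bullet> x + q \<bullet> (x + J p)"
        by (simp add: inner_add_left inner_add_right)
      have "?F (q + p) p = ec ((q + p) \<bullet> x + (q + p) \<bullet> J p) *\<^sub>C (fourier f p * (fourier g q * h (x + J (q + p))))"
        by (simp add: mult_scaleC_left scaleC_scaleC mult.assoc flip: ec_add)
      also have "\<dots> = ec (p \<bullet> x) *\<^sub>C (fourier f p * kern g h q (x + J p))"
        unfolding ph by (simp add: kern_def mult_scaleC_right scaleC_scaleC J_add add_ac flip: ec_add)
      finally show ?thesis .
    qed
    then have "integral UNIV (\<lambda>q. ?F (q + p) p) = ec (p \<bullet> x) *\<^sub>C (fourier f p * integral UNIV (\<lambda>q. kern g h q (x + J p)))"
      by (simp only: integral_mult_left'(3)[OF i] integral_mult_left'(1)[OF ki])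
    also have "\<dots> = kern f (g \<odot> h) p x" unfolding kern_def[of f] rieffel_prod_kern[OF g h] ..
    finally show "integral UNIV (\<lambda>s. ?F s p) = kern f (g \<odot> h) p x"
      using integral_shift_UNIV[of "\<lambda>s. ?F s p" p] by simp
  qed
  also have "\<dots> = (f \<odot> (g \<odot> h)) x" by (rule rieffel_prod_kern[OF f gh, symmetric])
  finally show "((f \<odot> g) \<odot> h) x = (f \<odot> (g \<odot> h)) x" .
qed

end

section \<open>Completions of pseudometric spaces\<close>

text \<open>Instantiated for two distances on the Schwartz functions: the module norm and the
  C*-norm.\<close>

locale pseudometric =
  fixes V :: "'a set" and d :: "'a \<Rightarrow> 'a \<Rightarrow> real"
  assumes d_self: "x \<in> V \<Longrightarrow> d x x = 0"
    and d_sym: "x \<in> V \<Longrightarrow> y \<in> V \<Longrightarrow> d x y = d y x"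
    and d_tri: "x \<in> V \<Longrightarrow> y \<in> V \<Longrightarrow> z \<in> V \<Longrightarrow> d x z \<le> d x y + d y z"
begin

lemma d_nonneg: "x \<in> V \<Longrightarrow> y \<in> V \<Longrightarrow> 0 \<le> d x y"
  using d_tri[of x y x] d_self[of x] d_sym[of x y] by simp

abbreviation "CS \<equiv> cauchy_seqs V d"
abbreviation "CR \<equiv> cauchy_rel V d"
abbreviation "cls X \<equiv> cauchy_rel V d `` {X}"

lemma CS_in: "X \<in> CS \<Longrightarrow> X k \<in> V"
  by (auto simp: cauchy_seqs_def)

lemma CS_D: "X \<in> CS \<Longrightarrow> 0 < e \<Longrightarrow> \<exists>N. \<forall>m\<ge>N. \<forall>k\<ge>N. d (X m) (X k) < e"
  by (simp add: cauchy_seqs_def)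

lemma CS_I: "(\<And>k. X k \<in> V) \<Longrightarrow> (\<And>e. 0 < e \<Longrightarrow> \<exists>N. \<forall>m\<ge>N. \<forall>k\<ge>N. d (X m) (X k) < e) \<Longrightarrow> X \<in> CS"
  by (auto simp: cauchy_seqs_def)

lemma CR_iff: "(X, Y) \<in> CR \<longleftrightarrow> X \<in> CS \<and> Y \<in> CS \<and> (\<lambda>k. d (X k) (Y k)) \<longlonglongrightarrow> 0"
  by (simp add: cauchy_rel_def)

lemma CR_refl: "X \<in> CS \<Longrightarrow> (X, X) \<in> CR"
  by (simp add: CR_iff d_self CS_in)

lemma CR_sym: "(X, Y) \<in> CR \<Longrightarrow> (Y, X) \<in> CR"
  by (auto simp: CR_iff d_sym CS_in)

lemma CR_trans:
  assumes "(X, Y) \<in> CR" "(Y, Z) \<in> CR"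
  shows "(X, Z) \<in> CR"
proof -
  have XYZ: "X \<in> CS" "Y \<in> CS" "Z \<in> CS" using assms by (simp_all add: CR_iff)
  have "(\<lambda>k. d (X k) (Z k)) \<longlonglongrightarrow> 0"
  proof (rule tendsto_sandwich[of "\<lambda>_. 0" _ _ "\<lambda>k. d (X k) (Y k) + d (Y k) (Z k)"])
    show "\<forall>\<^sub>F k in sequentially. 0 \<le> d (X k) (Z k)"
      using XYZ by (intro always_eventually allI d_nonneg CS_in)
    show "\<forall>\<^sub>F k in sequentially. d (X k) (Z k) \<le> d (X k) (Y k) + d (Y k) (Z k)"
      using XYZ by (intro always_eventually allI d_tri CS_in)
    have "(\<lambda>k. d (X k) (Y k) + d (Y k) (Z k)) \<longlonglongrightarrow> 0 + 0"
      using assms by (intro tendsto_add) (simp_all add: CR_iff)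
    then show "(\<lambda>k. d (X k) (Y k) + d (Y k) (Z k)) \<longlonglongrightarrow> 0" by simp
  qed simp
  with XYZ show ?thesis by (simp add: CR_iff)
qed

lemma cls_eq_iff: "X \<in> CS \<Longrightarrow> Y \<in> CS \<Longrightarrow> cls X = cls Y \<longleftrightarrow> (\<lambda>k. d (X k) (Y k)) \<longlonglongrightarrow> 0"
proof
  assume X: "X \<in> CS" and Y: "Y \<in> CS"
  show "(\<lambda>k. d (X k) (Y k)) \<longlonglongrightarrow> 0" if "cls X = cls Y"
  proof -
    have "Y \<in> cls X" unfolding that using CR_refl[OF Y] by simp
    then show ?thesis by (simp add: CR_iff)
  qed
  show "cls X = cls Y" if "(\<lambda>k. d (X k) (Y k)) \<longlonglongrightarrow> 0"
  proof -
    have r: "(X, Y) \<in> CR" using X Y that by (simp add: CR_iff)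
    show ?thesis using CR_trans[OF r] CR_trans[OF CR_sym[OF r]] by blast
  qed
qed

lemma cls_eqI: "(X, Y) \<in> CR \<Longrightarrow> cls X = cls Y"
  using cls_eq_iff[of X Y] by (simp add: CR_iff)

lemma completion_cls: "X \<in> CS \<Longrightarrow> cls X \<in> completion V d"
  unfolding completion_def by (rule quotientI)

lemma completion_cases:
  assumes "\<xi> \<in> completion V d"
  obtains X where "X \<in> CS" "\<xi> = cls X"
  using assms unfolding completion_def by (rule quotientE)

lemma const_CS: "x \<in> V \<Longrightarrow> (\<lambda>_. x) \<in> CS"
  by (rule CS_I) (simp_all add: d_self)

lemma embed_cls: "completion_embed V d x = cls (\<lambda>_. x)"
  by (simp add: completion_embed_def)

lemma mem_cls: "X \<in> CS \<Longrightarrow> X \<in> cls X"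
  using CR_refl by simp

text \<open>For \<open>X = Y\<close> the hypothesis on \<open>F\<close> also says that Cauchy
  sequences are mapped to Cauchy sequences.\<close>

lemma lift_cls:
  assumes F: "\<And>X Y. (X, Y) \<in> CR \<Longrightarrow> ((\<lambda>k. F (X k)), (\<lambda>k. F (Y k))) \<in> CR" and X: "X \<in> CS"
  shows "completion_lift V d F (cls X) = cls (\<lambda>k. F (X k))"
proof -
  have "cls (\<lambda>k. F (Y k)) = cls (\<lambda>k. F (X k))" if "Y \<in> cls X" for Y
    using that by (intro cls_eqI[symmetric] F) simp
  moreover have "cls X \<noteq> {}" using mem_cls[OF X] by blast
  ultimately show ?thesis unfolding completion_lift_def by simp
qed

lemma lift2_cls:
  assumes F: "\<And>X X' Y Y'. (X, X') \<in> CR \<Longrightarrow> (Y, Y') \<in> CR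
      \<Longrightarrow> ((\<lambda>k. F (X k) (Y k)), (\<lambda>k. F (X' k) (Y' k))) \<in> CR"
    and X: "X \<in> CS" and Y: "Y \<in> CS"
  shows "completion_lift2 V d F (cls X) (cls Y) = cls (\<lambda>k. F (X k) (Y k))"
proof -
  have "cls (\<lambda>k. F (X' k) (Y' k)) = cls (\<lambda>k. F (X k) (Y k))" if "X' \<in> cls X" "Y' \<in> cls Y" for X' Y'
    using that by (intro cls_eqI[symmetric] F) simp_all
  moreover have "cls X \<noteq> {}" "cls Y \<noteq> {}" using mem_cls[OF X] mem_cls[OF Y] by blast+
  ultimately show ?thesis unfolding completion_lift2_def by simp
qed

lemma lipschitz_CR:
  assumes F: "\<And>x. x \<in> V \<Longrightarrow> F x \<in> V" and L: "\<And>x y. x \<in> V \<Longrightarrow> y \<in> V \<Longrightarrow> d (F x) (F y) \<le> L * d x y"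
    and XY: "(X, Y) \<in> CR"
  shows "((\<lambda>k. F (X k)), (\<lambda>k. F (Y k))) \<in> CR"
proof -
  \<comment> \<open>\<open>\<bar>L\<bar> + 1\<close> is a strictly positive Lipschitz constant, by
    which \<open>e\<close> can be divided.\<close>
  have M: "d (F x) (F y) \<le> (\<bar>L\<bar> + 1) * d x y" if "x \<in> V" "y \<in> V" for x y
    using order_trans[OF L[OF that] mult_right_mono[of L "\<bar>L\<bar> + 1" "d x y"]] d_nonneg[OF that] by simp
  have CS: "(\<lambda>k. F (X k)) \<in> CS" if X: "X \<in> CS" for X
  proof (rule CS_I)
    show "F (X k) \<in> V" for k by (rule F[OF CS_in[OF X]])
    fix e :: real assume "0 < e"
    then have "0 < e / (\<bar>L\<bar> + 1)" by (intro divide_pos_pos) simp_all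
    from CS_D[OF X this] obtain N where N: "\<And>m k. m \<ge> N \<Longrightarrow> k \<ge> N \<Longrightarrow> d (X m) (X k) < e / (\<bar>L\<bar> + 1)" by blast
    have "d (F (X m)) (F (X k)) < e" if "m \<ge> N" "k \<ge> N" for m k
    proof -
      have "(\<bar>L\<bar> + 1) * d (X m) (X k) < e" using N[OF that] by (simp add: pos_less_divide_eq mult.commute)
      then show ?thesis using M[OF CS_in[OF X] CS_in[OF X], of m k] by simp
    qed
    then show "\<exists>N. \<forall>m\<ge>N. \<forall>k\<ge>N. d (F (X m)) (F (X k)) < e" by blast
  qed
  have X: "X \<in> CS" and Y: "Y \<in> CS" and lim: "(\<lambda>k. d (X k) (Y k)) \<longlonglongrightarrow> 0" using XY by (simp_all add: CR_iff)
  have "(\<lambda>k. d (F (X k)) (F (Y k))) \<longlonglongrightarrow> 0"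
  proof (rule tendsto_sandwich[of "\<lambda>_. 0" _ _ "\<lambda>k. (\<bar>L\<bar> + 1) * d (X k) (Y k)"])
    show "\<forall>\<^sub>F k in sequentially. 0 \<le> d (F (X k)) (F (Y k))"
      by (intro always_eventually allI d_nonneg F CS_in X Y)
    show "\<forall>\<^sub>F k in sequentially. d (F (X k)) (F (Y k)) \<le> (\<bar>L\<bar> + 1) * d (X k) (Y k)"
      by (intro always_eventually allI M CS_in X Y)
    show "(\<lambda>k. (\<bar>L\<bar> + 1) * d (X k) (Y k)) \<longlonglongrightarrow> 0"
      using tendsto_mult[OF tendsto_const[of "\<bar>L\<bar> + 1"] lim] by simp
  qed simp
  then show ?thesis by (simp add: CR_iff CS X Y)
qed

end

section \<open>The Hilbert module and the operator norm\<close>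

lemma norm2_zero [simp]: "schwartz_norm2 (\<lambda>_. 0) = 0"
  by (simp add: schwartz_norm2_def schwartz_inner_def)

lemma norm2_diff_commute: "schwartz_norm2 (\<lambda>x. f x - g x) = schwartz_norm2 (\<lambda>x. g x - f x)"
  using norm2_minus[of "\<lambda>x. g x - f x"] by simp

interpretation hilb: pseudometric "schwartz :: (real^'n::finite \<Rightarrow> 'c::unital_cstar_algebra) set" schwartz_dist2
proof
  fix f g h :: "real^'n \<Rightarrow> 'c"
  show "schwartz_dist2 f f = 0" by (simp add: schwartz_dist2_def)
  show "schwartz_dist2 f g = schwartz_dist2 g f"
    unfolding schwartz_dist2_def by (rule norm2_diff_commute)
  assume f: "f \<in> schwartz" and g: "g \<in> schwartz" and h: "h \<in> schwartz"
  show "schwartz_dist2 f h \<le> schwartz_dist2 f g + schwartz_dist2 g h"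
    using norm2_triangle[OF schwartz_dec[OF schwartz_diff[OF f g]] schwartz_dec[OF schwartz_diff[OF g h]]]
    by (simp add: schwartz_dist2_def)
qed

lemma norm2_triangle_diff:
  fixes f g :: "real^'n::finite \<Rightarrow> 'c::unital_cstar_algebra"
  assumes "f \<in> schwartz" "g \<in> schwartz"
  shows "schwartz_norm2 f \<le> schwartz_norm2 g + schwartz_dist2 f g"
  using norm2_triangle[OF schwartz_dec[OF assms(2)] schwartz_dec[OF schwartz_diff[OF assms]]]
  by (simp add: schwartz_dist2_def)

lemma inner_diff_bound:
  fixes f g f' g' :: "real^'n::finite \<Rightarrow> 'c::unital_cstar_algebra"
  assumes "f \<in> schwartz" "g \<in> schwartz" "f' \<in> schwartz" "g' \<in> schwartz"
  shows "norm (schwartz_inner f g - schwartz_inner f' g')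
    \<le> schwartz_dist2 f f' * schwartz_norm2 g + schwartz_norm2 f' * schwartz_dist2 g g'"
proof -
  note D = schwartz_dec
  have "schwartz_inner f g - schwartz_inner f' g'
      = schwartz_inner (\<lambda>x. f x - f' x) g + schwartz_inner f' (\<lambda>x. g x - g' x)"
    using inner_diff_left'[OF D D D, OF assms(1,3,2)] inner_diff_right'[OF D D D, OF assms(3,2,4)] by simp
  then show ?thesis
    using norm_triangle_mono[OF inner_cauchy_schwarz[OF D D] inner_cauchy_schwarz[OF D D],
        OF schwartz_diff[OF assms(1,3)] assms(2) assms(3) schwartz_diff[OF assms(2,4)]]
    by (simp add: schwartz_dist2_def)
qed

lemma hilb_CS_bounded:
  fixes X :: "nat \<Rightarrow> real^'n::finite \<Rightarrow> 'c::unital_cstar_algebra"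
  assumes X: "X \<in> cauchy_seqs schwartz schwartz_dist2"
  obtains B where "0 < B" "\<And>k. schwartz_norm2 (X k) \<le> B"
proof -
  obtain N where N: "\<And>m k. m \<ge> N \<Longrightarrow> k \<ge> N \<Longrightarrow> schwartz_dist2 (X m) (X k) < 1"
    using hilb.CS_D[OF X, of 1] by auto
  define B where "B = Max (insert 0 ((\<lambda>k. schwartz_norm2 (X k)) ` {..N})) + 1"
  have fin: "finite (insert 0 ((\<lambda>k. schwartz_norm2 (X k)) ` {..N}))" by simp
  have small: "schwartz_norm2 (X k) \<le> B - 1" if "k \<le> N" for k
  proof -
    have "schwartz_norm2 (X k) \<le> Max (insert 0 ((\<lambda>k. schwartz_norm2 (X k)) ` {..N}))"
      by (rule Max_ge[OF fin]) (use that in simp)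
    then show ?thesis unfolding B_def by simp
  qed
  have "schwartz_norm2 (X k) \<le> B" for k
  proof (cases "k \<le> N")
    case False
    then have "schwartz_dist2 (X k) (X N) < 1" by (intro N) simp_all
    then show ?thesis
      using norm2_triangle_diff[OF hilb.CS_in[OF X] hilb.CS_in[OF X], of k N] small[of N] by simp
  qed (use small in force)
  moreover have "0 < B" using small[of N] norm2_nonneg[of "X N"] by linarith
  ultimately show thesis using that by blast
qed

lemma hilb_inner_limits:
  fixes X Y X' Y' :: "nat \<Rightarrow> real^'n::finite \<Rightarrow> 'c::unital_cstar_algebra"
  assumes "(X, X') \<in> cauchy_rel schwartz schwartz_dist2" "(Y, Y') \<in> cauchy_rel schwartz schwartz_dist2"
  shows "(\<lambda>k. schwartz_inner (X k) (Y k) - schwartz_inner (X' k) (Y' k)) \<longlonglongrightarrow> 0"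
proof -
  have X: "X \<in> cauchy_seqs schwartz schwartz_dist2" "X' \<in> cauchy_seqs schwartz schwartz_dist2"
    "(\<lambda>k. schwartz_dist2 (X k) (X' k)) \<longlonglongrightarrow> 0" using assms(1) by (simp_all add: hilb.CR_iff)
  have Y: "Y \<in> cauchy_seqs schwartz schwartz_dist2" "Y' \<in> cauchy_seqs schwartz schwartz_dist2"
    "(\<lambda>k. schwartz_dist2 (Y k) (Y' k)) \<longlonglongrightarrow> 0" using assms(2) by (simp_all add: hilb.CR_iff)
  obtain B where B: "0 < B" "\<And>k. schwartz_norm2 (Y k) \<le> B" using hilb_CS_bounded[OF Y(1)] by blast
  obtain C where C: "0 < C" "\<And>k. schwartz_norm2 (X' k) \<le> C" using hilb_CS_bounded[OF X(2)] by blast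
  show ?thesis
  proof (rule Lim_null_comparison)
    show "\<forall>\<^sub>F k in sequentially. norm (schwartz_inner (X k) (Y k) - schwartz_inner (X' k) (Y' k))
        \<le> schwartz_dist2 (X k) (X' k) * B + C * schwartz_dist2 (Y k) (Y' k)"
    proof (rule always_eventually, rule allI)
      fix k
      have in': "X k \<in> schwartz" "Y k \<in> schwartz" "X' k \<in> schwartz" "Y' k \<in> schwartz"
        using X Y by (simp_all add: hilb.CS_in)
      have "schwartz_dist2 (X k) (X' k) * schwartz_norm2 (Y k) \<le> schwartz_dist2 (X k) (X' k) * B"
        by (intro mult_left_mono B hilb.d_nonneg in')
      moreover have "schwartz_norm2 (X' k) * schwartz_dist2 (Y k) (Y' k) \<le> C * schwartz_dist2 (Y k) (Y' k)"
        by (intro mult_right_mono C hilb.d_nonneg in')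
      ultimately show "norm (schwartz_inner (X k) (Y k) - schwartz_inner (X' k) (Y' k))
        \<le> schwartz_dist2 (X k) (X' k) * B + C * schwartz_dist2 (Y k) (Y' k)"
        using inner_diff_bound[OF in'] by linarith
    qed
    show "(\<lambda>k. schwartz_dist2 (X k) (X' k) * B + C * schwartz_dist2 (Y k) (Y' k)) \<longlonglongrightarrow> 0"
      using tendsto_add[OF tendsto_mult[OF X(3) tendsto_const] tendsto_mult[OF tendsto_const Y(3)]] by simp
  qed
qed

lemma hilb_inner_Cauchy:
  fixes X Y :: "nat \<Rightarrow> real^'n::finite \<Rightarrow> 'c::unital_cstar_algebra"
  assumes X: "X \<in> cauchy_seqs schwartz schwartz_dist2" and Y: "Y \<in> cauchy_seqs schwartz schwartz_dist2"
  shows "convergent (\<lambda>k. schwartz_inner (X k) (Y k))"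
proof (rule Cauchy_convergent, rule CauchyI)
  fix e :: real assume e: "0 < e"
  obtain B where B: "0 < B" "\<And>k. schwartz_norm2 (Y k) \<le> B" using hilb_CS_bounded[OF Y] by blast
  obtain C where C: "0 < C" "\<And>k. schwartz_norm2 (X k) \<le> C" using hilb_CS_bounded[OF X] by blast
  obtain M where M: "\<And>m k. m \<ge> M \<Longrightarrow> k \<ge> M \<Longrightarrow> schwartz_dist2 (X m) (X k) < e / (2 * B)"
    using hilb.CS_D[OF X, of "e / (2 * B)"] e B(1) by auto
  obtain N where N: "\<And>m k. m \<ge> N \<Longrightarrow> k \<ge> N \<Longrightarrow> schwartz_dist2 (Y m) (Y k) < e / (2 * C)"
    using hilb.CS_D[OF Y, of "e / (2 * C)"] e C(1) by auto
  show "\<exists>M. \<forall>m\<ge>M. \<forall>n\<ge>M. norm (schwartz_inner (X m) (Y m) - schwartz_inner (X n) (Y n)) < e"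
  proof (intro exI[of _ "max M N"] allI impI)
    fix m n assume mn: "max M N \<le> m" "max M N \<le> n"
    have in': "X m \<in> schwartz" "Y m \<in> schwartz" "X n \<in> schwartz" "Y n \<in> schwartz"
      using X Y by (simp_all add: hilb.CS_in)
    have "schwartz_dist2 (X m) (X n) * schwartz_norm2 (Y m) \<le> schwartz_dist2 (X m) (X n) * B"
      by (intro mult_left_mono B hilb.d_nonneg in')
    also have "\<dots> < e / (2 * B) * B" using M[of m n] mn B(1) by (intro mult_strict_right_mono) simp_all
    also have "\<dots> = e / 2" using B(1) by simp
    finally have 1: "schwartz_dist2 (X m) (X n) * schwartz_norm2 (Y m) < e / 2" .
    have "schwartz_norm2 (X n) * schwartz_dist2 (Y m) (Y n) \<le> C * schwartz_dist2 (Y m) (Y n)"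
      by (intro mult_right_mono C hilb.d_nonneg in')
    also have "\<dots> < C * (e / (2 * C))" using N[of m n] mn C(1) by (intro mult_strict_left_mono) simp_all
    also have "\<dots> = e / 2" using C(1) by simp
    finally have "schwartz_norm2 (X n) * schwartz_dist2 (Y m) (Y n) < e / 2" .
    with 1 show "norm (schwartz_inner (X m) (Y m) - schwartz_inner (X n) (Y n)) < e"
      using inner_diff_bound[OF in'] by linarith
  qed
qed

text \<open>\<open>hilb_inner\<close> describes the limit for some pair of representatives; by
  \<open>hilb_inner_limits\<close> it is the same for all pairs, so the description is
  unique.\<close>

lemma hilb_inner_tendsto:
  fixes X Y :: "nat \<Rightarrow> real^'n::finite \<Rightarrow> 'c::unital_cstar_algebra"
  assumes X: "X \<in> cauchy_seqs schwartz schwartz_dist2" and Y: "Y \<in> cauchy_seqs schwartz schwartz_dist2"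
  shows "(\<lambda>k. schwartz_inner (X k) (Y k)) \<longlonglongrightarrow> hilb_inner (hilb.cls X) (hilb.cls Y)"
proof -
  obtain c where c: "(\<lambda>k. schwartz_inner (X k) (Y k)) \<longlonglongrightarrow> c"
    using hilb_inner_Cauchy[OF X Y] by (auto simp: convergent_def)
  have "hilb_inner (hilb.cls X) (hilb.cls Y) = c"
    unfolding hilb_inner_def
  proof (rule the_equality)
    show "\<exists>X\<in>hilb.cls X. \<exists>Y\<in>hilb.cls Y. (\<lambda>k. schwartz_inner (X k) (Y k)) \<longlonglongrightarrow> c"
      by (intro bexI[of _ X] bexI[of _ Y] c hilb.mem_cls X Y)
    fix c' assume "\<exists>X\<in>hilb.cls X. \<exists>Y\<in>hilb.cls Y. (\<lambda>k. schwartz_inner (X k) (Y k)) \<longlonglongrightarrow> c'"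
    then obtain X' Y' where r: "(X, X') \<in> cauchy_rel schwartz schwartz_dist2" "(Y, Y') \<in> cauchy_rel schwartz schwartz_dist2"
      and c': "(\<lambda>k. schwartz_inner (X' k) (Y' k)) \<longlonglongrightarrow> c'" by auto
    have "(\<lambda>k. schwartz_inner (X k) (Y k) - schwartz_inner (X' k) (Y' k)) \<longlonglongrightarrow> c - c'"
      by (rule tendsto_diff[OF c c'])
    from LIMSEQ_unique[OF this hilb_inner_limits[OF r]] show "c' = c" by simp
  qed
  then show ?thesis using c by simp
qed

lemma hilb_norm_tendsto:
  fixes X :: "nat \<Rightarrow> real^'n::finite \<Rightarrow> 'c::unital_cstar_algebra"
  assumes X: "X \<in> cauchy_seqs schwartz schwartz_dist2"
  shows "(\<lambda>k. schwartz_norm2 (X k)) \<longlonglongrightarrow> hilb_norm (hilb.cls X)"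
  unfolding schwartz_norm2_def hilb_norm_def
  by (intro tendsto_real_sqrt tendsto_norm hilb_inner_tendsto X)

lemma hilb_cases:
  fixes \<xi> :: "(nat \<Rightarrow> real^'n::finite \<Rightarrow> 'c::unital_cstar_algebra) set"
  assumes "\<xi> \<in> hilb"
  obtains X where "X \<in> cauchy_seqs schwartz schwartz_dist2" "\<xi> = hilb.cls X"
  using hilb.completion_cases[of \<xi>] assms unfolding hilb_def by blast

lemma hilb_cls: "X \<in> cauchy_seqs schwartz schwartz_dist2 \<Longrightarrow> hilb.cls X \<in> hilb"
  for X :: "nat \<Rightarrow> real^'n::finite \<Rightarrow> 'c::unital_cstar_algebra"
  unfolding hilb_def by (rule hilb.completion_cls)

lemma hilb_embed_cls: "hilb_embed g = hilb.cls (\<lambda>_. g)"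
  unfolding hilb_embed_def by (rule hilb.embed_cls)

lemma hilb_embed_in: "g \<in> schwartz \<Longrightarrow> hilb_embed g \<in> hilb"
  for g :: "real^'n::finite \<Rightarrow> 'c::unital_cstar_algebra"
  unfolding hilb_embed_cls by (intro hilb_cls hilb.const_CS)

lemma cstar_hilb_inner:
  fixes \<xi> \<eta> :: "(nat \<Rightarrow> real^'n::finite \<Rightarrow> 'c::unital_cstar_algebra) set"
  assumes "\<xi> \<in> hilb" "\<eta> \<in> hilb"
  shows "cstar (hilb_inner \<xi> \<eta>) = hilb_inner \<eta> \<xi>"
proof -
  obtain X where X: "X \<in> cauchy_seqs schwartz schwartz_dist2" "\<xi> = hilb.cls X" using hilb_cases[OF assms(1)] .
  obtain Y where Y: "Y \<in> cauchy_seqs schwartz schwartz_dist2" "\<eta> = hilb.cls Y" using hilb_cases[OF assms(2)] .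
  have "(\<lambda>k. cstar (schwartz_inner (X k) (Y k))) \<longlonglongrightarrow> cstar (hilb_inner \<xi> \<eta>)"
    unfolding X Y by (intro tendsto_cstar hilb_inner_tendsto X Y)
  moreover have "cstar (schwartz_inner (X k) (Y k)) = schwartz_inner (Y k) (X k)" for k
    by (intro cstar_inner schwartz_dec hilb.CS_in X Y)
  ultimately show ?thesis
    using LIMSEQ_unique hilb_inner_tendsto[OF Y(1) X(1)] unfolding X(2) Y(2) by simp
qed

text \<open>The differences \<open>D k\<close> form a Cauchy sequence, and the inner square of
  \<open>D k\<close> is that of \<open>D k - D m\<close> with \<open>D k\<close> plus that of
  \<open>D m\<close> with \<open>D k\<close>. For a fixed late \<open>m\<close> the first is small
  uniformly in \<open>k\<close>, and the second tends to 0 because \<open>D m\<close> is itself a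
  Schwartz function.\<close>

lemma hilb_inner_nondegenerate:
  fixes \<xi> \<eta> :: "(nat \<Rightarrow> real^'n::finite \<Rightarrow> 'c::unital_cstar_algebra) set"
  assumes "\<xi> \<in> hilb" "\<eta> \<in> hilb"
    and eq: "\<And>g. g \<in> schwartz \<Longrightarrow> hilb_inner (hilb_embed g) \<xi> = hilb_inner (hilb_embed g) \<eta>"
  shows "\<xi> = \<eta>"
proof -
  obtain X where X: "X \<in> cauchy_seqs schwartz schwartz_dist2" "\<xi> = hilb.cls X" using hilb_cases[OF assms(1)] .
  obtain Y where Y: "Y \<in> cauchy_seqs schwartz schwartz_dist2" "\<eta> = hilb.cls Y" using hilb_cases[OF assms(2)] .
  have XS: "X k \<in> schwartz" and YS: "Y k \<in> schwartz" for k by (intro hilb.CS_in X Y)+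
  define D where "D = (\<lambda>k x. X k x - Y k x)"
  have DS: "D k \<in> schwartz" for k unfolding D_def by (rule schwartz_diff[OF XS YS])
  have D0: "(\<lambda>k. schwartz_inner g (D k)) \<longlonglongrightarrow> 0" if g: "g \<in> schwartz" for g
  proof -
    have "(\<lambda>k. schwartz_inner g (X k) - schwartz_inner g (Y k))
        \<longlonglongrightarrow> hilb_inner (hilb_embed g) \<xi> - hilb_inner (hilb_embed g) \<eta>"
      unfolding hilb_embed_cls X(2) Y(2)
      by (intro tendsto_diff hilb_inner_tendsto[of "\<lambda>_. g", simplified] hilb.const_CS g X Y)
    then show ?thesis
      unfolding D_def eq[OF g] using inner_diff_right'[OF schwartz_dec[OF g] schwartz_dec[OF XS] schwartz_dec[OF YS]]
      by simp
  qed
  have Dd: "schwartz_dist2 (D m) (D k) \<le> schwartz_dist2 (X m) (X k) + schwartz_dist2 (Y m) (Y k)" for m k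
  proof -
    have "(\<lambda>x. D m x - D k x) = (\<lambda>x. (X m x - X k x) + (Y k x - Y m x))" by (auto simp: D_def)
    then show ?thesis
      using norm2_triangle[OF schwartz_dec schwartz_dec, OF schwartz_diff[OF XS XS] schwartz_diff[OF YS YS], of m k k m]
      by (simp add: schwartz_dist2_def norm2_diff_commute[of "Y m" "Y k"])
  qed
  obtain B where B: "0 < B" "\<And>k. schwartz_norm2 (D k) \<le> B"
  proof -
    obtain P where P: "0 < P" "\<And>k. schwartz_norm2 (X k) \<le> P" using hilb_CS_bounded[OF X(1)] by blast
    obtain Q where Q: "0 < Q" "\<And>k. schwartz_norm2 (Y k) \<le> Q" using hilb_CS_bounded[OF Y(1)] by blast
    have "schwartz_norm2 (D k) \<le> P + Q" for k
      using norm2_triangle[OF schwartz_dec[OF XS] schwartz_dec[OF schwartz_minus[OF YS]], of k k] P(2)[of k] Q(2)[of k]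
      by (simp add: D_def norm2_minus)
    then show thesis using that[of "P + Q"] P(1) Q(1) by simp
  qed
  have "(\<lambda>k. (schwartz_norm2 (D k))\<^sup>2) \<longlonglongrightarrow> 0"
  proof (rule LIMSEQ_I)
    fix e :: real assume e: "0 < e"
    \<comment> \<open>The two Cauchy sequences contribute \<open>e / (4 B)\<close> each; after
      Cauchy-Schwarz with the bound \<open>B\<close> they take up half of \<open>e\<close>.\<close>
    then have e4: "0 < e / (4 * B)" using B(1) by simp
    obtain M where M: "\<And>m k. m \<ge> M \<Longrightarrow> k \<ge> M \<Longrightarrow> schwartz_dist2 (X m) (X k) < e / (4 * B)"
      using hilb.CS_D[OF X(1) e4] by blast
    obtain N where N: "\<And>m k. m \<ge> N \<Longrightarrow> k \<ge> N \<Longrightarrow> schwartz_dist2 (Y m) (Y k) < e / (4 * B)"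
      using hilb.CS_D[OF Y(1) e4] by blast
    define m where "m = max M N"
    obtain R where R: "\<And>k. k \<ge> R \<Longrightarrow> norm (schwartz_inner (D m) (D k) - 0) < e / 2"
      using LIMSEQ_D[OF D0[OF DS, of m], of "e / 2"] e by auto
    show "\<exists>no. \<forall>k\<ge>no. norm ((schwartz_norm2 (D k))\<^sup>2 - 0) < e"
    proof (intro exI[of _ "max m R"] allI impI)
      fix k assume k: "max m R \<le> k"
      have "schwartz_dist2 (D k) (D m) \<le> e / (4 * B) + e / (4 * B)"
        using Dd[of k m] M[of k m] N[of k m] k by (simp add: m_def)
      also have "\<dots> = e / (2 * B)" by simp
      finally have "schwartz_dist2 (D k) (D m) * schwartz_norm2 (D k) \<le> e / (2 * B) * B"
        using B(1) e by (intro mult_mono B(2)) simp_all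
      also have "\<dots> = e / 2" using B(1) by simp
      finally have "norm (schwartz_inner (D k) (D k) - schwartz_inner (D m) (D k)) \<le> e / 2"
        using inner_diff_bound[OF DS DS DS DS, of k k m k] by (simp add: hilb.d_self DS)
      moreover have "norm (schwartz_inner (D m) (D k)) < e / 2" using R[of k] k by simp
      ultimately have "norm (schwartz_inner (D k) (D k)) < e"
        using norm_triangle_sub[of "schwartz_inner (D k) (D k)" "schwartz_inner (D m) (D k)"] by linarith
      then show "norm ((schwartz_norm2 (D k))\<^sup>2 - 0) < e" by (simp add: norm2_square)
    qed
  qed
  then have "(\<lambda>k. sqrt ((schwartz_norm2 (D k))\<^sup>2)) \<longlonglongrightarrow> sqrt 0" by (rule tendsto_real_sqrt)
  then have "(\<lambda>k. schwartz_dist2 (X k) (Y k)) \<longlonglongrightarrow> 0" by (simp add: schwartz_dist2_def D_def)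
  then show ?thesis unfolding X(2) Y(2) using hilb.cls_eq_iff[OF X(1) Y(1)] by simp
qed

section \<open>Left multiplication operators and the C*-norm\<close>

context skew_form
begin

lemma rp_bounded:
  fixes f :: "real^'n \<Rightarrow> 'c::unital_cstar_algebra"
  assumes f: "f \<in> schwartz"
  obtains C where "0 \<le> C" "\<forall>g\<in>schwartz. schwartz_norm2 (f \<odot> g) \<le> C * schwartz_norm2 g"
proof -
  obtain K where K: "0 \<le> K" "\<And>p. norm (fourier f p) \<le> K * wt p" using fourier_wt_bound[OF f] by blast
  show thesis
    by (rule that[of "K * wt_total TYPE(real^'n)"])
      (intro mult_nonneg_nonneg K wt_total_nonneg, intro ballI norm2_rp_le[OF f _ K])
qed

lemma rp_CR:
  fixes f :: "real^'n \<Rightarrow> 'c::unital_cstar_algebra"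
  assumes f: "f \<in> schwartz" and XY: "(X, Y) \<in> cauchy_rel schwartz schwartz_dist2"
  shows "((\<lambda>k. f \<odot> X k), (\<lambda>k. f \<odot> Y k)) \<in> cauchy_rel schwartz schwartz_dist2"
proof -
  obtain C where C: "\<forall>g\<in>schwartz. schwartz_norm2 (f \<odot> g) \<le> C * schwartz_norm2 g" by (rule rp_bounded[OF f])
  show ?thesis
  proof (rule hilb.lipschitz_CR[OF _ _ XY])
    show "f \<odot> g \<in> schwartz" if "g \<in> schwartz" for g by (rule schwartz_rp[OF f that])
    show "schwartz_dist2 (f \<odot> g) (f \<odot> h) \<le> C * schwartz_dist2 g h" if "g \<in> schwartz" "h \<in> schwartz" for g h
      using C schwartz_diff[OF that] unfolding schwartz_dist2_def rp_diff_right[OF f that, symmetric] by blast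
  qed
qed

text \<open>The extension by continuity, restricted to \<open>hilb\<close> because adjointable
  operators are extensional functions.\<close>

definition lop :: "(real^'n \<Rightarrow> 'c::unital_cstar_algebra) \<Rightarrow> (nat \<Rightarrow> real^'n \<Rightarrow> 'c) set \<Rightarrow> (nat \<Rightarrow> real^'n \<Rightarrow> 'c) set" where
  "lop f = (\<lambda>\<xi>\<in>hilb. completion_lift schwartz schwartz_dist2 (rieffel_prod J f) \<xi>)"

lemma lop_cls:
  fixes f :: "real^'n \<Rightarrow> 'c::unital_cstar_algebra"
  assumes f: "f \<in> schwartz" and X: "X \<in> cauchy_seqs schwartz schwartz_dist2"
  shows "lop f (hilb.cls X) = hilb.cls (\<lambda>k. f \<odot> X k)"
    and "(\<lambda>k. f \<odot> X k) \<in> cauchy_seqs schwartz schwartz_dist2"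
proof -
  show "lop f (hilb.cls X) = hilb.cls (\<lambda>k. f \<odot> X k)"
    unfolding lop_def using hilb_cls[OF X] by (simp add: hilb.lift_cls[OF rp_CR[OF f] X])
  show "(\<lambda>k. f \<odot> X k) \<in> cauchy_seqs schwartz schwartz_dist2"
    using rp_CR[OF f hilb.CR_refl[OF X]] by (simp add: hilb.CR_iff)
qed

lemma lop_in: "f \<in> schwartz \<Longrightarrow> lop f \<in> hilb \<rightarrow>\<^sub>E hilb"
  for f :: "real^'n \<Rightarrow> 'c::unital_cstar_algebra"
proof (intro PiE_I)
  fix \<xi> :: "(nat \<Rightarrow> real^'n \<Rightarrow> 'c) set" assume f: "f \<in> schwartz" and "\<xi> \<in> hilb"
  then obtain X where X: "X \<in> cauchy_seqs schwartz schwartz_dist2" "\<xi> = hilb.cls X" using hilb_cases by blast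
  show "lop f \<xi> \<in> hilb" unfolding X(2) lop_cls(1)[OF f X(1)] by (rule hilb_cls[OF lop_cls(2)[OF f X(1)]])
qed (simp add: lop_def)

lemma lop_adjoint:
  fixes f :: "real^'n \<Rightarrow> 'c::unital_cstar_algebra"
  assumes f: "f \<in> schwartz" and "\<xi> \<in> hilb" "\<eta> \<in> hilb"
  shows "hilb_inner (lop f \<xi>) \<eta> = hilb_inner \<xi> (lop (\<lambda>x. cstar (f x)) \<eta>)"
proof -
  have fs: "(\<lambda>x. cstar (f x)) \<in> schwartz" by (rule schwartz_cstar[OF f])
  obtain X where X: "X \<in> cauchy_seqs schwartz schwartz_dist2" "\<xi> = hilb.cls X" using hilb_cases[OF assms(2)] .
  obtain Y where Y: "Y \<in> cauchy_seqs schwartz schwartz_dist2" "\<eta> = hilb.cls Y" using hilb_cases[OF assms(3)] .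
  have "schwartz_inner (f \<odot> X k) (Y k) = schwartz_inner (X k) ((\<lambda>x. cstar (f x)) \<odot> Y k)" for k
    by (intro inner_rp_adjoint f hilb.CS_in X Y)
  then show ?thesis
    using hilb_inner_tendsto[OF lop_cls(2)[OF f X(1)] Y(1)] hilb_inner_tendsto[OF X(1) lop_cls(2)[OF fs Y(1)]]
    unfolding X(2) Y(2) lop_cls(1)[OF f X(1)] lop_cls(1)[OF fs Y(1)] by (simp add: LIMSEQ_unique)
qed

text \<open>A competitor \<open>T\<close> is given as adjointable, without continuity, so density
  alone does not identify it. Testing on embedded Schwartz functions first determines its adjoint
  \<open>S\<close>, and \<open>S\<close> then determines \<open>T\<close>.\<close>

lemma left_op_eq_lop:
  fixes f :: "real^'n \<Rightarrow> 'c::unital_cstar_algebra"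
  assumes f: "f \<in> schwartz"
  shows "left_op J f = lop f"
  unfolding left_op_def
proof (rule the_equality)
  have fs: "(\<lambda>x. cstar (f x)) \<in> schwartz" by (rule schwartz_cstar[OF f])
  have adj: "lop f \<in> adjointable"
    unfolding adjointable_def
    by (rule CollectI, rule conjI[OF lop_in[OF f]], rule bexI[OF _ lop_in[OF fs]], intro ballI, rule lop_adjoint[OF f])
  have emb: "lop f (hilb_embed g) = hilb_embed (f \<odot> g)" if "g \<in> schwartz" for g
    unfolding hilb_embed_cls by (rule lop_cls(1)[OF f hilb.const_CS[OF that]])
  show "lop f \<in> adjointable \<and> (\<forall>g\<in>schwartz. lop f (hilb_embed g) = hilb_embed (f \<odot> g))"
    using adj emb by blast
  fix T :: "(nat \<Rightarrow> real^'n \<Rightarrow> 'c) set \<Rightarrow> (nat \<Rightarrow> real^'n \<Rightarrow> 'c) set"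
  assume "T \<in> adjointable \<and> (\<forall>g\<in>schwartz. T (hilb_embed g) = hilb_embed (f \<odot> g))"
  then obtain S where T: "T \<in> hilb \<rightarrow>\<^sub>E hilb" and S: "S \<in> hilb \<rightarrow>\<^sub>E hilb"
    and TS': "\<forall>\<xi>\<in>hilb. \<forall>\<eta>\<in>hilb. hilb_inner (T \<xi>) \<eta> = hilb_inner \<xi> (S \<eta>)"
    and Te': "\<forall>g\<in>schwartz. T (hilb_embed g) = hilb_embed (f \<odot> g)"
    unfolding adjointable_def by (elim conjE CollectE bexE)
  note TS = TS'[rule_format] and Te = Te'[rule_format]
  note Tin = PiE_mem[OF T] and Sin = PiE_mem[OF S] and Lin = PiE_mem[OF lop_in[OF f]]
    and Lsin = PiE_mem[OF lop_in[OF fs]]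
  have SL: "S \<eta> = lop (\<lambda>x. cstar (f x)) \<eta>" if \<eta>: "\<eta> \<in> hilb" for \<eta> :: "(nat \<Rightarrow> real^'n \<Rightarrow> 'c) set"
  proof (rule hilb_inner_nondegenerate[OF Sin[OF \<eta>] Lsin[OF \<eta>]])
    fix g :: "real^'n \<Rightarrow> 'c" assume g: "g \<in> schwartz"
    have "hilb_inner (hilb_embed g) (S \<eta>) = hilb_inner (T (hilb_embed g)) \<eta>"
      by (rule TS[OF hilb_embed_in[OF g] \<eta>, symmetric])
    also have "\<dots> = hilb_inner (lop f (hilb_embed g)) \<eta>" by (simp only: Te[OF g] emb[OF g])
    also have "\<dots> = hilb_inner (hilb_embed g) (lop (\<lambda>x. cstar (f x)) \<eta>)"
      by (rule lop_adjoint[OF f hilb_embed_in[OF g] \<eta>])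
    finally show "hilb_inner (hilb_embed g) (S \<eta>) = hilb_inner (hilb_embed g) (lop (\<lambda>x. cstar (f x)) \<eta>)" .
  qed
  show "T = lop f"
  proof (rule PiE_ext[OF T lop_in[OF f]])
    fix \<xi> assume \<xi>: "\<xi> \<in> (hilb :: (nat \<Rightarrow> real^'n \<Rightarrow> 'c) set set)"
    show "T \<xi> = lop f \<xi>"
    proof (rule hilb_inner_nondegenerate[OF Tin[OF \<xi>] Lin[OF \<xi>]])
      fix g :: "real^'n \<Rightarrow> 'c" assume g: "g \<in> schwartz"
      note e = hilb_embed_in[OF g]
      have "hilb_inner (T \<xi>) (hilb_embed g) = hilb_inner (lop f \<xi>) (hilb_embed g)"
        unfolding TS[OF \<xi> e] SL[OF e] lop_adjoint[OF f \<xi> e] ..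
      then have "cstar (hilb_inner (T \<xi>) (hilb_embed g)) = cstar (hilb_inner (lop f \<xi>) (hilb_embed g))"
        by (rule arg_cong)
      then show "hilb_inner (hilb_embed g) (T \<xi>) = hilb_inner (hilb_embed g) (lop f \<xi>)"
        unfolding cstar_hilb_inner[OF Tin[OF \<xi>] e] cstar_hilb_inner[OF Lin[OF \<xi>] e] .
    qed
  qed
qed

abbreviation nJ :: "(real^'n \<Rightarrow> 'c::unital_cstar_algebra) \<Rightarrow> real" where
  "nJ \<equiv> schwartz_cstar_norm J"

lemma hilb_norm_lop_le:
  fixes f :: "real^'n \<Rightarrow> 'c::unital_cstar_algebra"
  assumes f: "f \<in> schwartz" and C: "\<forall>g\<in>schwartz. schwartz_norm2 (f \<odot> g) \<le> C * schwartz_norm2 g"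
    and \<xi>: "\<xi> \<in> hilb"
  shows "hilb_norm (lop f \<xi>) \<le> C * hilb_norm \<xi>"
proof -
  obtain X where X: "X \<in> cauchy_seqs schwartz schwartz_dist2" "\<xi> = hilb.cls X" using hilb_cases[OF \<xi>] .
  have "(\<lambda>k. C * schwartz_norm2 (X k)) \<longlonglongrightarrow> C * hilb_norm \<xi>"
    unfolding X(2) by (intro tendsto_mult tendsto_const hilb_norm_tendsto X)
  moreover have "(\<lambda>k. schwartz_norm2 (f \<odot> X k)) \<longlonglongrightarrow> hilb_norm (lop f \<xi>)"
    unfolding X(2) lop_cls(1)[OF f X(1)] by (rule hilb_norm_tendsto[OF lop_cls(2)[OF f X(1)]])
  moreover have "schwartz_norm2 (f \<odot> X k) \<le> C * schwartz_norm2 (X k)" for k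
    using C hilb.CS_in[OF X(1)] by blast
  ultimately show ?thesis by (intro LIMSEQ_le) auto
qed

lemma hilb_norm_nonneg: "0 \<le> hilb_norm \<xi>"
  by (simp add: hilb_norm_def)

lemma hilb_norm_embed:
  fixes g :: "real^'n \<Rightarrow> 'c::unital_cstar_algebra"
  assumes "g \<in> schwartz"
  shows "hilb_norm (hilb_embed g) = schwartz_norm2 g"
  using hilb_norm_tendsto[OF hilb.const_CS[OF assms]] unfolding hilb_embed_cls by (simp add: LIMSEQ_const_iff)

lemma nJ_le:
  fixes f :: "real^'n \<Rightarrow> 'c::unital_cstar_algebra"
  assumes f: "f \<in> schwartz" and C: "0 \<le> C" "\<forall>g\<in>schwartz. schwartz_norm2 (f \<odot> g) \<le> C * schwartz_norm2 g"
  shows "nJ f \<le> C"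
  unfolding schwartz_cstar_norm_def left_op_eq_lop[OF f] op_norm_def
proof (rule cSup_least)
  let ?z = "hilb_embed (\<lambda>_::real^'n. 0 :: 'c)"
  have "?z \<in> hilb \<and> hilb_norm ?z \<le> 1"
    using hilb_embed_in[OF schwartz_zero] by (simp add: hilb_norm_embed schwartz_zero)
  then have "hilb_norm (lop f ?z) \<in> {hilb_norm (lop f \<xi>) |\<xi>. \<xi> \<in> hilb \<and> hilb_norm \<xi> \<le> 1}"
    by (intro CollectI exI[of _ ?z] conjI refl) simp_all
  then show "{hilb_norm (lop f \<xi>) |\<xi>. \<xi> \<in> hilb \<and> hilb_norm \<xi> \<le> 1} \<noteq> {}"
    by (rule ex_in_conv[THEN iffD1, OF exI])
  fix r assume "r \<in> {hilb_norm (lop f \<xi>) |\<xi>. \<xi> \<in> hilb \<and> hilb_norm \<xi> \<le> 1}"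
  then obtain \<xi> where \<xi>: "\<xi> \<in> hilb" "hilb_norm \<xi> \<le> 1" and r: "r = hilb_norm (lop f \<xi>)"
      by (elim CollectE exE conjE)
  have "hilb_norm (lop f \<xi>) \<le> C * hilb_norm \<xi>" by (rule hilb_norm_lop_le[OF f C(2) \<xi>(1)])
  also have "\<dots> \<le> C" using mult_left_mono[OF \<xi>(2) C(1)] by simp
  finally show "r \<le> C" by (simp add: r)
qed

lemma nJ_upper:
  fixes f :: "real^'n \<Rightarrow> 'c::unital_cstar_algebra"
  assumes f: "f \<in> schwartz" and \<xi>: "\<xi> \<in> hilb" "hilb_norm \<xi> \<le> 1"
  shows "hilb_norm (lop f \<xi>) \<le> nJ f"
  unfolding schwartz_cstar_norm_def left_op_eq_lop[OF f] op_norm_def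
proof (rule cSup_upper)
  show "hilb_norm (lop f \<xi>) \<in> {hilb_norm (lop f \<xi>) |\<xi>. \<xi> \<in> hilb \<and> hilb_norm \<xi> \<le> 1}"
    by (intro CollectI exI[of _ \<xi>] conjI refl \<xi>)
  obtain C where C: "0 \<le> C" "\<forall>g\<in>schwartz. schwartz_norm2 (f \<odot> g) \<le> C * schwartz_norm2 g" by (rule rp_bounded[OF f])
  show "bdd_above {hilb_norm (lop f \<xi>) |\<xi>. \<xi> \<in> hilb \<and> hilb_norm \<xi> \<le> 1}"
  proof (rule bdd_aboveI[of _ C])
    fix r assume "r \<in> {hilb_norm (lop f \<xi>) |\<xi>. \<xi> \<in> hilb \<and> hilb_norm \<xi> \<le> 1}"
    then obtain \<xi> where \<xi>: "\<xi> \<in> hilb" "hilb_norm \<xi> \<le> 1" and r: "r = hilb_norm (lop f \<xi>)"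
      by (elim CollectE exE conjE)
    have "hilb_norm (lop f \<xi>) \<le> C * hilb_norm \<xi>" by (rule hilb_norm_lop_le[OF f C(2) \<xi>(1)])
    also have "\<dots> \<le> C" using mult_left_mono[OF \<xi>(2) C(1)] by simp
    finally show "r \<le> C" by (simp add: r)
  qed
qed

lemma nJ_nonneg:
  fixes f :: "real^'n \<Rightarrow> 'c::unital_cstar_algebra"
  assumes f: "f \<in> schwartz"
  shows "0 \<le> nJ f"
  by (rule order_trans[OF hilb_norm_nonneg nJ_upper[OF f hilb_embed_in[OF schwartz_zero]]])
    (simp add: hilb_norm_embed schwartz_zero)

text \<open>With \<open>nJ_le\<close> this characterises the C*-norm as the least bound of left
  multiplication on Schwartz functions, so later norm estimates stay outside the completed
  module.\<close>

lemma norm2_rp_le_nJ: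
  fixes f g :: "real^'n \<Rightarrow> 'c::unital_cstar_algebra"
  assumes f: "f \<in> schwartz" and g: "g \<in> schwartz"
  shows "schwartz_norm2 (f \<odot> g) \<le> nJ f * schwartz_norm2 g"
proof (cases "schwartz_norm2 g = 0")
  case True
  \<comment> \<open>A null vector cannot be normalised; the a priori bound shows that its image is
    null as well.\<close>
  obtain C where "\<forall>g\<in>schwartz. schwartz_norm2 (f \<odot> g) \<le> C * schwartz_norm2 g" by (rule rp_bounded[OF f])
  then have "schwartz_norm2 (f \<odot> g) \<le> C * schwartz_norm2 g" using g by blast
  then show ?thesis using True by simp
next
  case False
  then have p: "0 < schwartz_norm2 g" by (simp add: less_le)
  let ?c = "complex_of_real (1 / schwartz_norm2 g)"
  let ?g = "\<lambda>x. ?c *\<^sub>C g x"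
  have gs: "?g \<in> schwartz" by (rule schwartz_scaleC[OF g])
  have n1: "schwartz_norm2 ?g = 1" unfolding norm2_scaleC using p by (simp add: norm_divide)
  have "hilb_norm (lop f (hilb_embed ?g)) \<le> nJ f"
    by (rule nJ_upper[OF f hilb_embed_in[OF gs]]) (simp only: hilb_norm_embed[OF gs] n1)
  moreover have "lop f (hilb_embed ?g) = hilb_embed (f \<odot> ?g)"
    unfolding hilb_embed_cls by (rule lop_cls(1)[OF f hilb.const_CS[OF gs]])
  ultimately have "schwartz_norm2 (f \<odot> ?g) \<le> nJ f" by (simp only: hilb_norm_embed[OF schwartz_rp[OF f gs]])
  moreover have "schwartz_norm2 (f \<odot> ?g) = schwartz_norm2 (f \<odot> g) / schwartz_norm2 g"
    unfolding rp_scaleC_right[OF f g] norm2_scaleC using p by (simp add: norm_divide)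
  ultimately show ?thesis using p by (simp add: pos_divide_le_eq)
qed

lemma nJ_zero: "nJ (\<lambda>_. 0 :: 'c::unital_cstar_algebra) = 0"
proof (rule antisym[OF _ nJ_nonneg[OF schwartz_zero]])
  have "(\<lambda>_. 0) \<odot> g = (\<lambda>_. 0)" if g: "g \<in> schwartz" for g :: "real^'n \<Rightarrow> 'c"
    using rp_scaleC_left[OF schwartz_zero g, of 0] by simp
  then show "nJ (\<lambda>_. 0 :: 'c) \<le> 0" by (intro nJ_le[OF schwartz_zero]) simp_all
qed

lemma nJ_add:
  fixes f g :: "real^'n \<Rightarrow> 'c::unital_cstar_algebra"
  assumes f: "f \<in> schwartz" and g: "g \<in> schwartz"
  shows "nJ (\<lambda>x. f x + g x) \<le> nJ f + nJ g"
proof (rule nJ_le[OF schwartz_add[OF f g]])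
  show "0 \<le> nJ f + nJ g" by (rule add_nonneg_nonneg[OF nJ_nonneg[OF f] nJ_nonneg[OF g]])
  show "\<forall>h\<in>schwartz. schwartz_norm2 ((\<lambda>x. f x + g x) \<odot> h) \<le> (nJ f + nJ g) * schwartz_norm2 h"
  proof
    fix h :: "real^'n \<Rightarrow> 'c" assume h: "h \<in> schwartz"
    show "schwartz_norm2 ((\<lambda>x. f x + g x) \<odot> h) \<le> (nJ f + nJ g) * schwartz_norm2 h"
      unfolding rp_add_left[OF f g h] distrib_right
      by (rule order_trans[OF norm2_triangle[OF schwartz_dec[OF schwartz_rp[OF f h]] schwartz_dec[OF schwartz_rp[OF g h]]]
            add_mono[OF norm2_rp_le_nJ[OF f h] norm2_rp_le_nJ[OF g h]]])
  qed
qed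

lemma nJ_scaleC:
  fixes f :: "real^'n \<Rightarrow> 'c::unital_cstar_algebra"
  assumes f: "f \<in> schwartz"
  shows "nJ (\<lambda>x. c *\<^sub>C f x) \<le> cmod c * nJ f"
proof (rule nJ_le[OF schwartz_scaleC[OF f]])
  show "0 \<le> cmod c * nJ f" by (intro mult_nonneg_nonneg norm_ge_zero nJ_nonneg[OF f])
  show "\<forall>h\<in>schwartz. schwartz_norm2 ((\<lambda>x. c *\<^sub>C f x) \<odot> h) \<le> cmod c * nJ f * schwartz_norm2 h"
  proof
    fix h :: "real^'n \<Rightarrow> 'c" assume h: "h \<in> schwartz"
    show "schwartz_norm2 ((\<lambda>x. c *\<^sub>C f x) \<odot> h) \<le> cmod c * nJ f * schwartz_norm2 h"
      unfolding rp_scaleC_left[OF f h] norm2_scaleC mult.assoc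
      by (rule mult_left_mono[OF norm2_rp_le_nJ[OF f h] norm_ge_zero])
  qed
qed

lemma nJ_minus:
  fixes f :: "real^'n \<Rightarrow> 'c::unital_cstar_algebra"
  assumes f: "f \<in> schwartz"
  shows "nJ (\<lambda>x. - f x) = nJ f"
  using nJ_scaleC[OF f, of "- 1"] nJ_scaleC[OF schwartz_minus[OF f], of "- 1"]
  by (simp add: scaleC_minus_one)

lemma nJ_diff:
  fixes f g :: "real^'n \<Rightarrow> 'c::unital_cstar_algebra"
  assumes f: "f \<in> schwartz" and g: "g \<in> schwartz"
  shows "nJ (\<lambda>x. f x - g x) \<le> nJ f + nJ g"
  using nJ_add[OF f schwartz_minus[OF g]] by (simp add: nJ_minus[OF g])

lemma nJ_rp:
  fixes f g :: "real^'n \<Rightarrow> 'c::unital_cstar_algebra"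
  assumes f: "f \<in> schwartz" and g: "g \<in> schwartz"
  shows "nJ (f \<odot> g) \<le> nJ f * nJ g"
proof (rule nJ_le[OF schwartz_rp[OF f g]])
  show "0 \<le> nJ f * nJ g" by (rule mult_nonneg_nonneg[OF nJ_nonneg[OF f] nJ_nonneg[OF g]])
  show "\<forall>h\<in>schwartz. schwartz_norm2 ((f \<odot> g) \<odot> h) \<le> nJ f * nJ g * schwartz_norm2 h"
  proof
    fix h :: "real^'n \<Rightarrow> 'c" assume h: "h \<in> schwartz"
    show "schwartz_norm2 ((f \<odot> g) \<odot> h) \<le> nJ f * nJ g * schwartz_norm2 h"
      unfolding rp_assoc[OF f g h] mult.assoc
      by (rule order_trans[OF norm2_rp_le_nJ[OF f schwartz_rp[OF g h]]
            mult_left_mono[OF norm2_rp_le_nJ[OF g h] nJ_nonneg[OF f]]])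
  qed
qed

text \<open>Translation is an automorphism of the product and an isometry of the module; the
  inequality for \<open>a\<close> and for \<open>- a\<close> gives equality.\<close>

lemma nJ_translate:
  fixes f :: "real^'n \<Rightarrow> 'c::unital_cstar_algebra"
  assumes f: "f \<in> schwartz"
  shows "nJ (\<lambda>x. f (x + a)) = nJ f"
proof -
  have le: "nJ (\<lambda>x. f (x + a)) \<le> nJ f" if f: "f \<in> schwartz" for f :: "real^'n \<Rightarrow> 'c" and a
  proof (rule nJ_le[OF schwartz_translate(1)[OF f] nJ_nonneg[OF f]])
    show "\<forall>g\<in>schwartz. schwartz_norm2 ((\<lambda>x. f (x + a)) \<odot> g) \<le> nJ f * schwartz_norm2 g"
    proof
      fix g :: "real^'n \<Rightarrow> 'c" assume g: "g \<in> schwartz"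
      have gt: "(\<lambda>x. g (x + - a)) \<in> schwartz" by (rule schwartz_translate(1)[OF g])
      have "((\<lambda>x. f (x + a)) \<odot> g) x = (f \<odot> (\<lambda>x. g (x + - a))) (x + a)" for x
        unfolding rp_translate by simp
      then have "schwartz_norm2 ((\<lambda>x. f (x + a)) \<odot> g) = schwartz_norm2 (\<lambda>x. (f \<odot> (\<lambda>x. g (x + - a))) (x + a))"
        by metis
      also have "\<dots> = schwartz_norm2 (f \<odot> (\<lambda>x. g (x + - a)))" by (rule norm2_translate)
      also have "\<dots> \<le> nJ f * schwartz_norm2 (\<lambda>x. g (x + - a))" by (rule norm2_rp_le_nJ[OF f gt])
      also have "schwartz_norm2 (\<lambda>x. g (x + - a)) = schwartz_norm2 g" by (rule norm2_translate)
      finally show "schwartz_norm2 ((\<lambda>x. f (x + a)) \<odot> g) \<le> nJ f * schwartz_norm2 g" .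
    qed
  qed
  show ?thesis using le[OF f, of a] le[OF schwartz_translate(1)[OF f], of "- a" a] by simp
qed

end

section \<open>Local inverses\<close>

text \<open>A Sobolev inequality for the module norm: Cauchy--Schwarz against \<open>wt\<close> bounds the Fourier
  transform, and Fourier inversion bounds the function.\<close>

definition sob :: "(real^'n::finite \<Rightarrow> 'c::real_normed_vector) \<Rightarrow> real^'n \<Rightarrow> 'c" where
  "sob F x = jap x ^ DIM(real^'n) *\<^sub>R (bessel ^^ DIM(real^'n)) F x"

lemma norm_fourier_le_norm2:
  fixes G :: "real^'n::finite \<Rightarrow> 'c::unital_cstar_algebra"
  assumes G: "G \<in> schwartz"
  shows "norm (fourier G p) \<le> schwartz_norm2 (\<lambda>x::real^'n. wt x *\<^sub>R (1::'c))
    * schwartz_norm2 (\<lambda>x. jap x ^ DIM(real^'n) *\<^sub>R G x)"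
proof -
  let ?u = "\<lambda>x::real^'n. ec (p \<bullet> x) *\<^sub>C (wt x *\<^sub>R (1::'c))"
  let ?G = "\<lambda>x. jap x ^ DIM(real^'n) *\<^sub>R G x"
  have "dec ?u"
  proof (rule decI[where K = 1])
    show "norm (?u x) \<le> 1 * wt x" for x
      using norm_scaleR_one_le[OF wt_nonneg[of x], where 'c = 'c] by simp
  qed (intro continuous_intros)
  moreover have "dec ?G" by (rule schwartz_dec[OF schwartz_jap[OF G]])
  ultimately have "norm (schwartz_inner ?u ?G) \<le> schwartz_norm2 ?u * schwartz_norm2 ?G"
    by (rule inner_cauchy_schwarz)
  moreover have "cstar (?u x) * ?G x = ec (- (p \<bullet> x)) *\<^sub>C G x" for x
  proof -
    have "jap x ^ DIM(real^'n) * wt x = 1" using jap_pos[of x] by (simp add: wt_def)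
    then show ?thesis by (simp add: cstar_scaleC cstar_scaleR cnj_ec mult_scaleC_left scaleC_scaleR)
  qed
  ultimately show ?thesis by (simp add: schwartz_inner_def fourier_def norm2_modulate)
qed

text \<open>The two powers in \<open>sob\<close> have different tasks: that of \<open>jap\<close>
  offsets \<open>wt\<close> in Cauchy-Schwarz, that of \<open>bessel\<close> gives the transform the
  decay \<open>wt p\<close> under which it can be integrated back.\<close>

lemma sobolev:
  fixes F :: "real^'n::finite \<Rightarrow> 'c::unital_cstar_algebra"
  assumes F: "F \<in> schwartz"
  shows "norm (F x) \<le> (schwartz_norm2 (\<lambda>x::real^'n. wt x *\<^sub>R (1::'c)) * wt_total TYPE(real^'n)) * schwartz_norm2 (sob F)"
proof -
  let ?w = "schwartz_norm2 (\<lambda>x::real^'n. wt x *\<^sub>R (1::'c))"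
  have b: "norm (ec (p \<bullet> x) *\<^sub>C fourier F p) \<le> (?w * schwartz_norm2 (sob F)) * wt p" for p
  proof -
    have j: "0 < jap p ^ DIM(real^'n)" using jap_pos[of p] by simp
    have "norm (fourier ((bessel ^^ DIM(real^'n)) F) p) \<le> ?w * schwartz_norm2 (sob F)"
      unfolding sob_def[abs_def] by (rule norm_fourier_le_norm2[OF schwartz_bessel_funpow[OF F]])
    then have "jap p ^ DIM(real^'n) * norm (fourier F p) \<le> ?w * schwartz_norm2 (sob F)"
      unfolding fourier_bessel_funpow[OF F] using j by simp
    then show ?thesis using j by (simp add: wt_def field_simps)
  qed
  have c: "continuous_on UNIV (\<lambda>p. ec (p \<bullet> x) *\<^sub>C fourier F p)"
    by (intro continuous_intros fourier_cont[OF F])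
  show ?thesis
    using norm_integral_wt_bound[OF c b] unfolding fourier_inversion[OF F] by (simp add: mult_ac)
qed

lemma schwartz_partial_derivs: "f \<in> schwartz \<Longrightarrow> partial_derivs is f \<in> schwartz"
  by (induction "is") (simp_all add: partial_derivs_Cons schwartz_partial_deriv)

lemma geometric_max:
  fixes C D r s u v :: real
  assumes "0 \<le> C" "0 \<le> D" "0 \<le> r" "0 \<le> s" "u \<le> C * r ^ k" "v \<le> D * s ^ k"
  shows "u + v \<le> (C + D) * (max r s) ^ (k::nat)"
proof -
  have "C * r ^ k \<le> C * (max r s) ^ k" "D * s ^ k \<le> D * (max r s) ^ k"
    using assms by (auto intro!: mult_left_mono power_mono)
  then show ?thesis using assms by (simp add: distrib_right)
qed

context skew_form
begin

text \<open>A differential seminorm; it is submultiplicative by the Leibniz rule, and for small \<open>s\<close> it is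
  close to the operator norm.\<close>

primrec dn :: "real \<Rightarrow> nat \<Rightarrow> (real^'n \<Rightarrow> 'c::unital_cstar_algebra) \<Rightarrow> real" where
  "dn s 0 g = nJ g"
| "dn s (Suc m) g = dn s m g + s * (\<Sum>i\<in>UNIV. dn s m (partial_deriv i g))"

lemma dn_nonneg:
  fixes g :: "real^'n \<Rightarrow> 'c::unital_cstar_algebra"
  assumes s: "0 \<le> s" and "g \<in> schwartz"
  shows "0 \<le> dn s m g"
  using assms(2)
proof (induction m arbitrary: g)
  case (Suc m)
  have "0 \<le> s * (\<Sum>i\<in>UNIV. dn s m (partial_deriv i g))"
    by (intro mult_nonneg_nonneg s sum_nonneg Suc.IH schwartz_partial_deriv Suc.prems)
  then show ?case using Suc.IH[OF Suc.prems] by simp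
qed (simp add: nJ_nonneg)

lemma dn_add:
  fixes g h :: "real^'n \<Rightarrow> 'c::unital_cstar_algebra"
  assumes s: "0 \<le> s" and "g \<in> schwartz" "h \<in> schwartz"
  shows "dn s m (\<lambda>x. g x + h x) \<le> dn s m g + dn s m h"
  using assms(2,3)
proof (induction m arbitrary: g h)
  case (Suc m)
  have pd: "partial_deriv i (\<lambda>x. g x + h x) = (\<lambda>x. partial_deriv i g x + partial_deriv i h x)" for i
    by (rule ext, rule partial_deriv_add[OF schwartz_differentiable[OF Suc.prems(1)] schwartz_differentiable[OF Suc.prems(2)]])
  have "(\<Sum>i\<in>UNIV. dn s m (partial_deriv i (\<lambda>x. g x + h x)))
      \<le> (\<Sum>i\<in>UNIV. dn s m (partial_deriv i g) + dn s m (partial_deriv i h))"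
    unfolding pd by (intro sum_mono Suc.IH schwartz_partial_deriv Suc.prems)
  then have "s * (\<Sum>i\<in>UNIV. dn s m (partial_deriv i (\<lambda>x. g x + h x)))
      \<le> s * (\<Sum>i\<in>UNIV. dn s m (partial_deriv i g) + dn s m (partial_deriv i h))"
    using s by (rule mult_left_mono)
  then show ?case using Suc.IH[OF Suc.prems] by (simp add: sum.distrib distrib_left)
qed (simp add: nJ_add)

lemma dn_rp:
  fixes g h :: "real^'n \<Rightarrow> 'c::unital_cstar_algebra"
  assumes s: "0 \<le> s" and "g \<in> schwartz" "h \<in> schwartz"
  shows "dn s m (g \<odot> h) \<le> dn s m g * dn s m h"
  using assms(2,3)
proof (induction m arbitrary: g h)
  case (Suc m)
  note g = Suc.prems(1) and h = Suc.prems(2)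
  note dg = schwartz_partial_deriv[OF g] and dh = schwartz_partial_deriv[OF h]
  define A where "A = (\<Sum>i\<in>UNIV. dn s m (partial_deriv i g))"
  define B where "B = (\<Sum>i\<in>UNIV. dn s m (partial_deriv i h))"
  have AB: "0 \<le> A" "0 \<le> B" unfolding A_def B_def by (intro sum_nonneg dn_nonneg s dg dh)+
  have "(\<Sum>i\<in>UNIV. dn s m (partial_deriv i (g \<odot> h)))
      \<le> (\<Sum>i\<in>UNIV. dn s m (partial_deriv i g) * dn s m h + dn s m g * dn s m (partial_deriv i h))"
    unfolding rp_partial_deriv[OF g h]
    by (rule sum_mono, rule order_trans[OF dn_add[OF s schwartz_rp[OF dg h] schwartz_rp[OF g dh]]
        add_mono[OF Suc.IH[OF dg h] Suc.IH[OF g dh]]])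
  also have "\<dots> = A * dn s m h + dn s m g * B"
    by (simp add: A_def B_def sum.distrib sum_distrib_left sum_distrib_right)
  finally have "s * (\<Sum>i\<in>UNIV. dn s m (partial_deriv i (g \<odot> h))) \<le> s * (A * dn s m h + dn s m g * B)"
    using s by (rule mult_left_mono)
  then have "dn s (Suc m) (g \<odot> h) \<le> dn s m g * dn s m h + s * (A * dn s m h + dn s m g * B)"
    using Suc.IH[OF g h] by simp
  \<comment> \<open>The slack is the nonnegative term \<open>s * A * (s * B)\<close>.\<close>
  also have "\<dots> \<le> (dn s m g + s * A) * (dn s m h + s * B)"
    using s AB by (simp add: algebra_simps)
  finally show ?case by (simp add: A_def B_def)
qed (simp add: nJ_rp)

text \<open>Each level of \<open>dn\<close> adds one derivative with a factor \<open>s\<close>. The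
  induction is on the reversed list because the recursion differentiates \<open>g\<close> itself,
  and the derivative next to \<open>g\<close> is the last entry.\<close>

lemma dn_ge:
  fixes g :: "real^'n \<Rightarrow> 'c::unital_cstar_algebra"
  assumes s: "0 \<le> s" and "g \<in> schwartz"
  shows "s ^ length is * nJ (partial_derivs is g) \<le> dn s (length is) g"
  using assms(2)
proof (induction "is" arbitrary: g rule: rev_induct)
  case (snoc i "is")
  note dg = schwartz_partial_deriv[OF snoc.prems]
  have "s ^ length is * nJ (partial_derivs is (partial_deriv i g)) \<le> dn s (length is) (partial_deriv i g)"
    by (rule snoc.IH[OF dg])
  also have "\<dots> \<le> (\<Sum>i\<in>UNIV. dn s (length is) (partial_deriv i g))"
    by (intro member_le_sum dn_nonneg s schwartz_partial_deriv snoc.prems) simp_all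
  finally have "s * (s ^ length is * nJ (partial_derivs is (partial_deriv i g)))
      \<le> s * (\<Sum>i\<in>UNIV. dn s (length is) (partial_deriv i g))"
    using s by (rule mult_left_mono)
  then show ?case
    using dn_nonneg[OF s snoc.prems, of "length is"] by (simp add: partial_derivs_partial_deriv mult.assoc)
qed simp

lemma dn_tendsto:
  fixes g :: "real^'n \<Rightarrow> 'c::unital_cstar_algebra"
  shows "(\<lambda>n. dn (inverse (real (Suc n))) m g) \<longlonglongrightarrow> nJ g"
proof (induction m arbitrary: g)
  case (Suc m)
  have "(\<lambda>n. dn (inverse (real (Suc n))) m g
      + inverse (real (Suc n)) * (\<Sum>i\<in>UNIV. dn (inverse (real (Suc n))) m (partial_deriv i g)))
      \<longlonglongrightarrow> nJ g + 0 * (\<Sum>i\<in>UNIV. nJ (partial_deriv i g))"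
    by (intro tendsto_add tendsto_mult tendsto_sum Suc.IH LIMSEQ_inverse_real_of_nat)
  then show ?case by simp
qed simp

section \<open>Powers and the decay of their derivatives\<close>

text \<open>\<open>pw f k\<close> is the power \<open>k + 1\<close>, as there is no unit to start
  from.\<close>

primrec pw :: "(real^'n \<Rightarrow> 'c::unital_cstar_algebra) \<Rightarrow> nat \<Rightarrow> real^'n \<Rightarrow> 'c" where
  "pw f 0 = f"
| "pw f (Suc k) = pw f k \<odot> f"

lemma schwartz_pw: "f \<in> schwartz \<Longrightarrow> pw f k \<in> schwartz"
  for f :: "real^'n \<Rightarrow> 'c::unital_cstar_algebra"
  by (induction k) (simp_all add: schwartz_rp)

lemma pw_commute:
  fixes f :: "real^'n \<Rightarrow> 'c::unital_cstar_algebra"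
  assumes f: "f \<in> schwartz"
  shows "f \<odot> pw f k = pw f k \<odot> f"
proof (induction k)
  case (Suc k)
  have "f \<odot> pw f (Suc k) = (f \<odot> pw f k) \<odot> f" by (simp add: rp_assoc[OF f schwartz_pw[OF f] f])
  then show ?case using Suc.IH by simp
qed simp

text \<open>Once the order \<open>m\<close> of the derivative is fixed, \<open>s\<close> is chosen
  with \<open>dn s m f < 1\<close>. Submultiplicativity gives geometric decay of \<open>dn\<close>,
  and \<open>s ^ m\<close> is divided out into the constant; the rate thus depends on the
  derivative.\<close>

lemma nJ_partial_derivs_pw:
  fixes f :: "real^'n \<Rightarrow> 'c::unital_cstar_algebra"
  assumes f: "f \<in> schwartz" and N: "nJ f < 1"
  obtains C r where "0 \<le> C" "0 \<le> r" "r < 1" "\<forall>k. nJ (partial_derivs is (pw f k)) \<le> C * r ^ k"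
proof -
  define m where "m = length is"
  have "\<forall>\<^sub>F n in sequentially. dn (inverse (real (Suc n))) m f < 1"
    by (rule order_tendstoD(2)[OF dn_tendsto N])
  then obtain n where n: "dn (inverse (real (Suc n))) m f < 1" by (auto simp: eventually_sequentially)
  define s where "s = inverse (real (Suc n))"
  define r where "r = dn s m f"
  have s: "0 < s" by (simp add: s_def)
  have r: "0 \<le> r" "r < 1" unfolding r_def using dn_nonneg[of s f m] s f n by (simp_all add: s_def)
  have "dn s m (pw f k) \<le> r ^ Suc k" for k
  proof (induction k)
    case (Suc k)
    have "dn s m (pw f (Suc k)) \<le> dn s m (pw f k) * r"
      using dn_rp[OF _ schwartz_pw[OF f] f] s by (simp add: r_def)
    also have "\<dots> \<le> r ^ Suc k * r" using Suc.IH r(1) by (rule mult_right_mono)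
    finally show ?case by (simp add: mult_ac)
  qed (simp add: r_def)
  then have "s ^ m * nJ (partial_derivs is (pw f k)) \<le> r ^ k * r" for k
    using dn_ge[OF less_imp_le[OF s] schwartz_pw[OF f], of "is" k] unfolding m_def
    by (metis order_trans power_Suc2)
  then have "nJ (partial_derivs is (pw f k)) \<le> (r / s ^ m) * r ^ k" for k
    using s by (simp add: pos_le_divide_eq mult_ac)
  moreover have "0 \<le> r / s ^ m" using r s by simp
  ultimately show thesis using that r by blast
qed

text \<open>Sequences of finite sums of \<open>(\<partial>\<^sup>\<gamma> f\<^sup>k) \<odot> h\<close>; they are stable under partial derivatives and under
  multiplication by coordinates.\<close>

inductive_set pseqs :: "(real^'n \<Rightarrow> 'c::unital_cstar_algebra) \<Rightarrow> (nat \<Rightarrow> real^'n \<Rightarrow> 'c) set" for f where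
  base: "h \<in> schwartz \<Longrightarrow> (\<lambda>k. partial_derivs is (pw f k) \<odot> h) \<in> pseqs f"
| add: "a \<in> pseqs f \<Longrightarrow> b \<in> pseqs f \<Longrightarrow> (\<lambda>k x. a k x + b k x) \<in> pseqs f"

context
  fixes f :: "real^'n \<Rightarrow> 'c::unital_cstar_algebra"
  assumes f: "f \<in> schwartz" and N: "nJ f < 1"
begin

lemma pd_pw: "partial_derivs is (pw f k) \<in> schwartz"
  by (rule schwartz_partial_derivs[OF schwartz_pw[OF f]])

lemma pseqs_schwartz: "a \<in> pseqs f \<Longrightarrow> a k \<in> schwartz"
  by (induction rule: pseqs.induct) (simp_all add: schwartz_rp pd_pw schwartz_add)

lemma pseqs_zero: "(\<lambda>k x. 0) \<in> pseqs f"
proof -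
  have "partial_derivs [] (pw f k) \<odot> (\<lambda>_. 0) = (\<lambda>_. 0)" for k
    using rp_scaleC_right[OF pd_pw schwartz_zero, of "[]" k 0] by simp
  then show ?thesis using pseqs.base[OF schwartz_zero, of "[]" f] by simp
qed

lemma pseqs_sum:
  assumes "finite A" "\<And>i. i \<in> A \<Longrightarrow> a i \<in> pseqs f"
  shows "(\<lambda>k x. \<Sum>i\<in>A. a i k x) \<in> pseqs f"
  using assms by (induction A rule: finite_induct) (simp_all add: pseqs_zero pseqs.add)

lemma pseqs_scaleR: "a \<in> pseqs f \<Longrightarrow> (\<lambda>k x. r *\<^sub>R a k x) \<in> pseqs f"
proof (induction rule: pseqs.induct)
  case (base h "is")
  have "(\<lambda>k x. r *\<^sub>R (partial_derivs is (pw f k) \<odot> h) x) = (\<lambda>k. partial_derivs is (pw f k) \<odot> (\<lambda>x. complex_of_real r *\<^sub>C h x))"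
    by (rule ext, subst rp_scaleC_right[OF pd_pw base], simp only: scaleC_of_real)
  then show ?case using pseqs.base[OF schwartz_scaleC[OF base]] by simp
next
  case (add a b)
  show ?case using pseqs.add[OF add.IH] by (simp add: scaleR_add_right)
qed

lemma pseqs_deriv: "a \<in> pseqs f \<Longrightarrow> (\<lambda>k. partial_deriv i (a k)) \<in> pseqs f"
proof (induction rule: pseqs.induct)
  case (base h "is")
  show ?case
    unfolding rp_partial_deriv[OF pd_pw base] partial_derivs_Cons[symmetric]
    by (rule pseqs.add[OF pseqs.base[OF base] pseqs.base[OF schwartz_partial_deriv[OF base]]])
next
  case (add a b)
  have "partial_deriv i (\<lambda>x. a k x + b k x) = (\<lambda>x. partial_deriv i (a k) x + partial_deriv i (b k) x)" for k
    by (rule ext, rule partial_deriv_add; rule schwartz_differentiable; rule pseqs_schwartz; fact)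
  then show ?case using pseqs.add[OF add.IH] by simp
qed

text \<open>\<open>Jd i G\<close> is a constant-coefficient combination of first derivatives of
  \<open>G\<close>, so \<open>rp_coord_right\<close> stays within \<open>pseqs f\<close>.\<close>

lemma pseqs_coord: "a \<in> pseqs f \<Longrightarrow> (\<lambda>k x. x $ i *\<^sub>R a k x) \<in> pseqs f"
proof (induction rule: pseqs.induct)
  case (base h "is")
  \<comment> \<open>The coefficient of the derivative \<open>l\<close> in \<open>Jd i\<close>. It is
    moved onto \<open>h\<close> together with the sign, so that each term has the shape of the base
    rule.\<close>
  define t where "t = (\<lambda>l. complex_of_real (J (axis l 1) $ i) * (- \<i> / complex_of_real (2 * pi)))"
  let ?c = "\<lambda>l. - t l"
  have ch: "(\<lambda>x. ?c l *\<^sub>C h x) \<in> schwartz" for l by (rule schwartz_scaleC[OF base])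
  have "(Jd i G \<odot> h) x = - (\<Sum>l\<in>UNIV. (partial_deriv l G \<odot> (\<lambda>x. ?c l *\<^sub>C h x)) x)"
    if G: "G \<in> schwartz" for G :: "real^'n \<Rightarrow> 'c" and x
  proof -
    note dG = schwartz_partial_deriv[OF G]
    have J: "Jd i G = (\<lambda>x. \<Sum>l\<in>UNIV. t l *\<^sub>C partial_deriv l G x)"
      unfolding Jd_def[abs_def] t_def by (simp only: scaleC_of_real[symmetric] scaleC_scaleC)
    have "(\<lambda>x. \<Sum>l\<in>A. t l *\<^sub>C partial_deriv l G x) \<odot> h
        = (\<lambda>x. - (\<Sum>l\<in>A. (partial_deriv l G \<odot> (\<lambda>x. ?c l *\<^sub>C h x)) x))" if "finite A" for A
      using that
    proof (induction A rule: finite_induct)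
      case empty
      show ?case using rp_scaleC_left[OF schwartz_zero base, of 0] by simp
    next
      case (insert l A)
      have s: "(\<lambda>x. \<Sum>l\<in>A. t l *\<^sub>C partial_deriv l G x) \<in> schwartz"
        by (rule schwartz_sum, rule schwartz_scaleC[OF dG])
      have "(\<lambda>x. \<Sum>l\<in>insert l A. t l *\<^sub>C partial_deriv l G x)
          = (\<lambda>x. t l *\<^sub>C partial_deriv l G x + (\<Sum>l\<in>A. t l *\<^sub>C partial_deriv l G x))"
        using insert.hyps by (intro ext) simp
      then have "(\<lambda>x. \<Sum>l\<in>insert l A. t l *\<^sub>C partial_deriv l G x) \<odot> h
          = (\<lambda>x. (t l *\<^sub>C (partial_deriv l G \<odot> h) x)
             + ((\<lambda>x. \<Sum>l\<in>A. t l *\<^sub>C partial_deriv l G x) \<odot> h) x)"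
        by (simp only: rp_add_left[OF schwartz_scaleC[OF dG] s base] rp_scaleC_left[OF dG base])
      also have "\<dots> = (\<lambda>x. - (\<Sum>l\<in>insert l A. (partial_deriv l G \<odot> (\<lambda>x. ?c l *\<^sub>C h x)) x))"
      proof -
        have "partial_deriv l G \<odot> (\<lambda>x. ?c l *\<^sub>C h x) = (\<lambda>x. - (t l *\<^sub>C (partial_deriv l G \<odot> h) x))"
          by (rule trans[OF rp_scaleC_right[OF dG base]]) (simp only: scaleC_minus_left)
        then show ?thesis unfolding insert.IH sum.insert[OF insert.hyps] by simp
      qed
      finally show ?case .
    qed
    from this[OF finite_class.finite_UNIV] show ?thesis unfolding J by simp
  qed
  then have "(\<lambda>k x. x $ i *\<^sub>R (partial_derivs is (pw f k) \<odot> h) x)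
      = (\<lambda>k x. (partial_derivs is (pw f k) \<odot> (\<lambda>x. x $ i *\<^sub>R h x)) x
        + (\<Sum>l\<in>UNIV. (partial_derivs (l # is) (pw f k) \<odot> (\<lambda>x. ?c l *\<^sub>C h x)) x))"
    by (simp only: rp_coord_right[OF pd_pw base] pd_pw partial_derivs_Cons diff_minus_eq_add)
  then show ?case
    using pseqs.add[OF pseqs.base[OF schwartz_coord[OF base]]
        pseqs_sum[OF finite_class.finite_UNIV pseqs.base[OF ch]], of "is" i "\<lambda>l. l # is"]
    by (simp only:)
next
  case (add a b)
  show ?case using pseqs.add[OF add.IH] by (simp add: scaleR_add_right)
qed

text \<open>The fixed right factor \<open>h\<close> converts the operator norms of the derivatives
  of powers, which decay geometrically, into the module norms that \<open>sobolev\<close>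
  requires.\<close>

lemma pseqs_norm2:
  "a \<in> pseqs f \<Longrightarrow> \<exists>C r. 0 \<le> C \<and> 0 \<le> r \<and> r < 1 \<and> (\<forall>k. schwartz_norm2 (a k) \<le> C * r ^ k)"
proof (induction rule: pseqs.induct)
  case (base h "is")
  obtain C r where C: "0 \<le> C" "0 \<le> r" "r < 1" "\<forall>k. nJ (partial_derivs is (pw f k)) \<le> C * r ^ k"
    by (rule nJ_partial_derivs_pw[OF f N])
  have "schwartz_norm2 (partial_derivs is (pw f k) \<odot> h) \<le> (C * schwartz_norm2 h) * r ^ k" for k
    using norm2_rp_le_nJ[OF pd_pw base, of "is" k] mult_right_mono[OF C(4)[rule_format, of k] norm2_nonneg[of h]]
    by (simp add: mult_ac)
  moreover have "0 \<le> C * schwartz_norm2 h" using C by simp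
  ultimately show ?case using C(2,3) by blast
next
  case (add a b)
  obtain C r where C: "0 \<le> C" "0 \<le> r" "r < 1" "\<forall>k. schwartz_norm2 (a k) \<le> C * r ^ k" using add.IH(1) by blast
  obtain D s where D: "0 \<le> D" "0 \<le> s" "s < 1" "\<forall>k. schwartz_norm2 (b k) \<le> D * s ^ k" using add.IH(2) by blast
  have "schwartz_norm2 (\<lambda>x. a k x + b k x) \<le> (C + D) * (max r s) ^ k" for k
    using norm2_triangle[OF schwartz_dec[OF pseqs_schwartz[OF add.hyps(1), of k]]
        schwartz_dec[OF pseqs_schwartz[OF add.hyps(2), of k]]]
      geometric_max[OF C(1) D(1) C(2) D(2) C(4)[rule_format, of k] D(4)[rule_format, of k]] by linarith
  moreover have "0 \<le> C + D" "0 \<le> max r s" "max r s < 1" using C D by auto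
  ultimately show ?case by blast
qed

lemma pseqs_jap: "a \<in> pseqs f \<Longrightarrow> (\<lambda>k x. jap x ^ m *\<^sub>R a k x) \<in> pseqs f"
proof (induction m)
  case (Suc m)
  let ?b = "\<lambda>k x. jap x ^ m *\<^sub>R a k x"
  have b: "?b \<in> pseqs f" by (rule Suc.IH[OF Suc.prems])
  have "(\<lambda>k x. ?b k x + (\<Sum>i\<in>UNIV. x $ i *\<^sub>R (x $ i *\<^sub>R ?b k x))) \<in> pseqs f"
    by (rule pseqs.add[OF b pseqs_sum[OF finite_class.finite_UNIV pseqs_coord[OF pseqs_coord[OF b]]]])
  moreover have "jap x ^ Suc m *\<^sub>R a k x = ?b k x + (\<Sum>i\<in>UNIV. x $ i *\<^sub>R (x $ i *\<^sub>R ?b k x))" for k x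
  proof -
    have j: "jap x = 1 + (\<Sum>i\<in>UNIV. x $ i * x $ i)"
      unfolding jap_def power2_norm_eq_inner inner_vec_def by simp
    have "jap x ^ Suc m *\<^sub>R a k x = (1 + (\<Sum>i\<in>UNIV. x $ i * x $ i)) *\<^sub>R ?b k x"
      unfolding j[symmetric] by simp
    also have "\<dots> = ?b k x + (\<Sum>i\<in>UNIV. (x $ i * x $ i) *\<^sub>R ?b k x)"
      unfolding scaleR_add_left scaleR_left.sum scaleR_one ..
    finally show ?thesis by (simp add: mult.assoc)
  qed
  ultimately show ?case by (simp only:)
qed simp

lemma pseqs_bessel: "a \<in> pseqs f \<Longrightarrow> (\<lambda>k. (bessel ^^ m) (a k)) \<in> pseqs f"
proof (induction m)
  case (Suc m)
  let ?b = "\<lambda>k. (bessel ^^ m) (a k)"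
  have b: "?b \<in> pseqs f" by (rule Suc.IH[OF Suc.prems])
  have "(\<lambda>k x. ?b k x + (- (1 / (4 * pi\<^sup>2))) *\<^sub>R (\<Sum>i\<in>UNIV. partial_deriv i (partial_deriv i (?b k)) x)) \<in> pseqs f"
    by (rule pseqs.add[OF b pseqs_scaleR[OF pseqs_sum[OF finite_class.finite_UNIV pseqs_deriv[OF pseqs_deriv[OF b]]]]])
  then show ?case by (simp add: bessel_def[abs_def])
qed simp

text \<open>\<open>pseqs f\<close> is stable under \<open>sob\<close>, so the module norms of
  \<open>sob (a k)\<close> decay geometrically as well, and the Sobolev inequality makes this decay
  uniform in \<open>x\<close>.\<close>

lemma pseqs_sup:
  assumes a: "a \<in> pseqs f"
  obtains C r where "0 \<le> C" "0 \<le> r" "r < 1" "\<forall>k x. norm (a k x) \<le> C * r ^ k"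
proof -
  define W where "W = schwartz_norm2 (\<lambda>x::real^'n. wt x *\<^sub>R (1::'c)) * wt_total TYPE(real^'n)"
  have W: "0 \<le> W" unfolding W_def by (intro mult_nonneg_nonneg norm2_nonneg wt_total_nonneg)
  have "(\<lambda>k. sob (a k)) \<in> pseqs f"
    unfolding sob_def[abs_def] by (rule pseqs_jap[OF pseqs_bessel[OF a]])
  from pseqs_norm2[OF this] obtain C r where C: "0 \<le> C" "0 \<le> r" "r < 1" "\<forall>k. schwartz_norm2 (sob (a k)) \<le> C * r ^ k"
    by blast
  have "norm (a k x) \<le> (W * C) * r ^ k" for k x
    using sobolev[OF pseqs_schwartz[OF a, of k], of x] mult_left_mono[OF C(4)[rule_format, of k] W]
    by (simp add: W_def mult.assoc)
  moreover have "0 \<le> W * C" using W C(1) by (rule mult_nonneg_nonneg)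
  ultimately show thesis using that C(2,3) by blast
qed

section \<open>Sums over \<open>pseqs\<close> and the Neumann series\<close>

definition psum :: "(nat \<Rightarrow> real^'n \<Rightarrow> 'c) \<Rightarrow> real^'n \<Rightarrow> 'c" where
  "psum a x = (\<Sum>k. a k x)"

lemma psum_bound:
  fixes u :: "nat \<Rightarrow> 'c"
  assumes b: "\<forall>k. norm (u k) \<le> C * r ^ k" and r: "0 \<le> r" "r < 1"
  shows "summable u" "norm (suminf u) \<le> C * (1 / (1 - r))"
proof -
  have g: "summable (\<lambda>k. C * r ^ k)" using r by (intro summable_mult summable_geometric) simp
  show "summable u" by (rule summable_comparison_test'[OF g, of 0]) (use b in simp)
  have "norm (suminf u) \<le> (\<Sum>k. C * r ^ k)" by (rule norm_suminf_le[OF _ g]) (use b in simp)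
  also have "\<dots> = C * (1 / (1 - r))" using r by (simp add: suminf_mult summable_geometric suminf_geometric)
  finally show "norm (suminf u) \<le> C * (1 / (1 - r))" .
qed

lemma pseqs_summable:
  assumes a: "a \<in> pseqs f"
  shows "summable (\<lambda>k. a k x)"
proof -
  obtain C r where C: "0 \<le> C" "0 \<le> r" "r < 1" "\<forall>k x. norm (a k x) \<le> C * r ^ k" by (rule pseqs_sup[OF a])
  show ?thesis by (rule psum_bound(1)[OF _ C(2,3)]) (use C(4) in blast)
qed

text \<open>Termwise differentiation: the Taylor remainders of the terms are summed, their second
  derivatives being bounded by a geometric sequence.\<close>

lemma psum_has_derivative:
  assumes a: "a \<in> pseqs f"
  shows "(psum a has_derivative (\<lambda>h. \<Sum>i\<in>UNIV. h $ i *\<^sub>R psum (\<lambda>k. partial_deriv i (a k)) x)) (at x)"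
proof -
  let ?D = "\<lambda>h. \<Sum>i\<in>UNIV. h $ i *\<^sub>R psum (\<lambda>k. partial_deriv i (a k)) x"
  have "\<exists>C r. 0 \<le> C \<and> 0 \<le> r \<and> r < 1 \<and> (\<forall>k x. norm (partial_deriv i (partial_deriv j (a k)) x) \<le> C * r ^ k)" for i j
    by (rule pseqs_sup[OF pseqs_deriv[OF pseqs_deriv[OF a]], of i j]) blast
  then obtain C r where Cr: "\<And>i j. 0 \<le> C i j" "\<And>i j. 0 \<le> r i j" "\<And>i j. r i j < 1"
    "\<And>i j k x. norm (partial_deriv i (partial_deriv j (a k)) x) \<le> C i j * r i j ^ k" by metis
  \<comment> \<open>Only finitely many pairs of coordinates occur, so one constant and one rate
    below 1 serve all second derivatives.\<close>
  define M where "M = (\<Sum>i\<in>UNIV. \<Sum>j\<in>UNIV. C i j)"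
  define q where "q = Max (range (\<lambda>(i, j). r i j))"
  have CM: "C i j \<le> M" for i j
  proof -
    have "C i j \<le> (\<Sum>j\<in>UNIV. C i j)" using Cr(1) by (intro member_le_sum) simp_all
    also have "\<dots> \<le> M" unfolding M_def using Cr(1) by (intro member_le_sum sum_nonneg) simp_all
    finally show ?thesis .
  qed
  have fin: "finite (range (\<lambda>(i, j). r i j))" by simp
  have rq: "r i j \<le> q" for i j unfolding q_def by (rule Max_ge[OF fin]) (auto intro: range_eqI[of _ _ "(i, j)"])
  have q0: "0 \<le> q" using order_trans[OF Cr(2) rq] .
  have q1: "q < 1" unfolding q_def using Cr(3) by (subst Max_less_iff[OF fin]) auto
  have bd: "norm (partial_deriv i (partial_deriv j (a k)) y) \<le> M * q ^ k" for i j k y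
  proof -
    have "C i j * r i j ^ k \<le> M * q ^ k"
      using Cr(1,2) CM rq order_trans[OF Cr(1) CM] by (intro mult_mono power_mono) simp_all
    then show ?thesis using Cr(4)[of i j k y] by linarith
  qed
  show ?thesis
  proof (rule has_derivative_quadratic)
    show "bounded_linear ?D"
      by (intro bounded_linear_sum bounded_linear_scaleR_left[THEN bounded_linear_compose] bounded_linear_vec_nth)
    fix h
    let ?u = "\<lambda>k. a k (x + h) - a k x - dird (a k) h x"
    have "norm (?u k) \<le> ((real CARD('n))\<^sup>2 * M * (norm h)\<^sup>2) * q ^ k" for k
      using taylor_bound[OF pseqs_schwartz[OF a] bd, of k x h] by (simp add: mult_ac)
    then have "norm (suminf ?u) \<le> ((real CARD('n))\<^sup>2 * M * (norm h)\<^sup>2) * (1 / (1 - q))"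
      by (intro psum_bound(2) q0 q1) blast
    moreover have "?u sums (psum a (x + h) - psum a x - ?D h)"
      unfolding psum_def dird_def
      by (intro sums_diff sums_sum sums_scaleR_right summable_sums pseqs_summable[OF a]
          pseqs_summable[OF pseqs_deriv[OF a]])
    ultimately show "norm (psum a (x + h) - psum a x - ?D h)
        \<le> ((real CARD('n))\<^sup>2 * M * (1 / (1 - q))) * (norm h)\<^sup>2"
      by (simp add: sums_iff mult_ac)
  qed
qed

text \<open>Derivatives and coordinate multiples commute with the summation and preserve
  \<open>pseqs f\<close>, so the sums form an invariant set.\<close>

lemma schwartz_psum:
  assumes "a \<in> pseqs f"
  shows "psum a \<in> schwartz"
proof (rule schwartz_coinduct[of _ "psum ` pseqs f"])
  show "psum a \<in> psum ` pseqs f" using assms by blast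
  fix g assume "g \<in> psum ` pseqs f"
  then obtain a where g: "g = psum a" and a: "a \<in> pseqs f" by blast
  show "g differentiable (at x)" for x unfolding g by (rule differentiableI[OF psum_has_derivative[OF a]])
  obtain C r where C: "0 \<le> C" "0 \<le> r" "r < 1" "\<forall>k x. norm (a k x) \<le> C * r ^ k" by (rule pseqs_sup[OF a])
  have "norm (g x) \<le> C * (1 / (1 - r))" for x
    unfolding g psum_def by (rule psum_bound(2)[OF _ C(2,3)]) (use C(4) in blast)
  then show "bounded (range g)" unfolding bounded_iff by (intro exI[of _ "C * (1 / (1 - r))"]) auto
  fix i
  have "partial_deriv i g = psum (\<lambda>k. partial_deriv i (a k))"
  proof
    fix x
    have "partial_deriv i g x = (\<Sum>j\<in>UNIV. axis i 1 $ j *\<^sub>R psum (\<lambda>k. partial_deriv j (a k)) x)"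
      unfolding g by (rule partial_deriv_has_derivative[OF psum_has_derivative[OF a]])
    also have "\<dots> = (\<Sum>j\<in>UNIV. if j = i then psum (\<lambda>k. partial_deriv j (a k)) x else 0)"
      by (rule sum.cong) (simp_all add: axis_def)
    finally show "partial_deriv i g x = psum (\<lambda>k. partial_deriv i (a k)) x" by simp
  qed
  then show "partial_deriv i g \<in> psum ` pseqs f" using pseqs_deriv[OF a] by simp
  have "(\<lambda>x. x $ i *\<^sub>R g x) = psum (\<lambda>k x. x $ i *\<^sub>R a k x)"
    unfolding g psum_def[abs_def] using suminf_scaleR_right[OF pseqs_summable[OF a]] by simp
  then show "(\<lambda>x. x $ i *\<^sub>R g x) \<in> psum ` pseqs f" using pseqs_coord[OF a] by simp
qed

text \<open>\<open>h\<close> is the sum of all positive powers of \<open>f\<close>; the two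
  equations say that \<open>1 + h\<close> inverts \<open>1 - f\<close>. The first power is split off
  because members of \<open>pseqs f\<close> carry a right factor. Multiplying a partial sum by
  \<open>f\<close> shifts it by one power, and the sup-norm bounds carry the uniform error through
  the product.\<close>

theorem local_inverse:
  obtains h where "h \<in> schwartz" "h = (\<lambda>x. f x + (f \<odot> h) x)" "h = (\<lambda>x. f x + (h \<odot> f) x)"
proof -
  \<comment> \<open>\<open>a k\<close> is the power \<open>k + 2\<close>.\<close>
  define a where "a = (\<lambda>k. pw f k \<odot> f)"
  have a: "a \<in> pseqs f" using pseqs.base[OF f, of "[]" f] by (simp add: a_def)
  define h where "h = (\<lambda>x. f x + psum a x)"
  have h: "h \<in> schwartz" unfolding h_def by (rule schwartz_add[OF f schwartz_psum[OF a]])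
  define S where "S = (\<lambda>n x. \<Sum>k\<le>n. pw f k x)"
  have SS: "S n \<in> schwartz" for n unfolding S_def by (rule schwartz_sum, rule schwartz_pw[OF f])
  have S_Suc: "S (Suc n) = (\<lambda>x. S n x + pw f (Suc n) x)" for n by (simp add: S_def)
  have left: "f \<odot> S n = (\<lambda>x. S (Suc n) x - f x)" and right: "S n \<odot> f = (\<lambda>x. S (Suc n) x - f x)" for n
  proof (induction n)
    case 0
    show "f \<odot> S 0 = (\<lambda>x. S (Suc 0) x - f x)" "S 0 \<odot> f = (\<lambda>x. S (Suc 0) x - f x)" by (simp_all add: S_def)
  next
    case (Suc n)
    note p = schwartz_pw[OF f, of "Suc n"]
    show "f \<odot> S (Suc n) = (\<lambda>x. S (Suc (Suc n)) x - f x)"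
      unfolding S_Suc[of n] rp_add_right[OF f SS p] Suc.IH(1) pw_commute[OF f] S_Suc[of "Suc n"] S_Suc[of n]
      by (simp add: algebra_simps)
    show "S (Suc n) \<odot> f = (\<lambda>x. S (Suc (Suc n)) x - f x)"
      unfolding S_Suc[of n] rp_add_left[OF SS p f] Suc.IH(2) S_Suc[of "Suc n"] S_Suc[of n]
      by (simp add: algebra_simps)
  qed
  obtain C r where C: "0 \<le> C" "0 \<le> r" "r < 1" "\<forall>k x. norm (a k x) \<le> C * r ^ k" by (rule pseqs_sup[OF a])
  define e where "e = (\<lambda>n. C * r ^ n * (1 / (1 - r)))"
  have e0: "e \<longlonglongrightarrow> 0"
    unfolding e_def using C(2,3) by (intro tendsto_mult_left_zero tendsto_mult_right_zero LIMSEQ_power_zero) simp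
  have Sh: "norm (h x - S n x) \<le> e n" for n x
  proof -
    have "S n x = f x + (\<Sum>k<n. a k x)" by (induction n) (simp_all add: S_def a_def)
    then have "h x - S n x = (\<Sum>k. a (k + n) x)"
      using suminf_minus_initial_segment[OF pseqs_summable[OF a, of x], of n] by (simp add: h_def psum_def)
    also have "norm \<dots> \<le> (C * r ^ n) * (1 / (1 - r))"
    proof (rule psum_bound(2)[OF _ C(2,3)], rule allI)
      fix k show "norm (a (k + n) x) \<le> C * r ^ n * r ^ k"
        using C(4)[rule_format, of "k + n" x] by (simp add: power_add mult_ac)
    qed
    finally show ?thesis by (simp add: e_def)
  qed
  have hS: "(\<lambda>x. h x - S n x) \<in> schwartz" for n by (rule schwartz_diff[OF h SS])
  \<comment> \<open>Any value approximated by the shifted partial sums must be that of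
    \<open>h - f\<close>; applied to the products on both sides.\<close>
  have lim: "v x = h x - f x" if v: "\<And>n. norm (v x - (S (Suc n) x - f x)) \<le> e n * D" for v :: "real^'n \<Rightarrow> 'c" and x D
  proof -
    have "(\<lambda>n. v x - (S (Suc n) x - f x)) \<longlonglongrightarrow> 0"
      by (rule Lim_null_comparison[of _ "\<lambda>n. e n * D"])
        (simp_all add: v tendsto_mult_left_zero[OF e0])
    moreover have "(\<lambda>n. h x - S (Suc n) x) \<longlonglongrightarrow> 0"
      by (rule Lim_null_comparison[of _ "\<lambda>n. e (Suc n)"]) (simp_all add: Sh LIMSEQ_Suc[OF e0])
    ultimately have "(\<lambda>n. (v x - (S (Suc n) x - f x)) - (h x - S (Suc n) x)) \<longlonglongrightarrow> 0 - 0" by (rule tendsto_diff)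
    then have "(\<lambda>n::nat. v x + f x - h x) \<longlonglongrightarrow> 0" by (simp add: algebra_simps)
    then show ?thesis by (simp add: LIMSEQ_const_iff algebra_simps)
  qed
  have "(f \<odot> h) x = h x - f x" for x
  proof -
    obtain D where D: "\<forall>g\<in>schwartz. \<forall>B. (\<forall>x. norm (g x) \<le> B) \<longrightarrow> (\<forall>x. norm ((f \<odot> g) x) \<le> B * D)"
      by (rule rp_sup_right[OF f])
    have "norm ((f \<odot> (\<lambda>x. h x - S n x)) x) \<le> e n * D" for n
    proof -
      have "\<forall>x. norm (h x - S n x) \<le> e n" using Sh by blast
      from D[THEN bspec, OF hS, THEN spec, THEN mp, OF this] show ?thesis by (rule spec)
    qed
    then show ?thesis by (intro lim[of "f \<odot> h" x D]) (simp add: rp_diff_right[OF f h SS] left)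
  qed
  moreover have "(h \<odot> f) x = h x - f x" for x
  proof -
    obtain D where D: "\<forall>g\<in>schwartz. \<forall>B. (\<forall>x. norm (g x) \<le> B) \<longrightarrow> (\<forall>x. norm ((g \<odot> f) x) \<le> B * D)"
      by (rule rp_sup_left[OF f])
    have "norm (((\<lambda>x. h x - S n x) \<odot> f) x) \<le> e n * D" for n
    proof -
      have "\<forall>x. norm (h x - S n x) \<le> e n" using Sh by blast
      from D[THEN bspec, OF hS, THEN spec, THEN mp, OF this] show ?thesis by (rule spec)
    qed
    then show ?thesis by (intro lim[of "h \<odot> f" x D]) (simp add: rp_diff_left[OF h f SS] right)
  qed
  ultimately show thesis using h by (intro that[of h]) simp_all
qed

end

end

section \<open>Spectral invariance\<close>

context pseudometric
begin

text \<open>\<open>b\<close> plays the part of the seminorm that keeps the other factor bounded: the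
  constant 1 for addition, \<open>nJ\<close> for the product.\<close>

lemma bilinear_CR:
  fixes b :: "'a \<Rightarrow> real"
  assumes F: "\<And>x y. x \<in> V \<Longrightarrow> y \<in> V \<Longrightarrow> F x y \<in> V"
    and dF: "\<And>x y x' y'. x \<in> V \<Longrightarrow> y \<in> V \<Longrightarrow> x' \<in> V \<Longrightarrow> y' \<in> V
      \<Longrightarrow> d (F x y) (F x' y') \<le> d x x' * b y + b x' * d y y'"
    and b: "\<And>x y. x \<in> V \<Longrightarrow> y \<in> V \<Longrightarrow> b x \<le> b y + d x y"
    and XX: "(X, X') \<in> CR" and YY: "(Y, Y') \<in> CR"
  shows "((\<lambda>k. F (X k) (Y k)), (\<lambda>k. F (X' k) (Y' k))) \<in> CR"
proof -
  have bounded: "\<exists>B>0. \<forall>k. b (X k) \<le> B" if X: "X \<in> CS" for X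
  proof -
    obtain N where N: "\<And>m k. m \<ge> N \<Longrightarrow> k \<ge> N \<Longrightarrow> d (X m) (X k) < 1" using CS_D[OF X, of 1] by auto
    define B where "B = Max (insert 0 ((\<lambda>k. b (X k)) ` {..N})) + 1"
    have fin: "finite (insert 0 ((\<lambda>k. b (X k)) ` {..N}))" by simp
    have small: "b (X k) \<le> B - 1" if "k \<le> N" for k
    proof -
      have "b (X k) \<le> Max (insert 0 ((\<lambda>k. b (X k)) ` {..N}))" by (rule Max_ge[OF fin]) (use that in simp)
      then show ?thesis unfolding B_def by simp
    qed
    have "b (X k) \<le> B" for k
    proof (cases "k \<le> N")
      case True
      then show ?thesis using small by fastforce
    next
      case False
      then have "d (X k) (X N) < 1" by (intro N) simp_all
      then show ?thesis using b[OF CS_in[OF X] CS_in[OF X], of k N] small[of N] by simp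
    qed
    moreover have "0 < B"
    proof -
      have "0 \<le> Max (insert 0 ((\<lambda>k. b (X k)) ` {..N}))" by (rule Max_ge[OF fin]) simp
      then show ?thesis unfolding B_def by simp
    qed
    ultimately show ?thesis by blast
  qed
  have CS: "(\<lambda>k. F (X k) (Y k)) \<in> CS" if X: "X \<in> CS" and Y: "Y \<in> CS" for X Y
  proof (rule CS_I)
    show "F (X k) (Y k) \<in> V" for k by (intro F CS_in X Y)
    fix e :: real assume e: "0 < e"
    obtain B where B: "0 < B" "\<forall>k. b (Y k) \<le> B" using bounded[OF Y] by blast
    obtain C where C: "0 < C" "\<forall>k. b (X k) \<le> C" using bounded[OF X] by blast
    obtain M where M: "\<And>m k. m \<ge> M \<Longrightarrow> k \<ge> M \<Longrightarrow> d (X m) (X k) < e / (2 * B)"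
      using CS_D[OF X, of "e / (2 * B)"] e B(1) by auto
    obtain N where N: "\<And>m k. m \<ge> N \<Longrightarrow> k \<ge> N \<Longrightarrow> d (Y m) (Y k) < e / (2 * C)"
      using CS_D[OF Y, of "e / (2 * C)"] e C(1) by auto
    show "\<exists>N. \<forall>m\<ge>N. \<forall>k\<ge>N. d (F (X m) (Y m)) (F (X k) (Y k)) < e"
    proof (intro exI[of _ "max M N"] allI impI)
      fix m k assume mk: "max M N \<le> m" "max M N \<le> k"
      note V = CS_in[OF X, of m] CS_in[OF Y, of m] CS_in[OF X, of k] CS_in[OF Y, of k]
      have "d (X m) (X k) * b (Y m) \<le> d (X m) (X k) * B"
        by (intro mult_left_mono B(2)[rule_format] d_nonneg V)
      also have "\<dots> < e / (2 * B) * B" using M[of m k] mk B(1) by (intro mult_strict_right_mono) simp_all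
      also have "\<dots> = e / 2" using B(1) by simp
      finally have 1: "d (X m) (X k) * b (Y m) < e / 2" .
      have "b (X k) * d (Y m) (Y k) \<le> C * d (Y m) (Y k)"
        by (intro mult_right_mono C(2)[rule_format] d_nonneg V)
      also have "\<dots> < C * (e / (2 * C))" using N[of m k] mk C(1) by (intro mult_strict_left_mono) simp_all
      also have "\<dots> = e / 2" using C(1) by simp
      finally have "b (X k) * d (Y m) (Y k) < e / 2" .
      with 1 show "d (F (X m) (Y m)) (F (X k) (Y k)) < e" using dF[OF V] by linarith
    qed
  qed
  have X: "X \<in> CS" "X' \<in> CS" "(\<lambda>k. d (X k) (X' k)) \<longlonglongrightarrow> 0" using XX by (simp_all add: CR_iff)
  have Y: "Y \<in> CS" "Y' \<in> CS" "(\<lambda>k. d (Y k) (Y' k)) \<longlonglongrightarrow> 0" using YY by (simp_all add: CR_iff)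
  obtain B where B: "0 < B" "\<forall>k. b (Y k) \<le> B" using bounded[OF Y(1)] by blast
  obtain C where C: "0 < C" "\<forall>k. b (X' k) \<le> C" using bounded[OF X(2)] by blast
  have "(\<lambda>k. d (F (X k) (Y k)) (F (X' k) (Y' k))) \<longlonglongrightarrow> 0"
  proof (rule tendsto_sandwich[of "\<lambda>_. 0" _ _ "\<lambda>k. d (X k) (X' k) * B + C * d (Y k) (Y' k)"])
    show "\<forall>\<^sub>F k in sequentially. 0 \<le> d (F (X k) (Y k)) (F (X' k) (Y' k))"
      by (intro always_eventually allI d_nonneg F CS_in X Y)
    show "\<forall>\<^sub>F k in sequentially. d (F (X k) (Y k)) (F (X' k) (Y' k)) \<le> d (X k) (X' k) * B + C * d (Y k) (Y' k)"
    proof (rule always_eventually, rule allI)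
      fix k
      note V = CS_in[OF X(1), of k] CS_in[OF Y(1), of k] CS_in[OF X(2), of k] CS_in[OF Y(2), of k]
      have "d (X k) (X' k) * b (Y k) \<le> d (X k) (X' k) * B"
        by (intro mult_left_mono B(2)[rule_format] d_nonneg V)
      moreover have "b (X' k) * d (Y k) (Y' k) \<le> C * d (Y k) (Y' k)"
        by (intro mult_right_mono C(2)[rule_format] d_nonneg V)
      ultimately show "d (F (X k) (Y k)) (F (X' k) (Y' k)) \<le> d (X k) (X' k) * B + C * d (Y k) (Y' k)"
        using dF[OF V] by linarith
    qed
    show "(\<lambda>k. d (X k) (X' k) * B + C * d (Y k) (Y' k)) \<longlonglongrightarrow> 0"
      using tendsto_add[OF tendsto_mult[OF X(3) tendsto_const] tendsto_mult[OF tendsto_const Y(3)]] by simp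
  qed simp
  then show ?thesis by (simp add: CR_iff CS X Y)
qed

end

context skew_form
begin

text \<open>An approximate left unit would have to act as the identity on far translates of \<open>f\<close>, but
  \<open>u \<odot> f(\<cdot> + a)\<close> tends to \<open>0\<close> as \<open>a\<close> tends to infinity.\<close>

lemma approximate_unit_imp_nJ_zero:
  fixes u f :: "real^'n \<Rightarrow> 'c::unital_cstar_algebra"
  assumes u: "u \<in> schwartz"
    and le: "\<And>f. f \<in> schwartz \<Longrightarrow> nJ (\<lambda>x. f x - (u \<odot> f) x) \<le> nJ f / 2"
    and f: "f \<in> schwartz"
  shows "nJ f = 0"
proof -
  define j where "j = (undefined :: 'n)"
  let ?x = "\<lambda>g x. x $ j *\<^sub>R g x :: 'c"
  define K where "K = nJ u * nJ (?x f) + ((nJ (?x u) * nJ f + nJ u * nJ (Jd j f)) + nJ (Jd j u) * nJ f)"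
  have bound: "nJ f \<le> (2 * K) * inverse (real (Suc n))" for n
  proof -
    define t where "t = real (Suc n)"
    define a where "a = t *\<^sub>R (axis j 1 :: real^'n)"
    have t: "0 < t" and aj: "a $ j = t" by (simp_all add: t_def a_def)
    let ?f = "\<lambda>x. f (x + a)"
    have fa: "?f \<in> schwartz" by (rule schwartz_translate(1)[OF f])
    have xfa: "(\<lambda>x. ?x f (x + a)) \<in> schwartz" by (rule schwartz_translate(1)[OF schwartz_coord[OF f]])
    have Jda: "Jd j ?f = (\<lambda>x. Jd j f (x + a))"
      by (rule ext) (simp only: Jd_def partial_deriv_translate[OF f])
    \<comment> \<open>The translation moves the coordinate \<open>j\<close> by \<open>t\<close>, so
      the factor \<open>t\<close> is traded for coordinate multiples taken before and after
      translating.\<close>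
    have "complex_of_real t *\<^sub>C (u \<odot> ?f) x = (u \<odot> (\<lambda>x. ?x f (x + a))) x - (u \<odot> ?x ?f) x" for x
    proof -
      have "(\<lambda>x. complex_of_real t *\<^sub>C ?f x) = (\<lambda>x. ?x f (x + a) - ?x ?f x)"
        by (rule ext) (simp add: scaleC_of_real scaleR_add_left aj)
      then have "u \<odot> (\<lambda>x. complex_of_real t *\<^sub>C ?f x) = u \<odot> (\<lambda>x. ?x f (x + a) - ?x ?f x)" by (rule arg_cong)
      then show ?thesis
        unfolding rp_scaleC_right[OF u fa] rp_diff_right[OF u xfa schwartz_coord[OF fa]] by (rule fun_cong)
    qed
    \<comment> \<open>Both coordinate rules contain the \<open>j\<close>-th coordinate multiple of
      \<open>u \<odot> ?f\<close>; eliminating it leaves products whose norm bounds do not depend on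
      the translation.\<close>
    moreover have "(u \<odot> ?x ?f) x = ((?x u \<odot> ?f) x + (u \<odot> Jd j ?f) x) + (Jd j u \<odot> ?f) x" for x
      using rp_coord_right[OF u fa, of x j] rp_coord_left[OF u fa, of j x] by (simp add: algebra_simps)
    ultimately have eq: "(\<lambda>x. complex_of_real t *\<^sub>C (u \<odot> ?f) x)
        = (\<lambda>x. (u \<odot> (\<lambda>x. ?x f (x + a))) x - (((?x u \<odot> ?f) x + (u \<odot> Jd j ?f) x) + (Jd j u \<odot> ?f) x))"
      by (intro ext) simp
    note Ju = schwartz_Jd[OF u, of j] and Jf = schwartz_Jd[OF fa, of j] and xu = schwartz_coord[OF u, of j]
    note S1 = schwartz_rp[OF u xfa] and S2 = schwartz_rp[OF xu fa] and S3 = schwartz_rp[OF u Jf]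
      and S4 = schwartz_rp[OF Ju fa]
    have "nJ (\<lambda>x. (u \<odot> (\<lambda>x. ?x f (x + a))) x - (((?x u \<odot> ?f) x + (u \<odot> Jd j ?f) x) + (Jd j u \<odot> ?f) x))
        \<le> nJ (u \<odot> (\<lambda>x. ?x f (x + a))) + ((nJ (?x u \<odot> ?f) + nJ (u \<odot> Jd j ?f)) + nJ (Jd j u \<odot> ?f))"
      using nJ_diff[OF S1 schwartz_add[OF schwartz_add[OF S2 S3] S4]] nJ_add[OF schwartz_add[OF S2 S3] S4]
        nJ_add[OF S2 S3] by linarith
    also have "\<dots> \<le> nJ u * nJ (\<lambda>x. ?x f (x + a)) + ((nJ (?x u) * nJ ?f + nJ u * nJ (Jd j ?f)) + nJ (Jd j u) * nJ ?f)"
      by (intro add_mono nJ_rp u xfa xu fa Jf Ju)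
    also have "\<dots> = K"
      unfolding K_def Jda nJ_translate[OF f] nJ_translate[OF schwartz_coord[OF f]] nJ_translate[OF schwartz_Jd[OF f]] ..
    finally have tK: "nJ (\<lambda>x. complex_of_real t *\<^sub>C (u \<odot> ?f) x) \<le> K" unfolding eq .
    have uf: "u \<odot> ?f \<in> schwartz" by (rule schwartz_rp[OF u fa])
    have "nJ (u \<odot> ?f) \<le> inverse t * nJ (\<lambda>x. complex_of_real t *\<^sub>C (u \<odot> ?f) x)"
    proof -
      have "(\<lambda>x. complex_of_real (inverse t) *\<^sub>C complex_of_real t *\<^sub>C (u \<odot> ?f) x) = u \<odot> ?f"
        by (rule ext) (simp only: scaleC_of_real scaleR_scaleR, use t in simp)
      with nJ_scaleC[OF schwartz_scaleC[OF uf], of "complex_of_real (inverse t)" "complex_of_real t"] t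
      show ?thesis by (simp add: norm_inverse)
    qed
    also have "\<dots> \<le> inverse t * K" using tK t by (intro mult_left_mono) simp_all
    finally have s: "nJ (u \<odot> ?f) \<le> inverse t * K" .
    have "(\<lambda>x. (?f x - (u \<odot> ?f) x) + (u \<odot> ?f) x) = ?f" by simp
    then have "nJ ?f \<le> nJ (\<lambda>x. ?f x - (u \<odot> ?f) x) + nJ (u \<odot> ?f)"
      using nJ_add[OF schwartz_diff[OF fa uf] uf] by simp
    then have "nJ ?f \<le> nJ ?f / 2 + inverse t * K" using s le[OF fa] by linarith
    moreover have "(2 * K) * inverse t = 2 * (inverse t * K)" by simp
    ultimately show ?thesis unfolding nJ_translate[OF f] t_def[symmetric] by linarith
  qed
  have "(\<lambda>n. (2 * K) * inverse (real (Suc n))) \<longlonglongrightarrow> (2 * K) * 0"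
    by (intro tendsto_mult tendsto_const LIMSEQ_inverse_real_of_nat)
  then have "nJ f \<le> (2 * K) * 0" by (rule LIMSEQ_le_const) (use bound in blast)
  then show ?thesis using nJ_nonneg[OF f] by simp
qed

section \<open>The completed algebra and its operations on Cauchy classes\<close>

lemma norm_dist_nJ: "norm_dist (schwartz_alg J) nJ f g = nJ (\<lambda>x. f x - g x)"
  for f g :: "real^'n \<Rightarrow> 'c::unital_cstar_algebra"
  by (simp add: norm_dist_def schwartz_alg_def scaleC_minus_one)

abbreviation dA :: "(real^'n \<Rightarrow> 'c::unital_cstar_algebra) \<Rightarrow> (real^'n \<Rightarrow> 'c) \<Rightarrow> real" where
  "dA \<equiv> norm_dist (schwartz_alg J) nJ"

lemma pseudometric_dA: "pseudometric (schwartz :: (real^'n \<Rightarrow> 'c::unital_cstar_algebra) set) dA"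
proof
  fix f g h :: "real^'n \<Rightarrow> 'c"
  show "dA f f = 0" by (simp add: norm_dist_nJ nJ_zero)
  assume f: "f \<in> schwartz" and g: "g \<in> schwartz"
  show "dA f g = dA g f"
    using nJ_minus[OF schwartz_diff[OF f g]] by (simp add: norm_dist_nJ)
  assume h: "h \<in> schwartz"
  show "dA f h \<le> dA f g + dA g h"
    using nJ_add[OF schwartz_diff[OF f g] schwartz_diff[OF g h]] by (simp add: norm_dist_nJ)
qed

interpretation alg: pseudometric "schwartz :: (real^'n \<Rightarrow> 'c::unital_cstar_algebra) set" dA
  by (rule pseudometric_dA)

abbreviation AA :: "(nat \<Rightarrow> real^'n \<Rightarrow> 'c::unital_cstar_algebra) set star_calgebra" where
  "AA \<equiv> schwartz_alg_completion J"

lemma AA_simps: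
  "car AA = completion schwartz dA"
  "zer AA = alg.cls (\<lambda>_ _. 0)"
  "add AA = completion_lift2 schwartz dA (\<lambda>f g x. f x + g x)"
  "scl AA s = completion_lift schwartz dA (\<lambda>f x. s *\<^sub>C f x)"
  "mul AA = completion_lift2 schwartz dA (rieffel_prod J)"
  by (simp_all add: schwartz_alg_completion_def alg_completion_def Let_def completion_embed_def)
    (simp_all add: schwartz_alg_def)

lemma add_CR:
  fixes X X' Y Y' :: "nat \<Rightarrow> real^'n \<Rightarrow> 'c::unital_cstar_algebra"
  assumes "(X, X') \<in> cauchy_rel schwartz dA" "(Y, Y') \<in> cauchy_rel schwartz dA"
  shows "((\<lambda>k x. X k x + Y k x), (\<lambda>k x. X' k x + Y' k x)) \<in> cauchy_rel schwartz dA"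
proof (rule alg.bilinear_CR[where F = "\<lambda>f g x. f x + g x" and b = "\<lambda>_. 1", OF _ _ _ assms])
  fix f g f' g' :: "real^'n \<Rightarrow> 'c"
  assume V: "f \<in> schwartz" "g \<in> schwartz"
  show "(\<lambda>x. f x + g x) \<in> schwartz" by (rule schwartz_add[OF V])
  show "1 \<le> 1 + dA f g" using alg.d_nonneg[OF V] by simp
  assume V': "f' \<in> schwartz" "g' \<in> schwartz"
  show "dA (\<lambda>x. f x + g x) (\<lambda>x. f' x + g' x) \<le> dA f f' * 1 + 1 * dA g g'"
    using nJ_add[OF schwartz_diff[OF V(1) V'(1)] schwartz_diff[OF V(2) V'(2)]]
    by (simp add: norm_dist_nJ algebra_simps)
qed

lemma mul_CR:
  fixes X X' Y Y' :: "nat \<Rightarrow> real^'n \<Rightarrow> 'c::unital_cstar_algebra"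
  assumes "(X, X') \<in> cauchy_rel schwartz dA" "(Y, Y') \<in> cauchy_rel schwartz dA"
  shows "((\<lambda>k. X k \<odot> Y k), (\<lambda>k. X' k \<odot> Y' k)) \<in> cauchy_rel schwartz dA"
proof (rule alg.bilinear_CR[where F = "rieffel_prod J" and b = nJ, OF _ _ _ assms])
  fix f g f' g' :: "real^'n \<Rightarrow> 'c"
  assume V: "f \<in> schwartz" "g \<in> schwartz"
  show "f \<odot> g \<in> schwartz" by (rule schwartz_rp[OF V])
  show "nJ f \<le> nJ g + dA f g"
    using nJ_add[OF V(2) schwartz_diff[OF V]] by (simp add: norm_dist_nJ)
  assume V': "f' \<in> schwartz" "g' \<in> schwartz"
  have "(\<lambda>x. (f \<odot> g) x - (f' \<odot> g') x)
      = (\<lambda>x. ((\<lambda>x. f x - f' x) \<odot> g) x + (f' \<odot> (\<lambda>x. g x - g' x)) x)"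
    unfolding rp_diff_left[OF V V'(1)] rp_diff_right[OF V'(1) V(2) V'(2)] by simp
  moreover have "nJ (\<lambda>x. ((\<lambda>x. f x - f' x) \<odot> g) x + (f' \<odot> (\<lambda>x. g x - g' x)) x)
      \<le> nJ (\<lambda>x. f x - f' x) * nJ g + nJ f' * nJ (\<lambda>x. g x - g' x)"
    by (rule order_trans[OF nJ_add add_mono[OF nJ_rp nJ_rp]]; intro schwartz_rp schwartz_diff V V')
  ultimately show "dA (f \<odot> g) (f' \<odot> g') \<le> dA f f' * nJ g + nJ f' * dA g g'"
    by (simp add: norm_dist_nJ)
qed

lemma scl_CR:
  fixes X X' :: "nat \<Rightarrow> real^'n \<Rightarrow> 'c::unital_cstar_algebra"
  assumes "(X, X') \<in> cauchy_rel schwartz dA"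
  shows "((\<lambda>k x. s *\<^sub>C X k x), (\<lambda>k x. s *\<^sub>C X' k x)) \<in> cauchy_rel schwartz dA"
proof (rule alg.lipschitz_CR[where F = "\<lambda>f x. s *\<^sub>C f x" and L = "cmod s", OF _ _ assms])
  fix f g :: "real^'n \<Rightarrow> 'c"
  assume f: "f \<in> schwartz"
  show "(\<lambda>x. s *\<^sub>C f x) \<in> schwartz" by (rule schwartz_scaleC[OF f])
  assume g: "g \<in> schwartz"
  show "dA (\<lambda>x. s *\<^sub>C f x) (\<lambda>x. s *\<^sub>C g x) \<le> cmod s * dA f g"
    using nJ_scaleC[OF schwartz_diff[OF f g], of s] by (simp add: norm_dist_nJ scaleC_diff_right)
qed

context
  fixes X Y :: "nat \<Rightarrow> real^'n \<Rightarrow> 'c::unital_cstar_algebra"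
  assumes X: "X \<in> cauchy_seqs schwartz dA" and Y: "Y \<in> cauchy_seqs schwartz dA"
begin

lemma AA_add: "add AA (alg.cls X) (alg.cls Y) = alg.cls (\<lambda>k x. X k x + Y k x)"
  unfolding AA_simps by (rule alg.lift2_cls[OF add_CR X Y])

lemma CS_add: "(\<lambda>k x. X k x + Y k x) \<in> cauchy_seqs schwartz dA"
  using add_CR[OF alg.CR_refl[OF X] alg.CR_refl[OF Y]] by (simp add: alg.CR_iff)

lemma AA_mul: "mul AA (alg.cls X) (alg.cls Y) = alg.cls (\<lambda>k. X k \<odot> Y k)"
  unfolding AA_simps by (rule alg.lift2_cls[OF mul_CR X Y])

lemma CS_mul: "(\<lambda>k. X k \<odot> Y k) \<in> cauchy_seqs schwartz dA"
  using mul_CR[OF alg.CR_refl[OF X] alg.CR_refl[OF Y]] by (simp add: alg.CR_iff)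

lemma AA_scl: "scl AA s (alg.cls X) = alg.cls (\<lambda>k x. s *\<^sub>C X k x)"
  unfolding AA_simps by (rule alg.lift_cls[OF scl_CR X])

lemma CS_scl: "(\<lambda>k x. s *\<^sub>C X k x) \<in> cauchy_seqs schwartz dA"
  using scl_CR[OF alg.CR_refl[OF X]] by (simp add: alg.CR_iff)

end

lemma CS_zero: "(\<lambda>_ _. 0 :: 'c::unital_cstar_algebra) \<in> cauchy_seqs schwartz dA"
  by (rule alg.const_CS[OF schwartz_zero])

lemma AA_cases:
  fixes \<xi> :: "(nat \<Rightarrow> real^'n \<Rightarrow> 'c::unital_cstar_algebra) set"
  assumes "\<xi> \<in> car AA"
  obtains X where "X \<in> cauchy_seqs schwartz dA" "\<xi> = alg.cls X"
  by (rule alg.completion_cases[OF assms[unfolded AA_simps]])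

lemma emb_cls: "schwartz_alg_embed J f = alg.cls (\<lambda>_. f)"
  for f :: "real^'n \<Rightarrow> 'c::unital_cstar_algebra"
  by (simp add: schwartz_alg_embed_def completion_embed_def) (simp add: schwartz_alg_def)

abbreviation BB :: "(nat \<Rightarrow> real^'n \<Rightarrow> 'c::unital_cstar_algebra) set set" where
  "BB \<equiv> schwartz_alg_embed J ` car (schwartz_alg J)"

lemma car_schwartz_alg: "car (schwartz_alg J) = schwartz"
  by (simp add: schwartz_alg_def)

lemma BB_cases:
  fixes \<xi> :: "(nat \<Rightarrow> real^'n \<Rightarrow> 'c::unital_cstar_algebra) set"
  assumes "\<xi> \<in> BB"
  obtains f where "f \<in> schwartz" "\<xi> = alg.cls (\<lambda>_. f)"
  using assms unfolding car_schwartz_alg emb_cls by (rule imageE)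

lemma cls_in_BB: "f \<in> schwartz \<Longrightarrow> alg.cls (\<lambda>_. f) \<in> BB"
  for f :: "real^'n \<Rightarrow> 'c::unital_cstar_algebra"
  unfolding car_schwartz_alg emb_cls by (rule imageI)

lemma BB_subset: "(BB :: (nat \<Rightarrow> real^'n \<Rightarrow> 'c::unital_cstar_algebra) set set) \<subseteq> car AA"
proof
  fix \<xi> :: "(nat \<Rightarrow> real^'n \<Rightarrow> 'c) set" assume "\<xi> \<in> BB"
  then obtain f where f: "f \<in> schwartz" "\<xi> = alg.cls (\<lambda>_. f)" by (rule BB_cases)
  show "\<xi> \<in> car AA" unfolding f(2) AA_simps by (rule alg.completion_cls[OF alg.const_CS[OF f(1)]])
qed

text \<open>A late term of a sequence representing the unit satisfies the hypothesis of
  \<open>approximate_unit_imp_nJ_zero\<close>. Hence \<open>nJ\<close> vanishes and every class is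
  that of 0, which lies in the image of the Schwartz algebra.\<close>

lemma unital_imp_BB_eq:
  assumes "unital (AA :: (nat \<Rightarrow> real^'n \<Rightarrow> 'c::unital_cstar_algebra) set star_calgebra)"
  shows "(BB :: (nat \<Rightarrow> real^'n \<Rightarrow> 'c) set set) = car AA"
proof -
  obtain e :: "(nat \<Rightarrow> real^'n \<Rightarrow> 'c) set" where e: "e \<in> car AA" "\<forall>a\<in>car AA. mul AA e a = a \<and> mul AA a e = a"
    using assms unfolding unital_def is_unit_of_def by (elim exE conjE)
  obtain E where E: "E \<in> cauchy_seqs schwartz dA" "e = alg.cls E" by (rule AA_cases[OF e(1)])
  \<comment> \<open>Distance 1/2 from all later terms gives the factor 1/2 in \<open>half\<close>,
    after the later index has tended to infinity.\<close>
  obtain N where N: "\<And>m k. m \<ge> N \<Longrightarrow> k \<ge> N \<Longrightarrow> dA (E m) (E k) < 1 / 2" using alg.CS_D[OF E(1), of "1/2"] by auto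
  have ES: "E k \<in> schwartz" for k by (rule alg.CS_in[OF E(1)])
  have half: "nJ (\<lambda>x. f x - (E N \<odot> f) x) \<le> nJ f / 2" if f: "f \<in> schwartz" for f
  proof -
    have c: "(\<lambda>_. f) \<in> cauchy_seqs schwartz dA" by (rule alg.const_CS[OF f])
    have "alg.cls (\<lambda>_. f) \<in> car AA" (is "?f \<in> _") unfolding AA_simps by (rule alg.completion_cls[OF c])
    then have "mul AA e ?f = ?f" by (rule bspec[OF e(2), THEN conjunct1])
    then have "alg.cls (\<lambda>k. E k \<odot> f) = alg.cls (\<lambda>_. f)" unfolding E(2) AA_mul[OF E(1) c] .
    then have lim: "(\<lambda>k. dA (E k \<odot> f) f) \<longlonglongrightarrow> 0" using alg.cls_eq_iff[OF CS_mul[OF E(1) c] c] by simp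
    have "nJ (\<lambda>x. f x - (E N \<odot> f) x) \<le> dA (E k \<odot> f) f + nJ f / 2" if "k \<ge> N" for k
    proof -
      note Ef = schwartz_rp[OF ES[of k] f] and EN = schwartz_rp[OF ES[of N] f]
      have "(\<lambda>x. f x - (E N \<odot> f) x) = (\<lambda>x. (f x - (E k \<odot> f) x) + ((\<lambda>x. E k x - E N x) \<odot> f) x)"
        unfolding rp_diff_left[OF ES f ES] by simp
      then have "nJ (\<lambda>x. f x - (E N \<odot> f) x) \<le> nJ (\<lambda>x. f x - (E k \<odot> f) x) + nJ ((\<lambda>x. E k x - E N x) \<odot> f)"
        using nJ_add[OF schwartz_diff[OF f Ef] schwartz_rp[OF schwartz_diff[OF ES[of k] ES[of N]] f]] by simp
      moreover have "nJ ((\<lambda>x. E k x - E N x) \<odot> f) \<le> 1 / 2 * nJ f"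
        using nJ_rp[OF schwartz_diff[OF ES[of k] ES[of N]] f]
          mult_right_mono[OF less_imp_le[OF N[OF that order_refl]] nJ_nonneg[OF f]]
        by (simp add: norm_dist_nJ)
      moreover have "nJ (\<lambda>x. f x - (E k \<odot> f) x) = dA (E k \<odot> f) f"
        using nJ_minus[OF schwartz_diff[OF f Ef]] by (simp add: norm_dist_nJ)
      ultimately show ?thesis by simp
    qed
    then have ev: "\<exists>M. \<forall>k\<ge>M. nJ (\<lambda>x. f x - (E N \<odot> f) x) \<le> dA (E k \<odot> f) f + nJ f / 2" by blast
    have "(\<lambda>k. dA (E k \<odot> f) f + nJ f / 2) \<longlonglongrightarrow> 0 + nJ f / 2"
      by (rule tendsto_add[OF lim tendsto_const])
    then have "nJ (\<lambda>x. f x - (E N \<odot> f) x) \<le> 0 + nJ f / 2" by (rule LIMSEQ_le_const[OF _ ev])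
    then show ?thesis by simp
  qed
  have z: "nJ f = 0" if "f \<in> schwartz" for f :: "real^'n \<Rightarrow> 'c"
    by (rule approximate_unit_imp_nJ_zero[OF ES half that])
  have "car AA \<subseteq> (BB :: (nat \<Rightarrow> real^'n \<Rightarrow> 'c) set set)"
  proof
    fix \<xi> :: "(nat \<Rightarrow> real^'n \<Rightarrow> 'c) set" assume "\<xi> \<in> car AA"
    then obtain X where X: "X \<in> cauchy_seqs schwartz dA" "\<xi> = alg.cls X" by (rule AA_cases)
    have "dA (X k) (\<lambda>_. 0) = 0" for k
      unfolding norm_dist_nJ by (rule z[OF schwartz_diff[OF alg.CS_in[OF X(1)] schwartz_zero]])
    then have "\<xi> = alg.cls (\<lambda>_ _. 0)" unfolding X(2) using alg.cls_eq_iff[OF X(1) CS_zero] by simp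
    then show "\<xi> \<in> BB" using cls_in_BB[OF schwartz_zero] by simp
  qed
  then show ?thesis using BB_subset by blast
qed

text \<open>Writing \<open>1 - r\<close> for \<open>(g + \<mu>) (y + \<nu>)\<close> and \<open>1 + s\<close> for the inverse of \<open>1 - r\<close>, the right inverse
  of \<open>g + \<mu>\<close> is \<open>(y + \<nu>) (1 + s)\<close>.\<close>

lemma right_inverse:
  fixes g y s r :: "real^'n \<Rightarrow> 'c::unital_cstar_algebra"
  assumes g: "g \<in> schwartz" and y: "y \<in> schwartz" and s: "s \<in> schwartz" and \<mu>: "\<mu> * \<nu> = 1"
    and r: "r = (\<lambda>x. - ((g \<odot> y) x + (\<mu> *\<^sub>C y x + \<nu> *\<^sub>C g x)))"
    and sr: "s = (\<lambda>x. r x + (r \<odot> s) x)"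
    and h: "h = (\<lambda>x. y x + ((y \<odot> s) x + \<nu> *\<^sub>C s x))"
  shows "(g \<odot> h) x + (\<mu> *\<^sub>C h x + \<nu> *\<^sub>C g x) = 0"
proof -
  note gy = schwartz_rp[OF g y] and ys = schwartz_rp[OF y s]
  have gh: "g \<odot> h = (\<lambda>x. (g \<odot> y) x + ((g \<odot> (y \<odot> s)) x + \<nu> *\<^sub>C (g \<odot> s) x))"
    unfolding h rp_add_right[OF g y schwartz_add[OF ys schwartz_scaleC[OF s]]]
      rp_add_right[OF g ys schwartz_scaleC[OF s]] rp_scaleC_right[OF g s] ..
  have rs: "r \<odot> s = (\<lambda>x. - (((g \<odot> y) \<odot> s) x + (\<mu> *\<^sub>C (y \<odot> s) x + \<nu> *\<^sub>C (g \<odot> s) x)))"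
    unfolding r rp_minus_left[OF schwartz_add[OF gy schwartz_add[OF schwartz_scaleC[OF y] schwartz_scaleC[OF g]]] s]
      rp_add_left[OF gy schwartz_add[OF schwartz_scaleC[OF y] schwartz_scaleC[OF g]] s]
      rp_add_left[OF schwartz_scaleC[OF y] schwartz_scaleC[OF g] s] rp_scaleC_left[OF y s] rp_scaleC_left[OF g s] ..
  have "s x = r x + (r \<odot> s) x" using sr by (rule fun_cong)
  then have sx: "s x = - ((g \<odot> y) x + (\<mu> *\<^sub>C y x + \<nu> *\<^sub>C g x))
      - ((g \<odot> (y \<odot> s)) x + (\<mu> *\<^sub>C (y \<odot> s) x + \<nu> *\<^sub>C (g \<odot> s) x))"
    unfolding rs rp_assoc[OF g y s] by (simp add: r)
  have \<mu>h: "\<mu> *\<^sub>C h x = \<mu> *\<^sub>C y x + (\<mu> *\<^sub>C (y \<odot> s) x + s x)"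
    by (simp add: h scaleC_add_right scaleC_scaleC \<mu>)
  show ?thesis unfolding gh \<mu>h sx by (simp add: algebra_simps)
qed

text \<open>The mirror image: for \<open>1 - r = (y + \<nu>) (g + \<mu>)\<close> the left inverse is
  \<open>(1 + s) (y + \<nu>)\<close>.\<close>

lemma left_inverse:
  fixes g y s r :: "real^'n \<Rightarrow> 'c::unital_cstar_algebra"
  assumes g: "g \<in> schwartz" and y: "y \<in> schwartz" and s: "s \<in> schwartz" and \<mu>: "\<mu> * \<nu> = 1"
    and r: "r = (\<lambda>x. - ((y \<odot> g) x + (\<nu> *\<^sub>C g x + \<mu> *\<^sub>C y x)))"
    and sr: "s = (\<lambda>x. r x + (s \<odot> r) x)"
    and h: "h = (\<lambda>x. y x + ((s \<odot> y) x + \<nu> *\<^sub>C s x))"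
  shows "(h \<odot> g) x + (\<nu> *\<^sub>C g x + \<mu> *\<^sub>C h x) = 0"
proof -
  note yg = schwartz_rp[OF y g] and sy = schwartz_rp[OF s y]
  have hg: "h \<odot> g = (\<lambda>x. (y \<odot> g) x + ((s \<odot> (y \<odot> g)) x + \<nu> *\<^sub>C (s \<odot> g) x))"
    unfolding h rp_add_left[OF y schwartz_add[OF sy schwartz_scaleC[OF s]] g]
      rp_add_left[OF sy schwartz_scaleC[OF s] g] rp_scaleC_left[OF s g] rp_assoc[OF s y g] ..
  have rs: "s \<odot> r = (\<lambda>x. - ((s \<odot> (y \<odot> g)) x + (\<nu> *\<^sub>C (s \<odot> g) x + \<mu> *\<^sub>C (s \<odot> y) x)))"
    unfolding r rp_minus_right[OF s schwartz_add[OF yg schwartz_add[OF schwartz_scaleC[OF g] schwartz_scaleC[OF y]]]]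
      rp_add_right[OF s yg schwartz_add[OF schwartz_scaleC[OF g] schwartz_scaleC[OF y]]]
      rp_add_right[OF s schwartz_scaleC[OF g] schwartz_scaleC[OF y]] rp_scaleC_right[OF s y] rp_scaleC_right[OF s g] ..
  have "s x = r x + (s \<odot> r) x" using sr by (rule fun_cong)
  then have sx: "s x = - ((y \<odot> g) x + (\<nu> *\<^sub>C g x + \<mu> *\<^sub>C y x))
      - ((s \<odot> (y \<odot> g)) x + (\<nu> *\<^sub>C (s \<odot> g) x + \<mu> *\<^sub>C (s \<odot> y) x))"
    unfolding rs by (simp add: r)
  have \<mu>h: "\<mu> *\<^sub>C h x = \<mu> *\<^sub>C y x + (\<mu> *\<^sub>C (s \<odot> y) x + s x)"
    by (simp add: h scaleC_add_right scaleC_scaleC \<mu>)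
  show ?thesis unfolding hg \<mu>h sx by (simp add: algebra_simps)
qed

text \<open>The usual evaluation of \<open>(k + \<nu>) (g + \<mu>) (h + \<nu>)\<close> in two ways,
  written without a unit: multiplying the right equation by \<open>k\<close> and the left one by
  \<open>h\<close> yields \<open>k \<odot> g = g \<odot> h\<close>, and the equations then force
  \<open>h = k\<close>.\<close>

lemma inverses_agree:
  fixes g h k :: "real^'n \<Rightarrow> 'c::unital_cstar_algebra"
  assumes g: "g \<in> schwartz" and h: "h \<in> schwartz" and k: "k \<in> schwartz" and \<mu>: "\<mu> * \<nu> = 1"
    and R: "\<And>x. (g \<odot> h) x + (\<mu> *\<^sub>C h x + \<nu> *\<^sub>C g x) = 0"
    and L: "\<And>x. (k \<odot> g) x + (\<nu> *\<^sub>C g x + \<mu> *\<^sub>C k x) = 0"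
  shows "h = k"
proof
  fix x
  note gh = schwartz_rp[OF g h] and kg = schwartz_rp[OF k g]
  have "k \<odot> (\<lambda>x. (g \<odot> h) x + (\<mu> *\<^sub>C h x + \<nu> *\<^sub>C g x)) = k \<odot> (\<lambda>x. 0)" unfolding R ..
  also have "\<dots> = (\<lambda>x. 0)" using rp_scaleC_right[OF k schwartz_zero, of 0] by simp
  finally have 1: "(k \<odot> (g \<odot> h)) x + (\<mu> *\<^sub>C (k \<odot> h) x + \<nu> *\<^sub>C (k \<odot> g) x) = 0"
    unfolding rp_add_right[OF k gh schwartz_add[OF schwartz_scaleC[OF h] schwartz_scaleC[OF g]]]
      rp_add_right[OF k schwartz_scaleC[OF h] schwartz_scaleC[OF g]] rp_scaleC_right[OF k h] rp_scaleC_right[OF k g]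
    by (rule fun_cong)
  have "(\<lambda>x. (k \<odot> g) x + (\<nu> *\<^sub>C g x + \<mu> *\<^sub>C k x)) \<odot> h = (\<lambda>x. 0) \<odot> h" unfolding L ..
  also have "\<dots> = (\<lambda>x. 0)" using rp_scaleC_left[OF schwartz_zero h, of 0] by simp
  finally have 2: "(k \<odot> (g \<odot> h)) x + (\<nu> *\<^sub>C (g \<odot> h) x + \<mu> *\<^sub>C (k \<odot> h) x) = 0"
    unfolding rp_add_left[OF kg schwartz_add[OF schwartz_scaleC[OF g] schwartz_scaleC[OF k]] h]
      rp_add_left[OF schwartz_scaleC[OF g] schwartz_scaleC[OF k] h] rp_scaleC_left[OF g h] rp_scaleC_left[OF k h]
      rp_assoc[OF k g h]
    by (rule fun_cong)
  have cancel: "\<mu> *\<^sub>C \<nu> *\<^sub>C u = u" "\<nu> *\<^sub>C \<mu> *\<^sub>C u = u" for u :: 'c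
    using \<mu> by (simp_all add: scaleC_scaleC mult.commute)
  have "\<nu> *\<^sub>C (k \<odot> g) x - \<nu> *\<^sub>C (g \<odot> h) x
      = ((k \<odot> (g \<odot> h)) x + (\<mu> *\<^sub>C (k \<odot> h) x + \<nu> *\<^sub>C (k \<odot> g) x))
        - ((k \<odot> (g \<odot> h)) x + (\<nu> *\<^sub>C (g \<odot> h) x + \<mu> *\<^sub>C (k \<odot> h) x))"
    by (simp add: algebra_simps)
  then have "\<nu> *\<^sub>C (k \<odot> g) x = \<nu> *\<^sub>C (g \<odot> h) x" unfolding 1 2 by simp
  then have "\<mu> *\<^sub>C \<nu> *\<^sub>C (k \<odot> g) x = \<mu> *\<^sub>C \<nu> *\<^sub>C (g \<odot> h) x" by (rule arg_cong)
  then have kg_gh: "(k \<odot> g) x = (g \<odot> h) x" by (simp only: cancel)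
  have "\<mu> *\<^sub>C h x - \<mu> *\<^sub>C k x
      = ((g \<odot> h) x + (\<mu> *\<^sub>C h x + \<nu> *\<^sub>C g x)) - ((k \<odot> g) x + (\<nu> *\<^sub>C g x + \<mu> *\<^sub>C k x))"
    unfolding kg_gh by (simp add: algebra_simps)
  then have "\<mu> *\<^sub>C h x = \<mu> *\<^sub>C k x" unfolding R L by simp
  then have "\<nu> *\<^sub>C \<mu> *\<^sub>C h x = \<nu> *\<^sub>C \<mu> *\<^sub>C k x" by (rule arg_cong)
  then show "h x = k x" by (simp only: cancel)
qed

text \<open>Both errors are below 1 at one common index. \<open>local_inverse\<close> corrects
  \<open>Y k + \<nu>\<close> to an exact right inverse and to an exact left inverse, and these
  coincide.\<close>

lemma schwartz_inverse:
  fixes g :: "real^'n \<Rightarrow> 'c::unital_cstar_algebra"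
  assumes g: "g \<in> schwartz" and Y: "Y \<in> cauchy_seqs schwartz dA" and \<mu>: "\<mu> * \<nu> = 1"
    and R: "(\<lambda>k. nJ (\<lambda>x. (g \<odot> Y k) x + (\<mu> *\<^sub>C Y k x + \<nu> *\<^sub>C g x))) \<longlonglongrightarrow> 0"
    and L: "(\<lambda>k. nJ (\<lambda>x. (Y k \<odot> g) x + (\<nu> *\<^sub>C g x + \<mu> *\<^sub>C Y k x))) \<longlonglongrightarrow> 0"
  obtains h where "h \<in> schwartz" "\<forall>x. (g \<odot> h) x + (\<mu> *\<^sub>C h x + \<nu> *\<^sub>C g x) = 0"
    "\<forall>x. (h \<odot> g) x + (\<nu> *\<^sub>C g x + \<mu> *\<^sub>C h x) = 0"
proof -
  have "\<forall>\<^sub>F k in sequentially. nJ (\<lambda>x. (g \<odot> Y k) x + (\<mu> *\<^sub>C Y k x + \<nu> *\<^sub>C g x)) < 1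
      \<and> nJ (\<lambda>x. (Y k \<odot> g) x + (\<nu> *\<^sub>C g x + \<mu> *\<^sub>C Y k x)) < 1"
    by (intro eventually_conj order_tendstoD(2)[OF R] order_tendstoD(2)[OF L]) simp_all
  then obtain k where k: "nJ (\<lambda>x. (g \<odot> Y k) x + (\<mu> *\<^sub>C Y k x + \<nu> *\<^sub>C g x)) < 1"
      "nJ (\<lambda>x. (Y k \<odot> g) x + (\<nu> *\<^sub>C g x + \<mu> *\<^sub>C Y k x)) < 1"
    by (auto simp: eventually_sequentially)
  define y where "y = Y k"
  have y: "y \<in> schwartz" unfolding y_def by (rule alg.CS_in[OF Y])
  define r where "r = (\<lambda>x. - ((g \<odot> y) x + (\<mu> *\<^sub>C y x + \<nu> *\<^sub>C g x)))"
  define r' where "r' = (\<lambda>x. - ((y \<odot> g) x + (\<nu> *\<^sub>C g x + \<mu> *\<^sub>C y x)))"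
  have q: "(\<lambda>x. (g \<odot> y) x + (\<mu> *\<^sub>C y x + \<nu> *\<^sub>C g x)) \<in> schwartz"
    "(\<lambda>x. (y \<odot> g) x + (\<nu> *\<^sub>C g x + \<mu> *\<^sub>C y x)) \<in> schwartz"
    by (intro schwartz_add schwartz_rp schwartz_scaleC g y)+
  have r: "r \<in> schwartz" "nJ r < 1"
    unfolding r_def by (rule schwartz_minus[OF q(1)]) (simp only: nJ_minus[OF q(1)] k(1)[folded y_def])
  have r': "r' \<in> schwartz" "nJ r' < 1"
    unfolding r'_def by (rule schwartz_minus[OF q(2)]) (simp only: nJ_minus[OF q(2)] k(2)[folded y_def])
  obtain s where s: "s \<in> schwartz" "s = (\<lambda>x. r x + (r \<odot> s) x)" using local_inverse[OF r] by metis
  obtain s' where s': "s' \<in> schwartz" "s' = (\<lambda>x. r' x + (s' \<odot> r') x)" using local_inverse[OF r'] by metis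
  define h where "h = (\<lambda>x. y x + ((y \<odot> s) x + \<nu> *\<^sub>C s x))"
  define h' where "h' = (\<lambda>x. y x + ((s' \<odot> y) x + \<nu> *\<^sub>C s' x))"
  have hs: "h \<in> schwartz" unfolding h_def by (intro schwartz_add schwartz_rp schwartz_scaleC s(1) y)
  have hs': "h' \<in> schwartz" unfolding h'_def by (intro schwartz_add schwartz_rp schwartz_scaleC s'(1) y)
  note right = right_inverse[OF g y s(1) \<mu> r_def s(2) h_def]
  note left = left_inverse[OF g y s'(1) \<mu> r'_def s'(2) h'_def]
  have "h = h'" by (rule inverses_agree[OF g hs hs' \<mu> right left])
  then show thesis using that[OF hs] right left by blast
qed

section \<open>Unitizations and spectra\<close>

lemma unitization_simps:
  "car (unitization A) = car A \<times> UNIV"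
  "add (unitization A) (a, s) (b, t) = (add A a b, s + t)"
  "scl (unitization A) r (a, s) = (scl A r a, r * s)"
  "mul (unitization A) (a, s) (b, t) = (add A (mul A a b) (add A (scl A s b) (scl A t a)), s * t)"
  by (simp_all add: unitization_def)

text \<open>The subset \<open>C\<close> is left open in order to cover the unitizations of the
  completion and of the Schwartz algebra alike, which thus share their unit.\<close>

lemma is_unit_unitization:
  assumes C: "C \<subseteq> car AA" "zer AA \<in> C"
  shows "is_unit_of (unitization ((AA :: (nat \<Rightarrow> real^'n \<Rightarrow> 'c::unital_cstar_algebra) set star_calgebra)\<lparr>car := C\<rparr>)) (zer AA, 1)"
  unfolding is_unit_of_def
proof (intro conjI ballI)
  show "(zer AA, 1) \<in> car (unitization (AA\<lparr>car := C\<rparr>))" using C by (simp add: unitization_simps)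
  fix a :: "(nat \<Rightarrow> real^'n \<Rightarrow> 'c) set \<times> complex" assume "a \<in> car (unitization (AA\<lparr>car := C\<rparr>))"
  then obtain \<xi> t where a: "a = (\<xi>, t)" "\<xi> \<in> car AA" using C(1) by (cases a) (auto simp: unitization_simps)
  obtain X where X: "X \<in> cauchy_seqs schwartz dA" "\<xi> = alg.cls X" by (rule AA_cases[OF a(2)])
  note XS = alg.CS_in[OF X(1)]
  have z: "(\<lambda>_. 0) \<odot> X k = (\<lambda>_. 0)" "X k \<odot> (\<lambda>_. 0) = (\<lambda>_. 0)" for k
    using rp_scaleC_left[OF schwartz_zero XS, of 0] rp_scaleC_right[OF XS schwartz_zero, of _ 0] by simp_all
  note Z = CS_zero
  show "mul (unitization (AA\<lparr>car := C\<rparr>)) (zer AA, 1) a = a"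
    unfolding a(1) X(2) unitization_simps
    by (simp add: AA_simps(2) AA_mul[OF Z X(1)] AA_scl[OF X(1) X(1)] AA_scl[OF Z Z] z AA_add[OF X(1) Z] AA_add[OF Z X(1)])
  show "mul (unitization (AA\<lparr>car := C\<rparr>)) a (zer AA, 1) = a"
    unfolding a(1) X(2) unitization_simps
    by (simp add: AA_simps(2) AA_mul[OF X(1) Z] AA_scl[OF X(1) X(1)] AA_scl[OF Z Z] z AA_add[OF Z X(1)])
qed

lemma is_unit_of_unique: "is_unit_of A e \<Longrightarrow> unit_of A = e"
  unfolding unit_of_def
proof (rule the_equality)
  fix e' assume "is_unit_of A e" "is_unit_of A e'"
  then show "e' = e" unfolding is_unit_of_def by metis
qed

text \<open>An inverse in the larger unitization is given by a Cauchy sequence \<open>Y\<close> and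
  a scalar \<open>\<nu>\<close>. Read componentwise, the two inverse equations say that the scalar
  parts are inverse to each other and that the errors of \<open>Y k + \<nu>\<close> tend to 0, which
  are the hypotheses of \<open>schwartz_inverse\<close>.\<close>

lemma non_unital_spectrum:
  fixes b :: "(nat \<Rightarrow> real^'n \<Rightarrow> 'c::unital_cstar_algebra) set \<times> complex"
  assumes b: "b \<in> car (unitization (AA\<lparr>car := BB\<rparr>))"
  shows "spectrum (unitization (AA\<lparr>car := BB\<rparr>)) b = spectrum (unitization AA) b"
proof -
  let ?A = "unitization (AA :: (nat \<Rightarrow> real^'n \<Rightarrow> 'c) set star_calgebra)"
  let ?B = "unitization ((AA :: (nat \<Rightarrow> real^'n \<Rightarrow> 'c) set star_calgebra)\<lparr>car := BB\<rparr>)"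
  note Z = CS_zero[where 'c = 'c]
  have zB: "zer AA \<in> (BB :: (nat \<Rightarrow> real^'n \<Rightarrow> 'c) set set)"
    unfolding AA_simps by (rule cls_in_BB[OF schwartz_zero])
  have uB: "unit_of ?B = (zer AA, 1)" by (rule is_unit_of_unique[OF is_unit_unitization[OF BB_subset zB]])
  have uA: "unit_of ?A = (zer AA, 1)"
    using is_unit_of_unique[OF is_unit_unitization[OF order_refl subsetD[OF BB_subset zB]]] by simp
  have ops: "add ?B = add ?A" "scl ?B = scl ?A" "mul ?B = mul ?A" by (simp_all add: unitization_def)
  have carB: "car ?B \<subseteq> car ?A" using BB_subset by (auto simp: unitization_simps)
  obtain f t where b': "b = (alg.cls (\<lambda>_. f), t)" and f: "f \<in> schwartz"
    using b by (cases b) (auto simp: unitization_simps elim!: BB_cases)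
  have "(\<exists>a\<in>car ?B. mul ?A c a = (zer AA, 1) \<and> mul ?A a c = (zer AA, 1))
      \<longleftrightarrow> (\<exists>a\<in>car ?A. mul ?A c a = (zer AA, 1) \<and> mul ?A a c = (zer AA, 1))"
    if c: "c = add ?A (scl ?A z (zer AA, 1)) (scl ?A (- 1) b)" for c z
  proof
    show "\<exists>a\<in>car ?A. mul ?A c a = (zer AA, 1) \<and> mul ?A a c = (zer AA, 1)"
      if "\<exists>a\<in>car ?B. mul ?A c a = (zer AA, 1) \<and> mul ?A a c = (zer AA, 1)"
      using that carB by blast
    \<comment> \<open>The element to be inverted, \<open>z - b\<close>, is the class of
      \<open>g\<close> with scalar part \<open>\<mu>\<close>.\<close>
    define g where "g = (\<lambda>x. - f x)"
    define \<mu> where "\<mu> = z - t"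
    have g: "g \<in> schwartz" unfolding g_def by (rule schwartz_minus[OF f])
    note Cg = alg.const_CS[OF g] and Cf = alg.const_CS[OF f]
    have c': "c = (alg.cls (\<lambda>_. g), \<mu>)"
      unfolding c b' unitization_simps AA_simps(2) AA_scl[OF Z Z] AA_scl[OF Cf Cf]
      by (simp add: AA_add[OF Z] alg.const_CS schwartz_minus f scaleC_minus_one g_def \<mu>_def)
    assume "\<exists>a\<in>car ?A. mul ?A c a = (zer AA, 1) \<and> mul ?A a c = (zer AA, 1)"
    then obtain \<eta> \<nu> where \<eta>: "\<eta> \<in> car AA" and R: "mul ?A c (\<eta>, \<nu>) = (zer AA, 1)"
      and L: "mul ?A (\<eta>, \<nu>) c = (zer AA, 1)" by (auto simp: unitization_simps)
    obtain Y where Y: "Y \<in> cauchy_seqs schwartz dA" "\<eta> = alg.cls Y" by (rule AA_cases[OF \<eta>])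
    note gY = CS_mul[OF Cg Y(1)] and Yg = CS_mul[OF Y(1) Cg]
      and \<mu>Y = CS_scl[OF Y(1) Y(1), of \<mu>] and \<nu>g = CS_scl[OF Cg Cg, of \<nu>]
    have mR: "mul ?A (alg.cls (\<lambda>_. g), \<mu>) (alg.cls Y, \<nu>)
        = (alg.cls (\<lambda>k x. (g \<odot> Y k) x + (\<mu> *\<^sub>C Y k x + \<nu> *\<^sub>C g x)), \<mu> * \<nu>)"
      if Y: "Y \<in> cauchy_seqs schwartz dA" for Y
      unfolding unitization_simps AA_mul[OF Cg Y] AA_scl[OF Y Y] AA_scl[OF Cg Cg]
        AA_add[OF CS_scl[OF Y Y] CS_scl[OF Cg Cg]]
        AA_add[OF CS_mul[OF Cg Y] CS_add[OF CS_scl[OF Y Y] CS_scl[OF Cg Cg]]] ..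
    have mL: "mul ?A (alg.cls Y, \<nu>) (alg.cls (\<lambda>_. g), \<mu>)
        = (alg.cls (\<lambda>k x. (Y k \<odot> g) x + (\<nu> *\<^sub>C g x + \<mu> *\<^sub>C Y k x)), \<nu> * \<mu>)"
      if Y: "Y \<in> cauchy_seqs schwartz dA" for Y
      unfolding unitization_simps AA_mul[OF Y Cg] AA_scl[OF Y Y] AA_scl[OF Cg Cg]
        AA_add[OF CS_scl[OF Cg Cg] CS_scl[OF Y Y]]
        AA_add[OF CS_mul[OF Y Cg] CS_add[OF CS_scl[OF Cg Cg] CS_scl[OF Y Y]]] ..
    have \<mu>\<nu>: "\<mu> * \<nu> = 1" using R unfolding c' Y(2) mR[OF Y(1)] by simp
    have "alg.cls (\<lambda>k x. (g \<odot> Y k) x + (\<mu> *\<^sub>C Y k x + \<nu> *\<^sub>C g x)) = alg.cls (\<lambda>_ _. 0)"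
      using R unfolding c' Y(2) mR[OF Y(1)] AA_simps by simp
    then have limR: "(\<lambda>k. nJ (\<lambda>x. (g \<odot> Y k) x + (\<mu> *\<^sub>C Y k x + \<nu> *\<^sub>C g x))) \<longlonglongrightarrow> 0"
      using alg.cls_eq_iff[OF CS_add[OF gY CS_add[OF \<mu>Y \<nu>g]] Z] by (simp add: norm_dist_nJ)
    have "alg.cls (\<lambda>k x. (Y k \<odot> g) x + (\<nu> *\<^sub>C g x + \<mu> *\<^sub>C Y k x)) = alg.cls (\<lambda>_ _. 0)"
      using L unfolding c' Y(2) mL[OF Y(1)] AA_simps by simp
    then have limL: "(\<lambda>k. nJ (\<lambda>x. (Y k \<odot> g) x + (\<nu> *\<^sub>C g x + \<mu> *\<^sub>C Y k x))) \<longlonglongrightarrow> 0"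
      using alg.cls_eq_iff[OF CS_add[OF Yg CS_add[OF \<nu>g \<mu>Y]] Z] by (simp add: norm_dist_nJ)
    obtain h where h: "h \<in> schwartz" "\<forall>x. (g \<odot> h) x + (\<mu> *\<^sub>C h x + \<nu> *\<^sub>C g x) = 0"
      "\<forall>x. (h \<odot> g) x + (\<nu> *\<^sub>C g x + \<mu> *\<^sub>C h x) = 0"
      by (rule schwartz_inverse[OF g Y(1) \<mu>\<nu> limR limL])
    note Ch = alg.const_CS[OF h(1)]
    have "mul ?A c (alg.cls (\<lambda>_. h), \<nu>) = (zer AA, 1)"
      unfolding c' mR[OF Ch] \<mu>\<nu> AA_simps(2) using h(2) by simp
    moreover have "mul ?A (alg.cls (\<lambda>_. h), \<nu>) c = (zer AA, 1)"
      unfolding c' mL[OF Ch] AA_simps(2) using h(3) \<mu>\<nu> by (simp add: mult.commute)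
    moreover have "(alg.cls (\<lambda>_. h), \<nu>) \<in> car ?B"
      using cls_in_BB[OF h(1)] by (simp add: unitization_simps)
    ultimately show "\<exists>a\<in>car ?B. mul ?A c a = (zer AA, 1) \<and> mul ?A a c = (zer AA, 1)" by blast
  qed
  then show ?thesis unfolding spectrum_def Let_def uA uB ops by simp
qed

text \<open>In the unital case the image of the Schwartz algebra is the whole completion, so the
  branch for a common unit compares an algebra with itself; otherwise the unitizations are
  compared.\<close>

theorem spectrally_invariant_BB:
  "spectrally_invariant (AA :: (nat \<Rightarrow> real^'n \<Rightarrow> 'c::unital_cstar_algebra) set star_calgebra) BB"
proof (cases "unital (AA :: (nat \<Rightarrow> real^'n \<Rightarrow> 'c) set star_calgebra)")
  case True
  then obtain e where e: "is_unit_of (AA :: (nat \<Rightarrow> real^'n \<Rightarrow> 'c) set star_calgebra) e"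
    unfolding unital_def by (elim exE)
  have BB: "(BB :: (nat \<Rightarrow> real^'n \<Rightarrow> 'c) set set) = car AA" by (rule unital_imp_BB_eq[OF True])
  have "unit_of (AA :: (nat \<Rightarrow> real^'n \<Rightarrow> 'c) set star_calgebra) \<in> car AA"
    using e unfolding is_unit_of_unique[OF e] is_unit_of_def by (elim conjE)
  then show ?thesis unfolding spectrally_invariant_def BB using True by simp
next
  case False
  then show ?thesis unfolding spectrally_invariant_def by (simp add: non_unital_spectrum del: ball_simps)
qed

end

theorem theorem3p11:
  fixes J :: "real^'n::finite \<Rightarrow> real^'n"
  assumes "linear J"
    and "\<And>x y. J x \<bullet> y = - (x \<bullet> J y)"
  shows "spectrally_invariant
    (schwartz_alg_completion J :: (nat \<Rightarrow> real^'n \<Rightarrow> 'c::unital_cstar_algebra) set star_calgebra)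
    (schwartz_alg_embed J ` car (schwartz_alg J))"
  by (rule skew_form.spectrally_invariant_BB[OF skew_form.intro[OF assms]])

end
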